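(* Let $\Psi$ and $\Sigma$ be bounded sets of positive kernel operators on a Banach function space $L$. If $r \in \{\rho, \hat{\rho}\}$ and $\alpha \in [0,1]$, then $$r \left(\Psi ^{\left( \frac{1}{2} \right)} \circ \Sigma ^{\left( \frac{1}{2} \right)} \right) \le r \left((\Psi \Sigma)^{\left(\frac{1}{2}\right)} \circ (\Sigma \Psi)^{\left(\frac{1}{2}\right)}\right) ^{\frac{1}{2}} \le r \left((\Psi \Sigma)^{\left(\frac{1}{2}\right)} \circ (\Psi \Sigma)^{\left(\frac{1}{2}\right)}\right) ^{\frac{1}{4}} r \left((\Sigma\Psi)^{\left(\frac{1}{2}\right)} \circ ( \Sigma \Psi)^{\left(\frac{1}{2}\right)}\right) ^{\frac{1}{4}} \le r (\Psi \Sigma) ^{\frac{1}{2}}$$ and $$r \left(\Psi ^{\left( \frac{1}{2} \right)} \circ \Sigma ^{\left( \frac{1}{2} \right)} \right) \le r \left( \left (\Psi ^{\left( \frac{1}{2} \right)} \circ \Psi ^{\left( \frac{1}{2} \right)}\right) \left (\Sigma^{\left( \frac{1}{2} \right)} \circ \Sigma ^{\left( \frac{1}{2} \right)}\right) \right) ^{\frac{1}{2} } \le r \left((\Psi \Sigma)^{\left(\frac{1}{2}\right)} \circ (\Psi \Sigma)^{\left(\frac{1}{2}\right)}\right) ^{\frac{\alpha}{2}} r \left((\Sigma\Psi)^{\left(\frac{1}{2}\right)} \circ ( \Sigma \Psi)^{\left(\frac{1}{2}\right)}\right) ^{\frac{1-\alpha}{2}} \le r (\Psi \Sigma) ^{\frac{1}{2}}.$$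 If, in addition, $L$ and its Banach dual $L^*$ have order continuous norms, then both of these chains of inequalities hold also for each $r\in \{ \rho _{ess}, \hat{\rho} _{ess}\}$ (and every $\alpha\in[0,1]$).
   Context: Let $\mu$ be a $\sigma$-finite positive measure on a $\sigma$-algebra of subsets of a non-void set $X$, and let $M(X,\mu)$ be the vector space of equivalence classes (modulo a.e. equality) of complex measurable functions on $X$. A Banach space $L\subseteq M(X,\mu)$ is a Banach function space if $f\in L$, $g\in M(X,\mu)$ and $|g|\le |f|$ imply $g\in L$ and $\|g\|\le\|f\|$. It is assumed throughout that $X$ is the carrier of $L$: there is no subset $Y\subseteq X$ of strictly positive measure such that $f=0$ a.e. on $Y$ for all $f\in L$. A norm is order continuous if $0\le f_n\downarrow 0$ implies $\|f_n\|\to 0$. A (linear) operator $A$ on $L$ is positive if it maps nonnegative functions to nonnegative ones (positive operators are automatically bounded). $A$ is a kernel operator if there is a $\mu\times\mu$-measurable function $a(x,y)$ on $X\times X$ such that for all $f\in L$ and almost all $x\in X$, $\int_X|a(x,y)f(y)|\,d\mu(y)<\infty$ and $(Af)(x)=\int_X a(x,y)f(y)\,d\mu(y)$; such an $A$ is positive iff $a\ge 0$ a.e. If $A_1,\dots,A_m$ are positive kernel operators on $L$ with kernels $a_1,\dots,a_m$ and $\alpha_1,\dots,\alpha_m>0$ with $\sum_j\alpha_j=1$, then the Hadamard weighted geometric mean $A_1^{(\alpha_1)}\circ\cdots\circ A_m^{(\alpha_m)}$ is the positive kernel operator on $L$ with kernel $a_1(x,y)^{\alpha_1}\cdots a_m(x,y)^{\alpha_m}$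 (it is defined on all of $L$). For bounded sets $\Psi_1,\dots,\Psi_m$ of positive kernel operators on $L$, $$\Psi_1^{(\alpha_1)}\circ\cdots\circ\Psi_m^{(\alpha_m)}=\{A_1^{(\alpha_1)}\circ\cdots\circ A_m^{(\alpha_m)}: A_1\in\Psi_1,\dots,A_m\in\Psi_m\}.$$ For sets of operators, $\Psi\Sigma=\{AB:A\in\Psi,B\in\Sigma\}$ and $\Sigma^m=\{A_1\cdots A_m: A_i\in\Sigma\}$. The Hausdorff measure of noncompactness of a bounded operator $A$ on $L$ is $\beta(A)=\inf\{\delta>0: \text{there is a finite } M\subset L \text{ with } A(D_L)\subset M+\delta D_L\}$, where $D_L$ is the closed unit ball of $L$. For a single operator $A$, $\rho(A)$ is the spectral radius and $\rho_{ess}(A)$ is the essential spectral radius (the spectral radius of the image of $A$ in the Calkin algebra), and $\rho_{ess}(A)=\lim_{j\to\infty}\beta(A^j)^{1/j}$. For a bounded set $\Sigma$ of bounded operators: $\rho(\Sigma)=\limsup_{m\to\infty}[\sup_{A\in\Sigma^m}\rho(A)]^{1/m}$ (generalized spectral radius), $\hat\rho(\Sigma)=\lim_{m\to\infty}[\sup_{A\in\Sigma^m}\|A\|]^{1/m}$ (joint spectral radius), $\rho_{ess}(\Sigma)=\limsup_{m\to\infty}[\sup_{A\in\Sigma^m}\rho_{ess}(A)]^{1/m}$ (generalized essential spectral radius), $\hat\rho_{ess}(\Sigma)=\lim_{m\to\infty}[\sup_{A\in\Sigma^m}\beta(A)]^{1/m}$ (joint essential spectral radius). *)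

theory Defs
  imports "HOL-Analysis.Analysis"
begin

text \<open>
  Elements of a function space are represented by measurable functions instead of equivalence
  classes: \<open>L\<close> is a set of measurable functions that is saturated under almost everywhere
  equality (a consequence of the ideal property), and \<open>N\<close> vanishes exactly on the null functions.
  Accordingly an operator on \<open>L\<close> is a map on representatives that respects a.e. equality, and all
  identities between functions are read a.e.
\<close>

type_synonym 'a cfun = "'a \<Rightarrow> complex"
type_synonym 'a cop = "'a cfun \<Rightarrow> 'a cfun"

locale banach_function_space = sigma_finite_measure M
  for M :: "'a measure" +
  fixes L :: "'a cfun set" and N :: "'a cfun \<Rightarrow> real"
  assumes space_nonempty: "space M \<noteq> {}"
    and measurable: "f \<in> L \<Longrightarrow> f \<in> borel_measurable M"
    and zero_mem: "(\<lambda>_. 0) \<in> L"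
    and add_mem: "f \<in> L \<Longrightarrow> g \<in> L \<Longrightarrow> (\<lambda>x. f x + g x) \<in> L"
    and scale_mem: "f \<in> L \<Longrightarrow> (\<lambda>x. c * f x) \<in> L"
    and norm_nonneg: "f \<in> L \<Longrightarrow> 0 \<le> N f"
    and norm_eq_zero_iff: "f \<in> L \<Longrightarrow> N f = 0 \<longleftrightarrow> (AE x in M. f x = 0)"
    and norm_triangle: "f \<in> L \<Longrightarrow> g \<in> L \<Longrightarrow> N (\<lambda>x. f x + g x) \<le> N f + N g"
    and norm_scale: "f \<in> L \<Longrightarrow> N (\<lambda>x. c * f x) = cmod c * N f"
    and complete: "(\<And>n. u n \<in> L) \<Longrightarrow>
          (\<And>e. e > 0 \<Longrightarrow> \<exists>K. \<forall>m\<ge>K. \<forall>n\<ge>K. N (\<lambda>x. u m x - u n x) < e) \<Longrightarrow>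
          \<exists>f\<in>L. (\<lambda>n. N (\<lambda>x. u n x - f x)) \<longlonglongrightarrow> 0"
    and ideal_mem: "f \<in> L \<Longrightarrow> g \<in> borel_measurable M \<Longrightarrow>
          (AE x in M. cmod (g x) \<le> cmod (f x)) \<Longrightarrow> g \<in> L"
    and norm_mono: "f \<in> L \<Longrightarrow> g \<in> borel_measurable M \<Longrightarrow>
          (AE x in M. cmod (g x) \<le> cmod (f x)) \<Longrightarrow> N g \<le> N f"
    and carrier: "Y \<in> sets M \<Longrightarrow> emeasure M Y > 0 \<Longrightarrow>
          \<exists>f\<in>L. \<not> (AE x in M. x \<in> Y \<longrightarrow> f x = 0)"


subsection \<open>Operators\<close>

definition linear_operator :: "'a measure \<Rightarrow> 'a cfun set \<Rightarrow> 'a cop \<Rightarrow> bool" where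
  "linear_operator M L A \<longleftrightarrow>
     (\<forall>f\<in>L. A f \<in> L) \<and>
     (\<forall>f\<in>L. \<forall>g\<in>L. (AE x in M. f x = g x) \<longrightarrow> (AE x in M. A f x = A g x)) \<and>
     (\<forall>f\<in>L. \<forall>g\<in>L. AE x in M. A (\<lambda>y. f y + g y) x = A f x + A g x) \<and>
     (\<forall>f\<in>L. \<forall>c. AE x in M. A (\<lambda>y. c * f y) x = c * A f x)"

definition bounded_operator ::
    "'a measure \<Rightarrow> 'a cfun set \<Rightarrow> ('a cfun \<Rightarrow> real) \<Rightarrow> 'a cop \<Rightarrow> bool" where
  "bounded_operator M L N A \<longleftrightarrow>
     linear_operator M L A \<and> (\<exists>C. \<forall>f\<in>L. N (A f) \<le> C * N f)"

definition op_norm :: "'a cfun set \<Rightarrow> ('a cfun \<Rightarrow> real) \<Rightarrow> 'a cop \<Rightarrow> real" where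
  "op_norm L N A = Sup {N (A f) | f. f \<in> L \<and> N f \<le> 1}"

definition positive_operator :: "'a measure \<Rightarrow> 'a cfun set \<Rightarrow> 'a cop \<Rightarrow> bool" where
  "positive_operator M L A \<longleftrightarrow> linear_operator M L A \<and>
     (\<forall>f\<in>L. (AE x in M. f x \<in> \<real>\<^sub>\<ge>\<^sub>0) \<longrightarrow> (AE x in M. A f x \<in> \<real>\<^sub>\<ge>\<^sub>0))"

definition has_kernel ::
    "'a measure \<Rightarrow> 'a cfun set \<Rightarrow> 'a cop \<Rightarrow> ('a \<times> 'a \<Rightarrow> complex) \<Rightarrow> bool" where
  "has_kernel M L A a \<longleftrightarrow> a \<in> borel_measurable (M \<Otimes>\<^sub>M M) \<and>
     (\<forall>f\<in>L. AE x in M. integrable M (\<lambda>y. a (x, y) * f y) \<and>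
                        A f x = (\<integral>y. a (x, y) * f y \<partial>M))"

definition positive_kernel_operator :: "'a measure \<Rightarrow> 'a cfun set \<Rightarrow> 'a cop \<Rightarrow> bool" where
  "positive_kernel_operator M L A \<longleftrightarrow> positive_operator M L A \<and> (\<exists>a. has_kernel M L A a)"

definition bounded_op_set :: "'a cfun set \<Rightarrow> ('a cfun \<Rightarrow> real) \<Rightarrow> 'a cop set \<Rightarrow> bool" where
  "bounded_op_set L N \<Psi> \<longleftrightarrow> (\<exists>C. \<forall>A\<in>\<Psi>. \<forall>f\<in>L. N (A f) \<le> C * N f)"


subsection \<open>Products and Hadamard weighted geometric means\<close>

definition op_set_mult :: "'a cop set \<Rightarrow> 'a cop set \<Rightarrow> 'a cop set" where
  "op_set_mult \<Psi> \<Phi> = {A \<circ> B | A B. A \<in> \<Psi> \<and> B \<in> \<Phi>}"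

primrec op_set_power :: "'a cop set \<Rightarrow> nat \<Rightarrow> 'a cop set" where
  "op_set_power \<Psi> 0 = {id}"
| "op_set_power \<Psi> (Suc m) = op_set_mult \<Psi> (op_set_power \<Psi> m)"

text \<open>
  The weighted mean of two operators is given as a relation since, on representatives, it is only
  determined up to a.e. equality: \<open>C\<close> is a positive kernel operator whose kernel is
  \<open>a\<^sup>\<alpha> b\<^sup>\<beta>\<close>, for nonnegative kernels \<open>a\<close> of \<open>A\<close> and \<open>b\<close> of \<open>B\<close>.
\<close>

definition is_hadamard_mean ::
    "'a measure \<Rightarrow> 'a cfun set \<Rightarrow> real \<Rightarrow> 'a cop \<Rightarrow> real \<Rightarrow> 'a cop \<Rightarrow> 'a cop \<Rightarrow> bool" where
  "is_hadamard_mean M L \<alpha> A \<beta> B C \<longleftrightarrow> positive_kernel_operator M L C \<and>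
     (\<exists>a b :: 'a \<times> 'a \<Rightarrow> real.
        a \<in> borel_measurable (M \<Otimes>\<^sub>M M) \<and> b \<in> borel_measurable (M \<Otimes>\<^sub>M M) \<and>
        (AE p in M \<Otimes>\<^sub>M M. 0 \<le> a p) \<and> (AE p in M \<Otimes>\<^sub>M M. 0 \<le> b p) \<and>
        has_kernel M L A (\<lambda>p. complex_of_real (a p)) \<and>
        has_kernel M L B (\<lambda>p. complex_of_real (b p)) \<and>
        has_kernel M L C (\<lambda>p. complex_of_real (a p powr \<alpha> * b p powr \<beta>)))"

definition hadamard_mean ::
    "'a measure \<Rightarrow> 'a cfun set \<Rightarrow> real \<Rightarrow> 'a cop set \<Rightarrow> real \<Rightarrow> 'a cop set \<Rightarrow> 'a cop set" where
  "hadamard_mean M L \<alpha> \<Psi> \<beta> \<Phi> = {C. \<exists>A\<in>\<Psi>. \<exists>B\<in>\<Phi>. is_hadamard_mean M L \<alpha> A \<beta> B C}"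

abbreviation geo_mean :: "'a measure \<Rightarrow> 'a cfun set \<Rightarrow> 'a cop set \<Rightarrow> 'a cop set \<Rightarrow> 'a cop set" where
  "geo_mean M L \<Psi> \<Phi> \<equiv> hadamard_mean M L (1/2) \<Psi> (1/2) \<Phi>"


subsection \<open>Spectral radius and essential spectral radius of an operator\<close>

definition invertible_op ::
    "'a measure \<Rightarrow> 'a cfun set \<Rightarrow> ('a cfun \<Rightarrow> real) \<Rightarrow> 'a cop \<Rightarrow> bool" where
  "invertible_op M L N A \<longleftrightarrow> (\<exists>B. bounded_operator M L N B \<and>
     (\<forall>f\<in>L. (AE x in M. A (B f) x = f x) \<and> (AE x in M. B (A f) x = f x)))"

definition op_spectrum ::
    "'a measure \<Rightarrow> 'a cfun set \<Rightarrow> ('a cfun \<Rightarrow> real) \<Rightarrow> 'a cop \<Rightarrow> complex set" where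
  "op_spectrum M L N A = {z. \<not> invertible_op M L N (\<lambda>f x. z * f x - A f x)}"

text \<open>
  All suprema below are suprema of sets of nonnegative reals; inserting \<open>0\<close> only fixes
  \<open>sup \<emptyset> = 0\<close>, which is needed for an empty spectrum (zero space, trivial Calkin
  algebra) and for an empty set of operators.
\<close>

definition spectral_rad ::
    "'a measure \<Rightarrow> 'a cfun set \<Rightarrow> ('a cfun \<Rightarrow> real) \<Rightarrow> 'a cop \<Rightarrow> real" where
  "spectral_rad M L N A = Sup (insert 0 (cmod ` op_spectrum M L N A))"

definition compact_op ::
    "'a measure \<Rightarrow> 'a cfun set \<Rightarrow> ('a cfun \<Rightarrow> real) \<Rightarrow> 'a cop \<Rightarrow> bool" where
  "compact_op M L N K \<longleftrightarrow> bounded_operator M L N K \<and>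
     (\<forall>u :: nat \<Rightarrow> 'a cfun. (\<forall>n. u n \<in> L \<and> N (u n) \<le> 1) \<longrightarrow>
        (\<exists>s g. strict_mono s \<and> g \<in> L \<and> (\<lambda>n. N (\<lambda>x. K (u (s n)) x - g x)) \<longlonglongrightarrow> 0))"

text \<open>Invertibility of the image of \<open>A\<close> in the Calkin algebra, i.e. modulo compact operators.\<close>

definition calkin_invertible ::
    "'a measure \<Rightarrow> 'a cfun set \<Rightarrow> ('a cfun \<Rightarrow> real) \<Rightarrow> 'a cop \<Rightarrow> bool" where
  "calkin_invertible M L N A \<longleftrightarrow> (\<exists>B. bounded_operator M L N B \<and>
     compact_op M L N (\<lambda>f x. A (B f) x - f x) \<and> compact_op M L N (\<lambda>f x. B (A f) x - f x))"

definition ess_spectrum ::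
    "'a measure \<Rightarrow> 'a cfun set \<Rightarrow> ('a cfun \<Rightarrow> real) \<Rightarrow> 'a cop \<Rightarrow> complex set" where
  "ess_spectrum M L N A = {z. \<not> calkin_invertible M L N (\<lambda>f x. z * f x - A f x)}"

definition ess_spectral_rad ::
    "'a measure \<Rightarrow> 'a cfun set \<Rightarrow> ('a cfun \<Rightarrow> real) \<Rightarrow> 'a cop \<Rightarrow> real" where
  "ess_spectral_rad M L N A = Sup (insert 0 (cmod ` ess_spectrum M L N A))"

text \<open>The Hausdorff measure of noncompactness.\<close>

definition hausdorff_mnc :: "'a cfun set \<Rightarrow> ('a cfun \<Rightarrow> real) \<Rightarrow> 'a cop \<Rightarrow> real" where
  "hausdorff_mnc L N A = Inf {\<delta>. \<delta> > 0 \<and> (\<exists>F. finite F \<and> F \<subseteq> L \<and>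
     (\<forall>f\<in>L. N f \<le> 1 \<longrightarrow> (\<exists>g\<in>F. N (\<lambda>x. A f x - g x) \<le> \<delta>)))}"


subsection \<open>Spectral radii of sets of operators\<close>

definition gen_spectral_rad ::
    "'a measure \<Rightarrow> 'a cfun set \<Rightarrow> ('a cfun \<Rightarrow> real) \<Rightarrow> 'a cop set \<Rightarrow> real" where
  "gen_spectral_rad M L N \<Psi> = real_of_ereal (limsup (\<lambda>m.
     ereal (root m (Sup (insert 0 (spectral_rad M L N ` op_set_power \<Psi> m))))))"

definition joint_spectral_rad ::
    "'a cfun set \<Rightarrow> ('a cfun \<Rightarrow> real) \<Rightarrow> 'a cop set \<Rightarrow> real" where
  "joint_spectral_rad L N \<Psi> =
     lim (\<lambda>m. root m (Sup (insert 0 (op_norm L N ` op_set_power \<Psi> m))))"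

definition gen_ess_spectral_rad ::
    "'a measure \<Rightarrow> 'a cfun set \<Rightarrow> ('a cfun \<Rightarrow> real) \<Rightarrow> 'a cop set \<Rightarrow> real" where
  "gen_ess_spectral_rad M L N \<Psi> = real_of_ereal (limsup (\<lambda>m.
     ereal (root m (Sup (insert 0 (ess_spectral_rad M L N ` op_set_power \<Psi> m))))))"

definition joint_ess_spectral_rad ::
    "'a cfun set \<Rightarrow> ('a cfun \<Rightarrow> real) \<Rightarrow> 'a cop set \<Rightarrow> real" where
  "joint_ess_spectral_rad L N \<Psi> =
     lim (\<lambda>m. root m (Sup (insert 0 (hausdorff_mnc L N ` op_set_power \<Psi> m))))"


subsection \<open>Order continuity of the norms of a function space and of its dual\<close>

text \<open>
  For a space \<open>V\<close> of complex functions with order \<open>le\<close> and norm \<open>nrm\<close>: if \<open>f n\<close> decreases and has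
  infimum \<open>0\<close> in \<open>V\<close>, then its norm tends to \<open>0\<close>. Both the function space (functions on \<open>X\<close>) and
  its dual (functions on \<open>L\<close>) have this form.
\<close>

definition order_continuous_norm ::
    "('b \<Rightarrow> complex) set \<Rightarrow> (('b \<Rightarrow> complex) \<Rightarrow> ('b \<Rightarrow> complex) \<Rightarrow> bool) \<Rightarrow>
     (('b \<Rightarrow> complex) \<Rightarrow> real) \<Rightarrow> bool" where
  "order_continuous_norm V le nrm \<longleftrightarrow>
     (\<forall>f :: nat \<Rightarrow> 'b \<Rightarrow> complex.
        (\<forall>n. f n \<in> V \<and> le (\<lambda>_. 0) (f n) \<and> le (f (Suc n)) (f n)) \<and>
        (\<forall>g\<in>V. (\<forall>n. le g (f n)) \<longrightarrow> le g (\<lambda>_. 0)) \<longrightarrow>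
        (\<lambda>n. nrm (f n)) \<longlonglongrightarrow> 0)"

definition ae_le :: "'a measure \<Rightarrow> 'a cfun \<Rightarrow> 'a cfun \<Rightarrow> bool" where
  "ae_le M f g \<longleftrightarrow> (AE x in M. g x - f x \<in> \<real>\<^sub>\<ge>\<^sub>0)"

definition dual_space :: "'a cfun set \<Rightarrow> ('a cfun \<Rightarrow> real) \<Rightarrow> ('a cfun \<Rightarrow> complex) set" where
  "dual_space L N = {\<phi>.
     (\<forall>f\<in>L. \<forall>g\<in>L. \<phi> (\<lambda>x. f x + g x) = \<phi> f + \<phi> g) \<and>
     (\<forall>f\<in>L. \<forall>c. \<phi> (\<lambda>x. c * f x) = c * \<phi> f) \<and>
     (\<exists>C. \<forall>f\<in>L. cmod (\<phi> f) \<le> C * N f)}"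

definition dual_norm :: "'a cfun set \<Rightarrow> ('a cfun \<Rightarrow> real) \<Rightarrow> ('a cfun \<Rightarrow> complex) \<Rightarrow> real" where
  "dual_norm L N \<phi> = Sup {cmod (\<phi> f) | f. f \<in> L \<and> N f \<le> 1}"

definition dual_le :: "'a measure \<Rightarrow> 'a cfun set \<Rightarrow>
    ('a cfun \<Rightarrow> complex) \<Rightarrow> ('a cfun \<Rightarrow> complex) \<Rightarrow> bool" where
  "dual_le M L \<phi> \<psi> \<longleftrightarrow> (\<forall>f\<in>L. ae_le M (\<lambda>_. 0) f \<longrightarrow> \<psi> f - \<phi> f \<in> \<real>\<^sub>\<ge>\<^sub>0)"


text \<open>Powers of nonnegative reals with \<open>0\<^sup>0 = 1\<close>, whereas \<open>0 powr 0 = 0\<close>.\<close>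

definition rpow :: "real \<Rightarrow> real \<Rightarrow> real" where
  "rpow x a = (if a = 0 then 1 else x powr a)"

end

theory Submission
  imports Defs "HOL-Library.Diagonal_Subsequence"
begin

text \<open>
  \<open>geo_dominated D P Q\<close> means \<open>|D \<surd>(f g)| \<le> \<surd>(P f \<cdot> Q g)\<close> for nonnegative \<open>f\<close>, \<open>g\<close>. This relation is
  closed under composition, holds for a Hadamard geometric mean \<open>D\<close> of \<open>P\<close> and \<open>Q\<close>, and implies
  \<open>p D \<le> \<surd>(p P \<cdot> p Q)\<close> for \<open>p\<close> the operator norm and, for order continuous norms, the measure of
  noncompactness, because \<open>\<surd>(u v)\<close> is the infimum of the arithmetic means \<open>(t u + v / t) / 2\<close>. Hence each
  of the radii satisfies \<open>r \<Phi> \<le> \<surd>(r \<Phi>\<^sub>1 \<cdot> r \<Phi>\<^sub>2)\<close> if all \<open>D \<in> \<Phi>\<close> are dominated by members of \<open>\<Phi>\<^sub>1\<close> and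
  \<open>\<Phi>\<^sub>2\<close>. In particular the geometric mean of \<open>\<Phi>\<close> with itself has the same radius as \<open>\<Phi>\<close>. As moreover
  \<open>r (\<Psi>\<Sigma>) = r (\<Sigma>\<Psi>)\<close>, all terms of the two chains except the first two of the first chain are equal.
  The first inequality follows from \<open>r (\<Phi>\<^sup>2) = (r \<Phi>)\<^sup>2\<close> and the Cauchy-Schwarz inequality, by which the
  product of the means of \<open>A\<^sub>1, B\<^sub>1\<close> and \<open>A\<^sub>2, B\<^sub>2\<close> lies below the mean of \<open>A\<^sub>1 B\<^sub>2\<close> and \<open>B\<^sub>1 A\<^sub>2\<close>.

  For the measure of noncompactness, the point is its monotonicity on positive kernel operators: if the
  norms of \<open>L\<close> and its dual are order continuous, it equals the distance of the image of the unit ball from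
  the order intervals.
\<close>

subsection \<open>Radii of sets of operators\<close>

text \<open>The radii of single operators are defined through spectra, while domination controls
  only limits of \<open>root n (p (A ^^ n))\<close>, so the two have to be identified. That the
  limit bounds the spectrum is a Neumann series, for the essential spectrum applied to a power of
  \<open>A\<close> split into a compact and a small part. The reverse, usually complex analysis of
  the resolvent, is replaced by positivity: the limit itself is a spectral value.

  Domination does not transport finite nets, so neither monotonicity nor the geometric mean bound is
  visible from the definition of the measure of noncompactness. Lying in an order interval up to a
  small error is transported. The way back to nets needs that kernel operators map order intervals
  to totally bounded sets (order continuity of \<open>N\<close>) and that the images of tails of the
  unit ball are uniformly controlled (order continuity of the dual norm). Both rest on two
  functions: a weak unit \<open>w > 0\<close> in \<open>L\<close>, and a weight \<open>v > 0\<close>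
  with \<open>\<integral> v |f| \<le> C N f\<close>. Multiplied by them a kernel becomes integrable
  on the product, where rectangles are dense.\<close>

lemma root_tendsto_of_submultiplicative:
  fixes a :: "nat \<Rightarrow> real"
  assumes nonneg: "\<And>n. 0 \<le> a n" and sub: "\<And>m n. m \<ge> 1 \<Longrightarrow> n \<ge> 1 \<Longrightarrow> a (m + n) \<le> a m * a n"
  obtains l where "0 \<le> l" "(\<lambda>n. root n (a n)) \<longlonglongrightarrow> l" "\<And>n. n \<ge> 1 \<Longrightarrow> l ^ n \<le> a n"
proof -
  \<comment> \<open>Fekete's argument: the limit is the infimum of the roots. Index 0 is left out:
    later sequences involve the identity there, and \<open>root 0\<close> is 0 anyway.\<close>
  define l where "l = Inf ((\<lambda>n. root n (a n)) ` {1..})"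
  have bdd: "bdd_below ((\<lambda>n. root n (a n)) ` {1..})"
    by (rule bdd_belowI[of _ 0]) (auto simp: nonneg)
  have l0: "0 \<le> l" unfolding l_def by (rule cINF_greatest) (auto simp: nonneg)
  have l_le: "l \<le> root n (a n)" if "n \<ge> 1" for n
    unfolding l_def by (rule cINF_lower[OF bdd]) (use that in auto)
  have ln: "l ^ n \<le> a n" if "n \<ge> 1" for n
    using power_mono[OF l_le[OF that] l0, of n] that nonneg[of n] by (simp add: real_root_pow_pos2)
  have "(\<lambda>n. root n (a n)) \<longlonglongrightarrow> l"
  proof (rule order_tendstoI)
    fix y assume "y < l"
    then show "\<forall>\<^sub>F n in sequentially. y < root n (a n)"
      using l_le by (auto simp: eventually_sequentially intro!: exI[of _ 1] elim: less_le_trans)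
  next
    fix y assume "l < y"
    then obtain c where c: "l < c" "c < y" using dense by blast
    have "\<exists>m\<in>{1..}. root m (a m) < c"
      using c(1) bdd unfolding l_def by (subst (asm) cINF_less_iff) auto
    then obtain m where m: "m \<ge> 1" "root m (a m) < c" by auto
    have c0: "0 < c" using l0 c by simp
    have am: "a m \<le> c ^ m"
      using power_mono[of "root m (a m)" c m] m nonneg[of m] by (simp add: real_root_pow_pos2)
    \<comment> \<open>Worst ratio over one period \<open>1..m\<close>; the induction below descends
      by \<open>m\<close> and stops there. Adding 1 makes \<open>K\<close> positive, so that
      \<open>root n K\<close> tends to 1.\<close>
    define K where "K = Max ((\<lambda>s. a s / c ^ s) ` {1..m}) + 1"
    have K: "a s \<le> K * c ^ s" if "1 \<le> s" "s \<le> m" for s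
    proof -
      have "a s / c ^ s \<le> Max ((\<lambda>s. a s / c ^ s) ` {1..m})" using that by (intro Max_ge) auto
      then show ?thesis unfolding K_def using c0 by (simp add: field_simps) (smt (verit) mult_right_mono zero_less_power)
    qed
    have "0 \<le> a m / c ^ m" using nonneg c0 by simp
    also have "a m / c ^ m \<le> Max ((\<lambda>s. a s / c ^ s) ` {1..m})" using m by (intro Max_ge) auto
    finally have K0: "0 < K" unfolding K_def by simp
    have main: "a n \<le> K * c ^ n" if "n \<ge> 1" for n
      using that
    proof (induction n rule: less_induct)
      case (less n)
      show ?case
      proof (cases "n \<le> m")
        case True then show ?thesis using K less.prems by auto
      next
        case False
        then have "a n \<le> a (n - m) * a m" using sub[of "n - m" m] m by simp
        also have "\<dots> \<le> (K * c ^ (n - m)) * c ^ m"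
          using less.IH[of "n - m"] False m am by (intro mult_mono) (auto simp: nonneg K0 c0 less_imp_le)
        also have "\<dots> = K * c ^ n" using False by (simp add: power_add[symmetric] mult.assoc)
        finally show ?thesis .
      qed
    qed
    have "(\<lambda>n. root n K * c) \<longlonglongrightarrow> 1 * c"
      by (intro tendsto_mult LIMSEQ_root_const tendsto_const K0)
    then have "\<forall>\<^sub>F n in sequentially. root n K * c < y"
      using c by (auto dest: order_tendstoD)
    then show "\<forall>\<^sub>F n in sequentially. root n (a n) < y"
      using eventually_ge_at_top[of 1]
    proof eventually_elim
      case (elim n)
      have "root n (a n) \<le> root n (K * c ^ n)" using main elim by simp
      also have "\<dots> = root n K * c" using elim c0 by (simp add: real_root_mult real_root_power_cancel)
      finally show ?case using elim by simp
    qed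
  qed
  with l0 ln show ?thesis using that by blast
qed

lemma root_sqrt_mult: "root k (sqrt (x * y)) = sqrt (root k x * root k y)"
  unfolding sqrt_def by (simp add: real_root_mult_exp[symmetric] real_root_mult mult.commute)

lemma root_mult_power:
  assumes "0 \<le> x" "n \<ge> 1" shows "root (n * k) x ^ n = root k x"
proof -
  have "root (n * k) x = root n (root k x)" by (simp add: real_root_mult_exp real_root_commute)
  then show ?thesis using assms real_root_pow_pos2[of n "root k x"] by (cases k) auto
qed

lemma op_set_powerE_Suc:
  assumes "D \<in> op_set_power \<Phi> (Suc m)"
  obtains A B where "D = A \<circ> B" "A \<in> \<Phi>" "B \<in> op_set_power \<Phi> m"
  using assms by (auto simp: op_set_mult_def)

lemma op_set_power_1 [simp]: "op_set_power \<Phi> (Suc 0) = \<Phi>"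
  by (auto simp: op_set_mult_def)

lemma op_set_mult_assoc: "op_set_mult (op_set_mult A B) C = op_set_mult A (op_set_mult B C)"
  unfolding op_set_mult_def by (auto; metis comp_assoc)

lemma op_set_mult_id [simp]: "op_set_mult {id} A = A" "op_set_mult A {id} = A"
  by (auto simp: op_set_mult_def)

lemma op_set_power_add: "op_set_power \<Phi> (m + n) = op_set_mult (op_set_power \<Phi> m) (op_set_power \<Phi> n)"
  by (induction m) (auto simp: op_set_mult_assoc)

lemma op_set_multI: "A \<in> \<Phi> \<Longrightarrow> B \<in> \<Theta> \<Longrightarrow> A \<circ> B \<in> op_set_mult \<Phi> \<Theta>"
  by (auto simp: op_set_mult_def)

lemma op_set_power_double: "op_set_power (op_set_mult \<Phi> \<Phi>) m = op_set_power \<Phi> (2 * m)"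
  by (induction m) (auto simp: op_set_mult_assoc)

lemma op_set_power_funpow: "A \<in> op_set_power \<Phi> m \<Longrightarrow> A ^^ k \<in> op_set_power \<Phi> (m * k)"
proof (induction k)
  case (Suc k)
  then have "A \<circ> A ^^ k \<in> op_set_power \<Phi> (m + m * k)"
    unfolding op_set_power_add by (auto intro: op_set_multI)
  then show ?case by (simp add: o_def)
qed simp

lemma op_set_power_swap:
  "op_set_mult \<Psi> (op_set_power (op_set_mult \<Phi> \<Psi>) m) = op_set_mult (op_set_power (op_set_mult \<Psi> \<Phi>) m) \<Psi>"
  by (induction m) (auto simp: op_set_mult_assoc)

text \<open>Basis of the invariance of the radii under exchange of the factors: the outer
  \<open>\<Psi>\<close> and \<open>\<Phi>\<close> cost a bounded factor, which disappears under
  roots.\<close>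

lemma op_set_power_Suc_swap:
  "op_set_power (op_set_mult \<Psi> \<Phi>) (Suc m)
     = op_set_mult \<Psi> (op_set_mult (op_set_power (op_set_mult \<Phi> \<Psi>) m) \<Phi>)"
  using op_set_power_swap[of \<Phi> \<Psi> m] by (simp add: op_set_mult_assoc)

lemma comp_funpow_swap: "(A \<circ> B) ^^ Suc k = A \<circ> (B \<circ> A) ^^ k \<circ> B"
proof (induction k)
  case (Suc k)
  have "(A \<circ> B) ^^ Suc (Suc k) = (A \<circ> B) \<circ> (A \<circ> (B \<circ> A) ^^ k \<circ> B)"
    by (simp only: funpow.simps(2)[of "Suc k"] Suc)
  then show ?case by (simp only: comp_assoc funpow.simps)
qed simp

text \<open>\<open>G D P Q\<close> stands for the domination of \<open>D\<close> by the geometric mean of \<open>P\<close> and \<open>Q\<close>.\<close>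

locale radius_functional =
  fixes C :: "'a cop set" and p s :: "'a cop \<Rightarrow> real"
    and G :: "'a cop \<Rightarrow> 'a cop \<Rightarrow> 'a cop \<Rightarrow> bool"
  assumes C_comp: "A \<in> C \<Longrightarrow> B \<in> C \<Longrightarrow> A \<circ> B \<in> C"
    and p_nonneg: "A \<in> C \<Longrightarrow> 0 \<le> p A" and p_id: "0 \<le> p id"
    and p_comp: "A \<in> C \<Longrightarrow> B \<in> C \<Longrightarrow> p (A \<circ> B) \<le> p A * p B"
    and G_comp: "G D P Q \<Longrightarrow> G D' P' Q' \<Longrightarrow> D \<in> C \<Longrightarrow> P \<in> C \<Longrightarrow> Q \<in> C \<Longrightarrow> D' \<in> C \<Longrightarrow> P' \<in> C \<Longrightarrow> Q' \<in> C
           \<Longrightarrow> G (D \<circ> D') (P \<circ> P') (Q \<circ> Q')"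
    and p_mean: "G D P Q \<Longrightarrow> D \<in> C \<Longrightarrow> P \<in> C \<Longrightarrow> Q \<in> C \<Longrightarrow> p D \<le> sqrt (p P * p Q)"
    and s_lim: "A \<in> C \<Longrightarrow> (\<lambda>k. root k (p (A ^^ k))) \<longlonglongrightarrow> s A"
begin

text \<open>Powers start at 1 because \<open>C\<close> need not contain the identity, which is in
  general not a kernel operator.\<close>

lemma C_funpow: "A \<in> C \<Longrightarrow> k \<ge> 1 \<Longrightarrow> A ^^ k \<in> C"
proof (induction k)
  case (Suc k)
  show ?case
  proof (cases k)
    case 0 then show ?thesis using Suc.prems by simp
  next
    case (Suc j)
    then have "A ^^ k \<in> C" using Suc.IH Suc.prems by (simp del: funpow.simps)
    then show ?thesis using Suc.prems unfolding funpow.simps(2) by (intro C_comp)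
  qed
qed simp

lemma C_mult: "\<Phi> \<subseteq> C \<Longrightarrow> \<Theta> \<subseteq> C \<Longrightarrow> op_set_mult \<Phi> \<Theta> \<subseteq> C"
  by (auto simp: op_set_mult_def intro!: C_comp)

lemma C_power: "\<Phi> \<subseteq> C \<Longrightarrow> m \<ge> 1 \<Longrightarrow> op_set_power \<Phi> m \<subseteq> C"
proof (induction m)
  case (Suc m)
  show ?case
  proof (cases m)
    case 0 then show ?thesis using Suc.prems by simp
  next
    case (Suc j)
    then have "op_set_power \<Phi> m \<subseteq> C" using Suc.IH Suc.prems by simp
    then show ?thesis using Suc.prems C_mult by simp
  qed
qed simp

lemma G_funpow: "G D P Q \<Longrightarrow> D \<in> C \<Longrightarrow> P \<in> C \<Longrightarrow> Q \<in> C \<Longrightarrow> k \<ge> 1 \<Longrightarrow> G (D ^^ k) (P ^^ k) (Q ^^ k)"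
proof (induction k)
  case (Suc k)
  show ?case
  proof (cases k)
    case 0 then show ?thesis using Suc.prems by simp
  next
    case (Suc j)
    then have "k \<ge> 1" by simp
    then show ?thesis using Suc.IH Suc.prems C_funpow[of _ k] unfolding funpow.simps(2) by (intro G_comp) blast+
  qed
qed simp

lemma p_funpow_nonneg: "A \<in> C \<Longrightarrow> 0 \<le> p (A ^^ k)"
  using p_id p_nonneg[OF C_funpow, of A k] by (cases k) (auto simp: id_def)

lemma s_nonneg: "A \<in> C \<Longrightarrow> 0 \<le> s A"
  by (rule LIMSEQ_le_const[OF s_lim]) (auto intro!: exI[of _ 1] simp: p_funpow_nonneg)

text \<open>For submultiplicative sequences the limit of the roots is their infimum, hence a lower
  bound at every \<open>n\<close>.\<close>

lemma s_power_le: assumes "A \<in> C" "n \<ge> 1" shows "s A ^ n \<le> p (A ^^ n)"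
proof -
  obtain l where l: "(\<lambda>n. root n (p (A ^^ n))) \<longlonglongrightarrow> l" "\<And>n. n \<ge> 1 \<Longrightarrow> l ^ n \<le> p (A ^^ n)"
    by (rule root_tendsto_of_submultiplicative[of "\<lambda>n. p (A ^^ n)"])
      (auto simp: p_funpow_nonneg[OF assms(1)] funpow_add intro!: p_comp C_funpow assms(1))
  then have "l = s A" using LIMSEQ_unique s_lim assms by blast
  with l assms show ?thesis by simp
qed

lemma s_le: "A \<in> C \<Longrightarrow> s A \<le> p A"
  using s_power_le[of A 1] by simp

text \<open>The roots belonging to \<open>A ^^ n\<close> are the \<open>n\<close>-th powers of the
  roots of \<open>A\<close> along the multiples of \<open>n\<close>.\<close>

lemma s_funpow: assumes "A \<in> C" "n \<ge> 1" shows "s (A ^^ n) = s A ^ n"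
proof -
  have "(\<lambda>k. root k (p ((A ^^ n) ^^ k))) \<longlonglongrightarrow> s (A ^^ n)" using assms C_funpow s_lim by simp
  moreover have "(\<lambda>k. root (n * k) (p (A ^^ (n * k)))) \<longlonglongrightarrow> s A"
    using LIMSEQ_subseq_LIMSEQ[OF s_lim[OF assms(1)], of "\<lambda>k. n * k"] assms
    by (simp add: strict_mono_def o_def)
  then have "(\<lambda>k. root (n * k) (p (A ^^ (n * k))) ^ n) \<longlonglongrightarrow> s A ^ n" by (rule tendsto_power)
  moreover have "root (n * k) (p (A ^^ (n * k))) ^ n = root k (p ((A ^^ n) ^^ k))" for k
    using assms p_funpow_nonneg[OF assms(1)] by (simp add: root_mult_power funpow_mult mult.commute[of k n])
  ultimately show ?thesis using LIMSEQ_unique by simp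
qed

text \<open>Since \<open>(A \<circ> B) ^^ Suc k = A \<circ> (B \<circ> A) ^^ k \<circ> B\<close>,
  the two sequences differ by a constant factor and a shift of the exponent.\<close>

lemma s_swap_le: assumes "A \<in> C" "B \<in> C" shows "s (A \<circ> B) \<le> s (B \<circ> A)"
proof -
  have AB: "A \<circ> B \<in> C" "B \<circ> A \<in> C" using assms C_comp by auto
  define K where "K = p A * p B + 1"
  have K: "K > 0" unfolding K_def using p_nonneg[OF assms(1)] p_nonneg[OF assms(2)] by (simp add: add_nonneg_pos)
  have le: "p ((A \<circ> B) ^^ Suc k) \<le> K * p ((B \<circ> A) ^^ k)" if k: "k \<ge> 1" for k
  proof -
    have "p ((A \<circ> B) ^^ Suc k) \<le> p A * p ((B \<circ> A) ^^ k) * p B"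
      unfolding comp_funpow_swap
      using p_comp[OF C_comp[OF assms(1) C_funpow[OF AB(2) k]] assms(2)]
        mult_right_mono[OF p_comp[OF assms(1) C_funpow[OF AB(2) k]] p_nonneg[OF assms(2)]] by linarith
    also have "\<dots> \<le> K * p ((B \<circ> A) ^^ k)" unfolding K_def using p_funpow_nonneg[OF AB(2)] by (simp add: algebra_simps)
    finally show ?thesis .
  qed
  have sn: "s (A \<circ> B) ^ Suc k \<le> K * p ((B \<circ> A) ^^ k)" if "k \<ge> 1" for k
    using s_power_le[OF AB(1), of "Suc k"] le[OF that] by simp
  show ?thesis
  proof (cases "s (A \<circ> B) = 0")
    case True then show ?thesis using s_nonneg[OF AB(2)] by simp
  next
    case False
    then have pos: "s (A \<circ> B) > 0" using s_nonneg[OF AB(1)] by simp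
    \<comment> \<open>Absorbs the surplus factor of \<open>s (A \<circ> B) ^ Suc k\<close>, so that
      \<open>k\<close>-th roots can be taken on both sides.\<close>
    define K' where "K' = K / s (A \<circ> B)"
    have K': "K' > 0" using K pos by (simp add: K'_def)
    have "(\<lambda>k. root k K' * root k (p ((B \<circ> A) ^^ k))) \<longlonglongrightarrow> 1 * s (B \<circ> A)"
      by (intro tendsto_mult LIMSEQ_root_const s_lim AB K')
    moreover have "s (A \<circ> B) \<le> root k K' * root k (p ((B \<circ> A) ^^ k))" if "k \<ge> 1" for k
    proof -
      have "s (A \<circ> B) ^ k \<le> K' * p ((B \<circ> A) ^^ k)"
        using sn[OF that] pos unfolding K'_def by (simp add: field_simps)
      then have "root k (s (A \<circ> B) ^ k) \<le> root k (K' * p ((B \<circ> A) ^^ k))"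
        using that by simp
      then show ?thesis using that pos by (simp add: real_root_power_cancel real_root_mult)
    qed
    ultimately show ?thesis by (intro LIMSEQ_le_const[of _ "s (B \<circ> A)"]) auto
  qed
qed

text \<open>Domination survives powers, so the bound for \<open>p\<close> can be applied to
  \<open>D ^^ k\<close> before \<open>k\<close>-th roots are taken.\<close>

lemma s_mean: assumes "G D P Q" "D \<in> C" "P \<in> C" "Q \<in> C" shows "s D \<le> sqrt (s P * s Q)"
proof (rule LIMSEQ_le)
  show "(\<lambda>k. root k (p (D ^^ k))) \<longlonglongrightarrow> s D" using assms s_lim by simp
  show "(\<lambda>k. sqrt (root k (p (P ^^ k)) * root k (p (Q ^^ k)))) \<longlonglongrightarrow> sqrt (s P * s Q)"
    using assms by (intro tendsto_intros s_lim)
  show "\<exists>N. \<forall>k\<ge>N. root k (p (D ^^ k)) \<le> sqrt (root k (p (P ^^ k)) * root k (p (Q ^^ k)))"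
  proof (intro exI[of _ 1] allI impI)
    fix k :: nat assume k: "k \<ge> 1"
    have "root k (p (D ^^ k)) \<le> root k (sqrt (p (P ^^ k) * p (Q ^^ k)))"
      using k assms by (simp add: p_mean G_funpow C_funpow)
    also have "\<dots> = sqrt (root k (p (P ^^ k)) * root k (p (Q ^^ k)))"
      by (rule root_sqrt_mult)
    finally show "root k (p (D ^^ k)) \<le> sqrt (root k (p (P ^^ k)) * root k (p (Q ^^ k)))" .
  qed
qed

section \<open>Joint and generalized radius of a set of operators\<close>

definition joint_radius :: "'a cop set \<Rightarrow> real" where
  "joint_radius \<Phi> = lim (\<lambda>m. root m (Sup (insert 0 (p ` op_set_power \<Phi> m))))"

definition gen_radius :: "'a cop set \<Rightarrow> real" where
  "gen_radius \<Phi> = real_of_ereal (limsup (\<lambda>m. ereal (root m (Sup (insert 0 (s ` op_set_power \<Phi> m))))))"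

definition admissible :: "'a cop set \<Rightarrow> bool" where
  "admissible \<Phi> \<longleftrightarrow> \<Phi> \<subseteq> C \<and> (\<exists>K. \<forall>A\<in>\<Phi>. p A \<le> K)"

abbreviation sup_p where "sup_p \<Phi> \<equiv> Sup (insert 0 (p ` \<Phi>))"

lemma admissible_mult: assumes "admissible \<Phi>" "admissible \<Theta>" shows "admissible (op_set_mult \<Phi> \<Theta>)"
proof -
  obtain K L where K: "\<forall>A\<in>\<Phi>. p A \<le> K" and L: "\<forall>A\<in>\<Theta>. p A \<le> L" using assms by (auto simp: admissible_def)
  have "p (A \<circ> B) \<le> \<bar>K\<bar> * \<bar>L\<bar>" if "A \<in> \<Phi>" "B \<in> \<Theta>" for A B
  proof -
    have "p (A \<circ> B) \<le> p A * p B" using that assms by (auto simp: admissible_def intro!: p_comp)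
    also have "\<dots> \<le> \<bar>K\<bar> * \<bar>L\<bar>"
    proof (rule mult_mono)
      show "p A \<le> \<bar>K\<bar>" "p B \<le> \<bar>L\<bar>" using K L that by fastforce+
      show "0 \<le> p B" using that assms by (intro p_nonneg) (auto simp: admissible_def)
    qed simp
    finally show ?thesis .
  qed
  then show ?thesis using assms C_mult by (auto simp: admissible_def op_set_mult_def intro!: exI[of _ "\<bar>K\<bar> * \<bar>L\<bar>"])
qed

lemma admissible_power: "admissible \<Phi> \<Longrightarrow> m \<ge> 1 \<Longrightarrow> admissible (op_set_power \<Phi> m)"
proof (induction m)
  case (Suc m) then show ?case by (cases m) (auto intro: admissible_mult)
qed simp

lemma admissible_C: "admissible \<Phi> \<Longrightarrow> A \<in> \<Phi> \<Longrightarrow> A \<in> C"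
  by (auto simp: admissible_def)

lemma bdd_p: "admissible \<Phi> \<Longrightarrow> bdd_above (insert 0 (p ` \<Phi>))"
  unfolding bdd_above_insert by (auto simp: admissible_def bdd_above_def)

lemma p_le_sup_p: "admissible \<Phi> \<Longrightarrow> A \<in> \<Phi> \<Longrightarrow> p A \<le> sup_p \<Phi>"
  by (intro cSup_upper bdd_p) auto

lemma sup_p_nonneg: "admissible \<Phi> \<Longrightarrow> 0 \<le> sup_p \<Phi>"
  by (intro cSup_upper bdd_p) auto

lemma sup_p_le: "0 \<le> K \<Longrightarrow> (\<And>A. A \<in> \<Phi> \<Longrightarrow> p A \<le> K) \<Longrightarrow> sup_p \<Phi> \<le> K"
  by (intro cSup_least) auto

lemma sup_p_mult:
  assumes "admissible \<Phi>" "admissible \<Theta>" shows "sup_p (op_set_mult \<Phi> \<Theta>) \<le> sup_p \<Phi> * sup_p \<Theta>"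
proof (rule sup_p_le)
  show "0 \<le> sup_p \<Phi> * sup_p \<Theta>" using assms by (simp add: sup_p_nonneg)
  fix D assume "D \<in> op_set_mult \<Phi> \<Theta>"
  then obtain A B where D: "D = A \<circ> B" "A \<in> \<Phi>" "B \<in> \<Theta>" by (auto simp: op_set_mult_def)
  then have "p D \<le> p A * p B" using assms by (auto simp: admissible_def intro!: p_comp)
  also have "\<dots> \<le> sup_p \<Phi> * sup_p \<Theta>" using assms D by (intro mult_mono p_le_sup_p sup_p_nonneg) (auto simp: admissible_def intro: p_nonneg)
  finally show "p D \<le> sup_p \<Phi> * sup_p \<Theta>" .
qed

lemma joint_radius_lim:
  assumes "admissible \<Phi>"
  shows "(\<lambda>m. root m (sup_p (op_set_power \<Phi> m))) \<longlonglongrightarrow> joint_radius \<Phi>" (is ?A)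
    and "0 \<le> joint_radius \<Phi>" (is ?B)
    and "n \<ge> 1 \<Longrightarrow> joint_radius \<Phi> ^ n \<le> sup_p (op_set_power \<Phi> n)" (is "_ \<Longrightarrow> ?C")
proof -
  \<comment> \<open>At index 0 the set of products is \<open>{id}\<close>, which need not be
    admissible. Resetting this value to 0 leaves the sequence of roots unchanged, because
    \<open>root 0\<close> is 0.\<close>
  define a where "a m = (if m = 0 then 0 else sup_p (op_set_power \<Phi> m))" for m
  have "0 \<le> a m" for m using sup_p_nonneg admissible_power assms by (auto simp: a_def)
  moreover have "a (m + n) \<le> a m * a n" if "m \<ge> 1" "n \<ge> 1" for m n
    using that sup_p_mult[of "op_set_power \<Phi> m" "op_set_power \<Phi> n"] admissible_power assms
    by (auto simp: a_def op_set_power_add)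
  ultimately obtain l where l: "0 \<le> l" "(\<lambda>n. root n (a n)) \<longlonglongrightarrow> l" "\<And>n. n \<ge> 1 \<Longrightarrow> l ^ n \<le> a n"
    using root_tendsto_of_submultiplicative by blast
  have "root m (a m) = root m (sup_p (op_set_power \<Phi> m))" for m
    by (cases m) (auto simp: a_def)
  then have "(\<lambda>m. root m (sup_p (op_set_power \<Phi> m))) \<longlonglongrightarrow> l" using l(2) by simp
  moreover from this have "joint_radius \<Phi> = l" unfolding joint_radius_def by (rule limI)
  ultimately show ?A ?B "n \<ge> 1 \<Longrightarrow> ?C" using l by (auto simp: a_def split: if_splits)
qed

abbreviation sup_s where "sup_s \<Phi> \<equiv> Sup (insert 0 (s ` \<Phi>))"

lemma bdd_s: assumes "admissible \<Phi>" shows "bdd_above (insert 0 (s ` \<Phi>))"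
proof -
  obtain K where "\<forall>A\<in>\<Phi>. p A \<le> K" using assms by (auto simp: admissible_def)
  then have "s A \<le> max K 0" if "A \<in> \<Phi>" for A
    using that s_le[OF admissible_C[OF assms that]] by force
  then show ?thesis by (intro bdd_aboveI[of _ "max K 0"]) auto
qed

text \<open>The powers \<open>A ^^ k\<close> lie in \<open>op_set_power \<Phi> (m * k)\<close> and
  \<open>s\<close> is multiplicative on them, so the value \<open>root m (s A)\<close> recurs at all
  multiples of \<open>m\<close> and the limsup cannot lie below it. The limsup thus becomes a least
  constant \<open>c\<close> with \<open>s A \<le> c ^ m\<close>, and later arguments use only
  this.\<close>

lemma gen_radius_props:
  assumes adm: "admissible \<Phi>"
  shows gen_radius_nonneg: "0 \<le> gen_radius \<Phi>"
    and gen_radius_upper: "m \<ge> 1 \<Longrightarrow> A \<in> op_set_power \<Phi> m \<Longrightarrow> s A \<le> gen_radius \<Phi> ^ m"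
    and gen_radius_least: "0 \<le> c \<Longrightarrow> (\<And>m A. m \<ge> 1 \<Longrightarrow> A \<in> op_set_power \<Phi> m \<Longrightarrow> s A \<le> c ^ m) \<Longrightarrow> gen_radius \<Phi> \<le> c"
proof -
  let ?g = "\<lambda>m. sup_s (op_set_power \<Phi> m)"
  let ?l = "limsup (\<lambda>m. ereal (root m (?g m)))"
  have le_c: "?l \<le> ereal c" if c: "0 \<le> c" "\<And>m A. m \<ge> 1 \<Longrightarrow> A \<in> op_set_power \<Phi> m \<Longrightarrow> s A \<le> c ^ m" for c
  proof (rule Limsup_bounded, rule eventually_sequentiallyI[of 1])
    fix m :: nat assume m: "1 \<le> m"
    have "?g m \<le> c ^ m" using c m by (intro cSup_least) auto
    then have "root m (?g m) \<le> root m (c ^ m)" using m by simp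
    then show "ereal (root m (?g m)) \<le> ereal c" using m c by (simp add: real_root_power_cancel)
  qed
  have g0: "0 \<le> ?g m" if "m \<ge> 1" for m
    using bdd_s[OF admissible_power[OF adm that]] by (intro cSup_upper) auto
  have l0: "0 \<le> ?l"
    by (rule le_Limsup) (auto intro!: eventually_sequentiallyI[of 1] g0)
  \<comment> \<open>A crude bound whose purpose is finiteness of the limsup, so that
    \<open>real_of_ereal\<close> does not distort it.\<close>
  define K where "K = sup_p \<Phi>"
  have K: "sup_p (op_set_power \<Phi> m) \<le> K ^ m" if "m \<ge> 1" for m
    using that
  proof (induction m)
    case (Suc m)
    show ?case
    proof (cases m)
      case 0 then show ?thesis by (simp add: K_def)
    next
      case (Suc k)
      have "sup_p (op_set_power \<Phi> (Suc m)) \<le> K * sup_p (op_set_power \<Phi> m)"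
        unfolding K_def op_set_power.simps using adm Suc by (intro sup_p_mult admissible_power) auto
      also have "\<dots> \<le> K * K ^ m" using Suc Suc.IH sup_p_nonneg[OF adm] by (intro mult_left_mono) (auto simp: K_def)
      finally show ?thesis by simp
    qed
  qed simp
  have "?l \<le> ereal K"
  proof (rule le_c)
    show "0 \<le> K" using sup_p_nonneg[OF adm] by (simp add: K_def)
    fix m A assume m: "(1::nat) \<le> m" "A \<in> op_set_power \<Phi> m"
    have "s A \<le> p A" using m adm C_power[of \<Phi> m] by (intro s_le) (auto simp: admissible_def)
    also have "\<dots> \<le> K ^ m" using p_le_sup_p[OF admissible_power[OF adm m(1)] m(2)] K[OF m(1)] by simp
    finally show "s A \<le> K ^ m" .
  qed
  then have fin: "?l = ereal (gen_radius \<Phi>)" using l0 unfolding gen_radius_def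
    by (cases ?l) auto
  show "0 \<le> gen_radius \<Phi>" using l0 fin by simp
  show "gen_radius \<Phi> \<le> c" if "0 \<le> c" "\<And>m A. m \<ge> 1 \<Longrightarrow> A \<in> op_set_power \<Phi> m \<Longrightarrow> s A \<le> c ^ m"
    using le_c[OF that] fin by simp
  show "s A \<le> gen_radius \<Phi> ^ m" if m: "m \<ge> 1" and A: "A \<in> op_set_power \<Phi> m"
  proof -
    have AC: "A \<in> C" using A m adm C_power[of \<Phi> m] by (auto simp: admissible_def)
    have "ereal (root m (s A)) \<le> ?l"
    proof (rule ccontr)
      assume "\<not> ?thesis"
      then have "?l < ereal (root m (s A))" by simp
      then have "\<forall>\<^sub>F n in sequentially. ereal (root n (?g n)) < ereal (root m (s A))" by (rule Limsup_lessD)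
      then obtain n0 where n0: "\<And>n. n \<ge> n0 \<Longrightarrow> root n (?g n) < root m (s A)" by (auto simp: eventually_sequentially)
      \<comment> \<open>Gives a multiple of \<open>m\<close> beyond \<open>n0\<close>, at which the
        value \<open>root m (s A)\<close> reappears.\<close>
      define k where "k = Suc n0"
      have mk: "m * k \<ge> n0" "m * k \<ge> 1" using mult_le_mono1[OF m, of k] by (auto simp: k_def)
      have "s A ^ k = s (A ^^ k)" using s_funpow[OF AC, of k] by (simp add: k_def del: funpow.simps power_Suc)
      also have "\<dots> \<le> ?g (m * k)"
        using op_set_power_funpow[OF A, of k] bdd_s[OF admissible_power[OF adm mk(2)]] by (intro cSup_upper) auto
      finally have "root (m * k) (s A ^ k) \<le> root (m * k) (?g (m * k))" using mk by simp
      moreover have "root (m * k) (s A ^ k) = root m (s A)"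
        using s_nonneg[OF AC] m by (simp add: real_root_mult_exp real_root_power_cancel k_def del: mult_Suc_right power_Suc)
      ultimately show False using n0[OF mk(1)] by simp
    qed
    then have "root m (s A) \<le> gen_radius \<Phi>" using fin by simp
    then have "root m (s A) ^ m \<le> gen_radius \<Phi> ^ m" using s_nonneg[OF AC] m by (intro power_mono) auto
    then show ?thesis using m s_nonneg[OF AC] by (simp add: real_root_pow_pos2)
  qed
qed

lemma radius_nonneg: "admissible \<Phi> \<Longrightarrow> r \<in> {joint_radius, gen_radius} \<Longrightarrow> 0 \<le> r \<Phi>"
  using joint_radius_lim(2) gen_radius_nonneg by auto

lemma G_power:
  assumes ex: "\<And>D. D \<in> \<Theta> \<Longrightarrow> \<exists>P\<in>\<Phi>. \<exists>Q\<in>\<Phi>'. G D P Q" and sub: "\<Theta> \<subseteq> C" "\<Phi> \<subseteq> C" "\<Phi>' \<subseteq> C"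
    and "m \<ge> 1" "D \<in> op_set_power \<Theta> m"
  shows "\<exists>P\<in>op_set_power \<Phi> m. \<exists>Q\<in>op_set_power \<Phi>' m. G D P Q"
  using assms(5,6)
proof (induction m arbitrary: D)
  case (Suc m)
  show ?case
  proof (cases m)
    case 0 then show ?thesis using Suc.prems ex by simp
  next
    case k: (Suc k)
    then have m1: "m \<ge> 1" by simp
    obtain A B where D: "D = A \<circ> B" "A \<in> \<Theta>" "B \<in> op_set_power \<Theta> m" using Suc.prems op_set_powerE_Suc by blast
    obtain P Q where PQ: "P \<in> \<Phi>" "Q \<in> \<Phi>'" "G A P Q" using ex D by blast
    obtain P' Q' where PQ': "P' \<in> op_set_power \<Phi> m" "Q' \<in> op_set_power \<Phi>' m" "G B P' Q'"
      using Suc.IH[of B] D(3) k by (auto simp del: op_set_power.simps)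
    have "G (A \<circ> B) (P \<circ> P') (Q \<circ> Q')"
      using PQ PQ' D sub C_power[OF _ m1] by (intro G_comp) blast+
    then show ?thesis using PQ PQ' unfolding D op_set_power.simps by (meson op_set_multI)
  qed
qed simp

text \<open>Domination passes to products of length \<open>m\<close>. The suprema over the
  dominating \<open>P\<close> and \<open>Q\<close> are then taken independently of each other, so
  the bound survives the supremum and the \<open>m\<close>-th root.\<close>

lemma radius_mean:
  assumes r: "r \<in> {joint_radius, gen_radius}" and adm: "admissible \<Theta>" "admissible \<Phi>" "admissible \<Phi>'"
    and ex: "\<And>D. D \<in> \<Theta> \<Longrightarrow> \<exists>P\<in>\<Phi>. \<exists>Q\<in>\<Phi>'. G D P Q"
  shows "r \<Theta> \<le> sqrt (r \<Phi> * r \<Phi>')"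
proof -
  have sub: "\<Theta> \<subseteq> C" "\<Phi> \<subseteq> C" "\<Phi>' \<subseteq> C" using adm by (auto simp: admissible_def)
  note ex' = G_power[OF ex sub]
  have "joint_radius \<Theta> \<le> sqrt (joint_radius \<Phi> * joint_radius \<Phi>')"
  proof (rule LIMSEQ_le[OF joint_radius_lim(1)[OF adm(1)]])
    show "(\<lambda>m. sqrt (root m (sup_p (op_set_power \<Phi> m)) * root m (sup_p (op_set_power \<Phi>' m))))
        \<longlonglongrightarrow> sqrt (joint_radius \<Phi> * joint_radius \<Phi>')"
      by (intro tendsto_intros joint_radius_lim adm)
    show "\<exists>N. \<forall>m\<ge>N. root m (sup_p (op_set_power \<Theta> m)) \<le>
        sqrt (root m (sup_p (op_set_power \<Phi> m)) * root m (sup_p (op_set_power \<Phi>' m)))"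
    proof (intro exI[of _ 1] allI impI)
      fix m :: nat assume m: "m \<ge> 1"
      have nn: "0 \<le> sup_p (op_set_power \<Phi> m)" "0 \<le> sup_p (op_set_power \<Phi>' m)"
        using adm m admissible_power sup_p_nonneg by auto
      have "sup_p (op_set_power \<Theta> m) \<le> sqrt (sup_p (op_set_power \<Phi> m) * sup_p (op_set_power \<Phi>' m))"
      proof (rule sup_p_le)
        fix D assume D: "D \<in> op_set_power \<Theta> m"
        then obtain P Q where PQ: "P \<in> op_set_power \<Phi> m" "Q \<in> op_set_power \<Phi>' m" "G D P Q" using ex' m by blast
        have mem: "D \<in> C" "P \<in> C" "Q \<in> C" using PQ D sub C_power m by blast+
        have "p D \<le> sqrt (p P * p Q)"
          using PQ mem by (intro p_mean)
        also have "\<dots> \<le> sqrt (sup_p (op_set_power \<Phi> m) * sup_p (op_set_power \<Phi>' m))"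
          using adm m PQ nn p_nonneg mem by (intro real_sqrt_le_mono mult_mono p_le_sup_p admissible_power) auto
        finally show "p D \<le> sqrt (sup_p (op_set_power \<Phi> m) * sup_p (op_set_power \<Phi>' m))" .
      qed (use nn in auto)
      then have "root m (sup_p (op_set_power \<Theta> m)) \<le> root m (sqrt (sup_p (op_set_power \<Phi> m) * sup_p (op_set_power \<Phi>' m)))"
        using m by simp
      also have "\<dots> = sqrt (root m (sup_p (op_set_power \<Phi> m)) * root m (sup_p (op_set_power \<Phi>' m)))"
        by (rule root_sqrt_mult)
      finally show "root m (sup_p (op_set_power \<Theta> m)) \<le>
          sqrt (root m (sup_p (op_set_power \<Phi> m)) * root m (sup_p (op_set_power \<Phi>' m)))" .
    qed
  qed
  moreover have "gen_radius \<Theta> \<le> sqrt (gen_radius \<Phi> * gen_radius \<Phi>')"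
  proof (rule gen_radius_least[OF adm(1)])
    show "0 \<le> sqrt (gen_radius \<Phi> * gen_radius \<Phi>')" using adm gen_radius_nonneg by simp
    fix m D assume m: "(1::nat) \<le> m" and D: "D \<in> op_set_power \<Theta> m"
    then obtain P Q where PQ: "P \<in> op_set_power \<Phi> m" "Q \<in> op_set_power \<Phi>' m" "G D P Q" using ex' m by blast
    then have mem: "D \<in> C" "P \<in> C" "Q \<in> C" using D sub C_power m by blast+
    have "s D \<le> sqrt (s P * s Q)" using PQ mem by (intro s_mean)
    also have "\<dots> \<le> sqrt (gen_radius \<Phi> ^ m * gen_radius \<Phi>' ^ m)"
      using adm m PQ s_nonneg mem gen_radius_nonneg by (intro real_sqrt_le_mono mult_mono gen_radius_upper) auto
    also have "\<dots> = sqrt (gen_radius \<Phi> * gen_radius \<Phi>') ^ m"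
      by (simp add: real_sqrt_power flip: power_mult_distrib)
    finally show "s D \<le> sqrt (gen_radius \<Phi> * gen_radius \<Phi>') ^ m" .
  qed
  ultimately show ?thesis using r by auto
qed

text \<open>Products of odd length in \<open>\<Phi>\<close> are not products in the squared set. For
  the joint radius the even subsequence suffices, as the limit exists; for the generalized radius
  such products are squared first.\<close>

lemma radius_double:
  assumes r: "r \<in> {joint_radius, gen_radius}" and adm: "admissible \<Phi>"
  shows "r (op_set_mult \<Phi> \<Phi>) = r \<Phi> ^ 2"
proof -
  have adm2: "admissible (op_set_mult \<Phi> \<Phi>)" using adm admissible_mult by simp
  have "joint_radius (op_set_mult \<Phi> \<Phi>) = joint_radius \<Phi> ^ 2"
  proof (rule LIMSEQ_unique[OF joint_radius_lim(1)[OF adm2]])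
    have "(\<lambda>m. root (2 * m) (sup_p (op_set_power \<Phi> (2 * m)))) \<longlonglongrightarrow> joint_radius \<Phi>"
      using LIMSEQ_subseq_LIMSEQ[OF joint_radius_lim(1)[OF adm], of "\<lambda>k. 2 * k"]
      by (simp add: strict_mono_def o_def)
    then have "(\<lambda>m. root (2 * m) (sup_p (op_set_power \<Phi> (2 * m))) ^ 2) \<longlonglongrightarrow> joint_radius \<Phi> ^ 2" by (rule tendsto_power)
    moreover have "root (2 * m) (sup_p (op_set_power \<Phi> (2 * m))) ^ 2 = root m (sup_p (op_set_power (op_set_mult \<Phi> \<Phi>) m))" for m
    proof (cases "m = 0")
      case False
      then have "0 \<le> sup_p (op_set_power \<Phi> (2 * m))" using adm by (intro sup_p_nonneg admissible_power) auto
      then show ?thesis by (simp add: op_set_power_double root_mult_power)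
    qed simp
    ultimately show "(\<lambda>m. root m (sup_p (op_set_power (op_set_mult \<Phi> \<Phi>) m))) \<longlonglongrightarrow> joint_radius \<Phi> ^ 2" by simp
  qed
  moreover have "gen_radius (op_set_mult \<Phi> \<Phi>) = gen_radius \<Phi> ^ 2"
  proof (rule antisym)
    show "gen_radius (op_set_mult \<Phi> \<Phi>) \<le> gen_radius \<Phi> ^ 2"
    proof (rule gen_radius_least[OF adm2])
      fix m A assume "(1::nat) \<le> m" "A \<in> op_set_power (op_set_mult \<Phi> \<Phi>) m"
      then have "s A \<le> gen_radius \<Phi> ^ (2 * m)" using adm by (intro gen_radius_upper) (auto simp: op_set_power_double)
      then show "s A \<le> (gen_radius \<Phi> ^ 2) ^ m" by (simp add: power_mult)
    qed simp
    have nn: "0 \<le> gen_radius (op_set_mult \<Phi> \<Phi>)" using gen_radius_nonneg adm2 by simp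
    have "gen_radius \<Phi> \<le> sqrt (gen_radius (op_set_mult \<Phi> \<Phi>))"
    proof (rule gen_radius_least[OF adm])
      fix m A assume m: "(1::nat) \<le> m" and A: "A \<in> op_set_power \<Phi> m"
      then have AC: "A \<in> C" using adm C_power[of \<Phi> m] by (auto simp: admissible_def)
      have "A ^^ 2 \<in> op_set_power (op_set_mult \<Phi> \<Phi>) m"
        using op_set_power_funpow[OF A, of 2] by (simp add: op_set_power_double mult.commute)
      then have "s A ^ 2 \<le> gen_radius (op_set_mult \<Phi> \<Phi>) ^ m"
        using gen_radius_upper[OF adm2 m, of "A ^^ 2"] s_funpow[OF AC, of 2] by simp
      then show "s A \<le> sqrt (gen_radius (op_set_mult \<Phi> \<Phi>)) ^ m"
        by (metis real_le_rsqrt real_sqrt_power)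
    qed (use nn in simp)
    then show "gen_radius \<Phi> ^ 2 \<le> gen_radius (op_set_mult \<Phi> \<Phi>)"
      using power_mono[of "gen_radius \<Phi>" "sqrt (gen_radius (op_set_mult \<Phi> \<Phi>))" 2] gen_radius_nonneg[OF adm] nn by simp
  qed
  ultimately show ?thesis using r by auto
qed

text \<open>For the joint radius the argument of \<open>s_swap_le\<close> is repeated with suprema.
  For the generalized radius each alternating product is rotated cyclically by one factor, which
  does not increase \<open>s\<close> by \<open>s_swap_le\<close>.\<close>

lemma radius_swap_le:
  assumes r: "r \<in> {joint_radius, gen_radius}" and adm: "admissible \<Phi>" "admissible \<Psi>"
  shows "r (op_set_mult \<Phi> \<Psi>) \<le> r (op_set_mult \<Psi> \<Phi>)"
proof -
  let ?A = "op_set_mult \<Phi> \<Psi>" and ?B = "op_set_mult \<Psi> \<Phi>"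
  have adm': "admissible ?A" "admissible ?B" using adm admissible_mult by auto
  have "joint_radius ?A \<le> joint_radius ?B"
  proof (cases "joint_radius ?A = 0")
    case True then show ?thesis using joint_radius_lim(2)[OF adm'(2)] by simp
  next
    case False
    then have pos: "joint_radius ?A > 0" using joint_radius_lim(2)[OF adm'(1)] by simp
    define K where "K = (sup_p \<Phi> * sup_p \<Psi> + 1) / joint_radius ?A"
    have K: "K > 0" unfolding K_def using pos sup_p_nonneg[OF adm(1)] sup_p_nonneg[OF adm(2)]
      by (intro divide_pos_pos) (auto simp: add_nonneg_pos)
    have le: "joint_radius ?A \<le> root k K * root k (sup_p (op_set_power ?B k))" if k: "k \<ge> 1" for k
    proof -
      let ?q = "sup_p (op_set_power ?B k)"
      have q: "0 \<le> ?q" using admissible_power[OF adm'(2) k] sup_p_nonneg by blast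
      have "joint_radius ?A ^ Suc k \<le> sup_p (op_set_power ?A (Suc k))"
        using joint_radius_lim(3)[OF adm'(1), of "Suc k"] by simp
      also have "\<dots> \<le> sup_p \<Phi> * (?q * sup_p \<Psi>)"
        unfolding op_set_power_Suc_swap
        using adm adm' k by (intro order_trans[OF sup_p_mult] mult_left_mono sup_p_mult admissible_mult admissible_power sup_p_nonneg) auto
      also have "\<dots> \<le> (sup_p \<Phi> * sup_p \<Psi> + 1) * ?q" using q by (simp add: algebra_simps)
      finally have "joint_radius ?A ^ k \<le> K * ?q" using pos unfolding K_def by (simp add: field_simps)
      then have "root k (joint_radius ?A ^ k) \<le> root k (K * ?q)" using k by simp
      then show ?thesis using k pos by (simp add: real_root_power_cancel real_root_mult)
    qed
    have "(\<lambda>k. root k K * root k (sup_p (op_set_power ?B k))) \<longlonglongrightarrow> 1 * joint_radius ?B"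
      by (intro tendsto_mult LIMSEQ_root_const joint_radius_lim adm' K)
    then show ?thesis using le by (intro LIMSEQ_le_const[of _ "joint_radius ?B"]) auto
  qed
  moreover have "gen_radius ?A \<le> gen_radius ?B"
  proof (rule gen_radius_least[OF adm'(1)])
    show "0 \<le> gen_radius ?B" using gen_radius_nonneg adm' by simp
    fix m D assume m: "(1::nat) \<le> m" and D: "D \<in> op_set_power ?A m"
    obtain k where k: "m = Suc k" using m by (cases m) auto
    obtain A W where D: "D = A \<circ> W" "A \<in> \<Phi>" "W \<in> op_set_mult (op_set_power ?B k) \<Psi>"
      using D unfolding k op_set_power_Suc_swap by (auto simp: op_set_mult_def)
    have "op_set_mult (op_set_mult (op_set_power ?B k) \<Psi>) \<Phi> = op_set_power ?B (k + 1)"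
      unfolding op_set_power_add by (simp add: op_set_mult_assoc)
    then have WA: "W \<circ> A \<in> op_set_power ?B m" using D k by (metis Suc_eq_plus1 op_set_multI)
    have "W \<in> C"
    proof (cases k)
      case 0 then show ?thesis using D adm by (auto simp: admissible_def)
    next
      case (Suc j)
      then have "admissible (op_set_mult (op_set_power ?B k) \<Psi>)" using adm adm' by (intro admissible_mult admissible_power) auto
      then show ?thesis using D admissible_C by blast
    qed
    then have "s D \<le> s (W \<circ> A)" unfolding D using D adm by (intro s_swap_le) (auto simp: admissible_def)
    also have "\<dots> \<le> gen_radius ?B ^ m" using gen_radius_upper[OF adm'(2) m WA] .
    finally show "s D \<le> gen_radius ?B ^ m" .
  qed
  ultimately show ?thesis using r by auto
qed

lemma radius_swap:
  assumes "r \<in> {joint_radius, gen_radius}" "admissible \<Phi>" "admissible \<Psi>"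
  shows "r (op_set_mult \<Phi> \<Psi>) = r (op_set_mult \<Psi> \<Phi>)"
  using radius_swap_le[OF assms] radius_swap_le[OF assms(1,3,2)] by simp

end

subsection \<open>Real inequalities and product measures\<close>

abbreviation (input) cpx :: "('a \<Rightarrow> real) \<Rightarrow> 'a \<Rightarrow> complex" where
  "cpx f \<equiv> \<lambda>x. complex_of_real (f x)"

lemma le_sqrt_multI:
  fixes X Y Z :: real
  assumes "0 \<le> Y" "0 \<le> Z" and le: "\<And>t. 0 < t \<Longrightarrow> X \<le> (t * Y + Z / t) / 2"
  shows "X \<le> sqrt (Y * Z)"
proof (rule field_le_epsilon)
  fix e :: real assume e: "0 < e"
  show "X \<le> sqrt (Y * Z) + e"
  proof (rule ccontr)
    assume neg: "\<not> X \<le> sqrt (Y * Z) + e"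
    show False
    proof (cases "Y = 0 \<or> Z = 0")
      case False
      then have YZ: "Y > 0" "Z > 0" using assms by auto
      \<comment> \<open>The minimiser in \<open>t\<close> of the arithmetic mean; both summands
        become \<open>sqrt (Y * Z)\<close>.\<close>
      have "X \<le> (sqrt (Z / Y) * Y + Z / sqrt (Z / Y)) / 2" using YZ by (intro le) auto
      also have "sqrt (Z / Y) * Y = sqrt (Y * Z)" using YZ
        by (simp add: real_sqrt_divide real_sqrt_mult field_simps)
      also have "Z / sqrt (Z / Y) = sqrt (Y * Z)" using YZ
        by (simp add: real_sqrt_divide real_sqrt_mult field_simps)
      finally show False using neg e by simp
    next
      \<comment> \<open>Here the infimum 0 need not be attained: a very large \<open>t\<close> (if
        \<open>Y = 0\<close>) or a very small one (if \<open>Z = 0\<close>) brings the mean below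
        \<open>e\<close>. The additions of 1 avoid a zero divisor.\<close>
      case True
      then show False
      proof
        assume Y0: "Y = 0"
        have "X \<le> (((Z + 1) / e) * Y + Z / ((Z + 1) / e)) / 2" using assms e by (intro le) auto
        also have "\<dots> \<le> e" using Y0 assms e by (simp add: field_simps)
        finally show False using neg Y0 by simp
      next
        assume Z0: "Z = 0"
        have "X \<le> ((e / (Y + 1)) * Y + Z / (e / (Y + 1))) / 2" using assms e by (intro le) auto
        also have "\<dots> \<le> e" using Z0 assms e by (simp add: field_simps)
        finally show False using neg Z0 by simp
      qed
    qed
  qed
qed

lemma sqrt_mult_le:
  fixes f g t :: real
  assumes "0 \<le> f" "0 \<le> g" "0 < t" shows "sqrt (f * g) \<le> (t * f + g / t) / 2"
  using arith_geo_mean_sqrt[of "t * f" "g / t"] assms by simp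

text \<open>Obtained by integrating the arithmetic mean bound for each \<open>t\<close> and
  optimising afterwards; integrability is the case \<open>t = 1\<close>.\<close>

lemma Cauchy_Schwarz_integral:
  assumes "integrable M f" "integrable M g" "\<And>x. 0 \<le> f x" "\<And>x. 0 \<le> g x"
  shows "integrable M (\<lambda>x. sqrt (f x * g x) :: real)"
    and "(\<integral>x. sqrt (f x * g x) \<partial>M) \<le> sqrt ((\<integral>x. f x \<partial>M) * (\<integral>x. g x \<partial>M))"
proof -
  note [measurable] = borel_measurable_integrable[OF assms(1)] borel_measurable_integrable[OF assms(2)]
  show int: "integrable M (\<lambda>x. sqrt (f x * g x))"
  proof (rule Bochner_Integration.integrable_bound)
    show "integrable M (\<lambda>x. (1 * f x + g x / 1) / 2)" using assms by auto
    have "sqrt (f x * g x) \<le> (1 * f x + g x / 1) / 2" for x using assms sqrt_mult_le[of "f x" "g x" 1] by simp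
    then show "AE x in M. norm (sqrt (f x * g x)) \<le> norm ((1 * f x + g x / 1) / 2)"
      using assms(3,4) by (auto simp: abs_of_nonneg)
  qed measurable
  show "(\<integral>x. sqrt (f x * g x) \<partial>M) \<le> sqrt ((\<integral>x. f x \<partial>M) * (\<integral>x. g x \<partial>M))"
  proof (rule le_sqrt_multI)
    fix t :: real assume t: "0 < t"
    have "(\<integral>x. sqrt (f x * g x) \<partial>M) \<le> (\<integral>x. (t * f x + g x / t) / 2 \<partial>M)"
      using assms int t sqrt_mult_le by (intro integral_mono) auto
    also have "\<dots> = (t * (\<integral>x. f x \<partial>M) + (\<integral>x. g x \<partial>M) / t) / 2" using assms by simp
    finally show "(\<integral>x. sqrt (f x * g x) \<partial>M) \<le> (t * (\<integral>x. f x \<partial>M) + (\<integral>x. g x \<partial>M) / t) / 2" .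
  qed (use assms in auto)
qed

lemma squeeze_zero:
  fixes a b :: "nat \<Rightarrow> real"
  assumes "\<And>n. 0 \<le> a n" "\<And>n. a n \<le> b n" "b \<longlonglongrightarrow> 0" shows "a \<longlonglongrightarrow> 0"
  by (rule tendsto_sandwich[OF _ _ tendsto_const assms(3)]) (auto simp: assms(1,2))

lemma norm_mult_left_mono:
  fixes d y B :: real
  assumes "0 \<le> y" "y \<le> B" shows "norm (d * y) \<le> norm (d * B)"
  using assms by (auto simp: abs_mult intro!: mult_left_mono)

text \<open>A quantitative midpoint convexity of \<open>1 / x\<close> on \<open>x \<ge> 1\<close>.
  Both sides are multiples of \<open>(a - b)\<^sup>2\<close>, and the comparison of the factors is
  \<open>a + b \<le> 2 * (a * b)\<close>. It turns the convexity gap of a minimising sequence into a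
  Cauchy estimate.\<close>

lemma inverse_midpoint_convex:
  fixes a b :: real
  assumes ab: "1 \<le> a" "1 \<le> b"
  shows "(1 / b - 1 / a)\<^sup>2 \<le> 2 / a + 2 / b - 8 / (a + b)"
proof -
  have pos: "0 < a" "0 < b" "0 < a + b" using ab by auto
  have "a + b \<le> 2 * (a * b)" using mult_left_mono[OF ab(2), of a] mult_right_mono[OF ab(1), of b] pos by linarith
  then have "0 \<le> (2 * (a * b) - (a + b)) / ((a * b)\<^sup>2 * (a + b))" using pos by (intro divide_nonneg_pos) auto
  also have "\<dots> = 2 / (a * b * (a + b)) - 1 / (a * b)\<^sup>2"
  proof -
    have "(2 * c - r) / (c\<^sup>2 * r) = 2 / (c * r) - 1 / c\<^sup>2" if "0 < c" "0 < r" for c r :: real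
      using that by (simp add: diff_divide_distrib power2_eq_square)
    from this[of "a * b" "a + b"] show ?thesis using pos by simp
  qed
  finally have "(a - b)\<^sup>2 * (1 / (a * b)\<^sup>2) \<le> (a - b)\<^sup>2 * (2 / (a * b * (a + b)))" by (intro mult_left_mono) auto
  then have "(a - b)\<^sup>2 / (a * b)\<^sup>2 \<le> 2 * (a - b)\<^sup>2 / (a * b * (a + b))" by (simp add: mult.commute)
  moreover have "(1 / b - 1 / a)\<^sup>2 = (a - b)\<^sup>2 / (a * b)\<^sup>2" using pos by (simp add: field_simps power2_eq_square)
  moreover have "2 / a + 2 / b - 8 / (a + b) = 2 * (a - b)\<^sup>2 / (a * b * (a + b))"
    using pos by (simp add: field_simps power2_eq_square)
  ultimately show ?thesis by simp
qed

text \<open>For \<open>s = 0\<close> the spectrum may be empty; the inserted 0 is then the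
  maximum.\<close>

lemma Sup_norm_eq:
  fixes S :: "complex set"
  assumes "0 \<le> s" "\<And>z. z \<in> S \<Longrightarrow> cmod z \<le> s" "0 < s \<Longrightarrow> of_real s \<in> S"
  shows "Sup (insert 0 (cmod ` S)) = s"
proof (rule cSup_eq_maximum)
  show "s \<in> insert 0 (cmod ` S)" using assms(1,3) by (cases "s = 0") (auto intro!: image_eqI[of _ _ "of_real s"])
qed (use assms in auto)

text \<open>The sets that can be approximated from the ring are closed under complements and
  countable unions; a union is cut off at a finite stage by continuity from below, where finiteness
  of \<open>\<nu>\<close> enters.\<close>

lemma (in semiring_of_sets) generated_ring_approx:
  assumes fin: "finite_measure \<nu>" and sets: "sets \<nu> = sigma_sets \<Omega> M" and \<Omega>: "\<Omega> \<in> M"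
    and Q: "Q \<in> sets \<nu>" and e: "e > (0::real)"
  shows "\<exists>R\<in>generated_ring. measure \<nu> ((Q - R) \<union> (R - Q)) < e"
proof -
  interpret G: ring_of_sets \<Omega> generated_ring by (rule generating_ring)
  interpret finite_measure \<nu> by fact
  have sub: "generated_ring \<subseteq> sets \<nu>"
  proof
    fix R assume "R \<in> generated_ring"
    then obtain C where "finite C" "C \<subseteq> M" "R = \<Union>C" by (auto elim: generated_ringE)
    moreover have "M \<subseteq> sets \<nu>" unfolding sets by (auto intro: sigma_sets.Basic)
    ultimately show "R \<in> sets \<nu>" by (auto intro!: sets.finite_Union)
  qed
  have "Q \<in> sigma_sets \<Omega> M" using Q sets by simp
  then show ?thesis using e
  proof (induction arbitrary: e rule: sigma_sets.induct)
    case (Basic a)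
    then show ?case by (intro bexI[of _ a]) (auto intro: generated_ringI_Basic)
  next
    case Empty
    then show ?case by (intro bexI[of _ "{}"]) auto
  next
    case (Compl a)
    then obtain R where R: "R \<in> generated_ring" "measure \<nu> ((a - R) \<union> (R - a)) < e" by blast
    have "a \<subseteq> \<Omega>" using Compl.hyps sigma_sets_into_sp[OF space_closed] by blast
    then have "(\<Omega> - a - (\<Omega> - R)) \<union> (\<Omega> - R - (\<Omega> - a)) = (a - R) \<union> (R - a)"
      using G.sets_into_space[OF R(1)] by auto
    moreover have "\<Omega> - R \<in> generated_ring" using R(1) \<Omega> generated_ringI_Basic by blast
    ultimately show ?case using R(2) by metis
  next
    case (Union a)
    have am: "a i \<in> sets \<nu>" for i using Union.hyps sets by simp
    have "(\<lambda>n. measure \<nu> (\<Union>i\<le>n. a i)) \<longlonglongrightarrow> measure \<nu> (\<Union>n. \<Union>i\<le>n. a i)"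
      using am by (intro finite_Lim_measure_incseq) (force simp: incseq_def)+
    then have "\<forall>\<^sub>F n in sequentially. measure \<nu> (\<Union>n. \<Union>i\<le>n. a i) - e / 2 < measure \<nu> (\<Union>i\<le>n. a i)"
      using Union.prems by (intro order_tendstoD) auto
    then obtain n where n: "measure \<nu> (\<Union>n. \<Union>i\<le>n. a i) - e / 2 < measure \<nu> (\<Union>i\<le>n. a i)"
      using eventually_happens'[OF sequentially_bot] by blast
    have un: "(\<Union>n. \<Union>i\<le>n. a i) = (\<Union>i. a i)" by auto
    have d1: "measure \<nu> ((\<Union>i. a i) - (\<Union>i\<le>n. a i)) < e / 2"
      using n am unfolding un by (subst finite_measure_Diff) auto
    \<comment> \<open>Half of the error is spent on cutting off the union, the other half is shared
      by the \<open>n + 1\<close> remaining members.\<close>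
    define e' where "e' = e / (2 * (real n + 1))"
    have e': "e' > 0" using Union.prems by (simp add: e'_def)
    then obtain R where R: "\<And>i. R i \<in> generated_ring" "\<And>i. measure \<nu> ((a i - R i) \<union> (R i - a i)) < e'"
      using Union.IH by metis
    have Rm: "R i \<in> sets \<nu>" for i using R sub by auto
    let ?R = "\<Union>i\<le>n. R i"
    have "measure \<nu> (((\<Union>i. a i) - ?R) \<union> (?R - (\<Union>i. a i)))
       \<le> measure \<nu> (((\<Union>i. a i) - (\<Union>i\<le>n. a i)) \<union> (\<Union>i\<le>n. (a i - R i) \<union> (R i - a i)))"
      using am Rm by (intro finite_measure_mono) auto
    also have "\<dots> \<le> measure \<nu> ((\<Union>i. a i) - (\<Union>i\<le>n. a i)) + measure \<nu> (\<Union>i\<le>n. (a i - R i) \<union> (R i - a i))"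
      using am Rm by (intro measure_Un_le) auto
    also have "measure \<nu> (\<Union>i\<le>n. (a i - R i) \<union> (R i - a i)) \<le> (\<Sum>i\<le>n. measure \<nu> ((a i - R i) \<union> (R i - a i)))"
      using am Rm by (intro measure_UNION_le) auto
    also have "\<dots> \<le> (\<Sum>i\<le>n. e')" using R(2) by (intro sum_mono less_imp_le) auto
    also have "\<dots> = e / 2" using Union.prems by (simp add: e'_def field_simps)
    finally have "measure \<nu> (((\<Union>i. a i) - ?R) \<union> (?R - (\<Union>i. a i))) < e" using d1 by simp
    moreover have "?R \<in> generated_ring" using R(1) by (intro G.finite_UN) auto
    ultimately show ?case by blast
  qed
qed

lemma semiring_of_rectangles:
  "semiring_of_sets (space M \<times> space N) {A \<times> B | A B. A \<in> sets M \<and> B \<in> sets N}"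
proof
  show "{A \<times> B | A B. A \<in> sets M \<and> B \<in> sets N} \<subseteq> Pow (space M \<times> space N)"
    by (rule pair_measure_closed)
  show "{} \<in> {A \<times> B | A B. A \<in> sets M \<and> B \<in> sets N}" by auto
  fix a b assume "a \<in> {A \<times> B | A B. A \<in> sets M \<and> B \<in> sets N}" "b \<in> {A \<times> B | A B. A \<in> sets M \<and> B \<in> sets N}"
  then obtain A B C D where ab: "a = A \<times> B" "b = C \<times> D" and m: "A \<in> sets M" "B \<in> sets N" "C \<in> sets M" "D \<in> sets N" by auto
  have "a \<inter> b = (A \<inter> C) \<times> (B \<inter> D)" using ab by auto
  then show "a \<inter> b \<in> {A \<times> B | A B. A \<in> sets M \<and> B \<in> sets N}" using m by blast
  show "\<exists>C\<subseteq>{A \<times> B | A B. A \<in> sets M \<and> B \<in> sets N}. finite C \<and> disjoint C \<and> a - b = \<Union> C"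
  proof (intro exI[of _ "{(A - C) \<times> B, (A \<inter> C) \<times> (B - D)}"] conjI)
    show "{(A - C) \<times> B, (A \<inter> C) \<times> (B - D)} \<subseteq> {A \<times> B | A B. A \<in> sets M \<and> B \<in> sets N}"
      using m by blast
    show "disjoint {(A - C) \<times> B, (A \<inter> C) \<times> (B - D)}" by (auto simp: disjoint_def)
    show "a - b = \<Union> {(A - C) \<times> B, (A \<inter> C) \<times> (B - D)}" using ab by auto
  qed simp
qed

text \<open>The set where \<open>k\<close> is negative is no rectangle, but it is approximated by
  finite disjoint unions of rectangles. Hence the integral of \<open>k\<close> over it is
  nonnegative, and the set is null.\<close>

lemma (in pair_sigma_finite) AE_nonneg_of_rectangles:
  fixes k :: "'a \<times> 'b \<Rightarrow> real"
  assumes k: "integrable (M1 \<Otimes>\<^sub>M M2) k"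
    and rect: "\<And>A B. A \<in> sets M1 \<Longrightarrow> B \<in> sets M2 \<Longrightarrow> 0 \<le> (\<integral>p. indicator (A \<times> B) p * k p \<partial>(M1 \<Otimes>\<^sub>M M2))"
  shows "AE p in M1 \<Otimes>\<^sub>M M2. 0 \<le> k p"
proof -
  let ?P = "M1 \<Otimes>\<^sub>M M2" and ?G = "{A \<times> B | A B. A \<in> sets M1 \<and> B \<in> sets M2}"
  have [measurable]: "k \<in> borel_measurable ?P" using k by simp
  interpret S: semiring_of_sets "space M1 \<times> space M2" ?G by (rule semiring_of_rectangles)
  \<comment> \<open>With density \<open>|k|\<close>, the mass of a symmetric difference bounds the
    change of the integral of \<open>k\<close>.\<close>
  define \<nu> where "\<nu> = density ?P (\<lambda>p. ennreal \<bar>k p\<bar>)"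
  have fin: "finite_measure \<nu>"
  proof
    have "emeasure \<nu> (space \<nu>) = (\<integral>\<^sup>+p. ennreal \<bar>k p\<bar> * indicator (space ?P) p \<partial>?P)"
      unfolding \<nu>_def by (simp add: emeasure_density)
    also have "\<dots> = (\<integral>\<^sup>+p. ennreal (norm (k p)) \<partial>?P)" by (intro nn_integral_cong) auto
    also have "\<dots> < \<infinity>" using k integrable_iff_bounded by blast
    finally show "emeasure \<nu> (space \<nu>) \<noteq> \<infinity>" by simp
  qed
  have sets: "sets \<nu> = sigma_sets (space M1 \<times> space M2) ?G" unfolding \<nu>_def by (simp add: sets_pair_measure)
  have im: "integrable ?P (\<lambda>p. indicator R p * k p)" if "R \<in> sets ?P" for R
    using that integrable_mult_indicator[OF that k] by simp
  have meas: "measure \<nu> R = (\<integral>p. indicator R p * \<bar>k p\<bar> \<partial>?P)" if "R \<in> sets ?P" for R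
  proof -
    have "(\<integral>\<^sup>+p. ennreal \<bar>k p\<bar> * indicator R p \<partial>?P) = (\<integral>\<^sup>+p. ennreal (indicator R p * \<bar>k p\<bar>) \<partial>?P)"
      by (intro nn_integral_cong) (auto simp: indicator_def)
    then show ?thesis unfolding \<nu>_def measure_def using that
      by (subst integral_eq_nn_integral) (auto simp: emeasure_density)
  qed
  have ring: "0 \<le> (\<integral>p. indicator R p * k p \<partial>?P)" if "R \<in> S.generated_ring" for R
  proof -
    obtain C where C: "finite C" "disjoint C" "C \<subseteq> ?G" "R = \<Union>C" using \<open>R \<in> S.generated_ring\<close> by (rule S.generated_ringE)
    have Cm: "c \<in> sets ?P" if "c \<in> C" for c using C(3) that by auto
    have "indicator R p = (\<Sum>c\<in>C. indicator c p :: real)" for p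
      unfolding C(4) using C(1,2) indicator_UN_disjoint[of C "\<lambda>c. c" p] by (simp add: disjoint_family_on_def disjoint_def)
    then have "(\<integral>p. indicator R p * k p \<partial>?P) = (\<Sum>c\<in>C. \<integral>p. indicator c p * k p \<partial>?P)"
      using Cm im by (simp add: sum_distrib_right)
    also have "\<dots> \<ge> 0" using C(3) rect by (intro sum_nonneg) auto
    finally show ?thesis .
  qed
  define Q where "Q = {p\<in>space ?P. k p < 0}"
  have Q: "Q \<in> sets ?P" unfolding Q_def by measurable
  have "0 \<le> (\<integral>p. indicator Q p * k p \<partial>?P)"
  proof (rule field_le_epsilon)
    fix e :: real assume "0 < e"
    have "space M1 \<times> space M2 \<in> ?G" by blast
    moreover have "Q \<in> sets \<nu>" using Q by (simp add: \<nu>_def)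
    ultimately obtain R where R: "R \<in> S.generated_ring" "measure \<nu> ((Q - R) \<union> (R - Q)) < e"
      using S.generated_ring_approx[OF fin sets _ _ \<open>0 < e\<close>] by blast
    have Rm: "R \<in> sets ?P"
    proof -
      obtain C where C: "finite C" "disjoint C" "C \<subseteq> ?G" "R = \<Union>C" using R(1) by (rule S.generated_ringE)
      then show ?thesis by (auto intro!: sets.finite_Union)
    qed
    let ?D = "(Q - R) \<union> (R - Q)"
    have D: "?D \<in> sets ?P" using Q Rm by auto
    have "(\<integral>p. indicator R p * k p \<partial>?P) - (\<integral>p. indicator Q p * k p \<partial>?P) = (\<integral>p. indicator R p * k p - indicator Q p * k p \<partial>?P)"
      using im[OF Rm] im[OF Q] by simp
    also have "\<dots> \<le> (\<integral>p. indicator ?D p * \<bar>k p\<bar> \<partial>?P)"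
      using im[OF Rm] im[OF Q] integrable_abs[OF im[OF D]]
      by (intro integral_mono) (auto simp: abs_mult indicator_def)
    also have "\<dots> < e" using R(2) meas[OF D] by simp
    finally show "0 \<le> (\<integral>p. indicator Q p * k p \<partial>?P) + e" using ring[OF R(1)] by simp
  qed
  then have "0 \<ge> (\<integral>p. - (indicator Q p * k p) \<partial>?P)" by simp
  moreover have nn: "0 \<le> - (indicator Q p * k p)" for p by (auto simp: Q_def indicator_def)
  ultimately have "(\<integral>p. - (indicator Q p * k p) \<partial>?P) = 0"
    by (intro antisym Bochner_Integration.integral_nonneg) auto
  then have "AE p in ?P. - (indicator Q p * k p) = 0"
    using integral_nonneg_eq_0_iff_AE[of ?P "\<lambda>p. - (indicator Q p * k p)"] im[OF Q] nn by auto
  then show ?thesis using AE_space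
    by eventually_elim (auto simp: Q_def indicator_def split: if_splits)
qed

text \<open>The indicators of rectangles of finite measure span a dense subspace of
  \<open>L\<^sup>1\<close> of the product, so linear conditions that are closed in
  \<open>L\<^sup>1\<close> need only be checked on them.\<close>

lemma (in pair_sigma_finite) L1_rectangle_induct [consumes 1, case_names rectangle add scale lim]:
  fixes P :: "('a \<times> 'b \<Rightarrow> real) \<Rightarrow> bool"
  assumes h: "integrable (M1 \<Otimes>\<^sub>M M2) h"
    and rect: "\<And>F E. F \<in> sets M1 \<Longrightarrow> E \<in> sets M2 \<Longrightarrow> emeasure M1 F < \<infinity> \<Longrightarrow> emeasure M2 E < \<infinity> \<Longrightarrow> P (indicator (F \<times> E))"
    and add: "\<And>f g. integrable (M1 \<Otimes>\<^sub>M M2) f \<Longrightarrow> integrable (M1 \<Otimes>\<^sub>M M2) g \<Longrightarrow> P f \<Longrightarrow> P g \<Longrightarrow> P (\<lambda>p. f p + g p)"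
    and scale: "\<And>f c. integrable (M1 \<Otimes>\<^sub>M M2) f \<Longrightarrow> P f \<Longrightarrow> P (\<lambda>p. c * f p)"
    and lim: "\<And>f. integrable (M1 \<Otimes>\<^sub>M M2) f \<Longrightarrow>
       (\<And>e. 0 < e \<Longrightarrow> \<exists>g. integrable (M1 \<Otimes>\<^sub>M M2) g \<and> P g \<and> (\<integral>p. \<bar>f p - g p\<bar> \<partial>(M1 \<Otimes>\<^sub>M M2)) \<le> e) \<Longrightarrow> P f"
  shows "P h"
proof -
  let ?P = "M1 \<Otimes>\<^sub>M M2" and ?G = "{A \<times> B | A B. A \<in> sets M1 \<and> B \<in> sets M2}"
  interpret S: semiring_of_sets "space M1 \<times> space M2" ?G by (rule semiring_of_rectangles)
  obtain A :: "nat \<Rightarrow> 'a set" where A: "range A \<subseteq> sets M1" "(\<Union>i. A i) = space M1" "\<And>i. emeasure M1 (A i) \<noteq> \<infinity>" "incseq A"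
    using M1.sigma_finite_incseq by blast
  obtain B :: "nat \<Rightarrow> 'b set" where B: "range B \<subseteq> sets M2" "(\<Union>i. B i) = space M2" "\<And>i. emeasure M2 (B i) \<noteq> \<infinity>" "incseq B"
    using M2.sigma_finite_incseq by blast
  have [measurable]: "A n \<in> sets M1" "B n \<in> sets M2" for n using A(1) B(1) by auto
  let ?R = "\<lambda>n. A n \<times> B n"
  have Rfin: "emeasure ?P (?R n) < \<infinity>" for n
    using A(3)[of n] B(3)[of n] by (simp add: M2.emeasure_pair_measure_Times ennreal_mult_less_top less_top)
  have P0: "P (\<lambda>p. 0)" using scale[of "indicator ({} \<times> {})" 0] rect[of "{}" "{}"] by simp
  have ind_sum: "P (\<lambda>p. \<Sum>c\<in>C. f c p)" if "finite C" "\<And>c. c \<in> C \<Longrightarrow> P (f c)" "\<And>c. c \<in> C \<Longrightarrow> integrable ?P (f c)"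
    for C :: "('a \<times> 'b) set set" and f
    using that by (induction C rule: finite_induct) (auto intro!: P0 add)
  \<comment> \<open>Inside one rectangle of finite measure the approximation from the ring is
    available; the approximating sets are cut down to \<open>?R n\<close>, so they still consist of
    rectangles of finite measure.\<close>
  have local: "P (indicator (Q \<inter> ?R n))" if Q: "Q \<in> sets ?P" for Q n
  proof (rule lim)
    have [measurable]: "Q \<in> sets ?P" by (rule Q)
    define \<nu> where "\<nu> = density ?P (indicator (?R n))"
    have em: "emeasure \<nu> X = emeasure ?P (?R n \<inter> X)" if "X \<in> sets ?P" for X
      unfolding \<nu>_def using that by (subst emeasure_density) (auto simp: indicator_inter_arith[symmetric])
    have ms: "measure \<nu> X = measure ?P (?R n \<inter> X)" if "X \<in> sets ?P" for X using em[OF that] by (simp add: measure_def)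
    have fin: "finite_measure \<nu>"
    proof
      have "emeasure \<nu> (space \<nu>) = emeasure ?P (?R n \<inter> space ?P)" by (subst em[symmetric]) (auto simp: \<nu>_def)
      also have "\<dots> \<le> emeasure ?P (?R n)" by (intro emeasure_mono) auto
      finally show "emeasure \<nu> (space \<nu>) \<noteq> \<infinity>" using Rfin[of n] by (auto simp: top_unique)
    qed
    have sets: "sets \<nu> = sigma_sets (space M1 \<times> space M2) ?G" unfolding \<nu>_def by (simp add: sets_pair_measure)
    have fm: "emeasure ?P (X \<inter> ?R n) < \<infinity>" if "X \<in> sets ?P" for X
      using emeasure_mono[of "X \<inter> ?R n" "?R n" ?P] Rfin[of n] by (auto intro: order.strict_trans1)
    show intQ: "integrable ?P (indicator (Q \<inter> ?R n) :: _ \<Rightarrow> real)" using fm[OF Q] by (intro integrable_real_indicator) auto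
    fix e :: real assume e: "0 < e"
    have "space M1 \<times> space M2 \<in> ?G" by blast
    moreover have "Q \<in> sets \<nu>" by (simp add: \<nu>_def)
    ultimately obtain R where R: "R \<in> S.generated_ring" "measure \<nu> ((Q - R) \<union> (R - Q)) < e"
      using S.generated_ring_approx[OF fin sets _ _ e] by blast
    obtain C where C: "finite C" "disjoint C" "C \<subseteq> ?G" "R = \<Union>C" using R(1) by (rule S.generated_ringE)
    have Cm: "c \<in> sets ?P" if "c \<in> C" for c using C(3) that by auto
    have Rm[measurable]: "R \<in> sets ?P" unfolding C(4) using C(1) Cm by auto
    have "indicator (R \<inter> ?R n) p = (\<Sum>c\<in>C. indicator (c \<inter> ?R n) p :: real)" for p
    proof -
      have "R \<inter> ?R n = (\<Union>c\<in>C. c \<inter> ?R n)" using C(4) by auto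
      moreover have "disjoint_family_on (\<lambda>c. c \<inter> ?R n) C" using C(2) by (auto simp: disjoint_family_on_def disjoint_def)
      ultimately show ?thesis using indicator_UN_disjoint[OF C(1), of "\<lambda>c. c \<inter> ?R n" p] by simp
    qed
    then have eq: "indicator (R \<inter> ?R n) = (\<lambda>p. \<Sum>c\<in>C. indicator (c \<inter> ?R n) p :: real)" by auto
    have PR: "P (indicator (R \<inter> ?R n))" unfolding eq
    proof (rule ind_sum[OF C(1)])
      fix c assume c: "c \<in> C"
      then obtain F E where c': "c = F \<times> E" "F \<in> sets M1" "E \<in> sets M2" using C(3) by auto
      have "c \<inter> ?R n = (F \<inter> A n) \<times> (E \<inter> B n)" using c' by auto
      moreover have "emeasure M1 (F \<inter> A n) < \<infinity>" "emeasure M2 (E \<inter> B n) < \<infinity>"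
        using emeasure_mono[of "F \<inter> A n" "A n" M1] emeasure_mono[of "E \<inter> B n" "B n" M2] A(3)[of n] B(3)[of n]
        by (auto simp: less_top intro: order.strict_trans1)
      ultimately show "P (indicator (c \<inter> ?R n))" using rect[of "F \<inter> A n" "E \<inter> B n"] c' by simp
      show "integrable ?P (indicator (c \<inter> ?R n) :: _ \<Rightarrow> real)" using fm[OF Cm[OF c]] Cm[OF c] by (intro integrable_real_indicator) auto
    qed
    have "(\<integral>p. \<bar>indicator (Q \<inter> ?R n) p - indicator (R \<inter> ?R n) p :: real\<bar> \<partial>?P) = (\<integral>p. indicator (?R n \<inter> ((Q - R) \<union> (R - Q))) p \<partial>?P)"
      by (intro Bochner_Integration.integral_cong) (auto simp: indicator_def)
    also have "\<dots> = measure ?P (?R n \<inter> ((Q - R) \<union> (R - Q)))" using sets.sets_into_space[OF Q] by (simp add: Int_absorb2 inf.coboundedI1 sets.sets_into_space)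
    also have "\<dots> \<le> e" using R(2) by (subst ms[symmetric]) auto
    finally have "(\<integral>p. \<bar>indicator (Q \<inter> ?R n) p - indicator (R \<inter> ?R n) p\<bar> \<partial>?P) \<le> e" .
    moreover have "integrable ?P (indicator (R \<inter> ?R n) :: _ \<Rightarrow> real)" using fm[OF Rm] by (intro integrable_real_indicator) auto
    ultimately show "\<exists>g. integrable ?P g \<and> P g \<and> (\<integral>p. \<bar>indicator (Q \<inter> ?R n) p - g p\<bar> \<partial>?P) \<le> e" using PR by blast
  qed
  \<comment> \<open>A set of finite measure is exhausted by its parts in \<open>?R n\<close>, by
    dominated convergence.\<close>
  have ind: "P (indicator Q)" if Q: "Q \<in> sets ?P" "emeasure ?P Q < \<infinity>" for Q
  proof (rule lim)
    have [measurable]: "Q \<in> sets ?P" by (rule Q)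
    show intQ: "integrable ?P (indicator Q :: _ \<Rightarrow> real)" using Q by (intro integrable_real_indicator) auto
    fix e :: real assume e: "0 < e"
    have "(\<lambda>n. \<integral>p. \<bar>indicator Q p - indicator (Q \<inter> ?R n) p :: real\<bar> \<partial>?P) \<longlonglongrightarrow> (\<integral>p. 0 \<partial>?P)"
    proof (rule integral_dominated_convergence[OF _ _ intQ])
      show "AE p in ?P. (\<lambda>n. \<bar>indicator Q p - indicator (Q \<inter> ?R n) p :: real\<bar> :: real) \<longlonglongrightarrow> 0"
      proof (rule AE_I2)
        fix p assume "p \<in> space ?P"
        then have "fst p \<in> (\<Union>i. A i)" "snd p \<in> (\<Union>i. B i)" unfolding A(2) B(2) by (auto simp: space_pair_measure)
        then obtain i j where ij: "fst p \<in> A i" "snd p \<in> B j" by blast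
        have "\<forall>\<^sub>F n in sequentially. \<bar>indicator Q p - indicator (Q \<inter> ?R n) p :: real\<bar> = (0 :: real)"
        proof (rule eventually_sequentiallyI[of "max i j"])
          fix n assume "max i j \<le> n"
          then have "A i \<subseteq> A n" "B j \<subseteq> B n" using incseqD[OF A(4), of i n] incseqD[OF B(4), of j n] by simp_all
          then have "fst p \<in> A n" "snd p \<in> B n" using ij by blast+
          then have "p \<in> ?R n" by (cases p) auto
          then show "\<bar>indicator Q p - indicator (Q \<inter> ?R n) p :: real\<bar> = (0 :: real)" by (auto simp: indicator_def)
        qed
        then show "(\<lambda>n. \<bar>indicator Q p - indicator (Q \<inter> ?R n) p :: real\<bar> :: real) \<longlonglongrightarrow> 0" by (rule tendsto_eventually)
      qed
      show "AE p in ?P. norm (\<bar>indicator Q p - indicator (Q \<inter> ?R n) p :: real\<bar> :: real) \<le> indicator Q p" for n by (auto simp: indicator_def)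
    qed measurable
    then have "\<forall>\<^sub>F n in sequentially. (\<integral>p. \<bar>indicator Q p - indicator (Q \<inter> ?R n) p :: real\<bar> \<partial>?P) < e" by (rule order_tendstoD) (use e in simp)
    then obtain n where n: "(\<integral>p. \<bar>indicator Q p - indicator (Q \<inter> ?R n) p :: real\<bar> \<partial>?P) < e" using eventually_happens'[OF sequentially_bot] by blast
    have "emeasure ?P (Q \<inter> ?R n) < \<infinity>" using emeasure_mono[of "Q \<inter> ?R n" Q ?P] Q by (auto intro: order.strict_trans1)
    then have "integrable ?P (indicator (Q \<inter> ?R n) :: _ \<Rightarrow> real)" by (intro integrable_real_indicator) auto
    then show "\<exists>g. integrable ?P g \<and> P g \<and> (\<integral>p. \<bar>indicator Q p - g p\<bar> \<partial>?P) \<le> e" using n local[OF Q(1), of n] by (intro exI[of _ "indicator (Q \<inter> ?R n)"]) auto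
  qed
  show ?thesis using h
  proof (induction rule: integrable_induct)
    case (base Q c)
    then show ?case using scale[of "indicator Q" c] ind[of Q] by (simp add: mult.commute)
  next
    case (add f g) then show ?case using assms(3) by blast
  next
    case (lim f t)
    then have fi: "integrable ?P f" and ti: "\<And>n. integrable ?P (t n)" and Pt: "\<And>n. P (t n)"
      and tf: "\<And>p. p \<in> space ?P \<Longrightarrow> (\<lambda>n. t n p) \<longlonglongrightarrow> f p"
      and tb: "\<And>p n. p \<in> space ?P \<Longrightarrow> norm (t n p) \<le> 2 * norm (f p)" by auto
    show ?case
    proof (rule assms(5)[OF fi])
      fix e :: real assume e: "0 < e"
      have "(\<lambda>n. \<integral>p. \<bar>f p - t n p\<bar> \<partial>?P) \<longlonglongrightarrow> (\<integral>p. 0 \<partial>?P)"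
      proof (rule integral_dominated_convergence[of _ _ _ "\<lambda>p. 3 * norm (f p)"])
        show "AE p in ?P. (\<lambda>n. \<bar>f p - t n p\<bar>) \<longlonglongrightarrow> 0"
        proof (rule AE_I2)
          fix p assume "p \<in> space ?P"
          then have "(\<lambda>n. \<bar>f p - t n p\<bar>) \<longlonglongrightarrow> \<bar>f p - f p\<bar>" by (intro tendsto_intros tf)
          then show "(\<lambda>n. \<bar>f p - t n p\<bar>) \<longlonglongrightarrow> 0" by simp
        qed
        show "AE p in ?P. norm \<bar>f p - t n p\<bar> \<le> 3 * norm (f p)" for n
        proof (rule AE_I2)
          fix p assume "p \<in> space ?P"
          then show "norm \<bar>f p - t n p\<bar> \<le> 3 * norm (f p)" using tb[of p n] by auto
        qed
      qed (use fi ti in auto)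
      then have "\<forall>\<^sub>F n in sequentially. (\<integral>p. \<bar>f p - t n p\<bar> \<partial>?P) < e" by (rule order_tendstoD) (use e in simp)
      then obtain n where "(\<integral>p. \<bar>f p - t n p\<bar> \<partial>?P) < e" using eventually_happens'[OF sequentially_bot] by blast
      then show "\<exists>g. integrable ?P g \<and> P g \<and> (\<integral>p. \<bar>f p - g p\<bar> \<partial>?P) \<le> e" using ti Pt by (intro exI[of _ "t n"]) auto
    qed
  qed
qed

subsection \<open>Kernel operators on Banach function spaces\<close>

context banach_function_space
begin

sublocale pair: pair_sigma_finite M M ..

lemma N_cong: assumes "f \<in> L" "g \<in> L" "AE x in M. f x = g x" shows "N f = N g"
proof (rule antisym)
  show "N f \<le> N g" using assms measurable by (intro norm_mono) (auto elim: eventually_mono)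
  show "N g \<le> N f" using assms measurable by (intro norm_mono) (auto elim: eventually_mono)
qed

lemma uminus_mem: "f \<in> L \<Longrightarrow> (\<lambda>x. - f x) \<in> L"
  using scale_mem[of f "-1"] by simp

lemma norm_uminus: "f \<in> L \<Longrightarrow> N (\<lambda>x. - f x) = N f"
  using norm_scale[of f "-1"] by simp

lemma diff_mem: "f \<in> L \<Longrightarrow> g \<in> L \<Longrightarrow> (\<lambda>x. f x - g x) \<in> L"
  using add_mem[of f "\<lambda>x. - g x"] uminus_mem by simp

lemma norm_diff_commute: "f \<in> L \<Longrightarrow> g \<in> L \<Longrightarrow> N (\<lambda>x. f x - g x) = N (\<lambda>x. g x - f x)"
  using norm_uminus[OF diff_mem, of f g] by simp

lemma norm_triangle_trans:
  "f \<in> L \<Longrightarrow> g \<in> L \<Longrightarrow> h \<in> L \<Longrightarrow> N (\<lambda>x. f x - h x) \<le> N (\<lambda>x. f x - g x) + N (\<lambda>x. g x - h x)"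
  using norm_triangle[OF diff_mem diff_mem, of f g g h] by simp

lemma norm_le_add_diff: "f \<in> L \<Longrightarrow> g \<in> L \<Longrightarrow> N f \<le> N g + N (\<lambda>x. f x - g x)"
  using norm_triangle[OF _ diff_mem, of g f g] by simp

lemma norm_zero [simp]: "N (\<lambda>_. 0) = 0"
  using norm_eq_zero_iff[OF zero_mem] by simp

lemma sum_mem: "(\<And>i. i \<in> I \<Longrightarrow> f i \<in> L) \<Longrightarrow> (\<lambda>x. \<Sum>i\<in>I. f i x) \<in> L"
  by (induction I rule: infinite_finite_induct) (auto intro: zero_mem add_mem)

lemma norm_sum_le: "(\<And>i. i \<in> I \<Longrightarrow> f i \<in> L) \<Longrightarrow> N (\<lambda>x. \<Sum>i\<in>I. f i x) \<le> (\<Sum>i\<in>I. N (f i))"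
proof (induction I rule: infinite_finite_induct)
  case (insert i I)
  then have "N (\<lambda>x. f i x + (\<Sum>i\<in>I. f i x)) \<le> N (f i) + N (\<lambda>x. \<Sum>i\<in>I. f i x)"
    by (intro norm_triangle sum_mem) auto
  with insert show ?case by fastforce
qed auto

lemma cmod_mem: "f \<in> L \<Longrightarrow> cpx (\<lambda>x. cmod (f x)) \<in> L"
  by (rule ideal_mem[of f]) (auto dest: measurable)

lemma norm_cmod: "f \<in> L \<Longrightarrow> N (cpx (\<lambda>x. cmod (f x))) = N f"
  by (intro antisym norm_mono) (auto dest: measurable cmod_mem)

text \<open>The positive cone of \<open>L\<close>, not a Lebesgue space. Its members are real and
  nonnegative everywhere rather than almost everywhere, so that square roots and monotone integrals
  involve no exceptional sets.\<close>

definition Lp :: "('a \<Rightarrow> real) set" where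
  "Lp = {f. f \<in> borel_measurable M \<and> (\<forall>x. 0 \<le> f x) \<and> cpx f \<in> L}"

lemma LpD: "f \<in> Lp \<Longrightarrow> f \<in> borel_measurable M" "f \<in> Lp \<Longrightarrow> 0 \<le> f x" "f \<in> Lp \<Longrightarrow> cpx f \<in> L"
  by (auto simp: Lp_def)

lemma Lp_le: "g \<in> Lp \<Longrightarrow> f \<in> borel_measurable M \<Longrightarrow> (\<And>x. 0 \<le> f x) \<Longrightarrow> AE x in M. f x \<le> g x \<Longrightarrow> f \<in> Lp"
  unfolding Lp_def using ideal_mem[of "cpx g" "cpx f"] by (auto elim!: eventually_mono)

lemma cmod_Lp: "f \<in> L \<Longrightarrow> (\<lambda>x. cmod (f x)) \<in> Lp"
  using cmod_mem measurable by (auto simp: Lp_def)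

lemma Lp_add: "f \<in> Lp \<Longrightarrow> g \<in> Lp \<Longrightarrow> (\<lambda>x. f x + g x) \<in> Lp"
  using add_mem[of "cpx f" "cpx g"] by (auto simp: Lp_def)

lemma Lp_scale: "f \<in> Lp \<Longrightarrow> 0 \<le> c \<Longrightarrow> (\<lambda>x. c * f x) \<in> Lp"
  using scale_mem[of "cpx f" "of_real c"] by (auto simp: Lp_def)

lemma Lp_zero: "(\<lambda>_. 0) \<in> Lp"
  using zero_mem by (auto simp: Lp_def)

lemma Lp_sum: "(\<And>i. i \<in> I \<Longrightarrow> f i \<in> Lp) \<Longrightarrow> (\<lambda>x. \<Sum>i\<in>I. f i x) \<in> Lp"
  by (induction I rule: infinite_finite_induct) (auto intro: Lp_zero Lp_add)

lemma Lp_norm_mono: "g \<in> Lp \<Longrightarrow> f \<in> borel_measurable M \<Longrightarrow> AE x in M. \<bar>f x\<bar> \<le> g x \<Longrightarrow> N (cpx f) \<le> N (cpx g)"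
  using LpD by (intro norm_mono) (auto elim!: eventually_mono)

lemma Lp_sqrt: assumes "f \<in> Lp" "g \<in> Lp" shows "(\<lambda>x. sqrt (f x * g x)) \<in> Lp"
proof (rule Lp_le[OF Lp_add[OF assms]])
  show "(\<lambda>x. sqrt (f x * g x)) \<in> borel_measurable M" using assms[THEN LpD(1)] by measurable
  have "sqrt (f x * g x) \<le> f x + g x" for x
    using sqrt_mult_le[of "f x" "g x" 1] LpD(2)[OF assms(1), of x] LpD(2)[OF assms(2), of x] by simp
  then show "AE x in M. sqrt (f x * g x) \<le> f x + g x" by simp
  show "0 \<le> sqrt (f x * g x)" for x using LpD(2)[OF assms(1), of x] LpD(2)[OF assms(2), of x] by simp
qed

text \<open>The positive part of \<open>g - Re W\<close> is dominated a.e. by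
  \<open>|u n - W|\<close> for each \<open>n \<ge> k\<close>, so its norm is 0. This works directly
  with norm convergence, without a subsequence converging a.e.\<close>

lemma limit_ge:
  assumes "g \<in> borel_measurable M" "\<And>n. u n \<in> L" "W \<in> L" "(\<lambda>n. N (\<lambda>x. u n x - W x)) \<longlonglongrightarrow> 0"
    and ge: "\<And>n. n \<ge> k \<Longrightarrow> AE x in M. g x \<le> Re (u n x)"
  shows "AE x in M. g x \<le> Re (W x)"
proof -
  let ?h = "\<lambda>x. max 0 (g x - Re (W x))"
  have m: "cpx ?h \<in> borel_measurable M" using assms(1) measurable[OF assms(3)] by measurable
  have bd: "AE x in M. cmod (complex_of_real (?h x)) \<le> cmod (u n x - W x)" if "n \<ge> k" for n
    using ge[OF that]
  proof eventually_elim
    case (elim x)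
    have "\<bar>Re (u n x - W x)\<bar> \<le> cmod (u n x - W x)" by (rule abs_Re_le_cmod)
    then show ?case using elim by (auto simp: max_def)
  qed
  have hL: "cpx ?h \<in> L" using ideal_mem[OF diff_mem[OF assms(2,3)] m bd[of k]] by simp
  have "N (cpx ?h) \<le> 0"
    by (rule LIMSEQ_le_const[OF assms(4)])
      (use norm_mono[OF diff_mem[OF assms(2,3)] m bd] in auto)
  then have "N (cpx ?h) = 0" using norm_nonneg[OF hL] by simp
  then have "AE x in M. complex_of_real (?h x) = 0" using norm_eq_zero_iff[OF hL] by blast
  then show ?thesis by eventually_elim (auto simp: max_def split: if_splits)
qed

lemma Cauchy_geometric:
  assumes u: "\<And>n. u n \<in> L" and q: "0 \<le> q" "q < (1::real)" "0 \<le> c"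
    and le: "\<And>n. N (\<lambda>x. u (Suc n) x - u n x) \<le> c * q ^ n"
  obtains f where "f \<in> L" "(\<lambda>n. N (\<lambda>x. u n x - f x)) \<longlonglongrightarrow> 0"
proof -
  have tele: "N (\<lambda>x. u (m + k) x - u m x) \<le> c * q ^ m / (1 - q)" for m k
  proof -
    have "N (\<lambda>x. u (m + k) x - u m x) \<le> c * q ^ m * (\<Sum>i<k. q ^ i)"
    proof (induction k)
      case (Suc k)
      have "N (\<lambda>x. u (m + Suc k) x - u m x) \<le> N (\<lambda>x. u (m + Suc k) x - u (m + k) x) + N (\<lambda>x. u (m + k) x - u m x)"
        by (rule norm_triangle_trans[OF u u u])
      also have "\<dots> \<le> c * q ^ (m + k) + c * q ^ m * (\<Sum>i<k. q ^ i)" using le[of "m + k"] Suc by simp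
      finally show ?case by (simp add: power_add algebra_simps)
    qed (simp add: zero_mem)
    also have "\<dots> \<le> c * q ^ m * (1 / (1 - q))"
      using q by (intro mult_left_mono) (auto simp: sum_gp_strict divide_right_mono)
    finally show ?thesis by simp
  qed
  have "\<exists>f\<in>L. (\<lambda>n. N (\<lambda>x. u n x - f x)) \<longlonglongrightarrow> 0"
  proof (rule complete[OF u])
    fix e :: real assume e: "e > 0"
    have "(\<lambda>m. c * q ^ m / (1 - q)) \<longlonglongrightarrow> c * 0 / (1 - q)"
      using q by (intro tendsto_intros LIMSEQ_power_zero) auto
    then have "\<forall>\<^sub>F m in sequentially. c * q ^ m / (1 - q) < e" using e by (auto dest: order_tendstoD)
    then obtain K where K: "\<And>m. m \<ge> K \<Longrightarrow> c * q ^ m / (1 - q) < e" by (auto simp: eventually_sequentially)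
    have "N (\<lambda>x. u m x - u n x) < e" if "m \<ge> K" "n \<ge> K" for m n
    proof (cases "m \<le> n")
      case True
      then show ?thesis using tele[of m "n - m"] K[OF that(1)] norm_diff_commute[OF u u, of m n] by simp
    next
      case False
      then show ?thesis using tele[of n "m - n"] K[OF that(2)] by simp
    qed
    then show "\<exists>K. \<forall>m\<ge>K. \<forall>n\<ge>K. N (\<lambda>x. u m x - u n x) < e" by blast
  qed
  then show ?thesis using that by blast
qed

text \<open>Exhaustion: the supports of elements of \<open>L\<close> have a largest one, which carries the whole space.\<close>

lemma obtain_weak_unit:
  obtains w where "w \<in> Lp" "\<And>x. 0 < w x"
proof -
  obtain d :: "'a \<Rightarrow> real" where d: "d \<in> borel_measurable M" "\<And>x. 0 < d x" "integrable M d"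
    by (rule obtain_positive_integrable_function) blast
  note [measurable] = d(1)
  \<comment> \<open>Size of the support in the finite measure with density \<open>d\<close>; its
    supremum over \<open>L\<close> is therefore finite, and it will be attained.\<close>
  define m where "m f = (\<integral>x. d x * indicator {x\<in>space M. f x \<noteq> (0::complex)} x \<partial>M)" for f
  have int: "integrable M (\<lambda>x. d x * indicator {x\<in>space M. f x \<noteq> 0} x)" if "f \<in> L" for f :: "'a cfun"
    using d measurable[OF that] by (intro Bochner_Integration.integrable_bound[OF d(3)]) (auto simp: indicator_def less_imp_le)
  have m_mono: "m f \<le> m g" if "f \<in> L" "g \<in> L" "AE x in M. f x \<noteq> 0 \<longrightarrow> g x \<noteq> 0" for f g
    unfolding m_def using that(3) d(2)
    by (intro integral_mono_AE int that) (auto elim!: eventually_mono simp: indicator_def less_imp_le)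
  have m_le: "m f \<le> (\<integral>x. d x \<partial>M)" if "f \<in> L" for f
    unfolding m_def using d by (intro integral_mono int that) (auto simp: indicator_def less_imp_le)
  define s where "s = Sup (m ` L)"
  have bdd: "bdd_above (m ` L)" using m_le by (auto intro!: bdd_aboveI)
  have ne: "m ` L \<noteq> {}" using zero_mem by auto
  have "\<exists>f\<in>L. s - 1 / Suc n < m f" for n
    using less_cSup_iff[OF ne bdd, of "s - 1 / Suc n"] unfolding s_def by auto
  then obtain f where f: "\<And>n. f n \<in> L" "\<And>n. s - 1 / Suc n < m (f n)" by metis
  \<comment> \<open>Normalised so that the sum of the \<open>c n |f n|\<close> converges in norm;
    the \<open>1 +\<close> guards against \<open>N (f n) = 0\<close>.\<close>
  define c where "c n = (1/2) ^ n / (1 + N (f n))" for n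
  have N0: "0 < 1 + N (f n)" for n using norm_nonneg[OF f(1), of n] by simp
  have c0: "c n > 0" for n using N0[of n] by (simp add: c_def)
  have "c n * N (f n) \<le> c n * (1 + N (f n))" for n using c0[of n] by (intro mult_left_mono) auto
  moreover have "c n * (1 + N (f n)) = (1/2)^n" for n using N0[of n] by (simp add: c_def)
  ultimately have c: "c n > 0" "c n * N (f n) \<le> (1/2)^n" for n using c0 by auto
  define t where "t n x = c n * cmod (f n x)" for n x
  have t: "t n \<in> Lp" for n unfolding t_def using cmod_Lp[OF f(1)] Lp_scale c(1)[of n] by simp
  define u where "u n = cpx (\<lambda>x. \<Sum>k<n. t k x)" for n
  have u: "u n \<in> L" for n unfolding u_def by (intro LpD(3) Lp_sum t)
  have "N (\<lambda>x. u (Suc n) x - u n x) \<le> 1 * (1/2)^n" for n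
  proof -
    have "N (\<lambda>x. u (Suc n) x - u n x) = N (\<lambda>x. of_real (c n) * of_real (cmod (f n x)))"
      by (simp add: u_def t_def)
    also have "\<dots> = c n * N (f n)" using norm_scale[OF cmod_mem[OF f(1)], of "of_real (c n)" n] norm_cmod[OF f(1)] c(1)[of n]
      by simp
    finally show ?thesis using c(2)[of n] by simp
  qed
  then obtain W where W: "W \<in> L" "(\<lambda>n. N (\<lambda>x. u n x - W x)) \<longlonglongrightarrow> 0"
    using Cauchy_geometric[of u "1/2" 1] u by auto
  have ge: "AE x in M. t k x \<le> Re (W x)" for k
  proof (rule limit_ge[OF _ u W])
    show "t k \<in> borel_measurable M" using LpD(1)[OF t] .
    fix n assume "Suc k \<le> n"
    then have "t k x \<le> Re (u n x)" for x
      unfolding u_def using LpD(2)[OF t] by (auto intro!: member_le_sum)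
    then show "AE x in M. t k x \<le> Re (u n x)" by simp
  qed
  have "m (f k) \<le> m W" for k
  proof (rule m_mono[OF f(1) W(1)])
    show "AE x in M. f k x \<noteq> 0 \<longrightarrow> W x \<noteq> 0" using ge[of k]
    proof eventually_elim
      case (elim x)
      have "f k x \<noteq> 0 \<Longrightarrow> 0 < t k x" using c(1)[of k] by (simp add: t_def)
      then show ?case using elim by auto
    qed
  qed
  then have s_le: "s \<le> m W + 1 / Suc n" for n using f(2)[of n] by (smt (verit))
  have "s \<le> m W"
  proof (rule LIMSEQ_le_const)
    show "(\<lambda>n. m W + 1 / real (Suc n)) \<longlonglongrightarrow> m W" using LIMSEQ_inverse_real_of_nat_add[of "m W"] by (simp add: inverse_eq_divide)
  qed (use s_le in auto)
  \<comment> \<open>If \<open>W\<close> vanished on a set of positive measure, the carrier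
    assumption would give \<open>h\<close> in \<open>L\<close> that does not vanish there a.e., and
    \<open>|W| + |h|\<close> would have a larger support than the supremum allows.\<close>
  have "AE x in M. W x \<noteq> 0"
  proof (rule ccontr)
    define Z where "Z = {x\<in>space M. W x = 0}"
    have Z: "Z \<in> sets M" unfolding Z_def using measurable[OF W(1)] by measurable
    assume "\<not> (AE x in M. W x \<noteq> 0)"
    then have "emeasure M Z \<noteq> 0" using AE_iff_measurable[OF Z, of "\<lambda>x. W x \<noteq> 0"] by (auto simp: Z_def)
    then obtain h where h: "h \<in> L" "\<not> (AE x in M. x \<in> Z \<longrightarrow> h x = 0)" using carrier[OF Z] by (auto simp: zero_less_iff_neq_zero)
    let ?V = "cpx (\<lambda>x. cmod (W x) + cmod (h x))"
    have V: "?V \<in> L" using Lp_add[OF cmod_Lp[OF W(1)] cmod_Lp[OF h(1)]] LpD(3) by blast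
    note [measurable] = measurable[OF W(1)] measurable[OF h(1)]
    let ?e = "\<lambda>x. d x * indicator {x\<in>space M. ?V x \<noteq> 0} x - d x * indicator {x\<in>space M. W x \<noteq> 0} x"
    have i: "integrable M ?e" by (intro Bochner_Integration.integrable_diff int V W)
    have V0: "cmod (W x) + cmod (h x) = 0 \<longleftrightarrow> W x = 0 \<and> h x = 0" for x
      by (simp only: add_nonneg_eq_0_iff norm_ge_zero norm_eq_zero)
    have e0: "0 \<le> ?e x" for x using d(2)[of x] by (auto simp: indicator_def V0 simp del: of_real_add)
    have "integral\<^sup>L M ?e = m ?V - m W"
      unfolding m_def by (rule Bochner_Integration.integral_diff[OF int[OF V] int[OF W(1)]])
    also have "\<dots> \<le> 0" using \<open>s \<le> m W\<close> cSup_upper[OF imageI[OF V] bdd] unfolding s_def by simp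
    finally have "integral\<^sup>L M ?e = 0" using Bochner_Integration.integral_nonneg[of M ?e] e0 by (intro antisym) auto
    then have "AE x in M. ?e x = 0" using integral_nonneg_eq_0_iff_AE[OF i] e0 by simp
    then have "AE x in M. x \<in> Z \<longrightarrow> h x = 0"
    proof (eventually_elim, intro impI)
      fix x assume "?e x = 0" "x \<in> Z"
      then show "h x = 0" using d(2)[of x]
        by (auto simp: Z_def indicator_def V0 simp del: of_real_add split: if_splits)
    qed
    with h show False by simp
  qed
  \<comment> \<open>The modulus makes \<open>W\<close> real, and the value 1 on its null set of
    zeros makes it positive everywhere.\<close>
  define w where "w x = (if W x = 0 then 1 else cmod (W x))" for x
  have [measurable]: "w \<in> borel_measurable M" unfolding w_def using measurable[OF W(1)] by measurable
  have "w \<in> Lp"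
  proof (rule Lp_le[OF cmod_Lp[OF W(1)]])
    show "AE x in M. w x \<le> cmod (W x)" using \<open>AE x in M. W x \<noteq> 0\<close> by eventually_elim (simp add: w_def)
  qed (auto simp: w_def)
  moreover have "0 < w x" for x by (simp add: w_def)
  ultimately show ?thesis using that by blast
qed

text \<open>Kernels are taken nonnegative everywhere, after correction on a null set. Linearity and
  compatibility with a.e. equality are consequences of the integral representation.\<close>

definition nonneg_kernel :: "'a cop \<Rightarrow> ('a \<times> 'a \<Rightarrow> real) \<Rightarrow> bool" where
  "nonneg_kernel A a \<longleftrightarrow> (\<forall>f\<in>L. A f \<in> L) \<and> a \<in> borel_measurable (M \<Otimes>\<^sub>M M) \<and> (\<forall>p. 0 \<le> a p) \<and>
     has_kernel M L A (\<lambda>p. complex_of_real (a p))"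

definition kernel_ops :: "'a cop set" where
  "kernel_ops = {A. \<exists>a. nonneg_kernel A a}"

lemma nonneg_kernelD:
  assumes "nonneg_kernel A a"
  shows "f \<in> L \<Longrightarrow> A f \<in> L" "a \<in> borel_measurable (M \<Otimes>\<^sub>M M)" "0 \<le> a p"
    "f \<in> L \<Longrightarrow> AE x in M. integrable M (\<lambda>y. of_real (a (x, y)) * f y) \<and> A f x = (\<integral>y. of_real (a (x, y)) * f y \<partial>M)"
  using assms by (simp_all add: nonneg_kernel_def has_kernel_def del: split_paired_All)

lemma nonneg_kernel_real:
  assumes "nonneg_kernel A a" "cpx f \<in> L"
  shows "AE x in M. integrable M (\<lambda>y. a (x, y) * f y) \<and> A (cpx f) x = of_real (\<integral>y. a (x, y) * f y \<partial>M)"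
  using nonneg_kernelD(4)[OF assms]
proof eventually_elim
  case (elim x)
  have eq: "(\<lambda>y. of_real (a (x, y)) * complex_of_real (f y)) = (\<lambda>y. of_real (a (x, y) * f y))" by simp
  from elim show ?case unfolding eq complex_of_real_integrable_eq integral_complex_of_real .
qed

lemma kernel_mem: "A \<in> kernel_ops \<Longrightarrow> f \<in> L \<Longrightarrow> A f \<in> L"
  by (auto simp: kernel_ops_def nonneg_kernelD)

lemma kernel_linear: assumes "A \<in> kernel_ops" shows "linear_operator M L A"
proof -
  obtain a where a: "nonneg_kernel A a" using assms by (auto simp: kernel_ops_def)
  have [measurable]: "(\<lambda>y. a (x, y)) \<in> borel_measurable M" if "x \<in> space M" for x
    using nonneg_kernelD(2)[OF a] that by measurable
  show ?thesis unfolding linear_operator_def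
  proof (intro conjI ballI allI impI)
    fix f g assume f: "f \<in> L" and g: "g \<in> L" and eq: "AE x in M. f x = g x"
    note [measurable] = measurable[OF f] measurable[OF g]
    show "AE x in M. A f x = A g x"
      using nonneg_kernelD(4)[OF a f] nonneg_kernelD(4)[OF a g] AE_space
    proof eventually_elim
      case (elim x)
      have "(\<integral>y. of_real (a (x, y)) * f y \<partial>M) = (\<integral>y. of_real (a (x, y)) * g y \<partial>M)"
        using eq elim(3) by (intro integral_cong_AE) auto
      then show ?case using elim by simp
    qed
  next
    fix f g assume f: "f \<in> L" and g: "g \<in> L"
    show "AE x in M. A (\<lambda>y. f y + g y) x = A f x + A g x"
      using nonneg_kernelD(4)[OF a f] nonneg_kernelD(4)[OF a g] nonneg_kernelD(4)[OF a add_mem[OF f g]]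
      by eventually_elim (simp add: distrib_left)
  next
    fix f c assume f: "f \<in> L"
    show "AE x in M. A (\<lambda>y. c * f y) x = c * A f x"
      using nonneg_kernelD(4)[OF a f] nonneg_kernelD(4)[OF a scale_mem[OF f, of c]]
      by eventually_elim (simp add: mult.left_commute[of _ c])
  qed (simp add: nonneg_kernelD[OF a])
qed

lemma kernel_nonneg: assumes "A \<in> kernel_ops" "f \<in> Lp"
  shows "AE x in M. A (cpx f) x = of_real (cmod (A (cpx f) x))"
proof -
  obtain a where a: "nonneg_kernel A a" using assms by (auto simp: kernel_ops_def)
  show ?thesis using nonneg_kernel_real[OF a LpD(3)[OF assms(2)]]
  proof eventually_elim
    case (elim x)
    have "0 \<le> (\<integral>y. a (x, y) * f y \<partial>M)" using LpD(2)[OF assms(2)] nonneg_kernelD(3)[OF a] by simp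
    then show ?case using elim by simp
  qed
qed

lemma kernel_mono: assumes "A \<in> kernel_ops" "f \<in> Lp" "g \<in> Lp" "AE x in M. f x \<le> g x"
  shows "AE x in M. cmod (A (cpx f) x) \<le> cmod (A (cpx g) x)"
proof -
  obtain a where a: "nonneg_kernel A a" using assms by (auto simp: kernel_ops_def)
  show ?thesis using nonneg_kernel_real[OF a LpD(3)[OF assms(2)]] nonneg_kernel_real[OF a LpD(3)[OF assms(3)]]
  proof eventually_elim
    case (elim x)
    have "(\<integral>y. a (x, y) * f y \<partial>M) \<le> (\<integral>y. a (x, y) * g y \<partial>M)"
      using elim assms(4) nonneg_kernelD(3)[OF a] by (intro integral_mono_AE) (auto elim!: eventually_mono intro!: mult_left_mono)
    moreover have "0 \<le> (\<integral>y. a (x, y) * f y \<partial>M)" using LpD(2)[OF assms(2)] nonneg_kernelD(3)[OF a] by simp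
    ultimately show ?case using elim by simp
  qed
qed

lemma kernel_cmod_le: assumes "A \<in> kernel_ops" "f \<in> L"
  shows "AE x in M. cmod (A f x) \<le> cmod (A (cpx (\<lambda>x. cmod (f x))) x)"
proof -
  obtain a where a: "nonneg_kernel A a" using assms by (auto simp: kernel_ops_def)
  show ?thesis using nonneg_kernelD(4)[OF a assms(2)] nonneg_kernel_real[OF a cmod_mem[OF assms(2)]]
  proof eventually_elim
    case (elim x)
    have "cmod (\<integral>y. of_real (a (x, y)) * f y \<partial>M) \<le> (\<integral>y. cmod (of_real (a (x, y)) * f y) \<partial>M)"
      by (rule integral_norm_bound)
    also have "\<dots> = (\<integral>y. a (x, y) * cmod (f y) \<partial>M)"
      using nonneg_kernelD(3)[OF a] by (simp add: norm_mult)
    finally show ?case using elim by simp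
  qed
qed

section \<open>Domination by geometric means\<close>

lemma linear_cong: "linear_operator M L A \<Longrightarrow> f \<in> L \<Longrightarrow> g \<in> L \<Longrightarrow> AE x in M. f x = g x \<Longrightarrow> AE x in M. A f x = A g x"
  by (auto simp: linear_operator_def)

lemma linear_add: "linear_operator M L A \<Longrightarrow> f \<in> L \<Longrightarrow> g \<in> L \<Longrightarrow> AE x in M. A (\<lambda>x. f x + g x) x = A f x + A g x"
  by (auto simp: linear_operator_def)

lemma linear_scale: "linear_operator M L A \<Longrightarrow> f \<in> L \<Longrightarrow> AE x in M. A (\<lambda>x. c * f x) x = c * A f x"
  by (auto simp: linear_operator_def)

lemma linear_mem: "linear_operator M L A \<Longrightarrow> f \<in> L \<Longrightarrow> A f \<in> L"
  by (auto simp: linear_operator_def)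

definition geo_dominated :: "'a cop \<Rightarrow> 'a cop \<Rightarrow> 'a cop \<Rightarrow> bool" where
  "geo_dominated D P Q \<longleftrightarrow> (\<forall>f\<in>Lp. \<forall>g\<in>Lp. AE x in M.
     cmod (D (cpx (\<lambda>x. sqrt (f x * g x))) x) \<le> sqrt (cmod (P (cpx f) x) * cmod (Q (cpx g) x)))"

lemma kernel_Lp: "A \<in> kernel_ops \<Longrightarrow> f \<in> Lp \<Longrightarrow> (\<lambda>x. cmod (A (cpx f) x)) \<in> Lp"
  by (rule cmod_Lp[OF kernel_mem[OF _ LpD(3)]])

lemma kernel_comp_abs: assumes "A \<in> kernel_ops" "B \<in> kernel_ops" "f \<in> Lp"
  shows "AE x in M. A (B (cpx f)) x = A (cpx (\<lambda>x. cmod (B (cpx f) x))) x"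
  by (rule linear_cong[OF kernel_linear[OF assms(1)] kernel_mem[OF assms(2) LpD(3)[OF assms(3)]]
        LpD(3)[OF kernel_Lp[OF assms(2,3)]] kernel_nonneg[OF assms(2,3)]])

text \<open>\<open>D\<close> is monotone, so the bound for \<open>D'\<close> may be inserted into
  it; the domination of \<open>D\<close> then applies to \<open>|P' f|\<close> and
  \<open>|Q' g|\<close>, which agree a.e. with \<open>P' f\<close> and \<open>Q' g\<close>.\<close>

lemma geo_dominated_comp:
  assumes G: "geo_dominated D P Q" "geo_dominated D' P' Q'"
    and K: "D \<in> kernel_ops" "P \<in> kernel_ops" "Q \<in> kernel_ops" "D' \<in> kernel_ops" "P' \<in> kernel_ops" "Q' \<in> kernel_ops"
  shows "geo_dominated (D \<circ> D') (P \<circ> P') (Q \<circ> Q')"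
  unfolding geo_dominated_def
proof (intro ballI)
  fix f g assume f: "f \<in> Lp" and g: "g \<in> Lp"
  let ?h = "\<lambda>x. sqrt (f x * g x)"
  let ?h' = "\<lambda>x. cmod (D' (cpx ?h) x)" and ?f' = "\<lambda>x. cmod (P' (cpx f) x)" and ?g' = "\<lambda>x. cmod (Q' (cpx g) x)"
  have mem: "?h \<in> Lp" "?h' \<in> Lp" "?f' \<in> Lp" "?g' \<in> Lp" using f g K by (auto intro!: Lp_sqrt kernel_Lp)
  have "AE x in M. ?h' x \<le> sqrt (?f' x * ?g' x)" using G(2) f g by (simp add: geo_dominated_def)
  then have 1: "AE x in M. cmod (D (cpx ?h') x) \<le> cmod (D (cpx (\<lambda>x. sqrt (?f' x * ?g' x))) x)"
    using mem by (intro kernel_mono K Lp_sqrt)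
  have 2: "AE x in M. cmod (D (cpx (\<lambda>x. sqrt (?f' x * ?g' x))) x) \<le> sqrt (cmod (P (cpx ?f') x) * cmod (Q (cpx ?g') x))"
    using G(1) mem by (simp add: geo_dominated_def)
  from 1 2 kernel_comp_abs[OF K(1,4) mem(1)] kernel_comp_abs[OF K(2,5) f] kernel_comp_abs[OF K(3,6) g]
  show "AE x in M. cmod ((D \<circ> D') (cpx ?h) x) \<le> sqrt (cmod ((P \<circ> P') (cpx f) x) * cmod ((Q \<circ> Q') (cpx g) x))"
    by eventually_elim simp
qed

text \<open>Cauchy-Schwarz in the integration variable for almost every fixed \<open>x\<close>,
  applied to \<open>a f\<close> and \<open>b g\<close>.\<close>

lemma geo_dominated_kernel:
  assumes a: "nonneg_kernel P a" and b: "nonneg_kernel Q b" and c: "nonneg_kernel D c"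
    and le: "AE p in M \<Otimes>\<^sub>M M. c p \<le> sqrt (a p * b p)"
  shows "geo_dominated D P Q"
  unfolding geo_dominated_def
proof (intro ballI)
  fix f g assume f: "f \<in> Lp" and g: "g \<in> Lp"
  have "AE x in M. AE y in M. c (x, y) \<le> sqrt (a (x, y) * b (x, y))" by (rule pair.AE_pair[OF le])
  then show "AE x in M. cmod (D (cpx (\<lambda>x. sqrt (f x * g x))) x) \<le> sqrt (cmod (P (cpx f) x) * cmod (Q (cpx g) x))"
    using nonneg_kernel_real[OF a LpD(3)[OF f]] nonneg_kernel_real[OF b LpD(3)[OF g]]
      nonneg_kernel_real[OF c LpD(3)[OF Lp_sqrt[OF f g]]]
  proof eventually_elim
    case (elim x)
    let ?F = "\<lambda>y. a (x, y) * f y" and ?G = "\<lambda>y. b (x, y) * g y"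
    have nn: "0 \<le> ?F y" "0 \<le> ?G y" "0 \<le> c (x, y) * sqrt (f y * g y)" for y
      using LpD(2)[OF f, of y] LpD(2)[OF g, of y] nonneg_kernelD(3)[OF a] nonneg_kernelD(3)[OF b] nonneg_kernelD(3)[OF c] by auto
    note cs = Cauchy_Schwarz_integral[of M ?F ?G, OF _ _ nn(1,2)]
    have "(\<integral>y. c (x, y) * sqrt (f y * g y) \<partial>M) \<le> (\<integral>y. sqrt (?F y * ?G y) \<partial>M)"
    proof (rule integral_mono_AE)
      show "AE y in M. c (x, y) * sqrt (f y * g y) \<le> sqrt (?F y * ?G y)" using elim(1)
      proof eventually_elim
        case (elim y)
        have "c (x, y) * sqrt (f y * g y) \<le> sqrt (a (x, y) * b (x, y)) * sqrt (f y * g y)"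
          using elim LpD(2)[OF f, of y] LpD(2)[OF g, of y] by (intro mult_right_mono) auto
        then show ?case by (simp add: real_sqrt_mult mult_ac)
      qed
    qed (use elim cs in auto)
    also have "\<dots> \<le> sqrt ((\<integral>y. ?F y \<partial>M) * (\<integral>y. ?G y \<partial>M))" using elim cs by blast
    finally show ?case using elim nn by (simp add: abs_of_nonneg Bochner_Integration.integral_nonneg del: norm_mult)
  qed
qed

lemma geo_dominated_self: assumes "A \<in> kernel_ops" shows "geo_dominated A A A"
proof -
  obtain a where a: "nonneg_kernel A a" using assms by (auto simp: kernel_ops_def)
  then show ?thesis by (intro geo_dominated_kernel[OF a a a]) (auto simp: nonneg_kernelD(3))
qed

text \<open>Domination at \<open>f = g\<close>, replaced by an arithmetic mean. This form is linear
  in \<open>P\<close> and \<open>Q\<close>, so it can be put into a triangle inequality.\<close>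

lemma geo_dominated_le:
  assumes G: "geo_dominated D P Q" and K: "D \<in> kernel_ops" "P \<in> kernel_ops" "Q \<in> kernel_ops"
    and f: "f \<in> L" and t: "0 < t"
  shows "AE x in M. cmod (D f x) \<le> (t * cmod (P (cpx (\<lambda>x. cmod (f x))) x) + cmod (Q (cpx (\<lambda>x. cmod (f x))) x) / t) / 2"
proof -
  let ?f = "\<lambda>x. cmod (f x)"
  have "AE x in M. cmod (D (cpx (\<lambda>x. sqrt (?f x * ?f x))) x) \<le> sqrt (cmod (P (cpx ?f) x) * cmod (Q (cpx ?f) x))"
    using bspec[OF bspec[OF G[unfolded geo_dominated_def] cmod_Lp[OF f]] cmod_Lp[OF f]] .
  with kernel_cmod_le[OF K(1) f] show ?thesis
  proof eventually_elim
    case (elim x)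
    then have "cmod (D f x) \<le> sqrt (cmod (P (cpx ?f) x) * cmod (Q (cpx ?f) x))" by simp
    also have "\<dots> \<le> (t * cmod (P (cpx ?f) x) + cmod (Q (cpx ?f) x) / t) / 2" by (intro sqrt_mult_le t) auto
    finally show ?case .
  qed
qed

section \<open>Positive operators have nonnegative kernels\<close>

lemma has_kernel_cong:
  assumes A: "has_kernel M L A a" and b: "b \<in> borel_measurable (M \<Otimes>\<^sub>M M)" and eq: "AE p in M \<Otimes>\<^sub>M M. a p = b p"
  shows "has_kernel M L A b"
  unfolding has_kernel_def
proof (intro conjI ballI)
  fix f assume f: "f \<in> L"
  have a: "a \<in> borel_measurable (M \<Otimes>\<^sub>M M)" using A by (simp add: has_kernel_def)
  have "AE x in M. integrable M (\<lambda>y. a (x, y) * f y) \<and> A f x = (\<integral>y. a (x, y) * f y \<partial>M)"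
    using A f unfolding has_kernel_def by blast
  then show "AE x in M. integrable M (\<lambda>y. b (x, y) * f y) \<and> A f x = (\<integral>y. b (x, y) * f y \<partial>M)"
    using pair.AE_pair[OF eq] AE_space
  proof eventually_elim
    case (elim x)
    have m: "(\<lambda>y. a (x, y) * f y) \<in> borel_measurable M" "(\<lambda>y. b (x, y) * f y) \<in> borel_measurable M"
      using a b measurable[OF f] elim(3) by measurable
    have ae: "AE y in M. a (x, y) * f y = b (x, y) * f y" using elim(2) by eventually_elim simp
    show ?case using elim(1) integrable_cong_AE[OF m ae] integral_cong_AE[OF m ae] by simp
  qed
qed (rule b)

text \<open>Positivity of \<open>A\<close> can be tested only against functions. With the weights
  \<open>e\<close> and \<open>w\<close> the kernel becomes integrable on the product, and its
  integral over \<open>F \<times> E\<close> is the integral over \<open>F\<close> of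
  \<open>e\<close> times \<open>A\<close> applied to \<open>w\<close> restricted to
  \<open>E\<close>. Nonnegativity on rectangles suffices.\<close>

lemma positive_kernel_AE_nonneg:
  assumes A: "positive_operator M L A" "has_kernel M L A a"
  shows "AE p in M \<Otimes>\<^sub>M M. a p \<in> \<real>\<^sub>\<ge>\<^sub>0"
proof -
  obtain w where w: "w \<in> Lp" "\<And>x. 0 < w x" using obtain_weak_unit by blast
  obtain d :: "'a \<Rightarrow> real" where d: "d \<in> borel_measurable M" "\<And>x. 0 < d x" "integrable M d"
    by (rule obtain_positive_integrable_function) blast
  have [measurable]: "a \<in> borel_measurable (M \<Otimes>\<^sub>M M)" using A(2) by (simp add: has_kernel_def)
  note [measurable] = LpD(1)[OF w(1)] d(1)
  have ker: "AE x in M. integrable M (\<lambda>y. a (x, y) * f y) \<and> A f x = (\<integral>y. a (x, y) * f y \<partial>M)" if "f \<in> L" for f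
    using A(2) that unfolding has_kernel_def by blast
  \<comment> \<open>The integral of \<open>|a (x, y)| w y\<close> over \<open>y\<close>, finite for
    almost all \<open>x\<close> because \<open>w\<close> lies in \<open>L\<close>. Dividing by
    \<open>1 + H\<close> in \<open>e\<close> bounds the double integral of \<open>|k|\<close> by the
    integral of \<open>d\<close>.\<close>
  define H where "H x = enn2real (\<integral>\<^sup>+y. ennreal (cmod (a (x, y)) * w y) \<partial>M)" for x
  have [measurable]: "H \<in> borel_measurable M" unfolding H_def by measurable
  define e where "e x = d x / (1 + H x)" for x
  have [measurable]: "e \<in> borel_measurable M" unfolding e_def by measurable
  have H0: "0 \<le> H x" for x by (simp add: H_def)
  have e0: "0 < e x" for x using d(2)[of x] H0[of x] by (simp add: e_def add_pos_nonneg)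
  define k where "k p = of_real (e (fst p)) * (a p * of_real (w (snd p)))" for p
  have [measurable]: "k \<in> borel_measurable (M \<Otimes>\<^sub>M M)" unfolding k_def by measurable
  have kint: "integrable (M \<Otimes>\<^sub>M M) k"
  proof (rule integrableI_bounded)
    have "(\<integral>\<^sup>+p. ennreal (norm (k p)) \<partial>(M \<Otimes>\<^sub>M M)) = (\<integral>\<^sup>+x. \<integral>\<^sup>+y. ennreal (norm (k (x, y))) \<partial>M \<partial>M)"
      by (intro nn_integral_fst[symmetric]) measurable
    also have "\<dots> \<le> (\<integral>\<^sup>+x. ennreal (d x) \<partial>M)"
    proof (rule nn_integral_mono_AE)
      show "AE x in M. (\<integral>\<^sup>+y. ennreal (norm (k (x, y))) \<partial>M) \<le> ennreal (d x)"
        using ker[OF LpD(3)[OF w(1)]] AE_space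
      proof eventually_elim
        case (elim x)
        have "(\<integral>\<^sup>+y. ennreal (norm (a (x, y) * of_real (w y))) \<partial>M) < \<infinity>" using elim(1) by (simp add: integrable_iff_bounded)
        also have "(\<lambda>y. ennreal (norm (a (x, y) * of_real (w y)))) = (\<lambda>y. ennreal (cmod (a (x, y)) * w y))"
          using LpD(2)[OF w(1)] by (simp add: norm_mult)
        finally have fin: "(\<integral>\<^sup>+y. ennreal (cmod (a (x, y)) * w y) \<partial>M) = ennreal (H x)" unfolding H_def by simp
        have [measurable]: "(\<lambda>y. a (x, y)) \<in> borel_measurable M" using elim(2) by measurable
        have "(\<integral>\<^sup>+y. ennreal (norm (k (x, y))) \<partial>M) = (\<integral>\<^sup>+y. ennreal (e x) * ennreal (cmod (a (x, y)) * w y) \<partial>M)"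
          using e0[of x] LpD(2)[OF w(1)] by (intro nn_integral_cong) (simp add: k_def norm_mult ennreal_mult[symmetric])
        also have "\<dots> = ennreal (e x) * ennreal (H x)" using fin by (simp add: nn_integral_cmult)
        also have "\<dots> = ennreal (e x * H x)" using e0[of x] by (simp add: ennreal_mult H0)
        also have "\<dots> \<le> ennreal (d x)" using d(2)[of x] H0[of x] by (intro ennreal_leI) (simp add: e_def field_simps)
        finally show ?case .
      qed
    qed
    also have "\<dots> < \<infinity>" using d(3) d(2) by (simp add: integrable_iff_bounded less_imp_le)
    finally show "(\<integral>\<^sup>+p. ennreal (norm (k p)) \<partial>(M \<Otimes>\<^sub>M M)) < \<infinity>" .
  qed measurable
  have rect: "(\<integral>p. indicator (F \<times> E) p * k p \<partial>(M \<Otimes>\<^sub>M M)) \<in> \<real>\<^sub>\<ge>\<^sub>0" if F[measurable]: "F \<in> sets M" and E[measurable]: "E \<in> sets M" for F E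
  proof -
    let ?g = "\<lambda>x. w x * indicator E x"
    have g: "?g \<in> Lp" using w by (intro Lp_le[OF w(1)]) (auto simp: indicator_def less_imp_le)
    have i: "integrable (M \<Otimes>\<^sub>M M) (\<lambda>p. indicator (F \<times> E) p * k p)"
    proof -
      have "integrable (M \<Otimes>\<^sub>M M) (\<lambda>p. indicator (F \<times> E) p *\<^sub>R k p)" using kint by (intro integrable_mult_indicator) auto
      then show ?thesis by (simp add: scaleR_conv_of_real of_real_indicator)
    qed
    have pos: "AE x in M. A (cpx ?g) x \<in> \<real>\<^sub>\<ge>\<^sub>0"
    proof -
      have "AE x in M. cpx ?g x \<in> \<real>\<^sub>\<ge>\<^sub>0" by (simp only: nonneg_Reals_of_real_iff LpD(2)[OF g] AE_I2)
      then show ?thesis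
        by (rule mp[OF bspec[OF conjunct2[OF A(1)[unfolded positive_operator_def]] LpD(3)[OF g]]])
    qed
    have eq1: "(\<integral>p. indicator (F \<times> E) p * k p \<partial>(M \<Otimes>\<^sub>M M)) = (\<integral>x. \<integral>y. indicator (F \<times> E) (x, y) * k (x, y) \<partial>M \<partial>M)"
      by (rule pair.integral_fst'[OF i, symmetric])
    have eq2: "(\<integral>x. \<integral>y. indicator (F \<times> E) (x, y) * k (x, y) \<partial>M \<partial>M) = (\<integral>x. of_real (Re (\<integral>y. indicator (F \<times> E) (x, y) * k (x, y) \<partial>M)) \<partial>M)"
      and nn: "AE x in M. 0 \<le> Re (\<integral>y. indicator (F \<times> E) (x, y) * k (x, y) \<partial>M)"
    proof -
      have *: "AE x in M. (\<integral>y. indicator (F \<times> E) (x, y) * k (x, y) \<partial>M) \<in> \<real>\<^sub>\<ge>\<^sub>0"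
        using pos ker[OF LpD(3)[OF g]]
      proof eventually_elim
        case (elim x)
        have "(\<integral>y. indicator (F \<times> E) (x, y) * k (x, y) \<partial>M) = (\<integral>y. (indicator F x * of_real (e x)) * (a (x, y) * of_real (?g y)) \<partial>M)"
          by (intro Bochner_Integration.integral_cong) (auto simp: k_def indicator_def)
        also have "\<dots> = (indicator F x * of_real (e x)) * A (cpx ?g) x" using elim by simp
        also have "\<dots> \<in> \<real>\<^sub>\<ge>\<^sub>0" using elim e0[of x] by (intro nonneg_Reals_mult_I) (auto simp: indicator_def less_imp_le)
        finally show ?case .
      qed
      then show "AE x in M. 0 \<le> Re (\<integral>y. indicator (F \<times> E) (x, y) * k (x, y) \<partial>M)"
        by eventually_elim (auto elim!: nonneg_Reals_cases)
      have "AE x in M. (\<integral>y. indicator (F \<times> E) (x, y) * k (x, y) \<partial>M) = of_real (Re (\<integral>y. indicator (F \<times> E) (x, y) * k (x, y) \<partial>M))"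
        using * by eventually_elim (auto elim!: nonneg_Reals_cases)
      then show "(\<integral>x. \<integral>y. indicator (F \<times> E) (x, y) * k (x, y) \<partial>M \<partial>M)
         = (\<integral>x. of_real (Re (\<integral>y. indicator (F \<times> E) (x, y) * k (x, y) \<partial>M)) \<partial>M)"
        by (intro integral_cong_AE) measurable
    qed
    show ?thesis unfolding eq1 eq2 integral_complex_of_real using nn by (simp add: integral_nonneg_AE)
  qed
  \<comment> \<open>The kernel is complex a priori. \<open>Re k\<close>, \<open>Im k\<close> and
    \<open>- Im k\<close> are tested separately; the last two force \<open>Im k = 0\<close>.\<close>
  have parts: "0 \<le> (\<integral>p. indicator (F \<times> E) p * Re (k p) \<partial>(M \<Otimes>\<^sub>M M))"
      "0 \<le> (\<integral>p. indicator (F \<times> E) p * Im (k p) \<partial>(M \<Otimes>\<^sub>M M))"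
      "0 \<le> (\<integral>p. indicator (F \<times> E) p * - Im (k p) \<partial>(M \<Otimes>\<^sub>M M))"
    if FE: "F \<in> sets M" "E \<in> sets M" for F E
  proof -
    have i: "integrable (M \<Otimes>\<^sub>M M) (\<lambda>p. indicator (F \<times> E) p * k p)"
    proof -
      have "integrable (M \<Otimes>\<^sub>M M) (\<lambda>p. indicator (F \<times> E) p *\<^sub>R k p)" using kint FE by (intro integrable_mult_indicator) auto
      then show ?thesis by (simp add: scaleR_conv_of_real of_real_indicator)
    qed
    have "(\<integral>p. indicator (F \<times> E) p * Re (k p) \<partial>(M \<Otimes>\<^sub>M M)) = (\<integral>p. Re (indicator (F \<times> E) p * k p) \<partial>(M \<Otimes>\<^sub>M M))"
      by (intro Bochner_Integration.integral_cong) (auto simp: indicator_def)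
    also have "\<dots> = Re (\<integral>p. indicator (F \<times> E) p * k p \<partial>(M \<Otimes>\<^sub>M M))" by (rule integral_Re[OF i])
    finally show "0 \<le> (\<integral>p. indicator (F \<times> E) p * Re (k p) \<partial>(M \<Otimes>\<^sub>M M))"
      using rect[OF FE] by (auto elim!: nonneg_Reals_cases)
    have "(\<integral>p. indicator (F \<times> E) p * Im (k p) \<partial>(M \<Otimes>\<^sub>M M)) = (\<integral>p. Im (indicator (F \<times> E) p * k p) \<partial>(M \<Otimes>\<^sub>M M))"
      by (intro Bochner_Integration.integral_cong) (auto simp: indicator_def)
    also have "\<dots> = Im (\<integral>p. indicator (F \<times> E) p * k p \<partial>(M \<Otimes>\<^sub>M M))" by (rule integral_Im[OF i])
    finally show "0 \<le> (\<integral>p. indicator (F \<times> E) p * Im (k p) \<partial>(M \<Otimes>\<^sub>M M))" "0 \<le> (\<integral>p. indicator (F \<times> E) p * - Im (k p) \<partial>(M \<Otimes>\<^sub>M M))"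
      using rect[OF FE] by (auto elim!: nonneg_Reals_cases)
  qed
  have "AE p in M \<Otimes>\<^sub>M M. 0 \<le> Re (k p)" "AE p in M \<Otimes>\<^sub>M M. 0 \<le> Im (k p)" "AE p in M \<Otimes>\<^sub>M M. 0 \<le> - Im (k p)"
    by (rule pair.AE_nonneg_of_rectangles; use kint parts in simp)+
  then show ?thesis
  proof eventually_elim
    case (elim p)
    have c: "0 < e (fst p) * w (snd p)" using e0 w(2) by simp
    have "k p = of_real (e (fst p) * w (snd p)) * a p" by (simp add: k_def)
    then have "Re (k p) = (e (fst p) * w (snd p)) * Re (a p)" "Im (k p) = (e (fst p) * w (snd p)) * Im (a p)"
      by (simp_all only: Re_complex_of_real Im_complex_of_real times_complex.sel mult_zero_left diff_0_right add_0_right)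
    moreover have "0 \<le> r" if "0 \<le> (e (fst p) * w (snd p)) * r" for r
      using c that by (simp only: zero_le_mult_iff) linarith
    ultimately have "0 \<le> Re (a p)" "0 \<le> Im (a p)" "0 \<le> - Im (a p)" using elim
      by (metis mult_minus_right)+
    then show ?case by (simp add: complex_nonneg_Reals_iff)
  qed
qed

lemma positive_kernel_operatorD:
  assumes "positive_kernel_operator M L A" shows "A \<in> kernel_ops"
proof -
  obtain a where a: "positive_operator M L A" "has_kernel M L A a" using assms by (auto simp: positive_kernel_operator_def)
  have [measurable]: "a \<in> borel_measurable (M \<Otimes>\<^sub>M M)" using a by (simp add: has_kernel_def)
  let ?b = "\<lambda>p. max 0 (Re (a p))"
  have "has_kernel M L A (\<lambda>p. complex_of_real (?b p))"
  proof (rule has_kernel_cong[OF a(2)])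
    show "AE p in M \<Otimes>\<^sub>M M. a p = complex_of_real (?b p)"
      using positive_kernel_AE_nonneg[OF a] by eventually_elim (auto elim!: nonneg_Reals_cases)
  qed measurable
  then have "nonneg_kernel A ?b"
    using a(1) by (auto simp: nonneg_kernel_def positive_operator_def linear_operator_def)
  then show ?thesis by (auto simp: kernel_ops_def)
qed

lemma kernel_positive: assumes "A \<in> kernel_ops" shows "positive_kernel_operator M L A"
proof -
  have "AE x in M. A f x \<in> \<real>\<^sub>\<ge>\<^sub>0" if f: "f \<in> L" "AE x in M. f x \<in> \<real>\<^sub>\<ge>\<^sub>0" for f
  proof -
    have "AE x in M. f x = cpx (\<lambda>x. cmod (f x)) x" using f(2) by eventually_elim (auto elim!: nonneg_Reals_cases)
    from linear_cong[OF kernel_linear[OF assms] f(1) cmod_mem[OF f(1)] this] kernel_nonneg[OF assms cmod_Lp[OF f(1)]]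
    show ?thesis by eventually_elim (metis nonneg_Reals_of_real_iff norm_ge_zero)
  qed
  then show ?thesis using assms kernel_linear[OF assms]
    by (auto simp: positive_kernel_operator_def positive_operator_def kernel_ops_def nonneg_kernel_def)
qed

section \<open>Products, sums and truncations of kernels\<close>

definition kernel_comp :: "('a \<times> 'a \<Rightarrow> real) \<Rightarrow> ('a \<times> 'a \<Rightarrow> real) \<Rightarrow> 'a \<times> 'a \<Rightarrow> real" where
  "kernel_comp a b p = (\<integral>z. a (fst p, z) * b (z, snd p) \<partial>M)"

text \<open>Tonelli and Fubini for fixed \<open>x\<close>, with \<open>f\<close> as weight.
  Convergence of the inner integral is recorded because \<open>Cauchy_Schwarz_integral\<close>
  relies on it when products of means are formed.\<close>

lemma nonneg_kernel_comp:
  assumes A: "nonneg_kernel A a" and B: "nonneg_kernel B b"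
  shows "nonneg_kernel (A \<circ> B) (kernel_comp a b)"
    and "AE p in M \<Otimes>\<^sub>M M. integrable M (\<lambda>z. a (fst p, z) * b (z, snd p))"
proof -
  note [measurable] = nonneg_kernelD(2)[OF A] nonneg_kernelD(2)[OF B]
  note a0 = nonneg_kernelD(3)[OF A] and b0 = nonneg_kernelD(3)[OF B]
  have [measurable]: "kernel_comp a b \<in> borel_measurable (M \<Otimes>\<^sub>M M)" unfolding kernel_comp_def by measurable
  \<comment> \<open>For a single \<open>f\<close> the inner integral is controlled only where
    \<open>f y \<noteq> 0\<close>; the strictly positive \<open>w\<close> removes this restriction
    at the end.\<close>
  have main: "AE x in M. (AE y in M. f y \<noteq> 0 \<longrightarrow> integrable M (\<lambda>z. a (x, z) * b (z, y))) \<and>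
      integrable M (\<lambda>y. of_real (kernel_comp a b (x, y)) * f y) \<and> A (B f) x = (\<integral>y. of_real (kernel_comp a b (x, y)) * f y \<partial>M)"
    if f: "f \<in> L" for f
  proof -
    note [measurable] = measurable[OF f]
    let ?g = "\<lambda>x. cmod (f x)"
    have gL: "cpx ?g \<in> L" by (rule cmod_mem[OF f])
    \<comment> \<open>The majorant: by Tonelli the integral of \<open>|?F|\<close> over both
      variables is \<open>A ?h\<close> at \<open>x\<close>, which is finite for almost all
      \<open>x\<close>.\<close>
    let ?h = "\<lambda>x. cmod (B (cpx ?g) x)"
    have hL: "cpx ?h \<in> L" by (intro cmod_mem nonneg_kernelD(1)[OF B] gL)
    have Bg: "AE z in M. integrable M (\<lambda>y. b (z, y) * ?g y) \<and> ?h z = (\<integral>y. b (z, y) * ?g y \<partial>M)"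
      using nonneg_kernel_real[OF B gL] by eventually_elim (simp add: b0)
    show ?thesis using nonneg_kernel_real[OF A hL] nonneg_kernelD(4)[OF A nonneg_kernelD(1)[OF B f]] AE_space
    proof eventually_elim
      case (elim x)
      note [measurable] = elim(3)
      have [measurable]: "(\<lambda>y. a (x, y)) \<in> borel_measurable M" by measurable
      let ?F = "\<lambda>(z, y). of_real (a (x, z) * b (z, y)) * f y"
      have F: "integrable (M \<Otimes>\<^sub>M M) ?F"
      proof (rule integrableI_bounded)
        have "(\<integral>\<^sup>+p. ennreal (norm (?F p)) \<partial>(M \<Otimes>\<^sub>M M)) = (\<integral>\<^sup>+z. \<integral>\<^sup>+y. ennreal (norm (?F (z, y))) \<partial>M \<partial>M)"
          by (intro nn_integral_fst[symmetric]) measurable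
        also have "\<dots> = (\<integral>\<^sup>+z. ennreal (a (x, z) * ?h z) \<partial>M)"
        proof (rule nn_integral_cong_AE)
          show "AE z in M. (\<integral>\<^sup>+y. ennreal (norm (?F (z, y))) \<partial>M) = ennreal (a (x, z) * ?h z)"
            using Bg AE_space
          proof eventually_elim
            case (elim z)
            note [measurable] = elim(2)
            have "(\<integral>\<^sup>+y. ennreal (norm (?F (z, y))) \<partial>M) = (\<integral>\<^sup>+y. ennreal (a (x, z)) * ennreal (b (z, y) * ?g y) \<partial>M)"
              by (intro nn_integral_cong) (simp add: norm_mult a0 b0 ennreal_mult[symmetric] mult.assoc)
            also have "\<dots> = ennreal (a (x, z)) * (\<integral>\<^sup>+y. ennreal (b (z, y) * ?g y) \<partial>M)"
              by (intro nn_integral_cmult) measurable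
            also have "(\<integral>\<^sup>+y. ennreal (b (z, y) * ?g y) \<partial>M) = ennreal (?h z)"
              using elim b0 by (subst nn_integral_eq_integral) auto
            finally show ?case by (simp add: ennreal_mult a0)
          qed
        qed
        also have "\<dots> < \<infinity>" using elim(1) a0 by (auto simp: integrable_iff_bounded abs_mult)
        finally show "(\<integral>\<^sup>+p. ennreal (norm (?F p)) \<partial>(M \<Otimes>\<^sub>M M)) < \<infinity>" .
      qed measurable
      have ae: "AE y in M. integrable M (\<lambda>z. ?F (z, y))" using pair.AE_integrable_snd[OF F] by simp
      have fin: "AE y in M. f y \<noteq> 0 \<longrightarrow> integrable M (\<lambda>z. a (x, z) * b (z, y))"
        using ae
      proof (eventually_elim, intro impI)
        fix y assume *: "integrable M (\<lambda>z. ?F (z, y))" "f y \<noteq> 0"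
        then have "integrable M (\<lambda>z. complex_of_real (a (x, z) * b (z, y)) * f y)" by simp
        then have "integrable M (\<lambda>z. complex_of_real (a (x, z) * b (z, y)))"
          using *(2) integrable_mult_left[of "1 / f y" M "\<lambda>z. complex_of_real (a (x, z) * b (z, y)) * f y"] by simp
        then show "integrable M (\<lambda>z. a (x, z) * b (z, y))" by (simp only: complex_of_real_integrable_eq)
      qed
      have eq: "AE y in M. (\<integral>z. ?F (z, y) \<partial>M) = of_real (kernel_comp a b (x, y)) * f y"
        using fin
      proof eventually_elim
        case (elim y)
        have "(\<integral>z. ?F (z, y) \<partial>M) = (\<integral>z. complex_of_real (a (x, z) * b (z, y)) \<partial>M) * f y" by simp
        also have "(\<integral>z. complex_of_real (a (x, z) * b (z, y)) \<partial>M) = of_real (kernel_comp a b (x, y))"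
          unfolding kernel_comp_def integral_complex_of_real by simp
        finally show ?case .
      qed
      have mF: "(\<lambda>y. \<integral>z. ?F (z, y) \<partial>M) \<in> borel_measurable M" "(\<lambda>y. of_real (kernel_comp a b (x, y)) * f y) \<in> borel_measurable M"
        by measurable
      have "integrable M (\<lambda>y. \<integral>z. ?F (z, y) \<partial>M)" using pair.integrable_snd[OF F] by simp
      then have 1: "integrable M (\<lambda>y. of_real (kernel_comp a b (x, y)) * f y)" using integrable_cong_AE[OF mF eq] by simp
      have "A (B f) x = (\<integral>z. of_real (a (x, z)) * B f z \<partial>M)" using elim(2) by simp
      also have "\<dots> = (\<integral>z. \<integral>y. ?F (z, y) \<partial>M \<partial>M)"
      proof (rule integral_cong_AE)
        show "AE z in M. of_real (a (x, z)) * B f z = (\<integral>y. ?F (z, y) \<partial>M)"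
          using nonneg_kernelD(4)[OF B f] by eventually_elim (simp add: mult.assoc)
        show "(\<lambda>z. of_real (a (x, z)) * B f z) \<in> borel_measurable M" using measurable[OF nonneg_kernelD(1)[OF B f]] by measurable
      qed measurable
      also have "\<dots> = (\<integral>y. \<integral>z. ?F (z, y) \<partial>M \<partial>M)" using pair.Fubini_integral[of "\<lambda>z y. ?F (z, y)"] F by (simp add: case_prod_beta)
      also have "\<dots> = (\<integral>y. of_real (kernel_comp a b (x, y)) * f y \<partial>M)" by (rule integral_cong_AE[OF mF eq])
      finally show ?case using 1 fin by simp
    qed
  qed
  show "nonneg_kernel (A \<circ> B) (kernel_comp a b)"
    unfolding nonneg_kernel_def has_kernel_def
  proof (intro conjI ballI allI)
    fix f assume f: "f \<in> L"
    show "(A \<circ> B) f \<in> L" using nonneg_kernelD(1)[OF A nonneg_kernelD(1)[OF B f]] by simp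
    show "AE x in M. complex_integrable M (\<lambda>y. of_real (kernel_comp a b (x, y)) * f y) \<and> (A \<circ> B) f x = (\<integral>y. of_real (kernel_comp a b (x, y)) * f y \<partial>M)"
      using main[OF f] by eventually_elim simp
  next
    show "0 \<le> kernel_comp a b p" for p unfolding kernel_comp_def using a0 b0 by simp
  qed measurable
  obtain w where w: "w \<in> Lp" "\<And>x. 0 < w x" using obtain_weak_unit by blast
  have "AE x in M. AE y in M. integrable M (\<lambda>z. a (fst (x, y), z) * b (z, snd (x, y)))"
    using main[OF LpD(3)[OF w(1)]]
  proof eventually_elim
    case (elim x)
    then show ?case using w(2) by (auto elim!: eventually_mono simp: less_imp_neq[symmetric])
  qed
  then show "AE p in M \<Otimes>\<^sub>M M. integrable M (\<lambda>z. a (fst p, z) * b (z, snd p))"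
    by (intro pair.AE_pair_measure) measurable
qed

lemma kernel_ops_comp: "A \<in> kernel_ops \<Longrightarrow> B \<in> kernel_ops \<Longrightarrow> A \<circ> B \<in> kernel_ops"
  unfolding kernel_ops_def by (auto intro: nonneg_kernel_comp(1))

lemma nonneg_kernel_add:
  assumes A: "nonneg_kernel A a" and B: "nonneg_kernel B b"
  shows "nonneg_kernel (\<lambda>f x. A f x + B f x) (\<lambda>p. a p + b p)"
  unfolding nonneg_kernel_def has_kernel_def
proof (intro conjI ballI allI)
  note [measurable] = nonneg_kernelD(2)[OF A] nonneg_kernelD(2)[OF B]
  show "(\<lambda>p. a p + b p) \<in> borel_measurable (M \<Otimes>\<^sub>M M)" "(\<lambda>p. complex_of_real (a p + b p)) \<in> borel_measurable (M \<Otimes>\<^sub>M M)" by measurable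
  show "0 \<le> a p + b p" for p using nonneg_kernelD(3)[OF A, of p] nonneg_kernelD(3)[OF B, of p] by simp
  fix f assume f: "f \<in> L"
  show "(\<lambda>x. A f x + B f x) \<in> L" using f by (intro add_mem nonneg_kernelD(1)[OF A] nonneg_kernelD(1)[OF B])
  show "AE x in M. complex_integrable M (\<lambda>y. of_real (a (x, y) + b (x, y)) * f y) \<and>
          A f x + B f x = (\<integral>y. of_real (a (x, y) + b (x, y)) * f y \<partial>M)"
    using nonneg_kernelD(4)[OF A f] nonneg_kernelD(4)[OF B f] by eventually_elim (simp add: distrib_right)
qed

lemma nonneg_kernel_scale:
  assumes A: "nonneg_kernel A a" and c: "0 \<le> c"
  shows "nonneg_kernel (\<lambda>f x. of_real c * A f x) (\<lambda>p. c * a p)"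
  unfolding nonneg_kernel_def has_kernel_def
proof (intro conjI ballI allI)
  note [measurable] = nonneg_kernelD(2)[OF A]
  show "(\<lambda>p. c * a p) \<in> borel_measurable (M \<Otimes>\<^sub>M M)" "(\<lambda>p. complex_of_real (c * a p)) \<in> borel_measurable (M \<Otimes>\<^sub>M M)" by measurable
  show "0 \<le> c * a p" for p using nonneg_kernelD(3)[OF A, of p] c by simp
  fix f assume f: "f \<in> L"
  show "(\<lambda>x. of_real c * A f x) \<in> L" using f by (intro scale_mem nonneg_kernelD(1)[OF A])
  show "AE x in M. complex_integrable M (\<lambda>y. of_real (c * a (x, y)) * f y) \<and>
          of_real c * A f x = (\<integral>y. of_real (c * a (x, y)) * f y \<partial>M)"
    using nonneg_kernelD(4)[OF A f] by eventually_elim (simp add: mult.assoc)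
qed

definition kernel_op :: "('a \<times> 'a \<Rightarrow> real) \<Rightarrow> 'a cop" where
  "kernel_op c f x = (\<integral>y. of_real (c (x, y)) * f y \<partial>M)"

text \<open>Domination of the kernel gives \<open>|kernel_op c f| \<le> P |f|\<close> a.e., and the
  ideal property puts the result into \<open>L\<close>. Means and truncations of kernels therefore
  act on all of \<open>L\<close>.\<close>

lemma nonneg_kernel_op:
  assumes P: "nonneg_kernel P p" and c[measurable]: "c \<in> borel_measurable (M \<Otimes>\<^sub>M M)" and c0: "\<And>q. 0 \<le> c q"
    and le: "AE q in M \<Otimes>\<^sub>M M. c q \<le> p q"
  shows "nonneg_kernel (kernel_op c) c"
proof -
  note [measurable] = nonneg_kernelD(2)[OF P]
  have le': "AE x in M. AE y in M. c (x, y) \<le> p (x, y)" by (rule pair.AE_pair[OF le])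
  have int: "AE x in M. integrable M (\<lambda>y. of_real (c (x, y)) * f y) \<and>
      cmod (kernel_op c f x) \<le> cmod (P (cpx (\<lambda>x. cmod (f x))) x)" if f: "f \<in> L" for f
    using le' nonneg_kernel_real[OF P cmod_mem[OF f]] AE_space
  proof eventually_elim
    case (elim x)
    note [measurable] = measurable[OF f] elim(3)
    have i: "integrable M (\<lambda>y. of_real (c (x, y)) * f y)"
    proof (rule Bochner_Integration.integrable_bound)
      show "integrable M (\<lambda>y. p (x, y) * cmod (f y))" using elim by simp
      show "AE y in M. cmod (of_real (c (x, y)) * f y) \<le> norm (p (x, y) * cmod (f y))"
        using elim(1) by eventually_elim (auto simp: norm_mult c0 abs_mult intro!: mult_right_mono)
    qed measurable
    have "cmod (kernel_op c f x) \<le> (\<integral>y. cmod (of_real (c (x, y)) * f y) \<partial>M)"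
      unfolding kernel_op_def by (rule integral_norm_bound)
    also have "\<dots> \<le> (\<integral>y. p (x, y) * cmod (f y) \<partial>M)"
      using i elim by (intro integral_mono_AE integrable_norm) (auto elim!: eventually_mono simp: norm_mult c0 intro!: mult_right_mono)
    also have "\<dots> \<le> cmod (P (cpx (\<lambda>x. cmod (f x))) x)" using elim by simp
    finally show ?case using i by simp
  qed
  show ?thesis unfolding nonneg_kernel_def has_kernel_def
  proof (intro conjI ballI allI)
    fix f assume f: "f \<in> L"
    note [measurable] = measurable[OF f]
    show "kernel_op c f \<in> L"
    proof (rule ideal_mem)
      show "P (cpx (\<lambda>x. cmod (f x))) \<in> L" by (intro nonneg_kernelD(1)[OF P] cmod_mem f)
      show "kernel_op c f \<in> borel_measurable M" unfolding kernel_op_def by measurable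
      show "AE x in M. cmod (kernel_op c f x) \<le> cmod (P (cpx (\<lambda>x. cmod (f x))) x)"
        using int[OF f] by eventually_elim simp
    qed
    show "AE x in M. complex_integrable M (\<lambda>y. of_real (c (x, y)) * f y) \<and> kernel_op c f x = (\<integral>y. of_real (c (x, y)) * f y \<partial>M)"
      using int[OF f] by eventually_elim (simp add: kernel_op_def)
  qed (auto simp: c0)
qed

text \<open>Comparison of kernels is expressed as domination by the mean of \<open>D\<close> with
  itself, so that one relation serves both for means and for monotonicity.\<close>

lemma geo_dominated_of_le:
  assumes C: "nonneg_kernel C c" and D: "nonneg_kernel D d" and le: "AE p in M \<Otimes>\<^sub>M M. c p \<le> d p"
  shows "geo_dominated C D D"
  using le by (intro geo_dominated_kernel[OF D D C]) (auto simp: nonneg_kernelD(3)[OF D] elim!: eventually_mono)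

subsection \<open>Hadamard geometric means\<close>

text \<open>The kernels in \<open>is_hadamard_mean\<close> are nonnegative only almost everywhere;
  their positive parts are again kernels of the same operators.\<close>

lemma hadamard_meanE:
  assumes "is_hadamard_mean M L (1/2) A (1/2) B C" "A \<in> kernel_ops" "B \<in> kernel_ops"
  obtains a b where "nonneg_kernel A a" "nonneg_kernel B b" "nonneg_kernel C (\<lambda>p. sqrt (a p * b p))"
proof -
  obtain a b where ab[measurable]: "a \<in> borel_measurable (M \<Otimes>\<^sub>M M)" "b \<in> borel_measurable (M \<Otimes>\<^sub>M M)"
    and nn: "AE p in M \<Otimes>\<^sub>M M. 0 \<le> a p" "AE p in M \<Otimes>\<^sub>M M. 0 \<le> b p"
    and k: "has_kernel M L A (\<lambda>p. complex_of_real (a p))" "has_kernel M L B (\<lambda>p. complex_of_real (b p))"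
      "has_kernel M L C (\<lambda>p. complex_of_real (a p powr (1/2) * b p powr (1/2)))"
    using assms(1) unfolding is_hadamard_mean_def by blast
  have C: "positive_kernel_operator M L C" using assms(1) by (simp add: is_hadamard_mean_def)
  let ?a = "\<lambda>p. max 0 (a p)" and ?b = "\<lambda>p. max 0 (b p)"
  have "has_kernel M L A (\<lambda>p. complex_of_real (?a p))"
    by (rule has_kernel_cong[OF k(1)]) (use nn(1) in \<open>auto elim!: eventually_mono\<close>)
  moreover have "has_kernel M L B (\<lambda>p. complex_of_real (?b p))"
    by (rule has_kernel_cong[OF k(2)]) (use nn(2) in \<open>auto elim!: eventually_mono\<close>)
  moreover have "has_kernel M L C (\<lambda>p. complex_of_real (sqrt (?a p * ?b p)))"
  proof (rule has_kernel_cong[OF k(3)])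
    show "AE p in M \<Otimes>\<^sub>M M. complex_of_real (a p powr (1/2) * b p powr (1/2)) = complex_of_real (sqrt (?a p * ?b p))"
      using nn by eventually_elim (simp add: powr_half_sqrt real_sqrt_mult)
  qed measurable
  ultimately show ?thesis using assms(2,3) positive_kernel_operatorD[OF C] that[of ?a ?b] kernel_mem
    by (auto simp: nonneg_kernel_def)
qed

lemma hadamard_meanI:
  assumes A: "nonneg_kernel A a" and B: "nonneg_kernel B b" and C: "nonneg_kernel C (\<lambda>p. sqrt (a p * b p))"
  shows "is_hadamard_mean M L (1/2) A (1/2) B C"
  unfolding is_hadamard_mean_def
proof (rule conjI, goal_cases)
  case 1
  show ?case using C kernel_positive by (auto simp: kernel_ops_def)
next
  case 2
  have "a p powr (1/2) * b p powr (1/2) = sqrt (a p * b p)" for p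
    using nonneg_kernelD(3)[OF A] nonneg_kernelD(3)[OF B] by (simp add: powr_half_sqrt real_sqrt_mult)
  then have "has_kernel M L C (\<lambda>p. complex_of_real (a p powr (1/2) * b p powr (1/2)))"
    using C by (simp add: nonneg_kernel_def)
  with A B show ?case unfolding nonneg_kernel_def by blast
qed

lemma hadamard_mean_geo_dominated:
  assumes "is_hadamard_mean M L (1/2) A (1/2) B C" "A \<in> kernel_ops" "B \<in> kernel_ops"
  shows "C \<in> kernel_ops" "geo_dominated C A B"
proof -
  obtain a b where ab: "nonneg_kernel A a" "nonneg_kernel B b" "nonneg_kernel C (\<lambda>p. sqrt (a p * b p))"
    using hadamard_meanE[OF assms] by blast
  then show "C \<in> kernel_ops" by (auto simp: kernel_ops_def)
  show "geo_dominated C A B" by (rule geo_dominated_kernel[OF ab]) simp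
qed

lemma hadamard_mean_self:
  assumes "A \<in> kernel_ops" shows "is_hadamard_mean M L (1/2) A (1/2) A A"
proof -
  obtain a where a: "nonneg_kernel A a" using assms by (auto simp: kernel_ops_def)
  then have "(\<lambda>p. sqrt (a p * a p)) = a" by (auto simp: nonneg_kernelD(3))
  then show ?thesis using hadamard_meanI[OF a a] a by simp
qed

text \<open>Cauchy-Schwarz in the inner variable, with the roles of the two factors of the second mean exchanged.\<close>

lemma hadamard_mean_comp:
  assumes C1: "is_hadamard_mean M L (1/2) A1 (1/2) B1 C1" and C2: "is_hadamard_mean M L (1/2) A2 (1/2) B2 C2"
    and K: "A1 \<in> kernel_ops" "B1 \<in> kernel_ops" "A2 \<in> kernel_ops" "B2 \<in> kernel_ops"
  shows "\<exists>D. is_hadamard_mean M L (1/2) (A1 \<circ> B2) (1/2) (B1 \<circ> A2) D \<and> geo_dominated (C1 \<circ> C2) D D"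
proof -
  obtain a1 b1 where 1: "nonneg_kernel A1 a1" "nonneg_kernel B1 b1" "nonneg_kernel C1 (\<lambda>p. sqrt (a1 p * b1 p))"
    using hadamard_meanE[OF C1] K by blast
  obtain a2 b2 where 2: "nonneg_kernel A2 a2" "nonneg_kernel B2 b2" "nonneg_kernel C2 (\<lambda>p. sqrt (a2 p * b2 p))"
    using hadamard_meanE[OF C2] K by blast
  let ?p = "kernel_comp a1 b2" and ?q = "kernel_comp b1 a2"
  note P = nonneg_kernel_comp[OF 1(1) 2(2)] and Q = nonneg_kernel_comp[OF 1(2) 2(1)]
  note [measurable] = nonneg_kernelD(2)[OF P(1)] nonneg_kernelD(2)[OF Q(1)]
  let ?d = "\<lambda>x. sqrt (?p x * ?q x)"
  \<comment> \<open>The mean of the two products has to be constructed as an operator: its kernel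
    lies below the sum of their kernels.\<close>
  have D: "nonneg_kernel (kernel_op ?d) ?d"
  proof (rule nonneg_kernel_op[OF nonneg_kernel_add[OF P(1) Q(1)]])
    have "?d x \<le> ?p x + ?q x" for x
      using sqrt_mult_le[of "?p x" "?q x" 1] nonneg_kernelD(3)[OF P(1), of x] nonneg_kernelD(3)[OF Q(1), of x] by simp
    then show "AE x in M \<Otimes>\<^sub>M M. ?d x \<le> ?p x + ?q x" by simp
  qed (auto simp: nonneg_kernelD(3)[OF P(1)] nonneg_kernelD(3)[OF Q(1)])
  have "AE x in M \<Otimes>\<^sub>M M. kernel_comp (\<lambda>p. sqrt (a1 p * b1 p)) (\<lambda>p. sqrt (a2 p * b2 p)) x \<le> ?d x"
    using P(2) Q(2)
  proof eventually_elim
    case (elim x)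
    have "(\<integral>z. sqrt ((a1 (fst x, z) * b2 (z, snd x)) * (b1 (fst x, z) * a2 (z, snd x))) \<partial>M) \<le> ?d x"
      unfolding kernel_comp_def using elim 1 2 by (intro Cauchy_Schwarz_integral(2)) (auto simp: nonneg_kernelD(3))
    then show ?case unfolding kernel_comp_def by (simp add: real_sqrt_mult mult_ac)
  qed
  then have "geo_dominated (C1 \<circ> C2) (kernel_op ?d) (kernel_op ?d)"
    by (rule geo_dominated_of_le[OF nonneg_kernel_comp(1)[OF 1(3) 2(3)] D])
  then show ?thesis using hadamard_meanI[OF P(1) Q(1) D] by blast
qed

subsection \<open>Operator norm and spectral radius\<close>

lemma linear_diff: assumes A: "linear_operator M L A" and f: "f \<in> L" and g: "g \<in> L"
  shows "AE x in M. A (\<lambda>x. f x - g x) x = A f x - A g x"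
proof -
  have m: "(\<lambda>x. - 1 * g x) \<in> L" using scale_mem[OF g] .
  have "AE x in M. A (\<lambda>x. f x + (- 1 * g x)) x = A f x + A (\<lambda>x. - 1 * g x) x" by (rule linear_add[OF A f m])
  moreover have "AE x in M. A (\<lambda>x. - 1 * g x) x = - 1 * A g x" by (rule linear_scale[OF A g])
  ultimately show ?thesis by eventually_elim simp
qed

lemma linear_zero: assumes A: "linear_operator M L A" shows "AE x in M. A (\<lambda>_. 0) x = 0"
  using linear_scale[OF A zero_mem, of 0] by simp

lemma linear_sum: assumes A: "linear_operator M L A" and f: "\<And>i. i \<in> I \<Longrightarrow> f i \<in> L"
  shows "AE x in M. A (\<lambda>x. \<Sum>i\<in>I. c i * f i x) x = (\<Sum>i\<in>I. c i * A (f i) x)"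
  using f
proof (induction I rule: infinite_finite_induct)
  case (insert i I)
  have m: "(\<lambda>x. c i * f i x) \<in> L" "(\<lambda>x. \<Sum>i\<in>I. c i * f i x) \<in> L"
    using insert.prems by (auto intro!: scale_mem sum_mem)
  have "AE x in M. A (\<lambda>x. \<Sum>i\<in>I. c i * f i x) x = (\<Sum>i\<in>I. c i * A (f i) x)" using insert by auto
  with linear_add[OF A m] linear_scale[OF A insert.prems[OF insertI1], of "c i"]
  show ?case unfolding sum.insert[OF insert.hyps] by eventually_elim simp
qed (auto simp: linear_zero[OF A])

lemma bounded_linear': "bounded_operator M L N A \<Longrightarrow> linear_operator M L A"
  by (simp add: bounded_operator_def)

lemma bounded_mem: "bounded_operator M L N A \<Longrightarrow> f \<in> L \<Longrightarrow> A f \<in> L"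
  by (auto simp: bounded_operator_def linear_operator_def)

lemma bounded_nonneg_bound: assumes "bounded_operator M L N A"
  obtains C where "0 \<le> C" "\<And>f. f \<in> L \<Longrightarrow> N (A f) \<le> C * N f"
proof -
  obtain C where C: "\<And>f. f \<in> L \<Longrightarrow> N (A f) \<le> C * N f" using assms by (auto simp: bounded_operator_def)
  have "N (A f) \<le> \<bar>C\<bar> * N f" if "f \<in> L" for f
    using C[OF that] norm_nonneg[OF that] by (meson abs_ge_self mult_right_mono order_trans)
  then show ?thesis using that[of "\<bar>C\<bar>"] by simp
qed

lemma op_norm_bdd: assumes "bounded_operator M L N A"
  shows "bdd_above {N (A f) | f. f \<in> L \<and> N f \<le> 1}"
proof -
  obtain C where C: "0 \<le> C" "\<And>f. f \<in> L \<Longrightarrow> N (A f) \<le> C * N f" using bounded_nonneg_bound[OF assms] by blast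
  have "N (A f) \<le> C" if "f \<in> L" "N f \<le> 1" for f using C(2)[OF that(1)] mult_left_mono[OF that(2) C(1)] by simp
  then show ?thesis by (auto intro!: bdd_aboveI[of _ C])
qed

lemma op_norm_nonneg: assumes "bounded_operator M L N A" shows "0 \<le> op_norm L N A"
proof -
  have "0 \<le> N (A (\<lambda>_. 0))" using bounded_mem[OF assms zero_mem] by (rule norm_nonneg)
  also have "\<dots> \<le> op_norm L N A" unfolding op_norm_def
    by (rule cSup_upper[OF _ op_norm_bdd[OF assms]]) (auto intro!: exI[of _ "\<lambda>_. 0"] zero_mem)
  finally show ?thesis .
qed

lemma op_norm_upper: assumes A: "bounded_operator M L N A" and f: "f \<in> L" shows "N (A f) \<le> op_norm L N A * N f"
proof (cases "N f = 0")
  case True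
  obtain C where C: "0 \<le> C" "\<And>f. f \<in> L \<Longrightarrow> N (A f) \<le> C * N f" using bounded_nonneg_bound[OF A] by blast
  show ?thesis using C(2)[OF f] True by simp
next
  case False
  then have pos: "0 < N f" using norm_nonneg[OF f] by simp
  let ?c = "complex_of_real (1 / N f)"
  have m: "(\<lambda>x. ?c * f x) \<in> L" by (rule scale_mem[OF f])
  have n1: "N (\<lambda>x. ?c * f x) \<le> 1" using norm_scale[OF f, of ?c] pos by (simp add: norm_divide)
  have "N (A (\<lambda>x. ?c * f x)) = N (\<lambda>x. ?c * A f x)"
    by (intro N_cong bounded_mem[OF A] m scale_mem linear_scale[OF bounded_linear'[OF A]] f)
  also have "\<dots> = N (A f) / N f" using norm_scale[OF bounded_mem[OF A f], of ?c] pos by (simp add: norm_divide)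
  finally have "N (A f) / N f \<le> op_norm L N A" unfolding op_norm_def
    by (intro cSup_upper[OF _ op_norm_bdd[OF A]] CollectI exI[of _ "\<lambda>x. ?c * f x"]) (use m n1 in auto)
  then show ?thesis using pos by (simp add: field_simps)
qed

lemma op_norm_least: assumes "\<And>f. f \<in> L \<Longrightarrow> N f \<le> 1 \<Longrightarrow> N (A f) \<le> C" shows "op_norm L N A \<le> C"
  unfolding op_norm_def using assms zero_mem norm_zero
  by (intro cSup_least) (auto intro!: exI[of _ "\<lambda>_. 0"])

lemma op_norm_le_bound: assumes "0 \<le> C" "\<And>f. f \<in> L \<Longrightarrow> N (A f) \<le> C * N f" shows "op_norm L N A \<le> C"
proof (rule op_norm_least)
  fix f assume f: "f \<in> L" "N f \<le> 1"
  show "N (A f) \<le> C" using assms(2)[OF f(1)] mult_left_mono[OF f(2) assms(1)] by simp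
qed

lemma bounded_operatorI: "linear_operator M L A \<Longrightarrow> (\<And>f. f \<in> L \<Longrightarrow> N (A f) \<le> C * N f) \<Longrightarrow> bounded_operator M L N A"
  by (auto simp: bounded_operator_def)

lemma linear_comp: assumes A: "linear_operator M L A" and B: "linear_operator M L B"
  shows "linear_operator M L (A \<circ> B)"
  unfolding linear_operator_def
proof (intro conjI ballI allI impI)
  note mem = linear_mem[OF A linear_mem[OF B]] and Bm = linear_mem[OF B]
  fix f assume f: "f \<in> L"
  show "(A \<circ> B) f \<in> L" using f mem by simp
  show "AE x in M. (A \<circ> B) (\<lambda>y. c * f y) x = c * (A \<circ> B) f x" for c
    using linear_cong[OF A Bm[OF scale_mem[OF f]] scale_mem[OF Bm[OF f]] linear_scale[OF B f], of c] linear_scale[OF A Bm[OF f], of c]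
    by eventually_elim simp
  fix g assume g: "g \<in> L"
  show "AE x in M. (A \<circ> B) (\<lambda>y. f y + g y) x = (A \<circ> B) f x + (A \<circ> B) g x"
    using linear_cong[OF A Bm[OF add_mem[OF f g]] add_mem[OF Bm[OF f] Bm[OF g]] linear_add[OF B f g]] linear_add[OF A Bm[OF f] Bm[OF g]]
    by eventually_elim simp
  assume "AE x in M. f x = g x"
  then show "AE x in M. (A \<circ> B) f x = (A \<circ> B) g x"
    using linear_cong[OF A Bm[OF f] Bm[OF g] linear_cong[OF B f g]] by simp
qed

lemma bounded_comp: assumes A: "bounded_operator M L N A" and B: "bounded_operator M L N B"
  shows "bounded_operator M L N (A \<circ> B)" "op_norm L N (A \<circ> B) \<le> op_norm L N A * op_norm L N B"
proof -
  have le: "N ((A \<circ> B) f) \<le> (op_norm L N A * op_norm L N B) * N f" if f: "f \<in> L" for f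
  proof -
    have "N (A (B f)) \<le> op_norm L N A * N (B f)" by (rule op_norm_upper[OF A bounded_mem[OF B f]])
    also have "\<dots> \<le> op_norm L N A * (op_norm L N B * N f)" by (intro mult_left_mono op_norm_upper[OF B f] op_norm_nonneg[OF A])
    finally show ?thesis by (simp add: mult.assoc)
  qed
  show "bounded_operator M L N (A \<circ> B)" by (rule bounded_operatorI[OF linear_comp le]) (use A B bounded_linear' in auto)
  show "op_norm L N (A \<circ> B) \<le> op_norm L N A * op_norm L N B"
    by (rule op_norm_le_bound[OF _ le]) (use A B op_norm_nonneg in auto)
qed

lemma bounded_add: assumes A: "bounded_operator M L N A" and B: "bounded_operator M L N B"
  shows "bounded_operator M L N (\<lambda>f x. A f x + B f x)" "op_norm L N (\<lambda>f x. A f x + B f x) \<le> op_norm L N A + op_norm L N B"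
proof -
  have le: "N (\<lambda>x. A f x + B f x) \<le> (op_norm L N A + op_norm L N B) * N f" if f: "f \<in> L" for f
    using norm_triangle[OF bounded_mem[OF A f] bounded_mem[OF B f]] op_norm_upper[OF A f] op_norm_upper[OF B f]
    by (simp add: distrib_right)
  have "linear_operator M L (\<lambda>f x. A f x + B f x)" unfolding linear_operator_def
  proof (intro conjI ballI allI impI)
    note A' = bounded_linear'[OF A] and B' = bounded_linear'[OF B]
    fix f assume f: "f \<in> L"
    show "(\<lambda>x. A f x + B f x) \<in> L" by (intro add_mem bounded_mem[OF A f] bounded_mem[OF B f])
    show "AE x in M. A (\<lambda>y. c * f y) x + B (\<lambda>y. c * f y) x = c * (A f x + B f x)" for c
      using linear_scale[OF A' f, of c] linear_scale[OF B' f, of c] by eventually_elim (simp add: distrib_left)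
    fix g assume g: "g \<in> L"
    show "AE x in M. A (\<lambda>y. f y + g y) x + B (\<lambda>y. f y + g y) x = A f x + B f x + (A g x + B g x)"
      using linear_add[OF A' f g] linear_add[OF B' f g] by eventually_elim simp
    assume "AE x in M. f x = g x"
    from linear_cong[OF A' f g this] linear_cong[OF B' f g this]
    show "AE x in M. A f x + B f x = A g x + B g x" by eventually_elim simp
  qed
  then show "bounded_operator M L N (\<lambda>f x. A f x + B f x)" using le by (rule bounded_operatorI)
  show "op_norm L N (\<lambda>f x. A f x + B f x) \<le> op_norm L N A + op_norm L N B"
    by (rule op_norm_le_bound[OF _ le]) (use A B op_norm_nonneg in auto)
qed

lemma bounded_scale: assumes A: "bounded_operator M L N A"
  shows "bounded_operator M L N (\<lambda>f x. c * A f x)" "op_norm L N (\<lambda>f x. c * A f x) \<le> cmod c * op_norm L N A"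
proof -
  have le: "N (\<lambda>x. c * A f x) \<le> (cmod c * op_norm L N A) * N f" if f: "f \<in> L" for f
    using norm_scale[OF bounded_mem[OF A f], of c] mult_left_mono[OF op_norm_upper[OF A f], of "cmod c"] by (simp add: mult.assoc)
  have "linear_operator M L (\<lambda>f x. c * A f x)" unfolding linear_operator_def
  proof (intro conjI ballI allI impI)
    note A' = bounded_linear'[OF A]
    fix f assume f: "f \<in> L"
    show "(\<lambda>x. c * A f x) \<in> L" by (intro scale_mem bounded_mem[OF A f])
    show "AE x in M. c * A (\<lambda>y. d * f y) x = d * (c * A f x)" for d
      using linear_scale[OF A' f, of d] by eventually_elim simp
    fix g assume g: "g \<in> L"
    show "AE x in M. c * A (\<lambda>y. f y + g y) x = c * A f x + c * A g x"
      using linear_add[OF A' f g] by eventually_elim (simp add: distrib_left)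
    assume "AE x in M. f x = g x"
    from linear_cong[OF A' f g this] show "AE x in M. c * A f x = c * A g x" by eventually_elim simp
  qed
  then show "bounded_operator M L N (\<lambda>f x. c * A f x)" using le by (rule bounded_operatorI)
  show "op_norm L N (\<lambda>f x. c * A f x) \<le> cmod c * op_norm L N A"
    by (rule op_norm_le_bound[OF _ le]) (use A op_norm_nonneg in auto)
qed

lemma bounded_diff: assumes A: "bounded_operator M L N A" and B: "bounded_operator M L N B"
  shows "bounded_operator M L N (\<lambda>f x. A f x - B f x)"
  using bounded_add(1)[OF A bounded_scale(1)[OF B, of "-1"]] by simp

lemma bounded_id: "bounded_operator M L N (\<lambda>f. f)"
  by (auto simp: bounded_operator_def linear_operator_def intro!: exI[of _ 1])

lemma bounded_funpow: "bounded_operator M L N A \<Longrightarrow> bounded_operator M L N (A ^^ n)"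
proof (induction n)
  case 0 then show ?case using bounded_id by (simp add: id_def)
next
  case (Suc n) then show ?case unfolding funpow.simps(2) by (intro bounded_comp(1))
qed

lemma op_norm_cong: assumes S: "bounded_operator M L N S" and T: "bounded_operator M L N T"
    and eq: "\<And>f. f \<in> L \<Longrightarrow> AE x in M. S f x = T f x"
  shows "op_norm L N S = op_norm L N T"
proof -
  have "N (S f) = N (T f)" if "f \<in> L" for f by (intro N_cong bounded_mem[OF S] bounded_mem[OF T] that eq)
  then show ?thesis unfolding op_norm_def by (metis (no_types, lifting))
qed

definition bounded_kernel_ops :: "'a cop set" where
  "bounded_kernel_ops = {A \<in> kernel_ops. bounded_operator M L N A}"

lemma bounded_kernel_opsD: "A \<in> bounded_kernel_ops \<Longrightarrow> A \<in> kernel_ops" "A \<in> bounded_kernel_ops \<Longrightarrow> bounded_operator M L N A"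
  by (auto simp: bounded_kernel_ops_def)

lemma bounded_kernel_ops_comp: "A \<in> bounded_kernel_ops \<Longrightarrow> B \<in> bounded_kernel_ops \<Longrightarrow> A \<circ> B \<in> bounded_kernel_ops"
  by (auto simp: bounded_kernel_ops_def intro: kernel_ops_comp bounded_comp)

lemma bounded_kernel_ops_funpow: "A \<in> bounded_kernel_ops \<Longrightarrow> A ^^ Suc n \<in> bounded_kernel_ops"
proof (induction n)
  case (Suc n) then show ?case unfolding funpow.simps(2)[of "Suc n"] by (intro bounded_kernel_ops_comp)
qed simp

lemma bounded_kernel_ops_add:
  assumes "A \<in> bounded_kernel_ops" "B \<in> bounded_kernel_ops" shows "(\<lambda>f x. A f x + B f x) \<in> bounded_kernel_ops"
proof -
  obtain a b where "nonneg_kernel A a" "nonneg_kernel B b" using assms by (auto simp: bounded_kernel_ops_def kernel_ops_def)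
  from nonneg_kernel_add[OF this] have "(\<lambda>f x. A f x + B f x) \<in> kernel_ops" unfolding kernel_ops_def by blast
  then show ?thesis using assms by (auto simp: bounded_kernel_ops_def intro: bounded_add)
qed

lemma bounded_kernel_ops_scale:
  assumes "A \<in> bounded_kernel_ops" "0 \<le> c" shows "(\<lambda>f x. of_real c * A f x) \<in> bounded_kernel_ops"
proof -
  obtain a where "nonneg_kernel A a" using assms by (auto simp: bounded_kernel_ops_def kernel_ops_def)
  from nonneg_kernel_scale[OF this assms(2)] have "(\<lambda>f x. of_real c * A f x) \<in> kernel_ops" unfolding kernel_ops_def by blast
  then show ?thesis using assms by (auto simp: bounded_kernel_ops_def intro: bounded_scale)
qed

lemma bounded_kernel_ops_zero: assumes "A \<in> bounded_kernel_ops" shows "(\<lambda>f x. 0) \<in> bounded_kernel_ops"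
  using bounded_kernel_ops_scale[OF assms, of 0] by simp

lemma bounded_kernel_opsI:
  assumes "A \<in> kernel_ops" "\<And>f. f \<in> L \<Longrightarrow> N (A f) \<le> C * N f" shows "A \<in> bounded_kernel_ops"
  using assms bounded_operatorI[OF kernel_linear] by (auto simp: bounded_kernel_ops_def)

end

text \<open>
  For a positive operator \<open>A\<close> the number \<open>r = lim p(A\<^sup>n)\<^sup>1\<^sup>/\<^sup>n\<close> is a spectral value: otherwise a bound
  \<open>p T \<le> c p((r - A)T)\<close> keeps the partial sums \<open>T\<^sub>k = \<Sum> A\<^sup>n / r\<^sup>n\<close> (\<open>1 \<le> n \<le> k\<close>) bounded, whereas
  \<open>T\<^sub>k\<^sup>2 \<ge> k A\<^sup>k\<^sup>+\<^sup>1 / r\<^sup>k\<^sup>+\<^sup>1\<close> by positivity. To have \<open>(r - A)T\<^sub>k\<close> under control one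
  works with \<open>\<mu> > r\<close> first. The argument only involves a seminorm \<open>p\<close> that is monotone
  on positive kernel operators, so it applies to the operator norm and to the measure of noncompactness.
\<close>

locale monotone_op_seminorm = banach_function_space M L N
  for M :: "'a measure" and L N +
  fixes p :: "'a cop \<Rightarrow> real"
  assumes p_nonneg: "bounded_operator M L N S \<Longrightarrow> 0 \<le> p S"
    and p_add: "bounded_operator M L N S \<Longrightarrow> bounded_operator M L N T \<Longrightarrow> p (\<lambda>f x. S f x + T f x) \<le> p S + p T"
    and p_scale: "bounded_operator M L N S \<Longrightarrow> p (\<lambda>f x. c * S f x) \<le> cmod c * p S"
    and p_comp: "bounded_operator M L N S \<Longrightarrow> bounded_operator M L N T \<Longrightarrow> p (S \<circ> T) \<le> p S * p T"
    and p_cong: "bounded_operator M L N S \<Longrightarrow> bounded_operator M L N T \<Longrightarrow> (\<And>f. f \<in> L \<Longrightarrow> AE x in M. S f x = T f x) \<Longrightarrow> p S = p T"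
    and p_mono: "S \<in> bounded_kernel_ops \<Longrightarrow> T \<in> bounded_kernel_ops \<Longrightarrow>
        (\<And>f. f \<in> Lp \<Longrightarrow> AE x in M. cmod (S (cpx f) x) \<le> cmod (T (cpx f) x)) \<Longrightarrow> p S \<le> p T"
begin

lemma spectral_value:
  assumes A: "A \<in> bounded_kernel_ops" and r: "0 < r"
    and lim: "(\<lambda>n. root n (p (A ^^ n))) \<longlonglongrightarrow> r" and ge: "\<And>n. n \<ge> 1 \<Longrightarrow> r ^ n \<le> p (A ^^ n)"
    and c: "\<And>T. bounded_operator M L N T \<Longrightarrow> p T \<le> c * p (\<lambda>f x. of_real r * T f x - A (T f) x)"
  shows False
proof -
  note Ab = bounded_kernel_opsD(2)[OF A] note Al = bounded_linear'[OF Ab]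
  have Anb: "bounded_operator M L N (A ^^ n)" for n by (rule bounded_funpow[OF Ab])
  note Am = bounded_mem[OF Anb]
  define T where "T \<mu> k f x = (\<Sum>n=1..k. of_real (1 / \<mu> ^ n) * (A ^^ n) f x)" for \<mu> k f x
  have TK: "T \<mu> k \<in> bounded_kernel_ops" if "\<mu> > 0" for \<mu> k
  proof (induction k)
    case 0
    have "T \<mu> 0 = (\<lambda>f x. 0)" by (simp add: T_def fun_eq_iff)
    then show ?case using bounded_kernel_ops_zero[OF A] by simp
  next
    case (Suc k)
    have "T \<mu> (Suc k) = (\<lambda>f x. T \<mu> k f x + of_real (1 / \<mu> ^ Suc k) * (A ^^ Suc k) f x)"
      by (simp add: T_def fun_eq_iff)
    moreover have "\<dots> \<in> bounded_kernel_ops" using that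
      by (intro bounded_kernel_ops_add Suc bounded_kernel_ops_scale bounded_kernel_ops_funpow A) auto
    ultimately show ?case by simp
  qed
  note Tb = bounded_kernel_opsD(2)[OF TK]
  have AT: "AE x in M. A (T \<mu> k f) x = (\<Sum>n=1..k. of_real (1 / \<mu> ^ n) * (A ^^ Suc n) f x)" if f: "f \<in> L" for \<mu> k f
    using linear_sum[OF Al, of "{1..k}" "\<lambda>n. (A ^^ n) f" "\<lambda>n. of_real (1 / \<mu> ^ n)"] Am[OF f] by (simp add: T_def[abs_def])
  \<comment> \<open>With \<open>z n = (A ^^ n) f x\<close> this is
    \<open>(\<mu> - A) T = A - A^(k+1) / \<mu>^k\<close>; for \<open>k = 0\<close> the sum
    \<open>T\<close> is empty and both sides are 0.\<close>
  have tele: "of_real \<mu> * (\<Sum>n=1..k. of_real (1 / \<mu> ^ n) * z n) - (\<Sum>n=1..k. of_real (1 / \<mu> ^ n) * z (Suc n))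
       = (if k = 0 then 0 else z 1 - of_real (1 / \<mu> ^ k) * z (Suc k))" if "\<mu> > 0" for \<mu> :: real and z :: "nat \<Rightarrow> complex" and k
  proof (induction k)
    case (Suc k)
    have "of_real \<mu> * of_real (1 / \<mu> ^ Suc k) = complex_of_real (1 / \<mu> ^ k)" using that by (simp only: of_real_mult[symmetric]) simp
    then show ?case using Suc that by (cases "k = 0") (simp_all add: algebra_simps)
  qed simp
  \<comment> \<open>A negative \<open>c\<close> would contradict the hypothesis for
    \<open>T = A\<close>, because \<open>p A \<ge> r > 0\<close>.\<close>
  have c0: "0 \<le> c"
  proof (rule ccontr)
    assume "\<not> 0 \<le> c"
    have "0 < r ^ 1" using r by simp
    also have "\<dots> \<le> p A" using ge[of 1] by simp
    also have "\<dots> \<le> c * p (\<lambda>f x. of_real r * A f x - A (A f) x)" by (rule c[OF Ab])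
    also have "\<dots> \<le> 0" using \<open>\<not> 0 \<le> c\<close> p_nonneg[OF bounded_diff[OF bounded_scale(1)[OF Ab] bounded_comp(1)[OF Ab Ab]], of "of_real r"]
      by (intro mult_nonpos_nonneg) (auto simp: o_def)
    finally show False by simp
  qed
  \<comment> \<open>The factor 2 comes from absorbing half of \<open>p (T \<mu> m)\<close> on the
    left in \<open>Tbound\<close>. The bound depends neither on \<open>k\<close> nor on
    \<open>\<mu>\<close>.\<close>
  define B where "B = 2 * c * (p A + 1)"
  have B0: "0 \<le> B" using c0 p_nonneg[OF Ab] by (simp add: B_def)
  have Tmono: "p (T \<mu> k) \<le> p (T \<mu> k')" if "k \<le> k'" "\<mu> > 0" for k k' \<mu>
  proof (rule p_mono[OF TK TK])
    fix f assume f: "f \<in> Lp"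
    have "AE x in M. \<forall>n. (A ^^ Suc n) (cpx f) x = of_real (cmod ((A ^^ Suc n) (cpx f) x))"
      unfolding AE_all_countable using kernel_nonneg[OF bounded_kernel_opsD(1)[OF bounded_kernel_ops_funpow[OF A]] f] by blast
    then show "AE x in M. cmod (T \<mu> k (cpx f) x) \<le> cmod (T \<mu> k' (cpx f) x)"
    proof eventually_elim
      case (elim x)
      have z: "(A ^^ n) (cpx f) x = of_real (cmod ((A ^^ n) (cpx f) x))" if "n \<ge> 1" for n
        using elim[rule_format, of "n - 1"] that by simp
      have eq: "T \<mu> k (cpx f) x = of_real (\<Sum>n=1..k. 1 / \<mu> ^ n * cmod ((A ^^ n) (cpx f) x))" for k
        unfolding T_def of_real_sum of_real_mult using z by (intro sum.cong) auto
      have nn: "0 \<le> (\<Sum>n=1..k. 1 / \<mu> ^ n * cmod ((A ^^ n) (cpx f) x))" for k using \<open>\<mu> > 0\<close> by (intro sum_nonneg) auto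
      have "(\<Sum>n=1..k. 1 / \<mu> ^ n * cmod ((A ^^ n) (cpx f) x)) \<le> (\<Sum>n=1..k'. 1 / \<mu> ^ n * cmod ((A ^^ n) (cpx f) x))"
        using \<open>k \<le> k'\<close> \<open>\<mu> > 0\<close> by (intro sum_mono2) auto
      then show ?case unfolding eq norm_of_real using nn by simp
    qed
  qed (use that in auto)
  \<comment> \<open>For \<open>\<mu> > r\<close> the remainder \<open>A^(m+1) / \<mu>^m\<close> is
    small in \<open>p\<close> for some large \<open>m\<close>, so \<open>T \<mu> m\<close> is
    bounded by absorption. \<open>Tmono\<close>, which rests on positivity, carries the bound to
    every \<open>k \<le> m\<close>. At \<open>\<mu> = r\<close> the remainder would stay at least
    \<open>r\<close>.\<close>
  have Tbound: "p (T \<mu> k) \<le> B" if mu: "r < \<mu>" "c * (\<mu> - r) \<le> 1 / 2" for \<mu> k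
  proof -
    have mu0: "\<mu> > 0" using mu r by simp
    \<comment> \<open>A rate strictly between, so that \<open>p (A ^^ n) \<le> q ^ n\<close> holds
      eventually and \<open>(q / \<mu>) ^ n\<close> still decays.\<close>
    define q where "q = (r + \<mu>) / 2"
    have q: "r < q" "q < \<mu>" "0 < q" using mu r by (auto simp: q_def)
    have "\<forall>\<^sub>F n in sequentially. root n (p (A ^^ n)) < q" using lim q by (auto dest: order_tendstoD)
    then have ev1: "\<forall>\<^sub>F n in sequentially. p (A ^^ n) \<le> q ^ n"
      using eventually_ge_at_top[of 1]
    proof eventually_elim
      case (elim n)
      have "p (A ^^ n) = root n (p (A ^^ n)) ^ n" using elim p_nonneg[OF Anb] by (simp add: real_root_pow_pos2)
      also have "\<dots> \<le> q ^ n" using elim p_nonneg[OF Anb] by (intro power_mono) auto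
      finally show ?case .
    qed
    have "(\<lambda>n. (q / \<mu>) ^ n * \<mu>) \<longlonglongrightarrow> 0 * \<mu>" using q mu0 by (intro tendsto_mult LIMSEQ_power_zero tendsto_const) auto
    then have "\<forall>\<^sub>F n in sequentially. (q / \<mu>) ^ n * \<mu> < 1" by (rule order_tendstoD) simp
    then have "\<forall>\<^sub>F n in sequentially. p (A ^^ n) \<le> q ^ n \<and> (q / \<mu>) ^ n * \<mu> < 1 \<and> n \<ge> k + 2"
      using ev1 eventually_ge_at_top[of "k + 2"] by eventually_elim auto
    then obtain n where n: "p (A ^^ n) \<le> q ^ n" "(q / \<mu>) ^ n * \<mu> < 1" "n \<ge> k + 2"
      using eventually_happens'[OF sequentially_bot] by blast
    obtain m where m: "n = Suc m" "m \<ge> 1" "k \<le> m" using n(3) by (cases n) auto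
    have small: "p (A ^^ Suc m) / \<mu> ^ m \<le> 1"
    proof -
      have "p (A ^^ Suc m) / \<mu> ^ m \<le> q ^ n / \<mu> ^ m" using n(1) m mu0 by (simp add: divide_right_mono)
      also have "\<dots> = (q / \<mu>) ^ n * \<mu>" using mu0 m by (simp add: power_divide)
      finally show ?thesis using n(2) by simp
    qed
    note b1 = bounded_scale(1)[OF Tb[OF mu0], of "of_real (r - \<mu>)" m]
      and b2 = bounded_scale(1)[OF Anb, of "of_real (- 1 / \<mu> ^ m)" "Suc m"]
    note b12 = bounded_add(1)[OF b1 bounded_add(1)[OF Ab b2]]
    have "p (T \<mu> m) \<le> c * p (\<lambda>f x. of_real r * T \<mu> m f x - A (T \<mu> m f) x)" by (rule c[OF Tb[OF mu0]])
    also have "p (\<lambda>f x. of_real r * T \<mu> m f x - A (T \<mu> m f) x)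
        = p (\<lambda>f x. of_real (r - \<mu>) * T \<mu> m f x + (A f x + of_real (- 1 / \<mu> ^ m) * (A ^^ Suc m) f x))"
    proof (rule p_cong[OF _ b12])
      show "bounded_operator M L N (\<lambda>f x. of_real r * T \<mu> m f x - A (T \<mu> m f) x)"
        using bounded_diff[OF bounded_scale(1)[OF Tb[OF mu0]] bounded_comp(1)[OF Ab Tb[OF mu0]]] by (simp add: o_def)
      fix f assume f: "f \<in> L"
      show "AE x in M. of_real r * T \<mu> m f x - A (T \<mu> m f) x
          = of_real (r - \<mu>) * T \<mu> m f x + (A f x + of_real (- 1 / \<mu> ^ m) * (A ^^ Suc m) f x)"
        using AT[OF f, of \<mu> m]
      proof eventually_elim
        case (elim x)
        have "of_real \<mu> * T \<mu> m f x - A (T \<mu> m f) x = A f x - of_real (1 / \<mu> ^ m) * (A ^^ Suc m) f x"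
          unfolding elim unfolding T_def using tele[OF mu0, of "\<lambda>n. (A ^^ n) f x" m] m by simp
        then show ?case by (simp add: algebra_simps)
      qed
    qed
    also have "\<dots> \<le> (\<mu> - r) * p (T \<mu> m) + (p A + p (A ^^ Suc m) / \<mu> ^ m)"
    proof -
      have "p (\<lambda>f x. of_real (r - \<mu>) * T \<mu> m f x) \<le> (\<mu> - r) * p (T \<mu> m)"
        using p_scale[OF Tb[OF mu0], of "of_real (r - \<mu>)" m] mu by (simp only: norm_of_real) simp
      moreover have "p (\<lambda>f x. of_real (- 1 / \<mu> ^ m) * (A ^^ Suc m) f x) \<le> p (A ^^ Suc m) / \<mu> ^ m"
        using p_scale[OF Anb, of "of_real (- 1 / \<mu> ^ m)" "Suc m"] mu0 by (simp only: norm_of_real) (simp add: abs_of_nonneg)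
      ultimately show ?thesis using p_add[OF b1 bounded_add(1)[OF Ab b2]] p_add[OF Ab b2] by linarith
    qed
    also have "\<dots> \<le> (\<mu> - r) * p (T \<mu> m) + (p A + 1)" using small by simp
    finally have "p (T \<mu> m) \<le> c * ((\<mu> - r) * p (T \<mu> m) + (p A + 1))" using c0 by (simp add: mult_left_mono)
    also have "\<dots> \<le> 1 / 2 * p (T \<mu> m) + c * (p A + 1)"
      using mult_right_mono[OF mu(2) p_nonneg[OF Tb[OF mu0], of m]] by (simp add: algebra_simps)
    finally have "p (T \<mu> m) \<le> B" unfolding B_def by simp
    then show ?thesis using Tmono[OF m(3) mu0] by simp
  qed
  \<comment> \<open>Exactly \<open>k\<close> of the pairs of indices in the square of
    \<open>T \<mu> k\<close> add up to \<open>k + 1\<close>; by positivity the other terms may be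
    dropped.\<close>
  have key: "real k * r ^ Suc k \<le> B\<^sup>2 * \<mu> ^ Suc k" if k: "k \<ge> 1" and mu: "r < \<mu>" "c * (\<mu> - r) \<le> 1 / 2" for k \<mu>
  proof -
    have mu0: "\<mu> > 0" using mu r by simp
    define e where "e = real k / \<mu> ^ Suc k"
    have e: "0 < e" using k mu0 by (simp add: e_def)
    let ?S = "\<lambda>f x. complex_of_real e * (A ^^ Suc k) f x"
    have SK: "?S \<in> bounded_kernel_ops" using e by (intro bounded_kernel_ops_scale bounded_kernel_ops_funpow A) auto
    have "p ?S \<le> p (T \<mu> k \<circ> T \<mu> k)"
    proof (rule p_mono[OF SK bounded_kernel_ops_comp[OF TK TK]])
      fix f assume f: "f \<in> Lp"
      have pos: "AE x in M. \<forall>n. (A ^^ Suc n) (cpx f) x = of_real (cmod ((A ^^ Suc n) (cpx f) x))"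
        unfolding AE_all_countable using kernel_nonneg[OF bounded_kernel_opsD(1)[OF bounded_kernel_ops_funpow[OF A]] f] by blast
      have "AE x in M. \<forall>n. (A ^^ n) (T \<mu> k (cpx f)) x = (\<Sum>j=1..k. of_real (1 / \<mu> ^ j) * (A ^^ n) ((A ^^ j) (cpx f)) x)"
        unfolding AE_all_countable T_def[abs_def]
        by (intro allI linear_sum[OF bounded_linear'[OF Anb] Am[OF LpD(3)[OF f]]])
      with pos show "AE x in M. cmod (?S (cpx f) x) \<le> cmod ((T \<mu> k \<circ> T \<mu> k) (cpx f) x)"
      proof eventually_elim
        case (elim x)
        define z where "z n = cmod ((A ^^ n) (cpx f) x)" for n
        have z: "(A ^^ n) (cpx f) x = of_real (z n)" if "n \<ge> 1" for n
          using elim(1)[rule_format, of "n - 1"] that by (simp add: z_def)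
        have z0: "0 \<le> z n" for n by (simp add: z_def)
        have TT: "(T \<mu> k \<circ> T \<mu> k) (cpx f) x = of_real (\<Sum>i=1..k. 1 / \<mu> ^ i * (\<Sum>j=1..k. 1 / \<mu> ^ j * z (i + j)))"
        proof -
          have "(T \<mu> k \<circ> T \<mu> k) (cpx f) x = (\<Sum>i=1..k. of_real (1 / \<mu> ^ i) * (A ^^ i) (T \<mu> k (cpx f)) x)"
            by (simp add: T_def[of \<mu> k "T \<mu> k (cpx f)"])
          also have "\<dots> = (\<Sum>i=1..k. of_real (1 / \<mu> ^ i) * (\<Sum>j=1..k. of_real (1 / \<mu> ^ j) * of_real (z (i + j))))"
          proof (intro sum.cong refl arg_cong2[of _ _ _ _ "(*)"])
            fix i assume i: "i \<in> {1..k}"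
            show "(A ^^ i) (T \<mu> k (cpx f)) x = (\<Sum>j=1..k. of_real (1 / \<mu> ^ j) * of_real (z (i + j)))"
              unfolding elim(2)[rule_format]
            proof (intro sum.cong refl arg_cong2[of _ _ _ _ "(*)"])
              fix j assume "j \<in> {1..k}"
              then show "(A ^^ i) ((A ^^ j) (cpx f)) x = of_real (z (i + j))" using z[of "i + j"] by (simp add: funpow_add)
            qed
          qed
          also have "\<dots> = of_real (\<Sum>i=1..k. 1 / \<mu> ^ i * (\<Sum>j=1..k. 1 / \<mu> ^ j * z (i + j)))" by simp
          finally show ?thesis .
        qed
        have "e * z (Suc k) = (\<Sum>i=1..k. 1 / \<mu> ^ i * (1 / \<mu> ^ (Suc k - i) * z (i + (Suc k - i))))"
        proof -
          have "1 / \<mu> ^ i * (1 / \<mu> ^ (Suc k - i) * z (i + (Suc k - i))) = 1 / \<mu> ^ Suc k * z (Suc k)" if "i \<in> {1..k}" for i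
          proof -
            have "\<mu> ^ i * \<mu> ^ (Suc k - i) = \<mu> ^ Suc k" using that by (subst power_add[symmetric]) simp
            then show ?thesis using that by (simp add: field_simps)
          qed
          then have "(\<Sum>i=1..k. 1 / \<mu> ^ i * (1 / \<mu> ^ (Suc k - i) * z (i + (Suc k - i)))) = (\<Sum>i=1..k. 1 / \<mu> ^ Suc k * z (Suc k))"
            by (intro sum.cong) auto
          then show ?thesis by (simp add: e_def)
        qed
        also have "\<dots> \<le> (\<Sum>i=1..k. 1 / \<mu> ^ i * (\<Sum>j=1..k. 1 / \<mu> ^ j * z (i + j)))"
        proof (intro sum_mono mult_left_mono)
          fix i assume "i \<in> {1..k}"
          then show "1 / \<mu> ^ (Suc k - i) * z (i + (Suc k - i)) \<le> (\<Sum>j=1..k. 1 / \<mu> ^ j * z (i + j))"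
            using mu0 z0 by (intro member_le_sum[of "Suc k - i" "{1..k}" "\<lambda>j. 1 / \<mu> ^ j * z (i + j)"]) auto
        qed (use mu0 in auto)
        finally have le: "e * z (Suc k) \<le> (\<Sum>i=1..k. 1 / \<mu> ^ i * (\<Sum>j=1..k. 1 / \<mu> ^ j * z (i + j)))" .
        have "cmod (?S (cpx f) x) = e * z (Suc k)" using e by (simp only: norm_mult norm_of_real z_def abs_of_pos)
        also have "\<dots> \<le> cmod ((T \<mu> k \<circ> T \<mu> k) (cpx f) x)" using le unfolding TT norm_of_real by simp
        finally show ?case .
      qed
    qed (use mu0 in auto)
    also have "\<dots> \<le> p (T \<mu> k) * p (T \<mu> k)" by (intro p_comp Tb mu0)
    also have "\<dots> \<le> B * B" using Tbound[OF mu] B0 p_nonneg[OF Tb[OF mu0]] by (intro mult_mono) auto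
    finally have S: "p ?S \<le> B\<^sup>2" by (simp add: power2_eq_square)
    have "p (A ^^ Suc k) = p (\<lambda>f x. of_real (1 / e) * ?S f x)"
      using e by (intro p_cong Anb bounded_scale bounded_kernel_opsD(2)[OF SK]) (simp add: mult.assoc[symmetric] flip: of_real_mult)
    also have "\<dots> \<le> cmod (of_real (1 / e)) * p ?S" by (rule p_scale[OF bounded_kernel_opsD(2)[OF SK]])
    also have "cmod (of_real (1 / e)) = 1 / e" using e by (simp only: norm_of_real) simp
    finally have "e * p (A ^^ Suc k) \<le> B\<^sup>2" using S e by (simp add: field_simps del: funpow.simps)
    then have "e * r ^ Suc k \<le> B\<^sup>2" using mult_left_mono[OF ge[of "Suc k"], of e] e by linarith
    then show ?thesis using mu0 by (simp add: e_def field_simps)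
  qed
  \<comment> \<open>\<open>k\<close> is fixed before \<open>\<mu>\<close> decreases to
    \<open>r\<close>; the limit of \<open>key\<close> is
    \<open>real k * r ^ Suc k \<le> B\<^sup>2 * r ^ Suc k\<close>, which is false for this
    \<open>k\<close>.\<close>
  obtain k where k: "real k > B\<^sup>2" using reals_Archimedean2 by blast
  then have k1: "k \<ge> 1" using zero_le_power2[of B] by (cases k) auto
  have "real k * r ^ Suc k \<le> B\<^sup>2 * r ^ Suc k"
  proof (rule tendsto_lowerbound)
    show "((\<lambda>\<mu>. B\<^sup>2 * \<mu> ^ Suc k) \<longlongrightarrow> B\<^sup>2 * r ^ Suc k) (at_right r)" by (intro tendsto_intros)
    show "\<forall>\<^sub>F \<mu> in at_right r. real k * r ^ Suc k \<le> B\<^sup>2 * \<mu> ^ Suc k"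
    proof -
      have "((\<lambda>\<mu>. c * (\<mu> - r)) \<longlongrightarrow> c * (r - r)) (at_right r)" by (intro tendsto_intros)
      then have "\<forall>\<^sub>F \<mu> in at_right r. c * (\<mu> - r) < 1 / 2" by (rule order_tendstoD) simp
      moreover have "\<forall>\<^sub>F \<mu> in at_right r. r < \<mu>" by (rule eventually_at_right_less)
      ultimately show ?thesis by eventually_elim (use key k1 in auto)
    qed
  qed simp
  then show False using k r by simp
qed

end

context banach_function_space
begin

text \<open>Monotonicity holds because \<open>|S f| \<le> |S |f||\<close> a.e. and \<open>N\<close>
  is monotone in moduli.\<close>

lemma op_norm_monotone_seminorm: "monotone_op_seminorm M L N (op_norm L N)"
proof (unfold_locales)
  fix S T assume S: "S \<in> bounded_kernel_ops" and T: "T \<in> bounded_kernel_ops"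
    and le: "\<And>f. f \<in> Lp \<Longrightarrow> AE x in M. cmod (S (cpx f) x) \<le> cmod (T (cpx f) x)"
  note Sb = bounded_kernel_opsD[OF S] and Tb = bounded_kernel_opsD[OF T]
  show "op_norm L N S \<le> op_norm L N T"
  proof (rule op_norm_le_bound[OF op_norm_nonneg[OF Tb(2)]])
    fix f assume f: "f \<in> L"
    have "AE x in M. cmod (S f x) \<le> cmod (T (cpx (\<lambda>x. cmod (f x))) x)"
      using kernel_cmod_le[OF Sb(1) f] le[OF cmod_Lp[OF f]] by eventually_elim simp
    then have "N (S f) \<le> N (T (cpx (\<lambda>x. cmod (f x))))"
      by (rule norm_mono[OF bounded_mem[OF Tb(2) cmod_mem[OF f]] measurable[OF bounded_mem[OF Sb(2) f]]])
    also have "\<dots> \<le> op_norm L N T * N f" using op_norm_upper[OF Tb(2) cmod_mem[OF f]] norm_cmod[OF f] by simp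
    finally show "N (S f) \<le> op_norm L N T * N f" .
  qed
qed (auto intro: op_norm_nonneg bounded_add bounded_scale bounded_comp op_norm_cong)

section \<open>Neumann series, resolvents and the spectral radius formula\<close>

lemma norm_limit_unique:
  assumes u: "\<And>n. u n \<in> L" and f: "f \<in> L" and g: "g \<in> L"
    and "(\<lambda>n. N (\<lambda>x. u n x - f x)) \<longlonglongrightarrow> 0" "(\<lambda>n. N (\<lambda>x. u n x - g x)) \<longlonglongrightarrow> 0"
  shows "AE x in M. f x = g x"
proof -
  have "N (\<lambda>x. f x - g x) \<le> N (\<lambda>x. u n x - f x) + N (\<lambda>x. u n x - g x)" for n
    using norm_triangle_trans[OF f u g, of n] norm_diff_commute[OF f u, of n] by simp
  moreover have "(\<lambda>n. N (\<lambda>x. u n x - f x) + N (\<lambda>x. u n x - g x)) \<longlonglongrightarrow> 0 + 0" by (intro tendsto_add assms)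
  ultimately have "N (\<lambda>x. f x - g x) \<le> 0" by (intro LIMSEQ_le_const) auto
  then have "N (\<lambda>x. f x - g x) = 0" using norm_nonneg[OF diff_mem[OF f g]] by simp
  then show ?thesis using norm_eq_zero_iff[OF diff_mem[OF f g]] by simp
qed

text \<open>The geometric bound concerns the powers instead of the norm of \<open>T\<close>, so that
  the series is available for every \<open>z\<close> beyond the spectral radius.\<close>

lemma Neumann:
  assumes T: "bounded_operator M L N T" and C: "0 \<le> C" and q: "0 \<le> q" "q < 1"
    and le: "\<And>n f. f \<in> L \<Longrightarrow> N ((T ^^ n) f) \<le> C * q ^ n * N f"
  obtains B where "bounded_operator M L N B"
    "\<And>f. f \<in> L \<Longrightarrow> AE x in M. B f x - T (B f) x = f x" "\<And>f. f \<in> L \<Longrightarrow> AE x in M. B f x - B (T f) x = f x"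
proof -
  define S where "S n f x = (\<Sum>k<n. (T ^^ k) f x)" for n f x
  note Tl = bounded_linear'[OF T]
  have Tn: "(T ^^ k) f \<in> L" if "f \<in> L" for k f by (rule bounded_mem[OF bounded_funpow[OF T] that])
  have Sm: "S n f \<in> L" if "f \<in> L" for n f unfolding S_def[abs_def] by (intro sum_mem Tn that)
  have ex: "\<exists>g\<in>L. (\<lambda>n. N (\<lambda>x. S n f x - g x)) \<longlonglongrightarrow> 0" if f: "f \<in> L" for f
  proof -
    have "N (\<lambda>x. S (Suc n) f x - S n f x) \<le> (C * N f) * q ^ n" for n
      using le[OF f, of n] by (simp add: S_def mult_ac)
    moreover have "0 \<le> C * N f" using C norm_nonneg[OF f] by simp
    ultimately show ?thesis using Cauchy_geometric[of "\<lambda>n. S n f" q "C * N f", OF Sm[OF f] q] by blast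
  qed
  \<comment> \<open>The limit is unique only up to null functions, so a representative is chosen.
    \<open>Bu\<close> identifies it a.e. with any other limit, and linearity and the two inverse
    identities reduce to that.\<close>
  define B where "B f = (SOME g. g \<in> L \<and> (\<lambda>n. N (\<lambda>x. S n f x - g x)) \<longlonglongrightarrow> 0)" for f
  have B: "B f \<in> L" "(\<lambda>n. N (\<lambda>x. S n f x - B f x)) \<longlonglongrightarrow> 0" if "f \<in> L" for f
    using someI_ex[of "\<lambda>g. g \<in> L \<and> (\<lambda>n. N (\<lambda>x. S n f x - g x)) \<longlonglongrightarrow> 0"] ex[OF that] unfolding B_def by blast+
  have Bu: "AE x in M. B f x = g x" if f: "f \<in> L" and g: "g \<in> L" and lim: "(\<lambda>n. N (\<lambda>x. S n f x - g x)) \<longlonglongrightarrow> 0" for f g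
    by (rule norm_limit_unique[OF Sm[OF f] B(1)[OF f] g B(2)[OF f] lim])
  have S_lin: "AE x in M. S n (\<lambda>x. f x + g x) x = S n f x + S n g x" if "f \<in> L" "g \<in> L" for n f g
  proof -
    have "AE x in M. \<forall>k. (T ^^ k) (\<lambda>x. f x + g x) x = (T ^^ k) f x + (T ^^ k) g x"
      unfolding AE_all_countable using linear_add[OF bounded_linear'[OF bounded_funpow[OF T]] that] by blast
    then show ?thesis by eventually_elim (simp add: S_def sum.distrib)
  qed
  have S_scale: "AE x in M. S n (\<lambda>x. c * f x) x = c * S n f x" if "f \<in> L" for n f c
  proof -
    have "AE x in M. \<forall>k. (T ^^ k) (\<lambda>x. c * f x) x = c * (T ^^ k) f x"
      unfolding AE_all_countable using linear_scale[OF bounded_linear'[OF bounded_funpow[OF T]] that] by blast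
    then show ?thesis by eventually_elim (simp add: S_def sum_distrib_left)
  qed
  have S_cong: "AE x in M. S n f x = S n g x" if "f \<in> L" "g \<in> L" "AE x in M. f x = g x" for n f g
  proof -
    have "AE x in M. \<forall>k. (T ^^ k) f x = (T ^^ k) g x"
      unfolding AE_all_countable using linear_cong[OF bounded_linear'[OF bounded_funpow[OF T]] that] by blast
    then show ?thesis by eventually_elim (simp add: S_def)
  qed
  have "linear_operator M L B" unfolding linear_operator_def
  proof (intro conjI ballI allI impI)
    fix f assume f: "f \<in> L"
    show "B f \<in> L" by (rule B(1)[OF f])
    show "AE x in M. B (\<lambda>y. c * f y) x = c * B f x" for c
    proof (rule Bu[OF scale_mem[OF f] scale_mem[OF B(1)[OF f]]])
      have "N (\<lambda>x. S n (\<lambda>y. c * f y) x - c * B f x) = cmod c * N (\<lambda>x. S n f x - B f x)" for n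
      proof -
        have "N (\<lambda>x. S n (\<lambda>y. c * f y) x - c * B f x) = N (\<lambda>x. c * (S n f x - B f x))"
          using S_scale[OF f, of n c] by (intro N_cong diff_mem scale_mem Sm B f) (auto elim!: eventually_mono simp: algebra_simps)
        then show ?thesis using norm_scale[OF diff_mem[OF Sm[OF f] B(1)[OF f]]] by simp
      qed
      then show "(\<lambda>n. N (\<lambda>x. S n (\<lambda>y. c * f y) x - c * B f x)) \<longlonglongrightarrow> 0"
        using tendsto_mult_right_zero[OF B(2)[OF f], of "cmod c"] by simp
    qed
    fix g assume g: "g \<in> L"
    show "AE x in M. B (\<lambda>y. f y + g y) x = B f x + B g x"
    proof (rule Bu[OF add_mem[OF f g] add_mem[OF B(1)[OF f] B(1)[OF g]]])
      have le: "N (\<lambda>x. S n (\<lambda>y. f y + g y) x - (B f x + B g x)) \<le> N (\<lambda>x. S n f x - B f x) + N (\<lambda>x. S n g x - B g x)" for n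
      proof -
        have "N (\<lambda>x. S n (\<lambda>y. f y + g y) x - (B f x + B g x)) = N (\<lambda>x. (S n f x - B f x) + (S n g x - B g x))"
          using S_lin[OF f g, of n] by (intro N_cong diff_mem add_mem Sm B f g) (auto elim!: eventually_mono)
        then show ?thesis using norm_triangle[OF diff_mem[OF Sm[OF f] B(1)[OF f]] diff_mem[OF Sm[OF g] B(1)[OF g]]] by simp
      qed
      show "(\<lambda>n. N (\<lambda>x. S n (\<lambda>y. f y + g y) x - (B f x + B g x))) \<longlonglongrightarrow> 0"
      proof (rule squeeze_zero[OF _ le])
        show "(\<lambda>n. N (\<lambda>x. S n f x - B f x) + N (\<lambda>x. S n g x - B g x)) \<longlonglongrightarrow> 0"
          using tendsto_add[OF B(2)[OF f] B(2)[OF g]] by simp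
        show "0 \<le> N (\<lambda>x. S n (\<lambda>y. f y + g y) x - (B f x + B g x))" for n
          by (rule norm_nonneg[OF diff_mem[OF Sm[OF add_mem[OF f g]] add_mem[OF B(1)[OF f] B(1)[OF g]]]])
      qed
    qed
    assume eq: "AE x in M. f x = g x"
    show "AE x in M. B f x = B g x"
    proof (rule Bu[OF f B(1)[OF g]])
      have "N (\<lambda>x. S n f x - B g x) = N (\<lambda>x. S n g x - B g x)" for n
        using S_cong[OF f g eq, of n] by (intro N_cong diff_mem Sm B f g) (auto elim!: eventually_mono)
      then show "(\<lambda>n. N (\<lambda>x. S n f x - B g x)) \<longlonglongrightarrow> 0" using B(2)[OF g] by simp
    qed
  qed
  moreover have "N (B f) \<le> C / (1 - q) * N f" if f: "f \<in> L" for f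
  proof -
    have Sn: "N (S n f) \<le> C / (1 - q) * N f" for n
    proof -
      have "N (S n f) \<le> (\<Sum>k<n. N ((T ^^ k) f))" unfolding S_def[abs_def] by (intro norm_sum_le Tn f)
      also have "\<dots> \<le> (\<Sum>k<n. C * q ^ k * N f)" by (intro sum_mono le f)
      also have "\<dots> = C * N f * (\<Sum>k<n. q ^ k)" by (simp add: sum_distrib_left mult_ac)
      also have "\<dots> \<le> C * N f * (1 / (1 - q))"
        using q C norm_nonneg[OF f] by (intro mult_left_mono) (auto simp: sum_gp_strict divide_right_mono)
      finally show ?thesis by simp
    qed
    have "N (B f) \<le> C / (1 - q) * N f + N (\<lambda>x. S n f x - B f x)" for n
      using norm_le_add_diff[OF B(1)[OF f] Sm[OF f], of n] norm_diff_commute[OF B(1)[OF f] Sm[OF f], of n] Sn[of n] by simp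
    moreover have "(\<lambda>n. C / (1 - q) * N f + N (\<lambda>x. S n f x - B f x)) \<longlonglongrightarrow> C / (1 - q) * N f + 0"
      by (intro tendsto_add tendsto_const B(2) f)
    ultimately show ?thesis by (intro LIMSEQ_le_const) auto
  qed
  ultimately have Bb: "bounded_operator M L N B" by (rule bounded_operatorI)
  have 1: "AE x in M. B f x - T (B f) x = f x" if f: "f \<in> L" for f
  proof -
    have "AE x in M. B f x = f x + T (B f) x"
    proof (rule norm_limit_unique[of "\<lambda>n. S (Suc n) f"])
      show "(\<lambda>n. N (\<lambda>x. S (Suc n) f x - B f x)) \<longlonglongrightarrow> 0" by (rule LIMSEQ_Suc[OF B(2)[OF f]])
      have "N (\<lambda>x. S (Suc n) f x - (f x + T (B f) x)) \<le> op_norm L N T * N (\<lambda>x. S n f x - B f x)" for n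
      proof -
        have "AE x in M. T (S n f) x = (\<Sum>k<n. (T ^^ Suc k) f x)"
          using linear_sum[OF Tl, of "{..<n}" "\<lambda>k. (T ^^ k) f" "\<lambda>_. 1"] Tn[OF f] by (simp add: S_def[abs_def])
        with linear_diff[OF Tl Sm[OF f] B(1)[OF f], of n]
        have "AE x in M. S (Suc n) f x - (f x + T (B f) x) = T (\<lambda>x. S n f x - B f x) x"
        proof eventually_elim
          case (elim x)
          have "S (Suc n) f x = f x + (\<Sum>k<n. (T ^^ Suc k) f x)" unfolding S_def by (subst sum.lessThan_Suc_shift) simp
          then show ?case using elim by simp
        qed
        then have "N (\<lambda>x. S (Suc n) f x - (f x + T (B f) x)) = N (T (\<lambda>x. S n f x - B f x))"
          by (rule N_cong[OF diff_mem[OF Sm[OF f] add_mem[OF f bounded_mem[OF T B(1)[OF f]]]] bounded_mem[OF T diff_mem[OF Sm[OF f] B(1)[OF f]]]])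
        also have "\<dots> \<le> op_norm L N T * N (\<lambda>x. S n f x - B f x)" by (rule op_norm_upper[OF T diff_mem[OF Sm[OF f] B(1)[OF f]]])
        finally show ?thesis .
      qed
      moreover have "(\<lambda>n. op_norm L N T * N (\<lambda>x. S n f x - B f x)) \<longlonglongrightarrow> 0" by (rule tendsto_mult_right_zero[OF B(2)[OF f]])
      ultimately show "(\<lambda>n. N (\<lambda>x. S (Suc n) f x - (f x + T (B f) x))) \<longlonglongrightarrow> 0"
        by (intro squeeze_zero[of "\<lambda>n. N (\<lambda>x. S (Suc n) f x - (f x + T (B f) x))"]
            norm_nonneg[OF diff_mem[OF Sm[OF f] add_mem[OF f bounded_mem[OF T B(1)[OF f]]]]])
    qed (use Sm B f add_mem bounded_mem[OF T] in auto)
    then show ?thesis by eventually_elim simp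
  qed
  have 2: "AE x in M. B f x - B (T f) x = f x" if f: "f \<in> L" for f
  proof -
    note Tf = bounded_mem[OF T f]
    have "AE x in M. B (T f) x = B f x - f x"
    proof (rule Bu[OF Tf diff_mem[OF B(1)[OF f] f]])
      have eq: "S n (T f) x - (B f x - f x) = S (Suc n) f x - B f x" for n x
      proof -
        have "S (Suc n) f x = f x + (\<Sum>k<n. (T ^^ Suc k) f x)" unfolding S_def by (subst sum.lessThan_Suc_shift) simp
        then show ?thesis by (simp add: S_def funpow_swap1)
      qed
      show "(\<lambda>n. N (\<lambda>x. S n (T f) x - (B f x - f x))) \<longlonglongrightarrow> 0" unfolding eq by (rule LIMSEQ_Suc[OF B(2)[OF f]])
    qed
    then show ?thesis by eventually_elim simp
  qed
  show ?thesis by (rule that[OF Bb 1 2])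
qed

lemma funpow_scale_AE:
  assumes A: "bounded_operator M L N A" and f: "f \<in> L"
  shows "AE x in M. ((\<lambda>f x. c * A f x) ^^ n) f x = c ^ n * (A ^^ n) f x"
proof (induction n)
  case (Suc n)
  let ?T = "\<lambda>f x. c * A f x"
  have m: "(?T ^^ n) f \<in> L" "(A ^^ n) f \<in> L" by (intro bounded_mem[OF bounded_funpow] bounded_scale A f)+
  from linear_cong[OF bounded_linear'[OF A] m(1) scale_mem[OF m(2)] Suc] linear_scale[OF bounded_linear'[OF A] m(2), of "c ^ n"]
  show ?case by eventually_elim simp
qed simp

lemma resolvent_exists:
  assumes A: "bounded_operator M L N A" and C: "0 \<le> C" and q: "0 \<le> q" "q < cmod z"
    and le: "\<And>n f. f \<in> L \<Longrightarrow> N ((A ^^ n) f) \<le> C * q ^ n * N f"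
  shows "invertible_op M L N (\<lambda>f x. z * f x - A f x)"
proof -
  have z: "z \<noteq> 0" using q by auto
  let ?T = "\<lambda>f x. (1 / z) * A f x"
  note T = bounded_scale(1)[OF A, of "1 / z"]
  have "N ((?T ^^ n) f) \<le> C * (q / cmod z) ^ n * N f" if f: "f \<in> L" for n f
  proof -
    have "N ((?T ^^ n) f) = N (\<lambda>x. (1 / z) ^ n * (A ^^ n) f x)"
      by (intro N_cong bounded_mem[OF bounded_funpow[OF T]] scale_mem bounded_mem[OF bounded_funpow[OF A]] f funpow_scale_AE A)
    also have "\<dots> = (1 / cmod z) ^ n * N ((A ^^ n) f)"
      using norm_scale[OF bounded_mem[OF bounded_funpow[OF A] f], of "(1 / z) ^ n" n] by (simp add: norm_power norm_divide)
    also have "\<dots> \<le> (1 / cmod z) ^ n * (C * q ^ n * N f)" by (intro mult_left_mono le f) auto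
    finally show ?thesis by (simp add: power_divide)
  qed
  then obtain B where B: "bounded_operator M L N B"
    "\<And>f. f \<in> L \<Longrightarrow> AE x in M. B f x - ?T (B f) x = f x" "\<And>f. f \<in> L \<Longrightarrow> AE x in M. B f x - B (?T f) x = f x"
    using Neumann[OF T C, of "q / cmod z"] q z by (auto simp: divide_less_eq)
  let ?R = "\<lambda>f x. (1 / z) * B f x"
  have "AE x in M. z * ?R f x - A (?R f) x = f x" if f: "f \<in> L" for f
    using B(2)[OF f] linear_scale[OF bounded_linear'[OF A] bounded_mem[OF B(1) f], of "1 / z"]
    by eventually_elim (use z in simp)
  moreover have "AE x in M. ?R (\<lambda>x. z * f x - A f x) x = f x" if f: "f \<in> L" for f
  proof -
    note Af = bounded_mem[OF A f] note Bl = bounded_linear'[OF B(1)]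
    from B(3)[OF f] linear_diff[OF Bl scale_mem[OF f] Af, of z] linear_scale[OF Bl f, of z] linear_scale[OF Bl Af, of "1 / z"]
    show ?thesis by eventually_elim (use z in \<open>simp add: field_simps\<close>)
  qed
  ultimately show ?thesis unfolding invertible_op_def using bounded_scale(1)[OF B(1), of "1 / z"] by blast
qed

lemma geometric_bound_of_root_lim:
  fixes a :: "nat \<Rightarrow> real"
  assumes "(\<lambda>n. root n (a n)) \<longlonglongrightarrow> s" "s < q" "0 \<le> s" "\<And>n. 0 \<le> a n"
  obtains C where "0 \<le> C" "\<And>n. a n \<le> C * q ^ n"
proof -
  have q: "0 < q" using assms by simp
  have "\<forall>\<^sub>F n in sequentially. root n (a n) < q" using assms by (auto dest: order_tendstoD)
  then obtain n0 where n0: "\<And>n. n \<ge> n0 \<Longrightarrow> root n (a n) < q" by (auto simp: eventually_sequentially)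
  define C where "C = 1 + (\<Sum>k\<le>n0. a k / q ^ k)"
  have C1: "1 \<le> C" unfolding C_def using assms(4) q by (simp add: sum_nonneg)
  have "a n \<le> C * q ^ n" for n
  proof (cases "n \<le> n0")
    case True
    then have "a n / q ^ n \<le> (\<Sum>k\<le>n0. a k / q ^ k)" using assms(4) q by (intro member_le_sum) auto
    then have "a n / q ^ n \<le> C" by (simp add: C_def)
    then show ?thesis using q by (simp add: field_simps)
  next
    case False
    then have "a n = root n (a n) ^ n" using assms(4) by (simp add: real_root_pow_pos2)
    also have "\<dots> \<le> q ^ n" using n0[of n] False assms(4) by (intro power_mono) auto
    also have "\<dots> \<le> C * q ^ n" using C1 q by simp
    finally show ?thesis .
  qed
  then show ?thesis using that[of C] C1 by simp
qed

text \<open>Outside the disc of radius \<open>s\<close> the resolvent is a Neumann series. If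
  \<open>s > 0\<close>, then \<open>s\<close> itself belongs to the spectrum by
  \<open>spectral_value\<close>; if \<open>s = 0\<close>, the 0 inserted into the supremum gives the
  value.\<close>

lemma spectral_rad_lim:
  assumes A: "A \<in> bounded_kernel_ops"
  shows "(\<lambda>n. root n (op_norm L N (A ^^ n))) \<longlonglongrightarrow> spectral_rad M L N A"
proof -
  interpret monotone_op_seminorm M L N "op_norm L N" by (rule op_norm_monotone_seminorm)
  note Ab = bounded_kernel_opsD(2)[OF A]
  have Anb: "bounded_operator M L N (A ^^ n)" for n by (rule bounded_funpow[OF Ab])
  obtain s where s: "0 \<le> s" "(\<lambda>n. root n (op_norm L N (A ^^ n))) \<longlonglongrightarrow> s" "\<And>n. n \<ge> 1 \<Longrightarrow> s ^ n \<le> op_norm L N (A ^^ n)"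
    by (rule root_tendsto_of_submultiplicative[of "\<lambda>n. op_norm L N (A ^^ n)"])
      (auto simp: funpow_add op_norm_nonneg[OF Anb] intro!: p_comp Anb)
  have upper: "cmod z \<le> s" if "z \<in> op_spectrum M L N A" for z
  proof (rule ccontr)
    assume "\<not> cmod z \<le> s"
    then obtain q where q: "s < q" "q < cmod z" using dense[of s "cmod z"] by auto
    obtain C where C: "0 \<le> C" "\<And>n. op_norm L N (A ^^ n) \<le> C * q ^ n"
      using geometric_bound_of_root_lim[OF s(2) q(1) s(1) op_norm_nonneg[OF Anb]] by blast
    have "N ((A ^^ n) f) \<le> C * q ^ n * N f" if "f \<in> L" for n f
      using op_norm_upper[OF Anb that, of n] mult_right_mono[OF C(2)[of n] norm_nonneg[OF that]] by simp
    then have "invertible_op M L N (\<lambda>f x. z * f x - A f x)"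
      using resolvent_exists[OF Ab C(1), of q z] q s(1) by auto
    then show False using that by (simp add: op_spectrum_def)
  qed
  have lower: "of_real s \<in> op_spectrum M L N A" if "0 < s"
  proof (rule ccontr)
    assume "of_real s \<notin> op_spectrum M L N A"
    then obtain R where R: "bounded_operator M L N R" "\<And>f. f \<in> L \<Longrightarrow> AE x in M. R (\<lambda>x. of_real s * f x - A f x) x = f x"
      unfolding op_spectrum_def invertible_op_def by auto
    \<comment> \<open>A bounded left inverse \<open>R\<close> of \<open>s - A\<close> yields the
      inequality that \<open>spectral_value\<close> refutes, with constant
      \<open>op_norm L N R\<close>.\<close>
    have c: "op_norm L N T \<le> op_norm L N R * op_norm L N (\<lambda>f x. of_real s * T f x - A (T f) x)" if T: "bounded_operator M L N T" for T
    proof -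
      let ?U = "\<lambda>f x. of_real s * T f x - A (T f) x"
      have U: "bounded_operator M L N ?U"
        using bounded_diff[OF bounded_scale(1)[OF T] bounded_comp(1)[OF Ab T]] by (simp add: o_def)
      have "op_norm L N T = op_norm L N (R \<circ> ?U)"
      proof (rule op_norm_cong[OF T bounded_comp(1)[OF R(1) U]])
        fix f assume "f \<in> L"
        from R(2)[OF bounded_mem[OF T this]] show "AE x in M. T f x = (R \<circ> ?U) f x" by eventually_elim simp
      qed
      also have "\<dots> \<le> op_norm L N R * op_norm L N ?U" by (rule bounded_comp(2)[OF R(1) U])
      finally show ?thesis .
    qed
    show False by (rule spectral_value[OF A that s(2) s(3) c])
  qed
  have "spectral_rad M L N A = s" unfolding spectral_rad_def by (rule Sup_norm_eq[OF s(1) upper lower])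
  then show ?thesis using s(2) by simp
qed

subsection \<open>Measure of noncompactness\<close>

abbreviation mnc where "mnc \<equiv> hausdorff_mnc L N"

definition finite_net :: "'a cop \<Rightarrow> real \<Rightarrow> bool" where
  "finite_net A \<delta> \<longleftrightarrow> (\<exists>F. finite F \<and> F \<subseteq> L \<and> (\<forall>f\<in>L. N f \<le> 1 \<longrightarrow> (\<exists>g\<in>F. N (\<lambda>x. A f x - g x) \<le> \<delta>)))"

lemma mnc_eq: "mnc A = Inf {\<delta>. \<delta> > 0 \<and> finite_net A \<delta>}"
  by (simp add: hausdorff_mnc_def finite_net_def)

lemma mnc_bdd: "bdd_below {\<delta>. \<delta> > 0 \<and> finite_net A \<delta>}"
  by (rule bdd_belowI[of _ 0]) auto

lemma mnc_le: "0 < \<delta> \<Longrightarrow> finite_net A \<delta> \<Longrightarrow> mnc A \<le> \<delta>"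
  unfolding mnc_eq by (rule cInf_lower[OF _ mnc_bdd]) auto

lemma finite_net_norm: assumes A: "bounded_operator M L N A" "op_norm L N A \<le> \<delta>" shows "finite_net A \<delta>"
  unfolding finite_net_def
proof (intro exI[of _ "{\<lambda>_. 0}"] conjI ballI impI)
  fix f assume f: "f \<in> L" "N f \<le> 1"
  have "N (A f) \<le> op_norm L N A * 1"
    using op_norm_upper[OF A(1) f(1)] mult_left_mono[OF f(2) op_norm_nonneg[OF A(1)]] by simp
  then show "\<exists>g\<in>{\<lambda>_. 0}. N (\<lambda>x. A f x - g x) \<le> \<delta>" using A(2) by simp
qed (auto simp: zero_mem)

lemma mnc_ne: assumes "bounded_operator M L N A" shows "{\<delta>. \<delta> > 0 \<and> finite_net A \<delta>} \<noteq> {}"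
  using finite_net_norm[OF assms, of "op_norm L N A + 1"] op_norm_nonneg[OF assms] by (auto intro!: exI[of _ "op_norm L N A + 1"])

lemma mnc_nonneg: "bounded_operator M L N A \<Longrightarrow> 0 \<le> mnc A"
  unfolding mnc_eq by (rule cInf_greatest[OF mnc_ne]) auto

lemma mnc_net: assumes A: "bounded_operator M L N A" and "mnc A < \<delta>" shows "finite_net A \<delta>"
proof -
  obtain e where e: "e > 0" "finite_net A e" "e < \<delta>"
    using assms(2) unfolding mnc_eq by (subst (asm) cInf_less_iff[OF mnc_ne[OF A] mnc_bdd]) auto
  then show ?thesis unfolding finite_net_def by (meson less_imp_le order_trans)
qed

lemma mnc_leI: assumes "\<And>e. 0 < e \<Longrightarrow> finite_net A (\<delta> + e)" "0 \<le> \<delta>" shows "mnc A \<le> \<delta>"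
  by (rule field_le_epsilon) (use assms in \<open>auto intro!: mnc_le\<close>)

lemma mnc_le_norm: "bounded_operator M L N A \<Longrightarrow> mnc A \<le> op_norm L N A"
  by (rule mnc_leI) (auto intro!: finite_net_norm op_norm_nonneg)

lemma mnc_cong: assumes S: "bounded_operator M L N S" and T: "bounded_operator M L N T"
    and eq: "\<And>f. f \<in> L \<Longrightarrow> AE x in M. S f x = T f x"
  shows "mnc S = mnc T"
proof -
  have "N (\<lambda>x. S f x - g x) = N (\<lambda>x. T f x - g x)" if "f \<in> L" "g \<in> L" for f g
    using eq[OF that(1)] by (intro N_cong diff_mem bounded_mem[OF S] bounded_mem[OF T] that) (auto elim!: eventually_mono)
  then have "(\<exists>g\<in>F. N (\<lambda>x. S f x - g x) \<le> \<delta>) = (\<exists>g\<in>F. N (\<lambda>x. T f x - g x) \<le> \<delta>)" if "f \<in> L" "F \<subseteq> L" for f F \<delta>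
    using that by (intro bex_cong) auto
  then have "finite_net S \<delta> = finite_net T \<delta>" for \<delta>
    unfolding finite_net_def by (intro ex_cong conj_cong ball_cong imp_cong refl) auto
  then show ?thesis unfolding mnc_eq by simp
qed

lemma mnc_add: assumes S: "bounded_operator M L N S" and T: "bounded_operator M L N T"
  shows "mnc (\<lambda>f x. S f x + T f x) \<le> mnc S + mnc T"
proof (rule mnc_leI)
  show "0 \<le> mnc S + mnc T" using mnc_nonneg[OF S] mnc_nonneg[OF T] by simp
  fix e :: real assume e: "0 < e"
  obtain F where F: "finite F" "F \<subseteq> L" "\<And>f. f \<in> L \<Longrightarrow> N f \<le> 1 \<Longrightarrow> \<exists>g\<in>F. N (\<lambda>x. S f x - g x) \<le> mnc S + e / 2"
    using mnc_net[OF S, of "mnc S + e / 2"] e unfolding finite_net_def by auto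
  obtain G where G: "finite G" "G \<subseteq> L" "\<And>f. f \<in> L \<Longrightarrow> N f \<le> 1 \<Longrightarrow> \<exists>g\<in>G. N (\<lambda>x. T f x - g x) \<le> mnc T + e / 2"
    using mnc_net[OF T, of "mnc T + e / 2"] e unfolding finite_net_def by auto
  show "finite_net (\<lambda>f x. S f x + T f x) (mnc S + mnc T + e)" unfolding finite_net_def
  proof (intro exI[of _ "(\<lambda>(g, h) x. g x + h x) ` (F \<times> G)"] conjI ballI impI)
    show "finite ((\<lambda>(g, h) x. g x + h x) ` (F \<times> G))" using F G by simp
    show "(\<lambda>(g, h) x. g x + h x) ` (F \<times> G) \<subseteq> L" using F(2) G(2) by (auto intro!: add_mem)
    fix f assume f: "f \<in> L" "N f \<le> 1"
    obtain g h where g: "g \<in> F" "N (\<lambda>x. S f x - g x) \<le> mnc S + e / 2" and h: "h \<in> G" "N (\<lambda>x. T f x - h x) \<le> mnc T + e / 2"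
      using F(3)[OF f] G(3)[OF f] by blast
    have gh: "g \<in> L" "h \<in> L" using g h F(2) G(2) by auto
    have "N (\<lambda>x. (S f x - g x) + (T f x - h x)) \<le> N (\<lambda>x. S f x - g x) + N (\<lambda>x. T f x - h x)"
      by (rule norm_triangle[OF diff_mem[OF bounded_mem[OF S f(1)] gh(1)] diff_mem[OF bounded_mem[OF T f(1)] gh(2)]])
    also have "\<dots> \<le> mnc S + mnc T + e" using g h by simp
    finally have "N (\<lambda>x. S f x + T f x - (g x + h x)) \<le> mnc S + mnc T + e" by (simp add: algebra_simps)
    then show "\<exists>g\<in>(\<lambda>(g, h) x. g x + h x) ` (F \<times> G). N (\<lambda>x. S f x + T f x - g x) \<le> mnc S + mnc T + e"
      using g h by (intro bexI[of _ "\<lambda>x. g x + h x"]) (auto intro!: image_eqI[of _ _ "(g, h)"])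
  qed
qed

lemma mnc_scale: assumes S: "bounded_operator M L N S" shows "mnc (\<lambda>f x. c * S f x) \<le> cmod c * mnc S"
proof (rule mnc_leI)
  show "0 \<le> cmod c * mnc S" using mnc_nonneg[OF S] by simp
  fix e :: real assume e: "0 < e"
  define e' where "e' = e / (cmod c + 1)"
  have e': "0 < e'" using e by (simp add: e'_def add_nonneg_pos)
  have "cmod c * e' \<le> (cmod c + 1) * e'" using e' by (intro mult_right_mono) auto
  also have "\<dots> = e" using norm_ge_zero[of c] by (simp add: e'_def add_nonneg_eq_0_iff)
  finally have ce: "cmod c * e' \<le> e" .
  obtain F where F: "finite F" "F \<subseteq> L" "\<And>f. f \<in> L \<Longrightarrow> N f \<le> 1 \<Longrightarrow> \<exists>g\<in>F. N (\<lambda>x. S f x - g x) \<le> mnc S + e'"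
    using mnc_net[OF S, of "mnc S + e'"] e' unfolding finite_net_def by auto
  show "finite_net (\<lambda>f x. c * S f x) (cmod c * mnc S + e)" unfolding finite_net_def
  proof (intro exI[of _ "(\<lambda>g x. c * g x) ` F"] conjI ballI impI)
    show "(\<lambda>g x. c * g x) ` F \<subseteq> L" using F(2) by (auto intro!: scale_mem)
    fix f assume f: "f \<in> L" "N f \<le> 1"
    obtain g where g: "g \<in> F" "N (\<lambda>x. S f x - g x) \<le> mnc S + e'" using F(3)[OF f] by blast
    have gL: "g \<in> L" using g F(2) by auto
    have "N (\<lambda>x. c * S f x - c * g x) = cmod c * N (\<lambda>x. S f x - g x)"
      using norm_scale[OF diff_mem[OF bounded_mem[OF S f(1)] gL], of c] by (simp add: right_diff_distrib)
    also have "\<dots> \<le> cmod c * (mnc S + e')" using g by (intro mult_left_mono) auto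
    also have "\<dots> \<le> cmod c * mnc S + e" using ce by (simp add: distrib_left)
    finally show "\<exists>g\<in>(\<lambda>g x. c * g x) ` F. N (\<lambda>x. c * S f x - g x) \<le> cmod c * mnc S + e"
      using g(1) by (intro bexI[of _ "\<lambda>x. c * g x"]) auto
  qed (use F in auto)
qed

text \<open>The error \<open>T f - g\<close> at a net point, divided by \<open>mnc T + e\<close>,
  lies in the unit ball, where the net of \<open>S\<close> applies; the net of
  \<open>S \<circ> T\<close> consists of the \<open>S g + (mnc T + e) h\<close>. The summand
  \<open>e\<close> keeps the divisor positive.\<close>

lemma mnc_comp: assumes S: "bounded_operator M L N S" and T: "bounded_operator M L N T"
  shows "mnc (S \<circ> T) \<le> mnc S * mnc T"
proof -
  have le: "mnc (S \<circ> T) \<le> (mnc S + e) * (mnc T + e)" if e: "0 < e" for e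
  proof (rule mnc_le)
    let ?s = "mnc S + e" and ?t = "mnc T + e"
    have pos: "0 < ?s" "0 < ?t" using mnc_nonneg[OF S] mnc_nonneg[OF T] e by auto
    then show "0 < ?s * ?t" by simp
    obtain F where F: "finite F" "F \<subseteq> L" "\<And>f. f \<in> L \<Longrightarrow> N f \<le> 1 \<Longrightarrow> \<exists>g\<in>F. N (\<lambda>x. T f x - g x) \<le> ?t"
      using mnc_net[OF T, of ?t] e unfolding finite_net_def by auto
    obtain G where G: "finite G" "G \<subseteq> L" "\<And>f. f \<in> L \<Longrightarrow> N f \<le> 1 \<Longrightarrow> \<exists>g\<in>G. N (\<lambda>x. S f x - g x) \<le> ?s"
      using mnc_net[OF S, of ?s] e unfolding finite_net_def by auto
    let ?h = "\<lambda>(g, h) x. S g x + of_real ?t * h x"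
    show "finite_net (S \<circ> T) (?s * ?t)" unfolding finite_net_def
    proof (intro exI[of _ "?h ` (F \<times> G)"] conjI ballI impI)
      show "finite (?h ` (F \<times> G))" using F G by simp
      show "?h ` (F \<times> G) \<subseteq> L"
      proof (clarsimp, intro add_mem)
        fix g h assume "g \<in> F" "h \<in> G"
        then have gh: "g \<in> L" "h \<in> L" using F(2) G(2) by auto
        show "S g \<in> L" by (rule bounded_mem[OF S gh(1)])
        show "(\<lambda>x. (of_real (mnc T) + of_real e) * h x) \<in> L" by (rule scale_mem[OF gh(2)])
      qed
      fix f assume f: "f \<in> L" "N f \<le> 1"
      obtain g where g: "g \<in> F" "N (\<lambda>x. T f x - g x) \<le> ?t" using F(3)[OF f] by blast
      have gL: "g \<in> L" using g F(2) by auto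
      note Tf = bounded_mem[OF T f(1)] note d = diff_mem[OF Tf gL]
      let ?k = "\<lambda>x. of_real (1 / ?t) * (T f x - g x)"
      have k: "?k \<in> L" by (rule scale_mem[OF d])
      have "N ?k = 1 / ?t * N (\<lambda>x. T f x - g x)" using norm_scale[OF d, of "of_real (1 / ?t)"] pos by (simp only: norm_of_real) simp
      also have "\<dots> \<le> 1" using g pos by simp
      finally obtain h where h: "h \<in> G" "N (\<lambda>x. S ?k x - h x) \<le> ?s" using G(3)[OF k] by blast
      have hL: "h \<in> L" using h G(2) by auto
      have "AE x in M. S ?k x = of_real (1 / ?t) * S (\<lambda>x. T f x - g x) x" by (rule linear_scale[OF bounded_linear'[OF S] d])
      with linear_diff[OF bounded_linear'[OF S] Tf gL]
      have "AE x in M. (S \<circ> T) f x - ?h (g, h) x = of_real ?t * (S ?k x - h x)"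
      proof eventually_elim
        case (elim x)
        have t: "complex_of_real ?t * of_real (1 / ?t) = 1" using pos by (simp only: of_real_mult[symmetric]) simp
        have "of_real ?t * (S ?k x - h x) = (complex_of_real ?t * of_real (1 / ?t)) * (S (T f) x - S g x) - of_real ?t * h x"
          unfolding elim(2) elim(1) by (simp only: right_diff_distrib mult.assoc)
        then show ?case unfolding t by (simp add: algebra_simps)
      qed
      then have "N (\<lambda>x. (S \<circ> T) f x - ?h (g, h) x) = N (\<lambda>x. of_real ?t * (S ?k x - h x))"
      proof (rule N_cong[rotated 2])
        show "(\<lambda>x. (S \<circ> T) f x - ?h (g, h) x) \<in> L"
          using diff_mem[OF bounded_mem[OF S Tf] add_mem[OF bounded_mem[OF S gL] scale_mem[OF hL, of "of_real ?t"]]] by simp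
        show "(\<lambda>x. of_real ?t * (S ?k x - h x)) \<in> L" by (rule scale_mem[OF diff_mem[OF bounded_mem[OF S k] hL]])
      qed
      also have "\<dots> = ?t * N (\<lambda>x. S ?k x - h x)"
        using norm_scale[OF diff_mem[OF bounded_mem[OF S k] hL], of "of_real ?t"] pos by (simp only: norm_of_real abs_of_pos)
      also have "\<dots> \<le> ?t * ?s" using h pos by (intro mult_left_mono) auto
      finally show "\<exists>g\<in>?h ` (F \<times> G). N (\<lambda>x. (S \<circ> T) f x - g x) \<le> ?s * ?t"
        using g h by (intro bexI[of _ "?h (g, h)"]) (auto simp: mult.commute)
    qed
  qed
  show ?thesis
  proof (rule tendsto_lowerbound)
    have "((\<lambda>e. (mnc S + e) * (mnc T + e)) \<longlongrightarrow> (mnc S + 0) * (mnc T + 0)) (at_right 0)" by (intro tendsto_intros)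
    then show "((\<lambda>e. (mnc S + e) * (mnc T + e)) \<longlongrightarrow> mnc S * mnc T) (at_right 0)" by simp
    show "\<forall>\<^sub>F e in at_right 0. mnc (S \<circ> T) \<le> (mnc S + e) * (mnc T + e)"
      using eventually_at_right_less[of 0] by eventually_elim (rule le)
  qed simp
qed

text \<open>Without a finite net of size \<open>e\<close> the image of the unit ball contains a
  sequence separated by \<open>e\<close>, which has no convergent subsequence.\<close>

lemma mnc_compact: assumes K: "compact_op M L N K" shows "mnc K = 0"
proof -
  have Kb: "bounded_operator M L N K" using K by (simp add: compact_op_def)
  have "finite_net K e" if e: "0 < e" for e
  proof (rule ccontr)
    assume no: "\<not> finite_net K e"
    define B where "B = {f \<in> L. N f \<le> 1}"
    have ex: "\<exists>f\<in>B. \<forall>h\<in>F. e < N (\<lambda>x. K f x - K h x)" if "finite F" "F \<subseteq> B" for F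
    proof -
      have "finite (K ` F)" "K ` F \<subseteq> L" using that bounded_mem[OF Kb] by (auto simp: B_def)
      then have "\<not> (\<forall>f\<in>L. N f \<le> 1 \<longrightarrow> (\<exists>g\<in>K ` F. N (\<lambda>x. K f x - g x) \<le> e))"
        using no unfolding finite_net_def by blast
      then show ?thesis by (auto simp: B_def not_le)
    qed
    \<comment> \<open>The state of the recursion is the set \<open>F\<close> of earlier points
      together with a new point \<open>f\<close> whose image is separated from theirs.\<close>
    define P where "P = (\<lambda>(n::nat) (F, f). finite F \<and> F \<subseteq> B \<and> f \<in> B \<and> (\<forall>h\<in>F. e < N (\<lambda>x. K f x - K h x)))"
    define Q where "Q = (\<lambda>(n::nat) (F :: 'a cfun set, f) (F', f' :: 'a cfun). F' = insert f F)"
    have "\<exists>s. \<forall>n. P n (s n) \<and> Q n (s n) (s (Suc n))"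
    proof (rule dependent_nat_choice)
      show "\<exists>x. P 0 x" using zero_mem by (intro exI[of _ "({}, \<lambda>_. 0)"]) (auto simp: P_def B_def)
      fix x n assume x: "P n x"
      obtain F f where xf: "x = (F, f)" by (cases x)
      obtain f' where "f' \<in> B" "\<forall>h\<in>insert f F. e < N (\<lambda>x. K f' x - K h x)"
        using ex[of "insert f F"] x unfolding xf P_def by auto
      then show "\<exists>y. P (Suc n) y \<and> Q n x y" using x unfolding xf P_def Q_def by (intro exI[of _ "(insert f F, f')"]) auto
    qed
    then obtain s where s: "\<And>n. P n (s n)" "\<And>n. Q n (s n) (s (Suc n))" by blast
    define u where "u n = snd (s n)" for n
    have sub: "u m \<in> fst (s n)" if "m < n" for m n
      using that
    proof (induction n)
      case (Suc n)
      have "fst (s (Suc n)) = insert (u n) (fst (s n))" using s(2)[of n] by (auto simp: Q_def u_def split: prod.splits)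
      then show ?case using Suc by (auto simp: less_Suc_eq)
    qed simp
    have u: "u n \<in> L" "N (u n) \<le> 1" for n using s(1)[of n] by (auto simp: P_def u_def B_def split: prod.splits)
    have sep: "e < N (\<lambda>x. K (u n) x - K (u m) x)" if "m < n" for m n
      using s(1)[of n] sub[OF that] by (auto simp: P_def u_def split: prod.splits)
    obtain t g where t: "strict_mono t" "g \<in> L" "(\<lambda>n. N (\<lambda>x. K (u (t n)) x - g x)) \<longlonglongrightarrow> 0"
      using K u unfolding compact_op_def by blast
    have "\<forall>\<^sub>F n in sequentially. N (\<lambda>x. K (u (t n)) x - g x) < e / 2" using t(3) by (rule order_tendstoD) (use e in simp)
    then obtain n where n: "N (\<lambda>x. K (u (t n)) x - g x) < e / 2" "N (\<lambda>x. K (u (t (Suc n))) x - g x) < e / 2"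
      unfolding eventually_sequentially by (meson le_SucI order_refl)
    have Ku: "K (u m) \<in> L" for m by (rule bounded_mem[OF Kb u(1)])
    have "e < N (\<lambda>x. K (u (t (Suc n))) x - K (u (t n)) x)" using t(1) by (intro sep) (simp add: strict_mono_def)
    also have "\<dots> \<le> N (\<lambda>x. K (u (t (Suc n))) x - g x) + N (\<lambda>x. g x - K (u (t n)) x)" by (rule norm_triangle_trans[OF Ku t(2) Ku])
    also have "\<dots> < e" using n norm_diff_commute[OF t(2) Ku, of "t n"] by simp
    finally show False .
  qed
  then have "mnc K \<le> 0" by (intro mnc_leI) auto
  then show ?thesis using mnc_nonneg[OF Kb] by simp
qed

text \<open>Pigeonhole on a finite net of size \<open>1 / (n + 1)\<close> at stage \<open>n\<close>,
  followed by a diagonal subsequence, which is Cauchy.\<close>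

lemma compact_of_mnc_zero: assumes K: "bounded_operator M L N K" and "mnc K \<le> 0" shows "compact_op M L N K"
  unfolding compact_op_def
proof (intro conjI K allI impI)
  fix u :: "nat \<Rightarrow> 'a cfun" assume u: "\<forall>n. u n \<in> L \<and> N (u n) \<le> 1"
  note Ku = bounded_mem[OF K, of "u _"]
  have Ku: "K (u n) \<in> L" for n using bounded_mem[OF K] u by blast
  \<comment> \<open>Stated for all pairs of indices, so that it passes to subsequences as the
    diagonal construction requires.\<close>
  define P where "P n s \<longleftrightarrow> (\<forall>i j. N (\<lambda>x. K (u (s i)) x - K (u (s j)) x) \<le> 2 / real (Suc n))" for n and s :: "nat \<Rightarrow> nat"
  interpret subseqs P
  proof
    fix n and s :: "nat \<Rightarrow> nat" assume "strict_mono s"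
    obtain F where F: "finite F" "F \<subseteq> L" "\<And>f. f \<in> L \<Longrightarrow> N f \<le> 1 \<Longrightarrow> \<exists>g\<in>F. N (\<lambda>x. K f x - g x) \<le> 1 / real (Suc n)"
      using mnc_net[OF K, of "1 / real (Suc n)"] assms(2) unfolding finite_net_def by (auto simp: order.strict_trans1)
    have "\<exists>g\<in>F. infinite {i\<in>UNIV. N (\<lambda>x. K (u (s i)) x - g x) \<le> 1 / real (Suc n)}"
      using F(1,3) u by (intro pigeonhole_infinite_rel) auto
    then obtain g where g: "g \<in> F" "infinite {i. N (\<lambda>x. K (u (s i)) x - g x) \<le> 1 / real (Suc n)}" by auto
    have gL: "g \<in> L" using g F(2) by auto
    let ?r = "enumerate {i. N (\<lambda>x. K (u (s i)) x - g x) \<le> 1 / real (Suc n)}"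
    have r: "strict_mono ?r" using g(2) by (rule strict_mono_enumerate)
    have r': "N (\<lambda>x. K (u (s (?r i))) x - g x) \<le> 1 / real (Suc n)" for i using enumerate_in_set[OF g(2), of i] by simp
    have "P n (s \<circ> ?r)" unfolding P_def
    proof (intro allI)
      fix i j
      have "N (\<lambda>x. K (u ((s \<circ> ?r) i)) x - K (u ((s \<circ> ?r) j)) x)
          \<le> N (\<lambda>x. K (u (s (?r i))) x - g x) + N (\<lambda>x. g x - K (u (s (?r j))) x)"
        using norm_triangle_trans[OF Ku gL Ku] by simp
      then show "N (\<lambda>x. K (u ((s \<circ> ?r) i)) x - K (u ((s \<circ> ?r) j)) x) \<le> 2 / real (Suc n)"
        using r'[of i] r'[of j] norm_diff_commute[OF gL Ku, of "s (?r j)"] by simp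
    qed
    with r show "\<exists>r'. strict_mono r' \<and> P n (s \<circ> r')" by blast
  qed
  have d: "P k (diagseq \<circ> (+) (Suc k))" for k by (rule diagseq_holds) (auto simp: P_def)
  have "\<exists>g\<in>L. (\<lambda>n. N (\<lambda>x. K (u (diagseq n)) x - g x)) \<longlonglongrightarrow> 0"
  proof (rule complete[OF Ku])
    fix e :: real assume "0 < e"
    then obtain k where k: "2 / e < real (Suc k)" using reals_Archimedean2 by (metis less_SucI less_trans of_nat_less_iff lessI)
    then have k': "2 / real (Suc k) < e" using \<open>0 < e\<close> by (simp add: field_simps)
    show "\<exists>n0. \<forall>m\<ge>n0. \<forall>n\<ge>n0. N (\<lambda>x. K (u (diagseq m)) x - K (u (diagseq n)) x) < e"
    proof (intro exI[of _ "Suc k"] allI impI)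
      fix m n assume "Suc k \<le> m" "Suc k \<le> n"
      then obtain i j where ij: "m = Suc k + i" "n = Suc k + j" using le_Suc_ex by metis
      have "N (\<lambda>x. K (u (diagseq m)) x - K (u (diagseq n)) x) \<le> 2 / real (Suc k)"
        using d[of k] unfolding P_def ij by simp
      then show "N (\<lambda>x. K (u (diagseq m)) x - K (u (diagseq n)) x) < e" using k' by simp
    qed
  qed
  then show "\<exists>s g. strict_mono s \<and> g \<in> L \<and> (\<lambda>n. N (\<lambda>x. K (u (s n)) x - g x)) \<longlonglongrightarrow> 0"
    using subseq_diagseq by blast
qed

text \<open>
  The image of the unit ball lies in an order interval up to an error of norm \<open>\<delta>\<close>. For positive kernel
  operators and order continuous norms the best such \<open>\<delta>\<close> is the measure of noncompactness.
\<close>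

definition almost_order_bounded :: "'a cop \<Rightarrow> real \<Rightarrow> bool" where
  "almost_order_bounded A \<delta> \<longleftrightarrow> (\<exists>g\<in>Lp. \<forall>f\<in>L. N f \<le> 1 \<longrightarrow> N (cpx (\<lambda>x. max 0 (cmod (A f x) - g x))) \<le> \<delta>)"

lemma excess_Lp:
  assumes "f \<in> L" "g \<in> Lp" shows "(\<lambda>x. max 0 (cmod (f x) - g x)) \<in> Lp"
proof (rule Lp_le[OF cmod_Lp[OF assms(1)]])
  show "(\<lambda>x. max 0 (cmod (f x) - g x)) \<in> borel_measurable M" using measurable[OF assms(1)] LpD(1)[OF assms(2)] by measurable
qed (use LpD(2)[OF assms(2)] in auto)

text \<open>The sum of the moduli of the net points serves as \<open>g\<close>: if \<open>h\<close>
  is the net point near \<open>A f\<close>, the excess of \<open>|A f|\<close> above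
  \<open>g\<close> is at most \<open>|A f - h|\<close>.\<close>

lemma mnc_almost_order_bounded:
  assumes A: "bounded_operator M L N A" and "mnc A < \<delta>" shows "almost_order_bounded A \<delta>"
proof -
  obtain F where F: "finite F" "F \<subseteq> L" "\<And>f. f \<in> L \<Longrightarrow> N f \<le> 1 \<Longrightarrow> \<exists>g\<in>F. N (\<lambda>x. A f x - g x) \<le> \<delta>"
    using mnc_net[OF assms] unfolding finite_net_def by auto
  let ?g = "\<lambda>x. \<Sum>h\<in>F. cmod (h x)"
  have g: "?g \<in> Lp" using F(2) by (intro Lp_sum cmod_Lp) auto
  show ?thesis unfolding almost_order_bounded_def
  proof (intro bexI[of _ ?g] ballI impI g)
    fix f assume f: "f \<in> L" "N f \<le> 1"
    note Af = bounded_mem[OF A f(1)]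
    obtain h where h: "h \<in> F" "N (\<lambda>x. A f x - h x) \<le> \<delta>" using F(3)[OF f] by blast
    have hL: "h \<in> L" using h F(2) by auto
    have "N (cpx (\<lambda>x. max 0 (cmod (A f x) - ?g x))) \<le> N (\<lambda>x. A f x - h x)"
    proof (rule norm_mono[OF diff_mem[OF Af hL]])
      show "cpx (\<lambda>x. max 0 (cmod (A f x) - ?g x)) \<in> borel_measurable M"
        by (rule measurable[OF LpD(3)[OF excess_Lp[OF Af g]]])
      have "max 0 (cmod (A f x) - ?g x) \<le> cmod (A f x - h x)" for x
      proof -
        have "cmod (h x) \<le> ?g x" using F(1) h(1) by (intro member_le_sum) auto
        then show ?thesis using norm_triangle_ineq2[of "A f x" "h x"] by simp
      qed
      then show "AE x in M. cmod (complex_of_real (max 0 (cmod (A f x) - ?g x))) \<le> cmod (A f x - h x)"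
        by (simp only: norm_of_real) simp
    qed
    with h show "N (cpx (\<lambda>x. max 0 (cmod (A f x) - ?g x))) \<le> \<delta>" by simp
  qed
qed

lemma almost_order_bounded_nonneg:
  assumes A: "bounded_operator M L N A" and "almost_order_bounded A \<delta>" shows "0 \<le> \<delta>"
proof -
  obtain g where g: "g \<in> Lp" "\<And>f. f \<in> L \<Longrightarrow> N f \<le> 1 \<Longrightarrow> N (cpx (\<lambda>x. max 0 (cmod (A f x) - g x))) \<le> \<delta>"
    using assms(2) unfolding almost_order_bounded_def by blast
  have "0 \<le> N (cpx (\<lambda>x. max 0 (cmod (A (\<lambda>_. 0) x) - g x)))"
    by (rule norm_nonneg[OF LpD(3)[OF excess_Lp[OF bounded_mem[OF A zero_mem] g(1)]]])
  then show ?thesis using g(2)[OF zero_mem] by simp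
qed

text \<open>The excess of a modulus above \<open>g\<close> grows with the modulus, and
  \<open>f\<close> may be replaced by \<open>|f|\<close>. This is the monotonicity that finite nets
  do not show.\<close>

lemma almost_order_bounded_mono:
  assumes S: "S \<in> kernel_ops" and T: "T \<in> kernel_ops"
    and le: "\<And>f. f \<in> Lp \<Longrightarrow> AE x in M. cmod (S (cpx f) x) \<le> cmod (T (cpx f) x)"
    and ob: "almost_order_bounded T \<delta>"
  shows "almost_order_bounded S \<delta>"
proof -
  obtain g where g: "g \<in> Lp" "\<And>f. f \<in> L \<Longrightarrow> N f \<le> 1 \<Longrightarrow> N (cpx (\<lambda>x. max 0 (cmod (T f x) - g x))) \<le> \<delta>"
    using ob unfolding almost_order_bounded_def by blast
  have "N (cpx (\<lambda>x. max 0 (cmod (S f x) - g x))) \<le> \<delta>" if f: "f \<in> L" "N f \<le> 1" for f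
  proof -
    let ?f = "cpx (\<lambda>x. cmod (f x))"
    have "N (cpx (\<lambda>x. max 0 (cmod (S f x) - g x))) \<le> N (cpx (\<lambda>x. max 0 (cmod (T ?f x) - g x)))"
    proof (rule Lp_norm_mono[OF excess_Lp[OF kernel_mem[OF T cmod_mem[OF f(1)]] g(1)] LpD(1)[OF excess_Lp[OF kernel_mem[OF S f(1)] g(1)]]])
      show "AE x in M. \<bar>max 0 (cmod (S f x) - g x)\<bar> \<le> max 0 (cmod (T ?f x) - g x)"
        using kernel_cmod_le[OF S f(1)] le[OF cmod_Lp[OF f(1)]] by eventually_elim auto
    qed
    also have "\<dots> \<le> \<delta>" using g(2)[OF cmod_mem[OF f(1)]] norm_cmod[OF f(1)] f(2) by simp
    finally show ?thesis .
  qed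
  then show ?thesis unfolding almost_order_bounded_def by (intro bexI[OF _ g(1)] ballI impI)
qed

text \<open>If \<open>g\<close> and \<open>h\<close> bound the intervals for \<open>P\<close> and
  \<open>Q\<close>, then \<open>t / 2 * g + 1 / (2 * t) * h\<close> works for \<open>D\<close>,
  since \<open>geo_dominated_le\<close> bounds \<open>|D f|\<close> by the same combination and the
  excess is subadditive.\<close>

lemma almost_order_bounded_mean:
  assumes G: "geo_dominated D P Q" and K: "D \<in> kernel_ops" "P \<in> kernel_ops" "Q \<in> kernel_ops"
    and P: "almost_order_bounded P a" and Q: "almost_order_bounded Q b" and t: "0 < t"
  shows "almost_order_bounded D ((t * a + b / t) / 2)"
proof -
  obtain g where g: "g \<in> Lp" "\<And>f. f \<in> L \<Longrightarrow> N f \<le> 1 \<Longrightarrow> N (cpx (\<lambda>x. max 0 (cmod (P f x) - g x))) \<le> a"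
    using P unfolding almost_order_bounded_def by blast
  obtain h where h: "h \<in> Lp" "\<And>f. f \<in> L \<Longrightarrow> N f \<le> 1 \<Longrightarrow> N (cpx (\<lambda>x. max 0 (cmod (Q f x) - h x))) \<le> b"
    using Q unfolding almost_order_bounded_def by blast
  let ?k = "\<lambda>x. t / 2 * g x + 1 / (2 * t) * h x"
  have k: "?k \<in> Lp" using t g h by (intro Lp_add Lp_scale) auto
  have "N (cpx (\<lambda>x. max 0 (cmod (D f x) - ?k x))) \<le> (t * a + b / t) / 2" if f: "f \<in> L" "N f \<le> 1" for f
  proof -
    let ?f = "cpx (\<lambda>x. cmod (f x))"
    have nf: "?f \<in> L" "N ?f \<le> 1" using cmod_mem[OF f(1)] norm_cmod[OF f(1)] f(2) by auto
    let ?p = "\<lambda>x. max 0 (cmod (P ?f x) - g x)" and ?q = "\<lambda>x. max 0 (cmod (Q ?f x) - h x)"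
    have p: "?p \<in> Lp" "?q \<in> Lp"
      by (rule excess_Lp[OF kernel_mem[OF K(2) nf(1)] g(1)], rule excess_Lp[OF kernel_mem[OF K(3) nf(1)] h(1)])
    have tp: "(\<lambda>x. t / 2 * ?p x) \<in> Lp" "(\<lambda>x. 1 / (2 * t) * ?q x) \<in> Lp" using t by (intro Lp_scale p; simp)+
    have "N (cpx (\<lambda>x. max 0 (cmod (D f x) - ?k x))) \<le> N (cpx (\<lambda>x. t / 2 * ?p x + 1 / (2 * t) * ?q x))"
    proof (rule Lp_norm_mono[OF Lp_add[OF tp] LpD(1)[OF excess_Lp[OF kernel_mem[OF K(1) f(1)] k]]])
      show "AE x in M. \<bar>max 0 (cmod (D f x) - ?k x)\<bar> \<le> t / 2 * ?p x + 1 / (2 * t) * ?q x"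
        using geo_dominated_le[OF G K f(1) t]
      proof eventually_elim
        case (elim x)
        have "t / 2 * (cmod (P ?f x) - g x) \<le> t / 2 * ?p x" "1 / (2 * t) * (cmod (Q ?f x) - h x) \<le> 1 / (2 * t) * ?q x"
          using t by (intro mult_left_mono; simp)+
        moreover have "0 \<le> t / 2 * ?p x" "0 \<le> 1 / (2 * t) * ?q x" using t by auto
        moreover have "(t * cmod (P ?f x) + cmod (Q ?f x) / t) / 2 = t / 2 * cmod (P ?f x) + 1 / (2 * t) * cmod (Q ?f x)"
          using t by (simp add: field_simps)
        ultimately show ?case using elim unfolding right_diff_distrib by linarith
      qed
    qed
    also have "\<dots> \<le> N (cpx (\<lambda>x. t / 2 * ?p x)) + N (cpx (\<lambda>x. 1 / (2 * t) * ?q x))"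
      using norm_triangle[OF LpD(3)[OF tp(1)] LpD(3)[OF tp(2)]] by simp
    also have "\<dots> = t / 2 * N (cpx ?p) + 1 / (2 * t) * N (cpx ?q)"
    proof -
      have "N (cpx (\<lambda>x. c * e x)) = c * N (cpx e)" if "e \<in> Lp" "0 \<le> c" for c e
        using norm_scale[OF LpD(3)[OF that(1)], of "of_real c"] that(2) by simp
      from this[OF p(1), of "t / 2"] this[OF p(2), of "1 / (2 * t)"] show ?thesis using t by (simp only:) simp
    qed
    also have "\<dots> \<le> t / 2 * a + 1 / (2 * t) * b"
      using g(2)[OF nf] h(2)[OF nf] t by (intro add_mono mult_left_mono) auto
    finally show ?thesis using t by (simp add: field_simps)
  qed
  then show ?thesis unfolding almost_order_bounded_def by (intro bexI[OF _ k] ballI impI)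
qed

section \<open>Total boundedness of integrable kernels\<close>

definition unit_functions :: "'a cfun set" where
  "unit_functions = {\<theta> \<in> borel_measurable M. \<forall>x. cmod (\<theta> x) \<le> 1}"

text \<open>The \<open>L\<^sup>1\<close> norm of the image of \<open>\<theta> - \<theta>'\<close>
  under the integral operator with kernel \<open>h\<close>.\<close>

definition kernel_dist :: "('a \<times> 'a \<Rightarrow> real) \<Rightarrow> 'a cfun \<Rightarrow> 'a cfun \<Rightarrow> real" where
  "kernel_dist h \<theta> \<theta>' = (\<integral>x. cmod (\<integral>y. of_real (h (x, y)) * (\<theta> y - \<theta>' y) \<partial>M) \<partial>M)"

text \<open>Finite covers by sets of small diameter are used instead of finite nets: the covers for
  two kernels combine by intersection, and no centres have to be chosen.\<close>

definition kernel_totally_bounded :: "('a \<times> 'a \<Rightarrow> real) \<Rightarrow> bool" where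
  "kernel_totally_bounded h \<longleftrightarrow> (\<forall>e>0. \<exists>T. finite T \<and> unit_functions \<subseteq> \<Union>T \<and>
     (\<forall>S\<in>T. \<forall>\<theta>\<in>S \<inter> unit_functions. \<forall>\<theta>'\<in>S \<inter> unit_functions. kernel_dist h \<theta> \<theta>' \<le> e))"

lemma kernel_dist_integrable:
  assumes h: "integrable (M \<Otimes>\<^sub>M M) h" and t: "\<theta> \<in> unit_functions" "\<theta>' \<in> unit_functions"
  shows "AE x in M. integrable M (\<lambda>y. of_real (h (x, y)) * (\<theta> y - \<theta>' y))"
    and "integrable M (\<lambda>x. cmod (\<integral>y. of_real (h (x, y)) * (\<theta> y - \<theta>' y) \<partial>M))"
proof -
  have [measurable]: "\<theta> \<in> borel_measurable M" "\<theta>' \<in> borel_measurable M" "h \<in> borel_measurable (M \<Otimes>\<^sub>M M)"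
    using t h by (auto simp: unit_functions_def)
  have b: "cmod (\<theta> y - \<theta>' y) \<le> 2" for y
    using norm_triangle_ineq4[of "\<theta> y" "\<theta>' y"] t by (auto simp: unit_functions_def) (smt (verit))
  have i: "integrable (M \<Otimes>\<^sub>M M) (\<lambda>p. of_real (h p) * (\<theta> (snd p) - \<theta>' (snd p)))"
  proof (rule Bochner_Integration.integrable_bound)
    show "integrable (M \<Otimes>\<^sub>M M) (\<lambda>p. h p * 2)" using h by simp
    show "AE p in M \<Otimes>\<^sub>M M. norm (of_real (h p) * (\<theta> (snd p) - \<theta>' (snd p))) \<le> norm (h p * 2)"
      using b by (auto simp: norm_mult abs_mult intro!: mult_left_mono)
  qed measurable
  show "AE x in M. integrable M (\<lambda>y. of_real (h (x, y)) * (\<theta> y - \<theta>' y))" using pair.AE_integrable_fst'[OF i] by simp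
  show "integrable M (\<lambda>x. cmod (\<integral>y. of_real (h (x, y)) * (\<theta> y - \<theta>' y) \<partial>M))"
    using integrable_norm[OF pair.integrable_fst'[OF i]] by simp
qed

lemma kernel_dist_add:
  assumes f: "integrable (M \<Otimes>\<^sub>M M) f" and g: "integrable (M \<Otimes>\<^sub>M M) g" and t: "\<theta> \<in> unit_functions" "\<theta>' \<in> unit_functions"
  shows "kernel_dist (\<lambda>p. f p + g p) \<theta> \<theta>' \<le> kernel_dist f \<theta> \<theta>' + kernel_dist g \<theta> \<theta>'"
proof -
  have "kernel_dist (\<lambda>p. f p + g p) \<theta> \<theta>' \<le> (\<integral>x. cmod (\<integral>y. of_real (f (x, y)) * (\<theta> y - \<theta>' y) \<partial>M) + cmod (\<integral>y. of_real (g (x, y)) * (\<theta> y - \<theta>' y) \<partial>M) \<partial>M)"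
    unfolding kernel_dist_def
  proof (rule integral_mono_AE)
    show "integrable M (\<lambda>x. cmod (\<integral>y. of_real (f (x, y) + g (x, y)) * (\<theta> y - \<theta>' y) \<partial>M))"
      using kernel_dist_integrable(2)[OF Bochner_Integration.integrable_add[OF f g] t] .
    show "AE x in M. cmod (\<integral>y. of_real (f (x, y) + g (x, y)) * (\<theta> y - \<theta>' y) \<partial>M)
       \<le> cmod (\<integral>y. of_real (f (x, y)) * (\<theta> y - \<theta>' y) \<partial>M) + cmod (\<integral>y. of_real (g (x, y)) * (\<theta> y - \<theta>' y) \<partial>M)"
      using kernel_dist_integrable(1)[OF f t] kernel_dist_integrable(1)[OF g t]
    proof eventually_elim
      case (elim x)
      have "(\<integral>y. of_real (f (x, y) + g (x, y)) * (\<theta> y - \<theta>' y) \<partial>M) = (\<integral>y. of_real (f (x, y)) * (\<theta> y - \<theta>' y) \<partial>M) + (\<integral>y. of_real (g (x, y)) * (\<theta> y - \<theta>' y) \<partial>M)"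
        unfolding Bochner_Integration.integral_add[OF elim, symmetric] by (simp add: distrib_right)
      then show ?case using norm_triangle_ineq by simp
    qed
  qed (use kernel_dist_integrable(2)[OF f t] kernel_dist_integrable(2)[OF g t] in auto)
  also have "\<dots> = kernel_dist f \<theta> \<theta>' + kernel_dist g \<theta> \<theta>'" unfolding kernel_dist_def
    by (rule Bochner_Integration.integral_add[OF kernel_dist_integrable(2)[OF f t] kernel_dist_integrable(2)[OF g t]])
  finally show ?thesis .
qed

text \<open>With \<open>kernel_dist_add\<close> this gives continuity of the distance in the kernel
  for the \<open>L\<^sup>1\<close> norm, uniformly over unit functions.\<close>

lemma kernel_dist_le:
  assumes f: "integrable (M \<Otimes>\<^sub>M M) f" and t: "\<theta> \<in> unit_functions" "\<theta>' \<in> unit_functions"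
  shows "kernel_dist f \<theta> \<theta>' \<le> 2 * (\<integral>p. \<bar>f p\<bar> \<partial>(M \<Otimes>\<^sub>M M))"
proof -
  have [measurable]: "\<theta> \<in> borel_measurable M" "\<theta>' \<in> borel_measurable M" using t by (auto simp: unit_functions_def)
  have b: "cmod (\<theta> y - \<theta>' y) \<le> 2" for y
    using norm_triangle_ineq4[of "\<theta> y" "\<theta>' y"] t by (auto simp: unit_functions_def) (smt (verit))
  have i: "integrable (M \<Otimes>\<^sub>M M) (\<lambda>p. \<bar>f p\<bar> * 2)" using f by simp
  have "kernel_dist f \<theta> \<theta>' \<le> (\<integral>x. \<integral>y. \<bar>f (x, y)\<bar> * 2 \<partial>M \<partial>M)" unfolding kernel_dist_def
  proof (rule integral_mono_AE[OF kernel_dist_integrable(2)[OF f t]])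
    show "integrable M (\<lambda>x. \<integral>y. \<bar>f (x, y)\<bar> * 2 \<partial>M)" using pair.integrable_fst'[OF i] .
    show "AE x in M. cmod (\<integral>y. of_real (f (x, y)) * (\<theta> y - \<theta>' y) \<partial>M) \<le> (\<integral>y. \<bar>f (x, y)\<bar> * 2 \<partial>M)"
      using kernel_dist_integrable(1)[OF f t] pair.AE_integrable_fst'[OF i]
    proof eventually_elim
      case (elim x)
      have "cmod (\<integral>y. of_real (f (x, y)) * (\<theta> y - \<theta>' y) \<partial>M) \<le> (\<integral>y. cmod (of_real (f (x, y)) * (\<theta> y - \<theta>' y)) \<partial>M)"
        by (rule integral_norm_bound)
      also have "\<dots> \<le> (\<integral>y. \<bar>f (x, y)\<bar> * 2 \<partial>M)"
      proof (rule integral_mono[OF integrable_norm[OF elim(1)] elim(2)])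
        show "cmod (of_real (f (x, y)) * (\<theta> y - \<theta>' y)) \<le> \<bar>f (x, y)\<bar> * 2" for y using b[of y] by (simp add: norm_mult mult_left_mono)
      qed
      finally show ?case .
    qed
  qed
  also have "\<dots> = (\<integral>p. \<bar>f p\<bar> * 2 \<partial>(M \<Otimes>\<^sub>M M))" using pair.integral_fst'[OF i] by simp
  finally show ?thesis by simp
qed

text \<open>Kernels of finite rank are totally bounded, and \<open>kernel_totally_bounded\<close> is a closed condition in \<open>L\<^sup>1\<close>.\<close>

lemma integrable_kernel_totally_bounded:
  assumes "integrable (M \<Otimes>\<^sub>M M) h" shows "kernel_totally_bounded h"
  using assms
proof (induction rule: pair.L1_rectangle_induct)
  case (rectangle F E)
  show ?case unfolding kernel_totally_bounded_def
  proof (intro allI impI)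
    fix e :: real assume e: "0 < e"
    \<comment> \<open>The kernel \<open>indicator (F \<times> E)\<close> sees
      \<open>\<theta>\<close> only through the number \<open>I \<theta>\<close>, which lies in a
      compact disc; a finite cover of the disc is pulled back.\<close>
    define I where "I \<theta> = (\<integral>y. indicator E y *\<^sub>R \<theta> y \<partial>M)" for \<theta> :: "'a cfun"
    have Ei: "integrable M (indicator E :: 'a \<Rightarrow> real)" using rectangle by (intro integrable_real_indicator) auto
    have Iint: "integrable M (\<lambda>y. indicator E y *\<^sub>R \<theta> y)" if "\<theta> \<in> unit_functions" for \<theta>
    proof (rule Bochner_Integration.integrable_bound[OF Ei])
      show "AE y in M. norm (indicator E y *\<^sub>R \<theta> y) \<le> norm (indicator E y :: real)" using that by (auto simp: unit_functions_def indicator_def)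
    qed (use that rectangle in \<open>auto simp: unit_functions_def\<close>)
    have Ibd: "I \<theta> \<in> cball 0 (measure M E)" if "\<theta> \<in> unit_functions" for \<theta>
    proof -
      have "norm (I \<theta>) \<le> (\<integral>y. norm (indicator E y *\<^sub>R \<theta> y) \<partial>M)" unfolding I_def by (rule integral_norm_bound)
      also have "\<dots> \<le> (\<integral>y. indicator E y \<partial>M)"
        by (rule integral_mono[OF integrable_norm[OF Iint[OF that]] Ei]) (use that in \<open>auto simp: unit_functions_def indicator_def\<close>)
      also have "\<dots> = measure M E" using rectangle by (simp add: Int_absorb2 sets.sets_into_space)
      finally show ?thesis by simp
    qed
    define \<delta> where "\<delta> = e / (2 * (measure M F + 1))"
    have d: "0 < \<delta>" using e by (simp add: \<delta>_def add_nonneg_pos)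
    have "cball (0::complex) (measure M E) \<subseteq> (\<Union>z\<in>cball 0 (measure M E). ball z \<delta>)" using d by auto
    then obtain k where k: "finite k" "cball (0::complex) (measure M E) \<subseteq> (\<Union>z\<in>k. ball z \<delta>)"
      by (rule compactE_image[OF compact_cball, of "cball (0::complex) (measure M E)" "\<lambda>z. ball z \<delta>" 0 "measure M E", rotated])
        auto
    show "\<exists>T. finite T \<and> unit_functions \<subseteq> \<Union>T \<and>
       (\<forall>S\<in>T. \<forall>\<theta>\<in>S \<inter> unit_functions. \<forall>\<theta>'\<in>S \<inter> unit_functions. kernel_dist (indicator (F \<times> E)) \<theta> \<theta>' \<le> e)"
    proof (intro exI[of _ "(\<lambda>z. {\<theta>. I \<theta> \<in> ball z \<delta>}) ` k"] conjI ballI)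
      show "finite ((\<lambda>z. {\<theta>. I \<theta> \<in> ball z \<delta>}) ` k)" using k by simp
      show "unit_functions \<subseteq> \<Union> ((\<lambda>z. {\<theta>. I \<theta> \<in> ball z \<delta>}) ` k)" using Ibd k(2) by blast
      fix S \<theta> \<theta>' assume "S \<in> (\<lambda>z. {\<theta>. I \<theta> \<in> ball z \<delta>}) ` k" and t: "\<theta> \<in> S \<inter> unit_functions" "\<theta>' \<in> S \<inter> unit_functions"
      then obtain z where z: "I \<theta> \<in> ball z \<delta>" "I \<theta>' \<in> ball z \<delta>" by auto
      have "dist (I \<theta>) (I \<theta>') \<le> dist z (I \<theta>) + dist z (I \<theta>')" by (metis dist_commute dist_triangle)
      then have near: "cmod (I \<theta> - I \<theta>') \<le> 2 * \<delta>" using z by (simp add: dist_norm)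
      have inner: "(\<integral>y. of_real (indicator (F \<times> E) (x, y)) * (\<theta> y - \<theta>' y) \<partial>M) = indicator F x *\<^sub>R (I \<theta> - I \<theta>')" for x
      proof -
        have "(\<integral>y. of_real (indicator (F \<times> E) (x, y)) * (\<theta> y - \<theta>' y) \<partial>M) = (\<integral>y. indicator F x *\<^sub>R (indicator E y *\<^sub>R \<theta> y - indicator E y *\<^sub>R \<theta>' y) \<partial>M)"
          by (intro Bochner_Integration.integral_cong) (auto simp: indicator_def)
        then show ?thesis unfolding I_def using Iint t by simp
      qed
      have "kernel_dist (indicator (F \<times> E)) \<theta> \<theta>' = (\<integral>x. indicator F x * cmod (I \<theta> - I \<theta>') \<partial>M)"
        unfolding kernel_dist_def inner by (intro Bochner_Integration.integral_cong) (auto simp: indicator_def)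
      also have "\<dots> = measure M F * cmod (I \<theta> - I \<theta>')" using rectangle by (simp add: Int_absorb2 sets.sets_into_space)
      also have "\<dots> \<le> (measure M F + 1) * (2 * \<delta>)" using near by (intro mult_mono) auto
      also have "\<dots> = e"
      proof -
        have "measure M F + 1 \<noteq> 0" using measure_nonneg[of M F] by linarith
        then have "(measure M F + 1) * (2 * (e / (2 * (measure M F + 1)))) = e" by (simp add: divide_simps)
        then show ?thesis by (simp only: \<delta>_def)
      qed
      finally show "kernel_dist (indicator (F \<times> E)) \<theta> \<theta>' \<le> e" .
    qed
  qed
next
  case (add f g)
  show ?case unfolding kernel_totally_bounded_def
  proof (intro allI impI)
    fix e :: real assume e: "0 < e"
    obtain T where T: "finite T" "unit_functions \<subseteq> \<Union>T"
      "\<And>S \<theta> \<theta>'. S \<in> T \<Longrightarrow> \<theta> \<in> S \<inter> unit_functions \<Longrightarrow> \<theta>' \<in> S \<inter> unit_functions \<Longrightarrow> kernel_dist f \<theta> \<theta>' \<le> e / 2"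
      using add.IH(1) e unfolding kernel_totally_bounded_def by (meson half_gt_zero)
    obtain T' where T': "finite T'" "unit_functions \<subseteq> \<Union>T'"
      "\<And>S \<theta> \<theta>'. S \<in> T' \<Longrightarrow> \<theta> \<in> S \<inter> unit_functions \<Longrightarrow> \<theta>' \<in> S \<inter> unit_functions \<Longrightarrow> kernel_dist g \<theta> \<theta>' \<le> e / 2"
      using add.IH(2) e unfolding kernel_totally_bounded_def by (meson half_gt_zero)
    show "\<exists>T. finite T \<and> unit_functions \<subseteq> \<Union>T \<and>
       (\<forall>S\<in>T. \<forall>\<theta>\<in>S \<inter> unit_functions. \<forall>\<theta>'\<in>S \<inter> unit_functions. kernel_dist (\<lambda>p. f p + g p) \<theta> \<theta>' \<le> e)"
    proof (intro exI[of _ "(\<lambda>(S, S'). S \<inter> S') ` (T \<times> T')"] conjI ballI)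
      show "finite ((\<lambda>(S, S'). S \<inter> S') ` (T \<times> T'))" using T(1) T'(1) by simp
      show "unit_functions \<subseteq> \<Union> ((\<lambda>(S, S'). S \<inter> S') ` (T \<times> T'))"
      proof
        fix \<theta> assume "\<theta> \<in> unit_functions"
        then obtain S S' where "\<theta> \<in> S" "S \<in> T" "\<theta> \<in> S'" "S' \<in> T'" using T(2) T'(2) by blast
        then show "\<theta> \<in> \<Union> ((\<lambda>(S, S'). S \<inter> S') ` (T \<times> T'))" by (intro UnionI[of "S \<inter> S'"]) (auto intro!: image_eqI[of _ _ "(S, S')"])
      qed
      fix R \<theta> \<theta>' assume "R \<in> (\<lambda>(S, S'). S \<inter> S') ` (T \<times> T')" and t: "\<theta> \<in> R \<inter> unit_functions" "\<theta>' \<in> R \<inter> unit_functions"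
      then obtain S S' where S: "R = S \<inter> S'" "S \<in> T" "S' \<in> T'" by auto
      have "kernel_dist f \<theta> \<theta>' \<le> e / 2" "kernel_dist g \<theta> \<theta>' \<le> e / 2" using T(3)[OF S(2)] T'(3)[OF S(3)] t S(1) by auto
      moreover have "kernel_dist (\<lambda>p. f p + g p) \<theta> \<theta>' \<le> kernel_dist f \<theta> \<theta>' + kernel_dist g \<theta> \<theta>'"
        using t by (intro kernel_dist_add add) auto
      ultimately show "kernel_dist (\<lambda>p. f p + g p) \<theta> \<theta>' \<le> e" by simp
    qed
  qed
next
  case (scale f c)
  have eq: "kernel_dist (\<lambda>p. c * f p) \<theta> \<theta>' = \<bar>c\<bar> * kernel_dist f \<theta> \<theta>'" for \<theta> \<theta>'
    unfolding kernel_dist_def by (simp add: mult.assoc norm_mult)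
  show ?case unfolding kernel_totally_bounded_def eq
  proof (intro allI impI)
    fix e :: real assume e: "0 < e"
    have "0 < e / (\<bar>c\<bar> + 1)" using e by (simp add: add_nonneg_pos)
    then obtain T where T: "finite T" "unit_functions \<subseteq> \<Union>T"
      "\<And>S \<theta> \<theta>'. S \<in> T \<Longrightarrow> \<theta> \<in> S \<inter> unit_functions \<Longrightarrow> \<theta>' \<in> S \<inter> unit_functions \<Longrightarrow> kernel_dist f \<theta> \<theta>' \<le> e / (\<bar>c\<bar> + 1)"
      using scale.IH unfolding kernel_totally_bounded_def by meson
    have "\<bar>c\<bar> * kernel_dist f \<theta> \<theta>' \<le> e" if "S \<in> T" "\<theta> \<in> S \<inter> unit_functions" "\<theta>' \<in> S \<inter> unit_functions" for S \<theta> \<theta>'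
    proof -
      have "\<bar>c\<bar> * kernel_dist f \<theta> \<theta>' \<le> \<bar>c\<bar> * (e / (\<bar>c\<bar> + 1))" using T(3)[OF that] by (intro mult_left_mono) auto
      also have "\<dots> \<le> (\<bar>c\<bar> + 1) * (e / (\<bar>c\<bar> + 1))" using e by (intro mult_right_mono) auto
      also have "\<dots> = e" by (simp add: add_nonneg_eq_0_iff)
      finally show ?thesis .
    qed
    then show "\<exists>T. finite T \<and> unit_functions \<subseteq> \<Union>T \<and>
       (\<forall>S\<in>T. \<forall>\<theta>\<in>S \<inter> unit_functions. \<forall>\<theta>'\<in>S \<inter> unit_functions. \<bar>c\<bar> * kernel_dist f \<theta> \<theta>' \<le> e)"
      using T(1,2) by (intro exI[of _ T]) auto
  qed
next
  case (lim f)
  show ?case unfolding kernel_totally_bounded_def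
  proof (intro allI impI)
    fix e :: real assume e: "0 < e"
    then obtain g where g: "integrable (M \<Otimes>\<^sub>M M) g" "kernel_totally_bounded g" "(\<integral>p. \<bar>f p - g p\<bar> \<partial>(M \<Otimes>\<^sub>M M)) \<le> e / 4"
      using lim.IH[of "e / 4"] by auto
    obtain T where T: "finite T" "unit_functions \<subseteq> \<Union>T"
      "\<And>S \<theta> \<theta>'. S \<in> T \<Longrightarrow> \<theta> \<in> S \<inter> unit_functions \<Longrightarrow> \<theta>' \<in> S \<inter> unit_functions \<Longrightarrow> kernel_dist g \<theta> \<theta>' \<le> e / 2"
      using g(2) e unfolding kernel_totally_bounded_def by (meson half_gt_zero)
    have fg: "integrable (M \<Otimes>\<^sub>M M) (\<lambda>p. f p - g p)" using lim g by simp
    have "kernel_dist f \<theta> \<theta>' \<le> e" if "S \<in> T" "\<theta> \<in> S \<inter> unit_functions" "\<theta>' \<in> S \<inter> unit_functions" for S \<theta> \<theta>'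
    proof -
      have "kernel_dist f \<theta> \<theta>' = kernel_dist (\<lambda>p. g p + (f p - g p)) \<theta> \<theta>'" by simp
      also have "\<dots> \<le> kernel_dist g \<theta> \<theta>' + kernel_dist (\<lambda>p. f p - g p) \<theta> \<theta>'" using that by (intro kernel_dist_add g fg) auto
      \<comment> \<open>Functions of modulus at most 1 differ by at most 2, hence the factor 2 and
        the approximation up to \<open>e / 4\<close>.\<close>
      also have "\<dots> \<le> e / 2 + 2 * (e / 4)"
        using T(3)[OF that] kernel_dist_le[OF fg, of \<theta> \<theta>'] g(3) that by (intro add_mono) auto
      finally show ?thesis by simp
    qed
    then show "\<exists>T. finite T \<and> unit_functions \<subseteq> \<Union>T \<and>
       (\<forall>S\<in>T. \<forall>\<theta>\<in>S \<inter> unit_functions. \<forall>\<theta>'\<in>S \<inter> unit_functions. kernel_dist f \<theta> \<theta>' \<le> e)"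
      using T(1,2) by (intro exI[of _ T]) auto
  qed
qed

text \<open>By Tonelli the double integral is that of \<open>v |A u|\<close>, and \<open>v\<close>
  integrates the moduli of all elements of \<open>L\<close>.\<close>

lemma weighted_kernel_integrable:
  assumes A: "nonneg_kernel A a" and v: "v \<in> borel_measurable M" "\<And>x. 0 < v x"
    and vint: "\<And>f. f \<in> L \<Longrightarrow> integrable M (\<lambda>x. v x * cmod (f x))" and u: "u \<in> Lp"
  shows "integrable (M \<Otimes>\<^sub>M M) (\<lambda>p. v (fst p) * a p * u (snd p))"
proof -
  note [measurable] = nonneg_kernelD(2)[OF A] v(1) LpD(1)[OF u]
  note a0 = nonneg_kernelD(3)[OF A] and u0 = LpD(2)[OF u]
  have "(\<integral>\<^sup>+p. ennreal (v (fst p) * a p * u (snd p)) \<partial>(M \<Otimes>\<^sub>M M)) = (\<integral>\<^sup>+x. \<integral>\<^sup>+y. ennreal (v x * a (x, y) * u y) \<partial>M \<partial>M)"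
    by (subst nn_integral_fst[symmetric]) auto
  also have "\<dots> = (\<integral>\<^sup>+x. ennreal (v x * cmod (A (cpx u) x)) \<partial>M)"
  proof (rule nn_integral_cong_AE)
    show "AE x in M. (\<integral>\<^sup>+y. ennreal (v x * a (x, y) * u y) \<partial>M) = ennreal (v x * cmod (A (cpx u) x))"
      using nonneg_kernel_real[OF A LpD(3)[OF u]]
    proof eventually_elim
      case (elim x)
      have "(\<integral>\<^sup>+y. ennreal (v x * (a (x, y) * u y)) \<partial>M) = ennreal (\<integral>y. v x * (a (x, y) * u y) \<partial>M)"
        using elim a0 u0 v(2)[of x] by (intro nn_integral_eq_integral) auto
      moreover have "0 \<le> (\<integral>y. a (x, y) * u y \<partial>M)" using a0 u0 by simp
      ultimately show ?case using elim by (simp add: mult.assoc)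
    qed
  qed
  also have "\<dots> < \<infinity>" using vint[OF nonneg_kernelD(1)[OF A LpD(3)[OF u]]] v(2) by (auto simp: integrable_iff_bounded abs_mult less_imp_le)
  finally show ?thesis using a0 u0 v(2) by (intro integrableI_nonneg) (auto simp: less_imp_le)
qed

end

subsection \<open>Order continuous norms\<close>

locale order_continuous_space = banach_function_space M L N
  for M :: "'a measure" and L N +
  assumes order_continuous: "order_continuous_norm L (ae_le M) N"
    and order_continuous_dual: "order_continuous_norm (dual_space L N) (dual_le M L) (dual_norm L N)"
begin

text \<open>Order continuity speaks of decreasing sequences; the tail suprema of the
  \<open>|h m|\<close> form one, and they still tend to 0 a.e.\<close>

lemma dominated_norm_convergence:
  assumes g: "g \<in> Lp" and h: "\<And>n. h n \<in> borel_measurable M" and le: "\<And>n. AE x in M. cmod (h n x) \<le> g x"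
    and lim: "AE x in M. (\<lambda>n. h n x) \<longlonglongrightarrow> 0"
  shows "(\<lambda>n. N (h n)) \<longlonglongrightarrow> 0"
proof -
  \<comment> \<open>The minimum with \<open>g\<close> makes the supremum finite at every point, also
    where the a.e. domination fails.\<close>
  define k where "k n x = (SUP m\<in>{n..}. min (cmod (h m x)) (g x))" for n x
  note g0 = LpD(2)[OF g]
  have bdd: "bdd_above ((\<lambda>m. min (cmod (h m x)) (g x)) ` A)" for x and A :: "nat set"
    by (rule bdd_aboveI[of _ "g x"]) auto
  have [measurable]: "k n \<in> borel_measurable M" for n
    unfolding k_def using h LpD(1)[OF g] bdd by (intro borel_measurable_cSUP) (auto intro!: borel_measurable_min measurable_compose[OF h])
  have k_ge: "min (cmod (h m x)) (g x) \<le> k n x" if "n \<le> m" for n m x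
    unfolding k_def using that by (intro cSUP_upper bdd) auto
  have k_le: "k n x \<le> c" if "\<And>m. m \<ge> n \<Longrightarrow> min (cmod (h m x)) (g x) \<le> c" for n x c
    unfolding k_def using that by (intro cSUP_least) auto
  have k0: "0 \<le> k n x" for n x using k_ge[OF order_refl, of n x] g0[of x] by (meson min.boundedI norm_ge_zero order_trans)
  have kg: "k n x \<le> g x" for n x by (rule k_le) simp
  have kdec: "k (Suc n) x \<le> k n x" for n x by (rule k_le) (rule k_ge, simp)
  have kL: "k n \<in> Lp" for n using k0 kg by (intro Lp_le[OF g]) auto
  have klim: "AE x in M. (\<lambda>n. k n x) \<longlonglongrightarrow> 0" using lim
  proof eventually_elim
    case (elim x)
    show ?case
    proof (rule LIMSEQ_I)
      fix e :: real assume e: "0 < e"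
      obtain n0 where n0: "\<And>n. n \<ge> n0 \<Longrightarrow> cmod (h n x) < e / 2" using LIMSEQ_D[OF elim, of "e / 2"] e by auto
      have "k n x \<le> e / 2" if "n \<ge> n0" for n
      proof (rule k_le)
        fix m assume "m \<ge> n"
        then show "min (cmod (h m x)) (g x) \<le> e / 2" using n0[of m] that by (simp add: min_le_iff_disj)
      qed
      then show "\<exists>n0. \<forall>n\<ge>n0. norm (k n x - 0) < e" using k0 e by (intro exI[of _ n0]) (force simp: abs_of_nonneg)
    qed
  qed
  have Nk: "(\<lambda>n. N (cpx (k n))) \<longlonglongrightarrow> 0"
  proof -
    have 1: "\<forall>n. cpx (k n) \<in> L \<and> ae_le M (\<lambda>_. 0) (cpx (k n)) \<and> ae_le M (cpx (k (Suc n))) (cpx (k n))"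
      using kL k0 kdec by (auto simp: ae_le_def LpD(3) simp flip: of_real_diff)
    have 2: "\<forall>q\<in>L. (\<forall>n. ae_le M q (cpx (k n))) \<longrightarrow> ae_le M q (\<lambda>_. 0)"
    proof (intro ballI impI)
      fix q assume q: "\<forall>n. ae_le M q (cpx (k n))"
      then have "AE x in M. \<forall>n. cpx (k n) x - q x \<in> \<real>\<^sub>\<ge>\<^sub>0" unfolding ae_le_def AE_all_countable by blast
      then show "ae_le M q (\<lambda>_. 0)" unfolding ae_le_def using klim
      proof eventually_elim
        case (elim x)
        have "(\<lambda>n. cpx (k n) x - q x) \<longlonglongrightarrow> of_real 0 - q x" by (intro tendsto_intros elim)
        then have "of_real 0 - q x \<in> \<real>\<^sub>\<ge>\<^sub>0"
          using elim(1) closed_sequentially[OF closed_nonneg_Reals_complex, of "\<lambda>n. cpx (k n) x - q x"] by blast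
        then show ?case by simp
      qed
    qed
    show ?thesis by (rule mp[OF spec[OF order_continuous[unfolded order_continuous_norm_def]] conjI[OF 1 2]])
  qed
  have hL: "h n \<in> L" for n
    using le[of n] g0 by (intro ideal_mem[OF LpD(3)[OF g] h]) (auto elim!: eventually_mono)
  show ?thesis
  proof (rule squeeze_zero[OF norm_nonneg[OF hL] _ Nk])
    fix n show "N (h n) \<le> N (cpx (k n))"
    proof (rule norm_mono[OF LpD(3)[OF kL] h])
      show "AE x in M. cmod (h n x) \<le> cmod (cpx (k n) x)" using le[of n]
      proof eventually_elim
        case (elim x)
        then show ?case using k_ge[OF order_refl, of n x] k0[of n x] by simp
      qed
    qed
  qed
qed

text \<open>
  A strictly positive weight \<open>v\<close> with \<open>\<integral> v |f| \<le> C N f\<close> on \<open>L\<close>, found by an optimisation instead of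
  Hahn-Banach: minimise \<open>\<integral> d / (1 + f)\<close> over the positive part of the unit ball. By strict convexity
  the functions \<open>1 / (1 + f\<^sub>n)\<close> of a minimising sequence converge to some \<open>g\<close>, and the first
  order condition at the minimum says \<open>\<integral> d g\<^sup>2 f \<le> \<integral> d\<close> on the ball.
\<close>

lemma obtain_dual_weight:
  obtains v :: "'a \<Rightarrow> real" and C where "v \<in> borel_measurable M" "\<And>x. 0 < v x" "0 \<le> C"
    "\<And>f. f \<in> L \<Longrightarrow> integrable M (\<lambda>x. v x * cmod (f x))" "\<And>f. f \<in> L \<Longrightarrow> (\<integral>x. v x * cmod (f x) \<partial>M) \<le> C * N f"
proof -
  obtain d :: "'a \<Rightarrow> real" where d: "d \<in> borel_measurable M" "\<And>x. 0 < d x" "integrable M d"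
    by (rule obtain_positive_integrable_function) blast
  obtain w where w: "w \<in> Lp" "\<And>x. 0 < w x" using obtain_weak_unit by blast
  note [measurable] = d(1) LpD(1)[OF w(1)]
  define P where "P = {f\<in>Lp. N (cpx f) \<le> 1}"
  define J where "J f = (\<integral>x. d x / (1 + f x) \<partial>M)" for f
  have Pm[measurable]: "f \<in> borel_measurable M" and P0: "0 \<le> f x" if "f \<in> P" for f x using that by (auto simp: P_def Lp_def)
  have Pconv: "(\<lambda>x. (1 - t) * f x + t * g x) \<in> P" if "f \<in> P" "g \<in> P" "0 \<le> t" "t \<le> 1" for f g t
  proof -
    have m: "(\<lambda>x. (1 - t) * f x) \<in> Lp" "(\<lambda>x. t * g x) \<in> Lp" using that by (auto simp: P_def intro!: Lp_scale)
    have n: "N (cpx (\<lambda>x. c * e x)) = c * N (cpx e)" if "e \<in> Lp" "0 \<le> c" for c e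
      using norm_scale[OF LpD(3)[OF that(1)], of "of_real c"] that(2) by simp
    have "N (cpx (\<lambda>x. (1 - t) * f x + t * g x)) \<le> N (cpx (\<lambda>x. (1 - t) * f x)) + N (cpx (\<lambda>x. t * g x))"
      using norm_triangle[OF LpD(3)[OF m(1)] LpD(3)[OF m(2)]] by simp
    also have "\<dots> = (1 - t) * N (cpx f) + t * N (cpx g)" using n[of f "1 - t"] n[of g t] that by (simp only: P_def mem_Collect_eq diff_ge_0_iff_ge)
    also have "\<dots> \<le> (1 - t) * 1 + t * 1" using that by (intro add_mono mult_left_mono) (auto simp: P_def)
    finally show ?thesis using Lp_add[OF m] by (simp add: P_def)
  qed
  have bint: "integrable M (\<lambda>x. d x * b x)" if "b \<in> borel_measurable M" "\<And>x. \<bar>b x\<bar> \<le> B" for b :: "'a \<Rightarrow> real" and B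
  proof (rule Bochner_Integration.integrable_bound)
    show "integrable M (\<lambda>x. d x * B)" using d(3) by simp
    have "\<bar>d x * b x\<bar> \<le> \<bar>d x * B\<bar>" for x using that(2)[of x] d(2)[of x] by (simp add: abs_mult)
    then show "AE x in M. norm (d x * b x) \<le> norm (d x * B)" by simp
  qed (use that(1) in measurable)
  have Jint: "integrable M (\<lambda>x. d x / (1 + f x))" if "f \<in> P" for f
  proof -
    have "\<bar>1 / (1 + f x)\<bar> \<le> 1" for x using P0[OF that, of x] by (simp add: abs_of_nonneg)
    then show ?thesis using bint[of "\<lambda>x. 1 / (1 + f x)" 1] Pm[OF that] by simp
  qed
  have J0: "0 \<le> J f" if "f \<in> P" for f unfolding J_def using P0[OF that] d(2) by (intro Bochner_Integration.integral_nonneg) (auto simp: less_imp_le)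
  define s where "s = Inf (J ` P)"
  have zP: "(\<lambda>_. 0) \<in> P" using Lp_zero by (simp add: P_def)
  have bddJ: "bdd_below (J ` P)" using J0 by (auto intro!: bdd_belowI[of _ 0])
  have s_le: "s \<le> J f" if "f \<in> P" for f unfolding s_def by (rule cINF_lower[OF bddJ that])
  \<comment> \<open>The rate \<open>(1/4)^n\<close> is chosen so that the increments of
    \<open>g\<close> remain summable after passing from squares to moduli.\<close>
  have "\<exists>f\<in>P. J f < s + (1/4)^n" for n :: nat
    using cInf_less_iff[OF _ bddJ, of "s + (1/4)^n"] zP unfolding s_def by auto
  then obtain f where f: "\<And>n. f n \<in> P" "\<And>n. J (f n) < s + (1/4)^n" by metis
  note [measurable] = Pm[OF f(1)]
  define g where "g n x = 1 / (1 + f n x)" for n x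
  have [measurable]: "g n \<in> borel_measurable M" for n unfolding g_def by measurable
  have g01: "0 < g n x" "g n x \<le> 1" for n x using P0[OF f(1), of n x] by (auto simp: g_def)
  \<comment> \<open>\<open>J\<close> is at least \<open>s\<close> at the midpoint, so
    \<open>2 J (f n) + 2 J (f (n+1)) - 4 J ?m\<close> is at most \<open>4 (1/4)^n\<close>; by
    \<open>inverse_midpoint_convex\<close> it bounds the weighted square distance.\<close>
  have sq: "(\<integral>x. d x * (g (Suc n) x - g n x)\<^sup>2 \<partial>M) \<le> 4 * (1/4)^n" for n
  proof -
    let ?m = "\<lambda>x. (1 - 1/2) * f n x + 1/2 * f (Suc n) x"
    have mP: "?m \<in> P" using Pconv[OF f(1) f(1), of "1/2" n "Suc n"] by simp
    have pt: "d x * (g (Suc n) x - g n x)\<^sup>2 \<le> 2 * (d x / (1 + f n x)) + 2 * (d x / (1 + f (Suc n) x)) - 4 * (d x / (1 + ?m x))" for x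
    proof -
      define a where "a = 1 + f n x" define b where "b = 1 + f (Suc n) x"
      have ab: "1 \<le> a" "1 \<le> b" using P0[OF f(1)] by (auto simp: a_def b_def)
      have "d x * (1 / b - 1 / a)\<^sup>2 \<le> d x * (2 / a + 2 / b - 8 / (a + b))"
        using d(2)[of x] inverse_midpoint_convex[OF ab] by (intro mult_left_mono) auto
      moreover have m_eq: "1 + ?m x = (a + b) / 2" by (simp add: a_def b_def field_simps)
      moreover have "d x * (2 / a + 2 / b - 8 / (a + b)) = 2 * (d x / a) + 2 * (d x / b) - 4 * (d x / ((a + b) / 2))"
        by (simp add: algebra_simps)
      ultimately show ?thesis unfolding g_def m_eq a_def[symmetric] b_def[symmetric] by simp
    qed
    have i: "integrable M (\<lambda>x. d x * (g (Suc n) x - g n x)\<^sup>2)"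
    proof (rule bint[of _ 1])
      fix x
      have "\<bar>g (Suc n) x - g n x\<bar> \<le> 1" using g01[of n x] g01[of "Suc n" x] by auto
      then show "\<bar>(g (Suc n) x - g n x)\<^sup>2\<bar> \<le> 1" by (simp add: abs_square_le_1)
    qed measurable
    have "(\<integral>x. d x * (g (Suc n) x - g n x)\<^sup>2 \<partial>M) \<le> (\<integral>x. 2 * (d x / (1 + f n x)) + 2 * (d x / (1 + f (Suc n) x)) - 4 * (d x / (1 + ?m x)) \<partial>M)"
      using i Jint[OF f(1)] Jint[OF mP] pt by (intro integral_mono) (auto simp del: times_divide_eq_right)
    also have "\<dots> = 2 * J (f n) + 2 * J (f (Suc n)) - 4 * J ?m"
      unfolding J_def using Jint[OF f(1)] Jint[OF mP] by (simp del: times_divide_eq_right)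
    also have "\<dots> \<le> 4 * (1/4)^n"
    proof -
      have "(0::real) \<le> (1/4)^n" by simp
      then show ?thesis using f(2)[of n] f(2)[of "Suc n"] s_le[OF mP] unfolding power_Suc by linarith
    qed
    finally show ?thesis .
  qed
  define D where "D = (\<integral>x. d x \<partial>M)"
  have D0: "0 \<le> D" unfolding D_def using d(2) by (intro Bochner_Integration.integral_nonneg) (simp add: less_imp_le)
  have abs_int: "(\<integral>\<^sup>+x. ennreal (d x * \<bar>g (Suc n) x - g n x\<bar>) \<partial>M) \<le> ennreal ((D + 4) * (1/2)^n)" for n
  proof -
    have sqb: "\<bar>(g (Suc n) x - g n x)\<^sup>2\<bar> \<le> 1" for x
    proof -
      have "\<bar>g (Suc n) x - g n x\<bar> \<le> 1" using g01[of n x] g01[of "Suc n" x] by auto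
      then show ?thesis by (simp add: abs_square_le_1)
    qed
    have i: "integrable M (\<lambda>x. d x * \<bar>g (Suc n) x - g n x\<bar>)" "integrable M (\<lambda>x. d x * (g (Suc n) x - g n x)\<^sup>2)"
      using g01 sqb by (auto intro!: bint[of _ 1] simp: abs_le_iff) (smt (verit))+
    \<comment> \<open>\<open>|y| \<le> (1/2)^n + 2^n y^2\<close> trades the square bound of order
      \<open>(1/4)^n\<close> for an integral of order \<open>(1/2)^n\<close>, which is
      summable.\<close>
    have pt: "d x * \<bar>g (Suc n) x - g n x\<bar> \<le> (1/2)^n * d x + 2^n * (d x * (g (Suc n) x - g n x)\<^sup>2)" for x
    proof -
      let ?y = "\<bar>g (Suc n) x - g n x\<bar>"
      have "0 \<le> ((1/2)^n - ?y * 1)\<^sup>2 + (1/2)^n * ?y" by simp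
      then have "(1/2)^n * ?y \<le> (1/2)^n * (1/2)^n + ?y\<^sup>2" by (simp add: power2_eq_square algebra_simps)
      then have "2^n * ((1/2)^n * ?y) \<le> 2^n * ((1/2)^n * (1/2)^n + ?y\<^sup>2)" by (intro mult_left_mono) auto
      moreover have "(2::real)^n * (1/2)^n = 1" by (simp flip: power_mult_distrib)
      ultimately have "?y \<le> (1/2)^n + 2^n * ?y\<^sup>2" by (simp only: distrib_left mult.assoc[symmetric] mult_1)
      then have "d x * ?y \<le> d x * ((1/2)^n + 2^n * ?y\<^sup>2)" using d(2)[of x] by (intro mult_left_mono) auto
      then show ?thesis by (simp add: algebra_simps)
    qed
    have "(\<integral>\<^sup>+x. ennreal (d x * \<bar>g (Suc n) x - g n x\<bar>) \<partial>M) = ennreal (\<integral>x. d x * \<bar>g (Suc n) x - g n x\<bar> \<partial>M)"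
      using i d(2) by (intro nn_integral_eq_integral) (auto simp: less_imp_le)
    also have "\<dots> \<le> ennreal (\<integral>x. (1/2)^n * d x + 2^n * (d x * (g (Suc n) x - g n x)\<^sup>2) \<partial>M)"
      using i d(3) pt by (intro ennreal_leI integral_mono) auto
    also have "(\<integral>x. (1/2)^n * d x + 2^n * (d x * (g (Suc n) x - g n x)\<^sup>2) \<partial>M) = (1/2)^n * D + 2^n * (\<integral>x. d x * (g (Suc n) x - g n x)\<^sup>2 \<partial>M)"
      unfolding D_def using i d(3) by simp
    also have "\<dots> \<le> (1/2)^n * D + 2^n * (4 * (1/4)^n)" using sq[of n] by simp
    also have "(2::real)^n * (4 * (1/4)^n) = 4 * (1/2)^n" by (simp flip: power_mult_distrib)
    finally show ?thesis by (simp add: algebra_simps ennreal_leI)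
  qed
  have conv: "AE x in M. convergent (\<lambda>n. g n x)"
  proof -
    have "(\<integral>\<^sup>+x. (\<Sum>n. ennreal (d x * \<bar>g (Suc n) x - g n x\<bar>)) \<partial>M) = (\<Sum>n. \<integral>\<^sup>+x. ennreal (d x * \<bar>g (Suc n) x - g n x\<bar>) \<partial>M)"
      by (intro nn_integral_suminf) measurable
    also have "\<dots> \<le> (\<Sum>n. ennreal ((D + 4) * (1/2)^n))" by (intro suminf_le abs_int) auto
    also have "\<dots> = ennreal (\<Sum>n. (D + 4) * (1/2)^n)" using D0 by (intro suminf_ennreal2) (auto intro!: summable_mult summable_geometric)
    finally have "(\<integral>\<^sup>+x. (\<Sum>n. ennreal (d x * \<bar>g (Suc n) x - g n x\<bar>)) \<partial>M) \<noteq> \<infinity>" by (auto simp: top_unique)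
    then have "AE x in M. (\<Sum>n. ennreal (d x * \<bar>g (Suc n) x - g n x\<bar>)) \<noteq> \<infinity>" by (intro nn_integral_PInf_AE) measurable
    then show ?thesis
    proof eventually_elim
      case (elim x)
      have "summable (\<lambda>n. d x * \<bar>g (Suc n) x - g n x\<bar>)"
        using elim d(2)[of x] by (intro summable_suminf_not_top) (auto simp: less_imp_le)
      then have "summable (\<lambda>n. (1 / d x) * (d x * \<bar>g (Suc n) x - g n x\<bar>))" by (rule summable_mult)
      then have "summable (\<lambda>n. \<bar>g (Suc n) x - g n x\<bar>)" using d(2)[of x] by (simp add: less_imp_neq[symmetric])
      then have "summable (\<lambda>n. g (Suc n) x - g n x)" by (rule summable_rabs_cancel)
      then have "(\<lambda>n. \<Sum>k<n. g (Suc k) x - g k x) \<longlonglongrightarrow> (\<Sum>n. g (Suc n) x - g n x)" by (rule summable_LIMSEQ)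
      then have "(\<lambda>n. g n x - g 0 x + g 0 x) \<longlonglongrightarrow> (\<Sum>n. g (Suc n) x - g n x) + g 0 x"
        by (intro tendsto_add tendsto_const) (simp add: sum_lessThan_telescope[of "\<lambda>n. g n x"])
      then show ?case by (auto simp: convergent_def)
    qed
  qed
  \<comment> \<open>The \<open>f n\<close> themselves may tend to infinity; only the
    \<open>g n\<close>, with values between 0 and 1, converge. That \<open>h > 0\<close> a.e. is
    shown separately in \<open>hpos\<close>.\<close>
  define h where "h x = lim (\<lambda>n. g n x)" for x
  have [measurable]: "h \<in> borel_measurable M" unfolding h_def by (rule borel_measurable_lim_metric) measurable
  have gh: "AE x in M. (\<lambda>n. g n x) \<longlonglongrightarrow> h x" using conv by eventually_elim (simp add: h_def convergent_LIMSEQ_iff)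
  have h01: "AE x in M. 0 \<le> h x \<and> h x \<le> 1" using gh
  proof eventually_elim
    case (elim x)
    show ?case using LIMSEQ_le_const[OF elim, of 0] LIMSEQ_le_const2[OF elim, of 1] g01 by (auto intro: less_imp_le)
  qed
  have Jg: "(\<integral>x. d x * g n x \<partial>M) = J (f n)" for n by (simp add: J_def g_def)
  have hint: "integrable M (\<lambda>x. d x * h x)"
  proof (rule Bochner_Integration.integrable_bound[OF d(3)])
    show "AE x in M. norm (d x * h x) \<le> norm (d x)" using h01 by eventually_elim (use d(2) in \<open>auto simp: abs_mult less_imp_le intro!: mult_left_le\<close>)
  qed measurable
  have Jh: "(\<integral>x. d x * h x \<partial>M) = s"
  proof (rule LIMSEQ_unique)
    show "(\<lambda>n. \<integral>x. d x * g n x \<partial>M) \<longlonglongrightarrow> (\<integral>x. d x * h x \<partial>M)"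
    proof (rule integral_dominated_convergence[OF _ _ d(3)])
      show "AE x in M. (\<lambda>n. d x * g n x) \<longlonglongrightarrow> d x * h x" using gh by eventually_elim (intro tendsto_intros)
      fix n show "AE x in M. norm (d x * g n x) \<le> d x"
        using g01 d(2) by (auto simp: abs_mult less_imp_le abs_of_pos intro!: mult_left_le)
    qed measurable
    show "(\<lambda>n. \<integral>x. d x * g n x \<partial>M) \<longlonglongrightarrow> s" unfolding Jg
    proof (rule tendsto_sandwich[of "\<lambda>_. s" _ _ "\<lambda>n. s + (1/4)^n"])
      show "(\<lambda>n. s + (1/4)^n) \<longlonglongrightarrow> s" using tendsto_add[OF tendsto_const LIMSEQ_power_zero[of "1/4::real"], of s] by simp
      show "\<forall>\<^sub>F n in sequentially. s \<le> J (f n)" using s_le[OF f(1)] by simp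
      show "\<forall>\<^sub>F n in sequentially. J (f n) \<le> s + (1/4)^n" using f(2) by (simp add: less_imp_le)
    qed simp
  qed
  \<comment> \<open>\<open>J\<close> is at least \<open>s\<close> at
    \<open>(1 - t) f n + t q\<close>. In the limit this says
    \<open>\<integral> d h \<le> \<integral> d h / a\<close> with
    \<open>a = (1 - t) + t (1 + q) h\<close>; collecting both sides and dividing by \<open>t\<close>
    gives the estimate.\<close>
  have first: "(\<integral>x. d x * ((1 + q x) * h x * h x / ((1 - t) + t * (1 + q x) * h x)) \<partial>M) \<le> D / (1 - t)"
    and first_int: "integrable M (\<lambda>x. d x * ((1 + q x) * h x * h x / ((1 - t) + t * (1 + q x) * h x)))"
    if q: "q \<in> P" and t: "0 < t" "t < 1" for q t
  proof -
    note [measurable] = Pm[OF q]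
    let ?A = "\<lambda>y x. (1 - t) + t * (1 + q x) * y"
    have A: "1 - t \<le> ?A y x" if "0 \<le> y" for y x using t that P0[OF q, of x] by simp
    have eq: "1 / (1 + ((1 - t) * f n x + t * q x)) = g n x / ?A (g n x) x" for n x
    proof -
      have p: "1 + f n x > 0" "1 + ((1 - t) * f n x + t * q x) > 0" "?A (g n x) x > 0"
        using P0[OF f(1), of n x] P0[OF q, of x] t g01[of n x] by (auto simp: add_pos_nonneg add_nonneg_pos)
      have "1 - t + t * (1 + q x) / (1 + f n x) = (1 + ((1 - t) * f n x + t * q x)) / (1 + f n x)"
        using p(1) by (simp add: field_simps)
      then show ?thesis using p by (simp add: g_def)
    qed
    have cP: "(\<lambda>x. (1 - t) * f n x + t * q x) \<in> P" for n using Pconv[OF f(1) q, of t n] t by simp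
    have "s \<le> (\<integral>x. d x * (h x / ?A (h x) x) \<partial>M)"
    proof (rule LIMSEQ_le_const)
      show "(\<lambda>n. \<integral>x. d x * (g n x / ?A (g n x) x) \<partial>M) \<longlonglongrightarrow> (\<integral>x. d x * (h x / ?A (h x) x) \<partial>M)"
      proof (rule integral_dominated_convergence[OF _ _ d(3)])
        show "AE x in M. (\<lambda>n. d x * (g n x / ?A (g n x) x)) \<longlonglongrightarrow> d x * (h x / ?A (h x) x)" using gh h01
        proof eventually_elim
          case (elim x)
          then have "?A (h x) x \<noteq> 0" using A[of "h x" x] t by simp
          then show ?case by (intro tendsto_intros elim) auto
        qed
        fix n
        have "0 \<le> 1 / (1 + ((1 - t) * f n x + t * q x))" "1 / (1 + ((1 - t) * f n x + t * q x)) \<le> 1" for x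
          using P0[OF cP[of n], of x] by auto
        then show "AE x in M. norm (d x * (g n x / ?A (g n x) x)) \<le> d x"
          unfolding eq[symmetric] using d(2) by (auto simp only: real_norm_def abs_mult less_imp_le abs_of_pos abs_of_nonneg intro!: mult_left_le AE_I2)
      qed measurable
      have "(\<integral>x. d x * (g n x / ?A (g n x) x) \<partial>M) = J (\<lambda>x. (1 - t) * f n x + t * q x)" for n
        unfolding J_def eq[symmetric] by simp
      then show "\<exists>n0. \<forall>n\<ge>n0. s \<le> (\<integral>x. d x * (g n x / ?A (g n x) x) \<partial>M)" using s_le[OF cP] by simp
    qed
    then have *: "(\<integral>x. d x * h x \<partial>M) \<le> (\<integral>x. d x * (h x / ?A (h x) x) \<partial>M)" unfolding Jh .
    have i1: "integrable M (\<lambda>x. d x * (h x / ?A (h x) x))"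
    proof (rule Bochner_Integration.integrable_bound[of _ "\<lambda>x. d x / (1 - t)"])
      show "AE x in M. norm (d x * (h x / ?A (h x) x)) \<le> norm (d x / (1 - t))" using h01
      proof eventually_elim
        case (elim x)
        then have "h x / ?A (h x) x \<le> 1 / (1 - t)" using A[of "h x" x] t by (intro frac_le) auto
        moreover have "0 \<le> h x / ?A (h x) x" using elim A[of "h x" x] t by auto
        ultimately show ?case using norm_mult_left_mono[of "h x / ?A (h x) x" "1 / (1 - t)" "d x"] by simp
      qed
    qed (use d in auto)
    show i2: "integrable M (\<lambda>x. d x * ((1 + q x) * h x * h x / ?A (h x) x))"
    proof (rule Bochner_Integration.integrable_bound[of _ "\<lambda>x. d x / t"])
      show "AE x in M. norm (d x * ((1 + q x) * h x * h x / ?A (h x) x)) \<le> norm (d x / t)" using h01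
      proof eventually_elim
        case (elim x)
        have Ap: "0 < ?A (h x) x" using A[of "h x" x] t elim by simp
        have q0: "0 \<le> q x" by (rule P0[OF q])
        have "t * ((1 + q x) * h x * h x) \<le> t * ((1 + q x) * h x * 1)" using elim t q0 by (intro mult_left_mono) auto
        also have "\<dots> \<le> ?A (h x) x" using t by simp
        finally have "(1 + q x) * h x * h x / ?A (h x) x \<le> 1 / t" using Ap t by (simp add: field_simps)
        moreover have "0 \<le> (1 + q x) * h x * h x / ?A (h x) x" using elim Ap q0 by auto
        ultimately show ?case using norm_mult_left_mono[of "(1 + q x) * h x * h x / ?A (h x) x" "1 / t" "d x"] by simp
      qed
    qed (use d in auto)
    have "t * (\<integral>x. d x * ((1 + q x) * h x * h x / ?A (h x) x) \<partial>M) - t * (\<integral>x. d x * (h x / ?A (h x) x) \<partial>M)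
        = (\<integral>x. t * (d x * ((1 + q x) * h x * h x / ?A (h x) x)) - t * (d x * (h x / ?A (h x) x)) \<partial>M)"
      by (subst Bochner_Integration.integral_diff) (use i1 i2 in \<open>simp_all only: integrable_mult_right Bochner_Integration.integral_mult_right_zero\<close>)
    also have "\<dots> = (\<integral>x. d x * h x - d x * (h x / ?A (h x) x) \<partial>M)"
    proof (rule integral_cong_AE)
      show "AE x in M. t * (d x * ((1 + q x) * h x * h x / ?A (h x) x)) - t * (d x * (h x / ?A (h x) x)) = d x * h x - d x * (h x / ?A (h x) x)"
        using h01
      proof eventually_elim
        case (elim x)
        define a where "a = ?A (h x) x"
        have a: "0 < a" using A[of "h x" x] t elim by (simp add: a_def)
        have "t * ((1 + q x) * h x * h x) - t * h x = h x * a - h x" by (simp add: a_def algebra_simps)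
        then have "(t * ((1 + q x) * h x * h x) - t * h x) / a = (h x * a - h x) / a" by simp
        then have "t * ((1 + q x) * h x * h x / a) - t * (h x / a) = h x - h x / a" using a by (simp add: diff_divide_distrib)
        then have "d x * (t * ((1 + q x) * h x * h x / a) - t * (h x / a)) = d x * (h x - h x / a)" by simp
        then show ?case unfolding a_def[symmetric] by (simp only: right_diff_distrib mult.left_commute)
      qed
    qed measurable
    also have "\<dots> = (\<integral>x. d x * h x \<partial>M) - (\<integral>x. d x * (h x / ?A (h x) x) \<partial>M)" using hint i1 by simp
    also have "\<dots> \<le> 0" using * by simp
    finally have "(\<integral>x. d x * ((1 + q x) * h x * h x / ?A (h x) x) \<partial>M) \<le> (\<integral>x. d x * (h x / ?A (h x) x) \<partial>M)" using t by simp
    also have "\<dots> \<le> (\<integral>x. d x / (1 - t) \<partial>M)"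
    proof (rule integral_mono_AE[OF i1])
      show "AE x in M. d x * (h x / ?A (h x) x) \<le> d x / (1 - t)" using h01
      proof eventually_elim
        case (elim x)
        then have "h x / ?A (h x) x \<le> 1 / (1 - t)" using A[of "h x" x] t by (intro frac_le) auto
        then have "d x * (h x / ?A (h x) x) \<le> d x * (1 / (1 - t))" using d(2)[of x] by (intro mult_left_mono) auto
        then show ?case by simp
      qed
    qed (use d in auto)
    finally show "(\<integral>x. d x * ((1 + q x) * h x * h x / ?A (h x) x) \<partial>M) \<le> D / (1 - t)" by (simp add: D_def)
  qed
  \<comment> \<open>Fatou's lemma as \<open>t\<close> tends to 0; the offset 2 in \<open>t n\<close>
    keeps \<open>t n < 1\<close>.\<close>
  have main: "(\<integral>\<^sup>+x. ennreal (d x * (h x)\<^sup>2 * q x) \<partial>M) \<le> ennreal D" if q: "q \<in> P" for q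
  proof -
    note [measurable] = Pm[OF q]
    define t where "t n = 1 / real (n + 2)" for n
    have t: "0 < t n" "t n < 1" for n by (auto simp: t_def)
    have tlim: "t \<longlonglongrightarrow> 0"
      using LIMSEQ_ignore_initial_segment[OF lim_1_over_n, of 2] by (simp add: t_def[abs_def])
    let ?F = "\<lambda>n x. ennreal (d x * ((1 + q x) * h x * h x / ((1 - t n) + t n * (1 + q x) * h x)))"
    have "(\<integral>\<^sup>+x. ennreal (d x * (h x)\<^sup>2 * q x) \<partial>M) \<le> (\<integral>\<^sup>+x. liminf (\<lambda>n. ?F n x) \<partial>M)"
    proof (rule nn_integral_mono_AE)
      show "AE x in M. ennreal (d x * (h x)\<^sup>2 * q x) \<le> liminf (\<lambda>n. ?F n x)" using h01
      proof eventually_elim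
        case (elim x)
        have "(\<lambda>n. (1 - t n) + t n * (1 + q x) * h x) \<longlonglongrightarrow> (1 - 0) + 0 * (1 + q x) * h x" by (intro tendsto_intros tlim)
        then have "(\<lambda>n. d x * ((1 + q x) * h x * h x / ((1 - t n) + t n * (1 + q x) * h x))) \<longlonglongrightarrow> d x * ((1 + q x) * h x * h x / 1)"
          by (intro tendsto_mult tendsto_divide tendsto_const) auto
        then have "(\<lambda>n. ?F n x) \<longlonglongrightarrow> ennreal (d x * ((1 + q x) * h x * h x / 1))" by (rule tendsto_ennrealI)
        then have "liminf (\<lambda>n. ?F n x) = ennreal (d x * ((1 + q x) * h x * h x / 1))" by (rule lim_imp_Liminf[OF sequentially_bot])
        moreover have "d x * (h x)\<^sup>2 * q x \<le> d x * ((1 + q x) * h x * h x / 1)"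
          using d(2)[of x] by (simp add: power2_eq_square algebra_simps)
        ultimately show ?case by (simp add: ennreal_leI)
      qed
    qed
    also have "\<dots> \<le> liminf (\<lambda>n. \<integral>\<^sup>+x. ?F n x \<partial>M)" by (intro nn_integral_liminf) measurable
    also have "\<dots> \<le> liminf (\<lambda>n. ennreal (D / (1 - t n)))"
    proof (rule Liminf_mono, intro always_eventually allI)
      fix n
      have "(\<integral>\<^sup>+x. ?F n x \<partial>M) = ennreal (\<integral>x. d x * ((1 + q x) * h x * h x / ((1 - t n) + t n * (1 + q x) * h x)) \<partial>M)"
      proof (rule nn_integral_eq_integral[OF first_int[OF q t]])
        show "AE x in M. 0 \<le> d x * ((1 + q x) * h x * h x / ((1 - t n) + t n * (1 + q x) * h x))"
          using h01 by eventually_elim (use d(2) P0[OF q] t[of n] in \<open>auto simp: less_imp_le intro!: mult_nonneg_nonneg divide_nonneg_nonneg add_nonneg_nonneg\<close>)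
      qed
      also have "\<dots> \<le> ennreal (D / (1 - t n))" by (rule ennreal_leI[OF first[OF q t]])
      finally show "(\<integral>\<^sup>+x. ?F n x \<partial>M) \<le> ennreal (D / (1 - t n))" .
    qed
    also have "\<dots> = ennreal D"
    proof (rule lim_imp_Liminf[OF sequentially_bot])
      have "(\<lambda>n. D / (1 - t n)) \<longlonglongrightarrow> D / (1 - 0)" by (intro tendsto_intros tlim) auto
      then show "(\<lambda>n. ennreal (D / (1 - t n))) \<longlonglongrightarrow> ennreal D" by (intro tendsto_ennrealI) simp
    qed
    finally show ?thesis .
  qed
  \<comment> \<open>Where \<open>h\<close> vanishes, \<open>f n\<close> tends to infinity, so
    \<open>w \<le> e f n\<close> holds there eventually for every \<open>e > 0\<close>. The part of
    \<open>w\<close> above \<open>e f n\<close> on this set vanishes in norm by dominated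
    convergence, and \<open>N (f n) \<le> 1\<close> leaves a norm of at most
    \<open>e\<close>.\<close>
  have hpos: "AE x in M. 0 < h x"
  proof -
    let ?u = "\<lambda>x. if h x \<le> 0 then w x else 0"
    have uL: "?u \<in> Lp" using w by (intro Lp_le[OF w(1)]) (auto simp: less_imp_le)
    have le_e: "N (cpx ?u) \<le> e" if e: "0 < e" for e
    proof -
      define k where "k n x = max 0 (?u x - e * f n x)" for n x
      have [measurable]: "k n \<in> borel_measurable M" for n unfolding k_def by measurable
      have kL: "k n \<in> Lp" for n
      proof (rule Lp_le[OF uL])
        show "AE x in M. k n x \<le> ?u x" using P0[OF f(1)] e w(2) by (auto simp: k_def less_imp_le)
      qed (auto simp: k_def)
      have efL: "(\<lambda>x. e * f n x) \<in> Lp" for n using f(1)[of n] e by (intro Lp_scale) (auto simp: P_def)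
      have Nk: "(\<lambda>n. N (cpx (k n))) \<longlonglongrightarrow> 0"
      proof (rule dominated_norm_convergence[OF uL])
        show "cpx (k n) \<in> borel_measurable M" for n by measurable
        show "AE x in M. cmod (cpx (k n) x) \<le> ?u x" for n using P0[OF f(1)] e w(2) by (auto simp: k_def less_imp_le)
        show "AE x in M. (\<lambda>n. cpx (k n) x) \<longlonglongrightarrow> 0" using gh h01
        proof eventually_elim
          case (elim x)
          have "\<forall>\<^sub>F n in sequentially. k n x = 0"
          proof (cases "h x \<le> 0")
            case True
            then have "(\<lambda>n. g n x) \<longlonglongrightarrow> 0" using elim by simp
            moreover have "0 < 1 / (1 + w x / e)" using w(2)[of x] e by (simp add: add_pos_pos)
            ultimately have "\<forall>\<^sub>F n in sequentially. g n x < 1 / (1 + w x / e)" by (rule order_tendstoD(2))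
            then show ?thesis
            proof eventually_elim
              case (elim n)
              then have "1 + w x / e < 1 + f n x" using P0[OF f(1), of n x] w(2)[of x] e
                by (simp add: g_def frac_less_eq divide_simps add_pos_pos mult.commute split: if_splits)
              then have "w x < e * f n x" using e by (simp add: field_simps)
              then show ?case using True by (simp add: k_def)
            qed
          next
            case False
            then show ?thesis using P0[OF f(1)] e by (simp add: k_def)
          qed
          then have "\<forall>\<^sub>F n in sequentially. cpx (k n) x = 0" by eventually_elim simp
          then show ?case by (rule tendsto_eventually)
        qed
      qed
      have "N (cpx ?u) \<le> e + N (cpx (k n))" for n
      proof -
        have "N (cpx ?u) \<le> N (cpx (\<lambda>x. e * f n x + k n x))"
          using w(2) by (intro Lp_norm_mono[OF Lp_add[OF efL kL] LpD(1)[OF uL]]) (auto simp: k_def less_imp_le)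
        also have "\<dots> \<le> N (cpx (\<lambda>x. e * f n x)) + N (cpx (k n))" using norm_triangle[OF LpD(3)[OF efL] LpD(3)[OF kL], of n n] by simp
        also have "N (cpx (\<lambda>x. e * f n x)) = e * N (cpx (f n))"
          using norm_scale[of "cpx (f n)" "of_real e"] f(1)[of n] e by (simp add: P_def LpD(3))
        also have "\<dots> \<le> e" using f(1)[of n] e by (simp add: P_def mult_left_le)
        finally show ?thesis by simp
      qed
      then show ?thesis using tendsto_add[OF tendsto_const Nk, of e] by (intro LIMSEQ_le_const) auto
    qed
    have "N (cpx ?u) \<le> 0" by (rule field_le_epsilon) (simp only: add_0_left le_e)
    then have "N (cpx ?u) = 0" using norm_nonneg[OF LpD(3)[OF uL]] by simp
    then have "AE x in M. cpx ?u x = 0" using norm_eq_zero_iff[OF LpD(3)[OF uL]] by simp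
    then show ?thesis by eventually_elim (use w(2) in \<open>auto simp: not_le less_imp_neq[symmetric] split: if_splits\<close>)
  qed
  \<comment> \<open>The value 1 on the null set where \<open>h\<close> is not positive makes the
    weight positive everywhere.\<close>
  define v where "v x = (if 0 < h x then d x * (h x)\<^sup>2 else 1)" for x
  have [measurable]: "v \<in> borel_measurable M" unfolding v_def by measurable
  have veq: "(\<integral>\<^sup>+x. ennreal (v x * q x) \<partial>M) = (\<integral>\<^sup>+x. ennreal (d x * (h x)\<^sup>2 * q x) \<partial>M)" for q
    using hpos by (intro nn_integral_cong_AE) (auto elim!: eventually_mono simp: v_def)
  have vfin: "(\<integral>\<^sup>+x. ennreal (v x * cmod (f x)) \<partial>M) \<le> ennreal (D * N f)" if f: "f \<in> L" for f
  proof (cases "N f = 0")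
    case True
    then have "AE x in M. f x = 0" using norm_eq_zero_iff[OF f] by simp
    then have "(\<integral>\<^sup>+x. ennreal (v x * cmod (f x)) \<partial>M) = (\<integral>\<^sup>+x. 0 \<partial>M)" by (intro nn_integral_cong_AE) (auto elim!: eventually_mono)
    then show ?thesis by simp
  next
    case False
    then have pos: "0 < N f" using norm_nonneg[OF f] by simp
    let ?q = "\<lambda>x. 1 / N f * cmod (f x)"
    have q: "?q \<in> Lp" using pos by (intro Lp_scale cmod_Lp f) auto
    have "N (cpx ?q) = 1 / N f * N f"
      using norm_scale[OF cmod_mem[OF f], of "of_real (1 / N f)"] norm_cmod[OF f] pos by (simp add: norm_divide)
    then have qP: "?q \<in> P" using q pos by (simp add: P_def)
    note [measurable] = measurable[OF f]
    have "(\<integral>\<^sup>+x. ennreal (v x * cmod (f x)) \<partial>M) = (\<integral>\<^sup>+x. ennreal (N f) * ennreal (v x * ?q x) \<partial>M)"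
      using pos by (intro nn_integral_cong) (simp flip: ennreal_mult')
    also have "\<dots> = ennreal (N f) * (\<integral>\<^sup>+x. ennreal (v x * ?q x) \<partial>M)" by (intro nn_integral_cmult) measurable
    also have "\<dots> \<le> ennreal (N f) * ennreal D" unfolding veq by (intro mult_left_mono main[OF qP]) auto
    also have "\<dots> = ennreal (D * N f)" using pos D0 by (simp flip: ennreal_mult' add: mult.commute)
    finally show ?thesis .
  qed
  have v0: "0 < v x" for x using d(2)[of x] by (simp add: v_def)
  have vint: "integrable M (\<lambda>x. v x * cmod (f x))" if f: "f \<in> L" for f
  proof (rule integrableI_nonneg)
    show "(\<lambda>x. v x * cmod (f x)) \<in> borel_measurable M" using measurable[OF f] by measurable
    show "(\<integral>\<^sup>+x. ennreal (v x * cmod (f x)) \<partial>M) < \<infinity>" by (rule order.strict_trans1[OF vfin[OF f]]) simp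
  qed (use v0 in \<open>auto simp: less_imp_le\<close>)
  have "(\<integral>x. v x * cmod (f x) \<partial>M) \<le> D * N f" if f: "f \<in> L" for f
  proof -
    have "ennreal (\<integral>x. v x * cmod (f x) \<partial>M) \<le> ennreal (D * N f)"
      using vfin[OF f] nn_integral_eq_integral[OF vint[OF f]] v0 by (simp add: less_imp_le)
    then show ?thesis using D0 norm_nonneg[OF f] by simp
  qed
  then show ?thesis using that[of v D] v0 D0 vint by simp
qed

text \<open>Otherwise some \<open>h n\<close> below \<open>g\<close> have weighted integrals at most
  \<open>(1/2)^n\<close> and norms above \<open>e\<close>. Summability makes them tend to 0 a.e.,
  and dominated convergence in norm gives a contradiction.\<close>

lemma norm_small_of_weighted_integral_small:
  assumes v: "v \<in> borel_measurable M" "\<And>x. 0 < v x" and vint: "\<And>f. f \<in> L \<Longrightarrow> integrable M (\<lambda>x. v x * cmod (f x))"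
    and g: "g \<in> Lp" and e: "0 < (e :: real)"
  obtains c where "0 < c" "\<And>h. h \<in> L \<Longrightarrow> AE x in M. cmod (h x) \<le> g x \<Longrightarrow> (\<integral>x. v x * cmod (h x) \<partial>M) \<le> c \<Longrightarrow> N h \<le> e"
proof -
  have "\<exists>c>0. \<forall>h\<in>L. (AE x in M. cmod (h x) \<le> g x) \<longrightarrow> (\<integral>x. v x * cmod (h x) \<partial>M) \<le> c \<longrightarrow> N h \<le> e"
  proof (rule ccontr)
    assume "\<not> ?thesis"
    then have "\<exists>h\<in>L. (AE x in M. cmod (h x) \<le> g x) \<and> (\<integral>x. v x * cmod (h x) \<partial>M) \<le> (1/2)^n \<and> e < N h" for n :: nat
      by (auto simp: not_le dest!: spec[of _ "(1/2)^n"])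
    then obtain h where h: "\<And>n. h n \<in> L" "\<And>n. AE x in M. cmod (h n x) \<le> g x"
      "\<And>n. (\<integral>x. v x * cmod (h n x) \<partial>M) \<le> (1/2)^n" "\<And>n. e < N (h n)" by metis
    note [measurable] = measurable[OF h(1)] v(1)
    have "(\<lambda>n. N (h n)) \<longlonglongrightarrow> 0"
    proof (rule dominated_norm_convergence[OF g measurable[OF h(1)] h(2)])
      have "(\<integral>\<^sup>+x. (\<Sum>n. ennreal (v x * cmod (h n x))) \<partial>M) = (\<Sum>n. \<integral>\<^sup>+x. ennreal (v x * cmod (h n x)) \<partial>M)"
        by (intro nn_integral_suminf) measurable
      also have "\<dots> \<le> (\<Sum>n. ennreal ((1/2)^n))"
      proof (intro suminf_le)
        fix n
        have "(\<integral>\<^sup>+x. ennreal (v x * cmod (h n x)) \<partial>M) = ennreal (\<integral>x. v x * cmod (h n x) \<partial>M)"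
          using v(2) by (intro nn_integral_eq_integral vint h) (simp add: less_imp_le)
        then show "(\<integral>\<^sup>+x. ennreal (v x * cmod (h n x)) \<partial>M) \<le> ennreal ((1/2)^n)" using h(3)[of n] by (simp add: ennreal_leI)
      qed auto
      also have "\<dots> = ennreal (\<Sum>n. (1/2)^n)" by (intro suminf_ennreal2) (auto intro!: summable_geometric)
      finally have "(\<integral>\<^sup>+x. (\<Sum>n. ennreal (v x * cmod (h n x))) \<partial>M) \<noteq> \<infinity>" by (auto simp: top_unique)
      then have "AE x in M. (\<Sum>n. ennreal (v x * cmod (h n x))) \<noteq> \<infinity>" by (intro nn_integral_PInf_AE) measurable
      then show "AE x in M. (\<lambda>n. h n x) \<longlonglongrightarrow> 0"
      proof eventually_elim
        case (elim x)
        have "summable (\<lambda>n. v x * cmod (h n x))" using elim v(2)[of x] by (intro summable_suminf_not_top) (auto simp: less_imp_le)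
        then have "(\<lambda>n. 1 / v x * (v x * cmod (h n x))) \<longlonglongrightarrow> 1 / v x * 0" by (intro tendsto_mult tendsto_const summable_LIMSEQ_zero)
        then have "(\<lambda>n. cmod (h n x)) \<longlonglongrightarrow> 0" using v(2)[of x] by (simp add: less_imp_neq[symmetric])
        then show ?case by (rule tendsto_norm_zero_cancel)
      qed
    qed
    then have "\<forall>\<^sub>F n in sequentially. N (h n) < e" using e by (rule order_tendstoD)
    then show False using h(4) by (auto simp: eventually_sequentially dest: less_asym)
  qed
  then show ?thesis using that by blast
qed

text \<open>
  Order continuity of the dual norm enters here: a functional \<open>\<integral> t f\<close> is uniformly small on the tails
  \<open>(f - k w)\<^sup>+\<close> of the functions \<open>f\<close> of the unit ball. Otherwise restrict it to the sets
  \<open>\<Union>\<^sub>n\<^sub>\<ge>\<^sub>m {f\<^sub>n > 2\<^sup>n w}\<close>, which decrease to a null set of \<open>t\<close>.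
\<close>

lemma dual_tail_small:
  assumes t: "t \<in> borel_measurable M" "\<And>x. 0 \<le> t x" and tint: "\<And>f. f \<in> L \<Longrightarrow> integrable M (\<lambda>x. t x * cmod (f x))"
    and tC: "\<And>f. f \<in> L \<Longrightarrow> (\<integral>x. t x * cmod (f x) \<partial>M) \<le> C * N f" and C: "0 \<le> C"
    and w: "w \<in> Lp" "\<And>x. 0 < w x" and e: "0 < (e :: real)"
  obtains k where "0 \<le> k" "\<And>f. f \<in> Lp \<Longrightarrow> N (cpx f) \<le> 1 \<Longrightarrow> (\<integral>x. t x * max 0 (f x - k * w x) \<partial>M) \<le> e"
proof -
  have "\<exists>k\<ge>0. \<forall>f\<in>Lp. N (cpx f) \<le> 1 \<longrightarrow> (\<integral>x. t x * max 0 (f x - k * w x) \<partial>M) \<le> e"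
  proof (rule ccontr)
    assume "\<not> ?thesis"
    then have "\<exists>f\<in>Lp. N (cpx f) \<le> 1 \<and> e < (\<integral>x. t x * max 0 (f x - 2^n * w x) \<partial>M)" for n :: nat
      by (auto simp: not_le dest!: spec[of _ "2^n"])
    then obtain f where f: "\<And>n. f n \<in> Lp" "\<And>n. N (cpx (f n)) \<le> 1" "\<And>n. e < (\<integral>x. t x * max 0 (f n x - 2^n * w x) \<partial>M)" by metis
    note [measurable] = t(1) LpD(1)[OF f(1)] LpD(1)[OF w(1)]
    note f0 = LpD(2)[OF f(1)]
    have fint: "integrable M (\<lambda>x. t x * q x)" if "q \<in> Lp" for q
      using tint[OF LpD(3)[OF that]] LpD(2)[OF that] by (simp add: abs_of_nonneg)
    \<comment> \<open>By Markov's inequality the mass of \<open>t w\<close> on \<open>E n\<close> is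
      at most \<open>C (1/2)^n\<close>. The thresholds \<open>2^n\<close> make this summable, so
      almost every point with \<open>t x > 0\<close> lies in finitely many
      \<open>E n\<close>.\<close>
    define E where "E n = {x\<in>space M. 2^n * w x < f n x}" for n
    have [measurable]: "E n \<in> sets M" for n unfolding E_def by measurable
    define F where "F m = (\<Union>n\<in>{m..}. E n)" for m
    have [measurable]: "F m \<in> sets M" for m unfolding F_def by measurable
    have "(\<integral>\<^sup>+x. ennreal (t x * w x * indicator (E n) x) \<partial>M) \<le> ennreal (C * (1/2)^n)" for n
    proof -
      have le: "t x * w x * indicator (E n) x \<le> (1/2)^n * (t x * f n x)" for x
      proof -
        have "w x * indicator (E n) x \<le> (1/2)^n * f n x"
        proof (cases "x \<in> E n")
          case True
          then have "(1/2)^n * (2^n * w x) \<le> (1/2)^n * f n x" by (intro mult_left_mono) (auto simp: E_def)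
          moreover have "(1/2::real)^n * 2^n = 1" by (simp flip: power_mult_distrib)
          ultimately show ?thesis using True by (simp add: mult.assoc[symmetric])
        qed (use f0 in simp)
        then have "t x * (w x * indicator (E n) x) \<le> t x * ((1/2)^n * f n x)" using t(2) by (intro mult_left_mono) auto
        then show ?thesis by (simp add: mult_ac)
      qed
      have "(\<integral>\<^sup>+x. ennreal (t x * w x * indicator (E n) x) \<partial>M) \<le> (\<integral>\<^sup>+x. ennreal ((1/2)^n * (t x * f n x)) \<partial>M)"
        by (intro nn_integral_mono ennreal_leI le)
      also have "\<dots> = ennreal (\<integral>x. (1/2)^n * (t x * f n x) \<partial>M)"
        using fint[OF f(1)] t(2) f0 by (intro nn_integral_eq_integral) auto
      also have "(\<integral>x. (1/2)^n * (t x * f n x) \<partial>M) = (1/2)^n * (\<integral>x. t x * f n x \<partial>M)" by simp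
      also have "\<dots> \<le> (1/2)^n * C"
      proof (rule mult_left_mono)
        have "(\<integral>x. t x * f n x \<partial>M) \<le> C * N (cpx (f n))" using tC[OF LpD(3)[OF f(1)], of n] f0 by (simp add: abs_of_nonneg)
        also have "\<dots> \<le> C" using f(2)[of n] C by (simp add: mult_left_le)
        finally show "(\<integral>x. t x * f n x \<partial>M) \<le> C" .
      qed simp
      finally show ?thesis by (simp add: mult.commute ennreal_leI)
    qed
    then have "(\<Sum>n. \<integral>\<^sup>+x. ennreal (t x * w x * indicator (E n) x) \<partial>M) \<le> (\<Sum>n. ennreal (C * (1/2)^n))" by (intro suminf_le) auto
    also have "\<dots> = ennreal (\<Sum>n. C * (1/2)^n)" using C by (intro suminf_ennreal2) (auto intro!: summable_mult summable_geometric)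
    finally have "(\<Sum>n. \<integral>\<^sup>+x. ennreal (t x * w x * indicator (E n) x) \<partial>M) \<noteq> \<infinity>" by (auto simp: top_unique)
    moreover have "(\<integral>\<^sup>+x. (\<Sum>n. ennreal (t x * w x * indicator (E n) x)) \<partial>M) = (\<Sum>n. \<integral>\<^sup>+x. ennreal (t x * w x * indicator (E n) x) \<partial>M)"
      by (intro nn_integral_suminf) measurable
    ultimately have "AE x in M. (\<Sum>n. ennreal (t x * w x * indicator (E n) x)) \<noteq> \<infinity>" by (intro nn_integral_PInf_AE) (simp_all, measurable)
    then have Flim: "AE x in M. (\<lambda>m. t x * indicator (F m) x) \<longlonglongrightarrow> 0"
    proof eventually_elim
      case (elim x)
      show ?case
      proof (cases "t x = 0")
        case False
        then have tw: "0 < t x * w x" using t(2)[of x] w(2)[of x] by simp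
        have "summable (\<lambda>n. t x * w x * indicator (E n) x)" using elim t(2)[of x] w(2)[of x] by (intro summable_suminf_not_top) (auto simp: less_imp_le)
        then have "(\<lambda>n. t x * w x * indicator (E n) x) \<longlonglongrightarrow> 0" by (rule summable_LIMSEQ_zero)
        then have "\<forall>\<^sub>F n in sequentially. t x * w x * indicator (E n) x < t x * w x" using tw by (rule order_tendstoD)
        then obtain n0 where "\<And>n. n \<ge> n0 \<Longrightarrow> t x * w x * indicator (E n) x < t x * w x" by (auto simp: eventually_sequentially)
        then have "x \<notin> E n" if "n \<ge> n0" for n using that by (force simp: indicator_def split: if_splits)
        then have "x \<notin> F m" if "m \<ge> n0" for m using that by (auto simp: F_def)
        then have "\<forall>\<^sub>F m in sequentially. t x * indicator (F m) x = 0"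
          by (intro eventually_sequentiallyI[of n0]) simp
        then show ?thesis by (rule tendsto_eventually)
      qed simp
    qed
    define \<phi> where "\<phi> m q = (\<integral>x. of_real (t x * indicator (F m) x) * q x \<partial>M)" for m and q :: "'a cfun"
    have i: "integrable M (\<lambda>x. of_real (t x * indicator (F m) x) * q x)" if q: "q \<in> L" for q m
    proof (rule Bochner_Integration.integrable_bound[OF tint[OF q]])
      show "AE x in M. norm (of_real (t x * indicator (F m) x) * q x) \<le> norm (t x * cmod (q x))"
        using t(2) by (auto simp: norm_mult indicator_def abs_mult)
    qed (use measurable[OF q] in measurable)
    have phi_le: "cmod (\<phi> m q) \<le> C * N q" if q: "q \<in> L" for q m
    proof -
      have "cmod (\<phi> m q) \<le> (\<integral>x. norm (of_real (t x * indicator (F m) x) * q x) \<partial>M)" unfolding \<phi>_def by (rule integral_norm_bound)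
      also have "\<dots> \<le> (\<integral>x. t x * cmod (q x) \<partial>M)"
        using t(2) by (intro integral_mono integrable_norm i q tint) (auto simp: norm_mult indicator_def abs_mult)
      also have "\<dots> \<le> C * N q" by (rule tC[OF q])
      finally show ?thesis .
    qed
    have dual: "\<phi> m \<in> dual_space L N" for m unfolding dual_space_def
    proof (intro CollectI conjI ballI allI exI[of _ C])
      fix q assume q: "q \<in> L"
      show "\<phi> m (\<lambda>x. c * q x) = c * \<phi> m q" for c
        unfolding \<phi>_def by (simp only: mult.left_commute[of _ c] Bochner_Integration.integral_mult_right_zero)
      show "cmod (\<phi> m q) \<le> C * N q" by (rule phi_le[OF q])
      fix q' assume q': "q' \<in> L"
      show "\<phi> m (\<lambda>x. q x + q' x) = \<phi> m q + \<phi> m q'"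
        unfolding \<phi>_def using i[OF q, of m] i[OF q', of m] by (simp add: distrib_left)
    qed
    have nonneg: "(\<integral>x. of_real (s x) * q x \<partial>M) \<in> \<real>\<^sub>\<ge>\<^sub>0"
      if "AE x in M. q x \<in> \<real>\<^sub>\<ge>\<^sub>0" "\<And>x. 0 \<le> s x" "s \<in> borel_measurable M" "q \<in> borel_measurable M" for s :: "'a \<Rightarrow> real" and q :: "'a cfun"
    proof -
      have "(\<integral>x. of_real (s x) * q x \<partial>M) = (\<integral>x. of_real (s x * cmod (q x)) \<partial>M)"
        using that by (intro integral_cong_AE) (auto elim!: eventually_mono nonneg_Reals_cases)
      then show ?thesis using that(2) by (simp only: integral_complex_of_real nonneg_Reals_of_real_iff) (simp add: Bochner_Integration.integral_nonneg)
    qed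
    \<comment> \<open>The infimum of the \<open>\<phi> m\<close> in the dual is 0: a lower bound
      \<open>q\<close> satisfies \<open>q h \<le> \<phi> m h\<close> for nonnegative
      \<open>h\<close>, and the right side tends to 0 by dominated convergence.\<close>
    have "(\<lambda>m. dual_norm L N (\<phi> m)) \<longlonglongrightarrow> 0"
    proof -
      have 1: "\<forall>m. \<phi> m \<in> dual_space L N \<and> dual_le M L (\<lambda>_. 0) (\<phi> m) \<and> dual_le M L (\<phi> (Suc m)) (\<phi> m)"
      proof (intro allI conjI dual)
        fix m
        show "dual_le M L (\<lambda>_. 0) (\<phi> m)" unfolding dual_le_def ae_le_def \<phi>_def
          using t(2) by (auto intro!: nonneg measurable simp del: of_real_mult)
        have "\<phi> m q - \<phi> (Suc m) q = (\<integral>x. of_real (t x * indicator (F m - F (Suc m)) x) * q x \<partial>M)" if q: "q \<in> L" for q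
        proof -
          have sub: "F (Suc m) \<subseteq> F m" unfolding F_def by (intro UN_mono) auto
          have "\<phi> m q - \<phi> (Suc m) q = (\<integral>x. of_real (t x * indicator (F m) x) * q x - of_real (t x * indicator (F (Suc m)) x) * q x \<partial>M)"
            unfolding \<phi>_def using i[OF q, of m] i[OF q, of "Suc m"] by simp
          also have "\<dots> = (\<integral>x. of_real (t x * indicator (F m - F (Suc m)) x) * q x \<partial>M)"
            using sub by (intro Bochner_Integration.integral_cong) (auto simp: indicator_def)
          finally show ?thesis .
        qed
        then show "dual_le M L (\<phi> (Suc m)) (\<phi> m)" unfolding dual_le_def ae_le_def
          using t(2) by (auto intro!: nonneg measurable simp del: of_real_mult)
      qed
      have 2: "\<forall>q\<in>dual_space L N. (\<forall>m. dual_le M L q (\<phi> m)) \<longrightarrow> dual_le M L q (\<lambda>_. 0)"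
      proof (intro ballI impI)
        fix q assume q: "\<forall>m. dual_le M L q (\<phi> m)"
        show "dual_le M L q (\<lambda>_. 0)" unfolding dual_le_def
        proof (intro ballI impI)
          fix h assume h: "h \<in> L" "ae_le M (\<lambda>_. 0) h"
          note [measurable] = measurable[OF h(1)]
          have "(\<lambda>m. \<phi> m h) \<longlonglongrightarrow> (\<integral>x. 0 \<partial>M)" unfolding \<phi>_def
          proof (rule integral_dominated_convergence[OF _ _ tint[OF h(1)]])
            show "AE x in M. (\<lambda>m. of_real (t x * indicator (F m) x) * h x) \<longlonglongrightarrow> 0" using Flim
            proof eventually_elim
              case (elim x)
              have "(\<lambda>m. of_real (t x * indicator (F m) x) * h x) \<longlonglongrightarrow> of_real 0 * h x" by (intro tendsto_mult tendsto_of_real elim tendsto_const)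
              then show ?case by simp
            qed
            show "AE x in M. norm (of_real (t x * indicator (F m) x) * h x) \<le> t x * cmod (h x)" for m
              using t(2) by (auto simp: norm_mult indicator_def abs_mult)
          qed measurable
          then have "(\<lambda>m. \<phi> m h - q h) \<longlonglongrightarrow> 0 - q h" by (intro tendsto_diff tendsto_const) simp
          moreover have "\<phi> m h - q h \<in> \<real>\<^sub>\<ge>\<^sub>0" for m using q h unfolding dual_le_def by blast
          ultimately show "0 - q h \<in> \<real>\<^sub>\<ge>\<^sub>0" using closed_sequentially[OF closed_nonneg_Reals_complex, of "\<lambda>m. \<phi> m h - q h"] by blast
        qed
      qed
      show ?thesis by (rule mp[OF spec[OF order_continuous_dual[unfolded order_continuous_norm_def]] conjI[OF 1 2]])
    qed
    then have "\<forall>\<^sub>F m in sequentially. dual_norm L N (\<phi> m) < e" using e by (rule order_tendstoD)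
    then obtain m where m: "dual_norm L N (\<phi> m) < e" using eventually_happens'[OF sequentially_bot] by blast
    have maxL: "(\<lambda>x. max 0 (f m x - 2^m * w x)) \<in> Lp"
    proof (rule Lp_le[OF f(1)])
      show "AE x in M. max 0 (f m x - 2 ^ m * w x) \<le> f m x" using f0 w(2) by (auto simp: less_imp_le)
    qed auto
    have FL: "(\<lambda>x. f m x * indicator (F m) x) \<in> Lp" using f0 by (intro Lp_le[OF f(1)]) (auto simp: indicator_def)
    \<comment> \<open>The tail of \<open>f m\<close> lives on \<open>E m \<subseteq> F m\<close>, so
      it is seen by \<open>\<phi> m\<close>, whose norm is below \<open>e\<close>.\<close>
    have "(\<integral>x. t x * max 0 (f m x - 2^m * w x) \<partial>M) \<le> (\<integral>x. t x * (f m x * indicator (F m) x) \<partial>M)"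
    proof (rule integral_mono[OF fint[OF maxL] fint[OF FL]])
      fix x assume "x \<in> space M"
      have "max 0 (f m x - 2^m * w x) \<le> f m x * indicator (F m) x"
      proof (cases "2^m * w x < f m x")
        case True
        then have "x \<in> F m" using \<open>x \<in> space M\<close> by (auto simp: F_def E_def)
        then show ?thesis using f0[of m x] w(2)[of x] by (simp add: less_imp_le)
      qed (use f0 in \<open>auto simp: indicator_def\<close>)
      then show "t x * max 0 (f m x - 2^m * w x) \<le> t x * (f m x * indicator (F m) x)" using t(2) by (intro mult_left_mono) auto
    qed
    also have "\<dots> = Re (\<phi> m (cpx (f m)))"
    proof -
      have "\<phi> m (cpx (f m)) = (\<integral>x. of_real (t x * (f m x * indicator (F m) x)) \<partial>M)"
        unfolding \<phi>_def by (intro Bochner_Integration.integral_cong) (auto simp: mult_ac)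
      then show ?thesis by (simp only: integral_complex_of_real Re_complex_of_real)
    qed
    also have "\<dots> \<le> cmod (\<phi> m (cpx (f m)))" by (rule complex_Re_le_cmod)
    also have "\<dots> \<le> dual_norm L N (\<phi> m)" unfolding dual_norm_def
    proof (rule cSup_upper)
      show "cmod (\<phi> m (cpx (f m))) \<in> {cmod (\<phi> m q) |q. q \<in> L \<and> N q \<le> 1}" using LpD(3)[OF f(1)] f(2) by blast
      show "bdd_above {cmod (\<phi> m q) |q. q \<in> L \<and> N q \<le> 1}"
      proof (rule bdd_aboveI[of _ C], clarify)
        fix q assume q: "q \<in> L" "N q \<le> 1"
        show "cmod (\<phi> m q) \<le> C" using phi_le[OF q(1), of m] mult_left_mono[OF q(2) C] by simp
      qed
    qed
    also have "\<dots> < e" by (rule m)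
    finally show False using f(3)[of m] by simp
  qed
  then show ?thesis using that by blast
qed

text \<open>An element of the interval is \<open>u \<theta>\<close> for a unit function
  \<open>\<theta>\<close>, so \<open>v A f\<close> comes from the integrable kernel
  \<open>v a u\<close>. Each cell of a finite cover then has an image of small diameter for the
  integral with weight \<open>v\<close>, and of small norm diameter because all differences lie
  below \<open>2 |A u|\<close>.\<close>

lemma order_interval_net:
  assumes A: "A \<in> kernel_ops" and u: "u \<in> Lp" and e: "0 < (e::real)"
  obtains F where "finite F" "F \<subseteq> L" "\<And>f. f \<in> L \<Longrightarrow> AE x in M. cmod (f x) \<le> u x \<Longrightarrow> \<exists>g\<in>F. N (\<lambda>x. A f x - g x) \<le> e"
proof -
  obtain a where a: "nonneg_kernel A a" using A by (auto simp: kernel_ops_def)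
  obtain v C where v: "v \<in> borel_measurable M" "\<And>x. 0 < v x" and vint: "\<And>f. f \<in> L \<Longrightarrow> integrable M (\<lambda>x. v x * cmod (f x))"
    by (rule obtain_dual_weight) blast
  define h where "h = (\<lambda>p. v (fst p) * a p * u (snd p))"
  have h: "integrable (M \<Otimes>\<^sub>M M) h" unfolding h_def by (rule weighted_kernel_integrable[OF a v vint u])
  let ?g = "\<lambda>x. 2 * cmod (A (cpx u) x)"
  have g: "?g \<in> Lp" by (intro Lp_scale kernel_Lp A u) simp
  obtain c where c: "0 < c" "\<And>k. k \<in> L \<Longrightarrow> AE x in M. cmod (k x) \<le> ?g x \<Longrightarrow> (\<integral>x. v x * cmod (k x) \<partial>M) \<le> c \<Longrightarrow> N k \<le> e"
    by (rule norm_small_of_weighted_integral_small[OF v vint g e]) blast+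
  obtain T where T: "finite T" "unit_functions \<subseteq> \<Union>T"
    "\<And>S \<theta> \<theta>'. S \<in> T \<Longrightarrow> \<theta> \<in> S \<inter> unit_functions \<Longrightarrow> \<theta>' \<in> S \<inter> unit_functions \<Longrightarrow> kernel_dist h \<theta> \<theta>' \<le> c"
    using integrable_kernel_totally_bounded[OF h] c(1) unfolding kernel_totally_bounded_def by meson
  define I where "I = {f\<in>L. AE x in M. cmod (f x) \<le> u x}"
  \<comment> \<open>The quotient \<open>f / u\<close>, set to 0 where \<open>u\<close> vanishes and
    on the null set where \<open>|f| \<le> u\<close> fails.\<close>
  define th where "th f x = (if cmod (f x) \<le> u x \<and> u x \<noteq> 0 then f x / of_real (u x) else 0)" for f x
  note [measurable] = LpD(1)[OF u]
  have th: "th f \<in> unit_functions" "AE x in M. f x = of_real (u x) * th f x" if f: "f \<in> I" for f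
  proof -
    have [measurable]: "f \<in> borel_measurable M" using f measurable by (auto simp: I_def)
    have "cmod (th f x) \<le> 1" for x using LpD(2)[OF u, of x] by (auto simp: th_def norm_divide)
    then show "th f \<in> unit_functions" unfolding unit_functions_def th_def by auto
    have "AE x in M. cmod (f x) \<le> u x" using f by (simp add: I_def)
    then show "AE x in M. f x = of_real (u x) * th f x" by eventually_elim (auto simp: th_def)
  qed
  have close: "N (\<lambda>x. A f x - A f' x) \<le> e" if f: "f \<in> I" "f' \<in> I" "S \<in> T" "th f \<in> S" "th f' \<in> S" for f f' S
  proof (rule c(2))
    have fL: "f \<in> L" "f' \<in> L" and fu: "AE x in M. cmod (f x) \<le> u x" "AE x in M. cmod (f' x) \<le> u x" using f by (auto simp: I_def)
    show "(\<lambda>x. A f x - A f' x) \<in> L" by (intro diff_mem kernel_mem[OF A] fL)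
    have up: "AE x in M. cmod (A q x) \<le> cmod (A (cpx u) x)" if "q \<in> L" "AE x in M. cmod (q x) \<le> u x" for q
      using kernel_cmod_le[OF A that(1)] kernel_mono[OF A cmod_Lp[OF that(1)] u that(2)] by eventually_elim simp
    show "AE x in M. cmod (A f x - A f' x) \<le> ?g x" using up[OF fL(1) fu(1)] up[OF fL(2) fu(2)]
    proof eventually_elim
      case (elim x) then show ?case using norm_triangle_ineq4[of "A f x" "A f' x"] by simp
    qed
    have "(\<integral>x. v x * cmod (A f x - A f' x) \<partial>M) = kernel_dist h (th f) (th f')" unfolding kernel_dist_def
    proof (rule integral_cong_AE)
      have [measurable]: "h \<in> borel_measurable (M \<Otimes>\<^sub>M M)" "th f \<in> borel_measurable M" "th f' \<in> borel_measurable M" using h th(1) f by (auto simp: unit_functions_def)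
      show "(\<lambda>x. v x * cmod (A f x - A f' x)) \<in> borel_measurable M" using measurable[OF kernel_mem[OF A fL(1)]] measurable[OF kernel_mem[OF A fL(2)]] v(1) by measurable
      show "(\<lambda>x. cmod (\<integral>y. of_real (h (x, y)) * (th f y - th f' y) \<partial>M)) \<in> borel_measurable M" by measurable
      show "AE x in M. v x * cmod (A f x - A f' x) = cmod (\<integral>y. of_real (h (x, y)) * (th f y - th f' y) \<partial>M)"
        using nonneg_kernelD(4)[OF a fL(1)] nonneg_kernelD(4)[OF a fL(2)] AE_space
      proof eventually_elim
        case (elim x)
        note [measurable] = nonneg_kernelD(2)[OF a] measurable[OF fL(1)] measurable[OF fL(2)] elim(3)
        have "(\<integral>y. of_real (h (x, y)) * (th f y - th f' y) \<partial>M) = (\<integral>y. of_real (v x) * (of_real (a (x, y)) * f y - of_real (a (x, y)) * f' y) \<partial>M)"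
        proof (rule integral_cong_AE)
          show "AE y in M. of_real (h (x, y)) * (th f y - th f' y) = of_real (v x) * (of_real (a (x, y)) * f y - of_real (a (x, y)) * f' y)"
            using th(2)[OF f(1)] th(2)[OF f(2)] by eventually_elim (simp add: h_def algebra_simps)
        qed measurable
        also have "\<dots> = of_real (v x) * (A f x - A f' x)" using elim by simp
        finally show ?case using v(2)[of x] by (simp add: norm_mult)
      qed
    qed
    also have "\<dots> \<le> c" using th(1)[OF f(1)] th(1)[OF f(2)] f by (intro T(3)[OF f(3)]) auto
    finally show "(\<integral>x. v x * cmod (A f x - A f' x) \<partial>M) \<le> c" .
  qed
  define pick where "pick S = (SOME f. f \<in> I \<and> th f \<in> S)" for S
  let ?F = "(\<lambda>S. A (pick S)) ` {S\<in>T. \<exists>f\<in>I. th f \<in> S}"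
  have pick: "pick S \<in> I" "th (pick S) \<in> S" if "\<exists>f\<in>I. th f \<in> S" for S
    using someI_ex[of "\<lambda>f. f \<in> I \<and> th f \<in> S"] that unfolding pick_def by blast+
  show ?thesis
  proof (rule that[of ?F])
    show "finite ?F" using T(1) by simp
    show "?F \<subseteq> L" using pick kernel_mem[OF A] by (auto simp: I_def)
    fix f assume "f \<in> L" "AE x in M. cmod (f x) \<le> u x"
    then have f: "f \<in> I" by (simp add: I_def)
    then obtain S where S: "S \<in> T" "th f \<in> S" using th(1)[OF f] T(2) by blast
    then have "N (\<lambda>x. A f x - A (pick S) x) \<le> e" using pick[of S] f by (intro close[of _ _ S]) auto
    then show "\<exists>g\<in>?F. N (\<lambda>x. A f x - g x) \<le> e" using S f by blast
  qed
qed

text \<open>The functional \<open>f \<mapsto> \<integral> v A f\<close> has the density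
  \<open>t\<close>, so it is small on tails by \<open>dual_tail_small\<close>. The image of a tail
  is cut at \<open>g\<close>: the part below has a small weighted integral, hence norm at most
  \<open>e\<close>, and the part above has norm at most \<open>\<delta>\<close>.\<close>

lemma kernel_tail_small:
  assumes A: "A \<in> bounded_kernel_ops" and ob: "almost_order_bounded A \<delta>"
    and w: "w \<in> Lp" "\<And>x. 0 < w x" and e: "0 < (e::real)"
  obtains k where "0 \<le> k"
    "\<And>f. f \<in> Lp \<Longrightarrow> N (cpx f) \<le> 1 \<Longrightarrow> N (A (cpx (\<lambda>x. max 0 (f x - k * w x)))) \<le> \<delta> + e"
proof -
  note Ak = bounded_kernel_opsD(1)[OF A] and Ab = bounded_kernel_opsD(2)[OF A]
  obtain a where a: "nonneg_kernel A a" using Ak by (auto simp: kernel_ops_def)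
  obtain v C where v: "v \<in> borel_measurable M" "\<And>x. 0 < v x" and vint: "\<And>f. f \<in> L \<Longrightarrow> integrable M (\<lambda>x. v x * cmod (f x))"
    and vC: "\<And>f. f \<in> L \<Longrightarrow> (\<integral>x. v x * cmod (f x) \<partial>M) \<le> C * N f" and C: "0 \<le> C"
    by (rule obtain_dual_weight) blast
  note [measurable] = v(1) nonneg_kernelD(2)[OF a]
  define t where "t y = (\<integral>x. v x * a (x, y) \<partial>M)" for y
  have t: "t \<in> borel_measurable M" unfolding t_def by measurable
  have t0: "0 \<le> t y" for y unfolding t_def using v(2) nonneg_kernelD(3)[OF a] by (simp add: less_imp_le)
  have tA: "integrable M (\<lambda>y. t y * f y)" "(\<integral>y. t y * f y \<partial>M) = (\<integral>x. v x * cmod (A (cpx f) x) \<partial>M)" if f: "f \<in> Lp" for f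
  proof -
    note [measurable] = LpD(1)[OF f]
    have "integrable (M \<Otimes>\<^sub>M M) (\<lambda>p. v (fst p) * a p * f (snd p))" by (rule weighted_kernel_integrable[OF a v vint f])
    then have i: "integrable (M \<Otimes>\<^sub>M M) (\<lambda>(x, y). v x * a (x, y) * f y)" by (simp add: case_prod_beta')
    have eq: "(\<integral>x. v x * a (x, y) * f y \<partial>M) = t y * f y" for y unfolding t_def by simp
    show "integrable M (\<lambda>y. t y * f y)" using pair.integrable_snd[OF i] unfolding eq .
    have "(\<integral>y. t y * f y \<partial>M) = (\<integral>x. \<integral>y. v x * a (x, y) * f y \<partial>M \<partial>M)" using pair.Fubini_integral[OF i] unfolding eq .
    also have "\<dots> = (\<integral>x. v x * cmod (A (cpx f) x) \<partial>M)"
    proof (rule integral_cong_AE)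
      show "AE x in M. (\<integral>y. v x * a (x, y) * f y \<partial>M) = v x * cmod (A (cpx f) x)"
        using nonneg_kernel_real[OF a LpD(3)[OF f]]
      proof eventually_elim
        case (elim x)
        have "0 \<le> (\<integral>y. a (x, y) * f y \<partial>M)" using nonneg_kernelD(3)[OF a] LpD(2)[OF f] by simp
        then show ?case using elim by (simp add: mult.assoc)
      qed
      show "(\<lambda>x. v x * cmod (A (cpx f) x)) \<in> borel_measurable M" using measurable[OF kernel_mem[OF Ak LpD(3)[OF f]]] by measurable
    qed measurable
    finally show "(\<integral>y. t y * f y \<partial>M) = (\<integral>x. v x * cmod (A (cpx f) x) \<partial>M)" .
  qed
  have tC: "(\<integral>x. t x * cmod (f x) \<partial>M) \<le> (C * op_norm L N A) * N f" if f: "f \<in> L" for f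
  proof -
    have "(\<integral>x. t x * cmod (f x) \<partial>M) \<le> C * N (A (cpx (\<lambda>x. cmod (f x))))"
      unfolding tA(2)[OF cmod_Lp[OF f]] by (rule vC[OF kernel_mem[OF Ak cmod_mem[OF f]]])
    also have "\<dots> \<le> C * (op_norm L N A * N f)"
      using op_norm_upper[OF Ab cmod_mem[OF f]] norm_cmod[OF f] C by (intro mult_left_mono) auto
    finally show ?thesis by (simp add: mult.assoc)
  qed
  obtain g where g: "g \<in> Lp" "\<And>f. f \<in> L \<Longrightarrow> N f \<le> 1 \<Longrightarrow> N (cpx (\<lambda>x. max 0 (cmod (A f x) - g x))) \<le> \<delta>"
    using ob unfolding almost_order_bounded_def by blast
  obtain c where c: "0 < c" "\<And>h. h \<in> L \<Longrightarrow> AE x in M. cmod (h x) \<le> g x \<Longrightarrow> (\<integral>x. v x * cmod (h x) \<partial>M) \<le> c \<Longrightarrow> N h \<le> e"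
    by (rule norm_small_of_weighted_integral_small[OF v vint g(1) e]) blast+
  have C': "0 \<le> C * op_norm L N A" using C op_norm_nonneg[OF Ab] by simp
  obtain k where k: "0 \<le> k" "\<And>f. f \<in> Lp \<Longrightarrow> N (cpx f) \<le> 1 \<Longrightarrow> (\<integral>x. t x * max 0 (f x - k * w x) \<partial>M) \<le> c"
    using dual_tail_small[OF t t0 tA(1)[OF cmod_Lp] tC C' w c(1)] by blast
  have "N (A (cpx (\<lambda>x. max 0 (f x - k * w x)))) \<le> \<delta> + e" if f: "f \<in> Lp" "N (cpx f) \<le> 1" for f
  proof -
    let ?f = "\<lambda>x. max 0 (f x - k * w x)"
    note [measurable] = LpD(1)[OF f(1)] LpD(1)[OF w(1)] LpD(1)[OF g(1)]
    have f'le: "?f x \<le> f x" for x using LpD(2)[OF f(1), of x] k(1) w(2)[of x] by simp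
    have f'L: "?f \<in> Lp" using f'le by (intro Lp_le[OF f(1)]) auto
    let ?q = "\<lambda>x. cmod (A (cpx ?f) x)"
    have q: "?q \<in> Lp" by (rule kernel_Lp[OF Ak f'L])
    note [measurable] = LpD(1)[OF q]
    let ?m = "\<lambda>x. min (?q x) (g x)" and ?r = "\<lambda>x. max 0 (?q x - g x)"
    have m: "?m \<in> Lp" using LpD(2)[OF g(1)] by (intro Lp_le[OF q]) auto
    have r: "?r \<in> Lp" by (rule excess_Lp[OF kernel_mem[OF Ak LpD(3)[OF f'L]] g(1)])
    have "(\<integral>x. v x * cmod (cpx ?m x) \<partial>M) \<le> (\<integral>x. v x * ?q x \<partial>M)"
      using LpD(2)[OF m] v(2) by (intro integral_mono vint LpD(3)[OF m] kernel_mem[OF Ak LpD(3)[OF f'L]]) (auto simp: abs_of_nonneg intro!: mult_left_mono less_imp_le)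
    also have "\<dots> = (\<integral>x. t x * ?f x \<partial>M)" by (rule tA(2)[OF f'L, symmetric])
    also have "\<dots> \<le> c" by (rule k(2)[OF f])
    finally have Nm: "N (cpx ?m) \<le> e" using LpD(2)[OF m] by (intro c(2) LpD(3)[OF m]) (auto simp: abs_of_nonneg)
    have "N (cpx ?r) \<le> N (cpx (\<lambda>x. max 0 (cmod (A (cpx f) x) - g x)))"
    proof (rule Lp_norm_mono[OF excess_Lp[OF kernel_mem[OF Ak LpD(3)[OF f(1)]] g(1)] LpD(1)[OF r]])
      show "AE x in M. \<bar>?r x\<bar> \<le> max 0 (cmod (A (cpx f) x) - g x)"
        using kernel_mono[OF Ak f'L f(1) AE_I2[OF f'le]] by eventually_elim auto
    qed
    also have "\<dots> \<le> \<delta>" by (rule g(2)[OF LpD(3)[OF f(1)] f(2)])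
    finally have Nr: "N (cpx ?r) \<le> \<delta>" .
    have "N (A (cpx ?f)) = N (cpx ?q)" by (rule norm_cmod[OF kernel_mem[OF Ak LpD(3)[OF f'L]], symmetric])
    also have "cpx ?q = (\<lambda>x. cpx ?m x + cpx ?r x)" by (auto simp: fun_eq_iff min_def max_def)
    also have "N \<dots> \<le> N (cpx ?m) + N (cpx ?r)" by (rule norm_triangle[OF LpD(3)[OF m] LpD(3)[OF r]])
    finally show ?thesis using Nm Nr by simp
  qed
  with k(1) show ?thesis using that by blast
qed

text \<open>Radial truncation at height \<open>u\<close>, which keeps the phase of
  \<open>f\<close>.\<close>

lemma split_at:
  assumes f: "f \<in> L" and u: "u \<in> Lp"
  obtains f1 f2 where "f1 \<in> L" "f2 \<in> L" "\<And>x. f x = f1 x + f2 x" "\<And>x. cmod (f1 x) \<le> u x" "\<And>x. cmod (f2 x) = max 0 (cmod (f x) - u x)"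
proof -
  note [measurable] = measurable[OF f] LpD(1)[OF u]
  define f1 where "f1 x = (if cmod (f x) \<le> u x then f x else of_real (u x / cmod (f x)) * f x)" for x
  have 1: "cmod (f1 x) \<le> u x" "cmod (f1 x) \<le> cmod (f x)" "cmod (f x - f1 x) = max 0 (cmod (f x) - u x)" for x
  proof -
    have u0: "0 \<le> u x" by (rule LpD(2)[OF u])
    have "cmod (f x - f1 x) = max 0 (cmod (f x) - u x) \<and> cmod (f1 x) \<le> u x \<and> cmod (f1 x) \<le> cmod (f x)"
    proof (cases "cmod (f x) \<le> u x")
      case True then show ?thesis by (simp add: f1_def)
    next
      case False
      then have p: "0 < cmod (f x)" using u0 by linarith
      have "f x - f1 x = of_real (1 - u x / cmod (f x)) * f x" using False by (simp add: f1_def algebra_simps)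
      then have "cmod (f x - f1 x) = \<bar>1 - u x / cmod (f x)\<bar> * cmod (f x)" by (simp only: norm_mult norm_of_real)
      also have "\<dots> = cmod (f x) - u x" using False p by (simp add: abs_of_pos field_simps)
      moreover have "cmod (f1 x) = u x" using False p u0 by (simp add: f1_def norm_mult norm_divide)
      ultimately show ?thesis using False by auto
    qed
    then show "cmod (f1 x) \<le> u x" "cmod (f1 x) \<le> cmod (f x)" "cmod (f x - f1 x) = max 0 (cmod (f x) - u x)" by auto
  qed
  have "f1 \<in> L" using 1(2) by (intro ideal_mem[OF f]) (auto simp: f1_def[abs_def])
  then show ?thesis using that[of f1 "\<lambda>x. f x - f1 x"] diff_mem[OF f] 1 by simp
qed

text \<open>Splitting \<open>f\<close> at height \<open>k w\<close> leaves a part in a fixed order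
  interval, whose image has a finite net, and a tail whose image has norm at most
  \<open>\<delta> + e / 2\<close>. Together with \<open>mnc_almost_order_bounded\<close> this
  describes \<open>mnc\<close> on bounded kernel operators by order intervals.\<close>

lemma mnc_le_of_almost_order_bounded:
  assumes A: "A \<in> bounded_kernel_ops" and ob: "almost_order_bounded A \<delta>" shows "mnc A \<le> \<delta>"
proof (rule mnc_leI)
  note Ak = bounded_kernel_opsD(1)[OF A] and Ab = bounded_kernel_opsD(2)[OF A]
  show "0 \<le> \<delta>" by (rule almost_order_bounded_nonneg[OF Ab ob])
  fix e :: real assume e: "0 < e"
  obtain w where w: "w \<in> Lp" "\<And>x. 0 < w x" using obtain_weak_unit by blast
  obtain k where k: "0 \<le> k" "\<And>f. f \<in> Lp \<Longrightarrow> N (cpx f) \<le> 1 \<Longrightarrow> N (A (cpx (\<lambda>x. max 0 (f x - k * w x)))) \<le> \<delta> + e / 2"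
    using kernel_tail_small[OF A ob w, of "e / 2"] e by auto
  have kw: "(\<lambda>x. k * w x) \<in> Lp" by (intro Lp_scale w k)
  obtain F where F: "finite F" "F \<subseteq> L" "\<And>f. f \<in> L \<Longrightarrow> AE x in M. cmod (f x) \<le> k * w x \<Longrightarrow> \<exists>g\<in>F. N (\<lambda>x. A f x - g x) \<le> e / 2"
    using order_interval_net[OF Ak kw, of "e / 2"] e by auto
  show "finite_net A (\<delta> + e)" unfolding finite_net_def
  proof (intro exI[of _ F] conjI F(1,2) ballI impI)
    fix f assume f: "f \<in> L" "N f \<le> 1"
    obtain f1 f2 where s: "f1 \<in> L" "f2 \<in> L" "\<And>x. f x = f1 x + f2 x" "\<And>x. cmod (f1 x) \<le> k * w x"
      "\<And>x. cmod (f2 x) = max 0 (cmod (f x) - k * w x)" using split_at[OF f(1) kw] by metis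
    obtain g where g: "g \<in> F" "N (\<lambda>x. A f1 x - g x) \<le> e / 2" using F(3)[OF s(1)] s(4) by blast
    have gL: "g \<in> L" using g(1) F(2) by auto
    have Am: "A q \<in> L" if "q \<in> L" for q by (rule kernel_mem[OF Ak that])
    have "N (A f2) \<le> N (A (cpx (\<lambda>x. max 0 (cmod (f x) - k * w x))))"
    proof (rule norm_mono[OF Am[OF LpD(3)[OF excess_Lp[OF f(1) kw]]] measurable[OF Am[OF s(2)]]])
      show "AE x in M. cmod (A f2 x) \<le> cmod (A (cpx (\<lambda>x. max 0 (cmod (f x) - k * w x))) x)"
        using kernel_cmod_le[OF Ak s(2)] unfolding s(5) .
    qed
    also have "\<dots> \<le> \<delta> + e / 2" using f norm_cmod[OF f(1)] by (intro k(2) cmod_Lp) auto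
    finally have N2: "N (A f2) \<le> \<delta> + e / 2" .
    have "f = (\<lambda>x. f1 x + f2 x)" using s(3) by auto
    then have "AE x in M. A f x = A f1 x + A f2 x" using linear_add[OF kernel_linear[OF Ak] s(1,2)] by simp
    then have "N (\<lambda>x. A f x - g x) = N (\<lambda>x. (A f1 x - g x) + A f2 x)"
      by (intro N_cong[OF diff_mem[OF Am[OF f(1)] gL] add_mem[OF diff_mem[OF Am[OF s(1)] gL] Am[OF s(2)]]]) (auto elim!: eventually_mono)
    also have "\<dots> \<le> N (\<lambda>x. A f1 x - g x) + N (A f2)" by (rule norm_triangle[OF diff_mem[OF Am[OF s(1)] gL] Am[OF s(2)]])
    finally show "\<exists>g\<in>F. N (\<lambda>x. A f x - g x) \<le> \<delta> + e" using g N2 by (intro bexI[OF _ g(1)]) auto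
  qed
qed

lemma mnc_monotone_seminorm: "monotone_op_seminorm M L N mnc"
proof (unfold_locales)
  fix S T assume S: "S \<in> bounded_kernel_ops" and T: "T \<in> bounded_kernel_ops"
    and le: "\<And>f. f \<in> Lp \<Longrightarrow> AE x in M. cmod (S (cpx f) x) \<le> cmod (T (cpx f) x)"
  show "mnc S \<le> mnc T"
  proof (rule field_le_epsilon)
    fix e :: real assume "0 < e"
    then have "almost_order_bounded T (mnc T + e)" by (intro mnc_almost_order_bounded bounded_kernel_opsD(2)[OF T]) auto
    then have "almost_order_bounded S (mnc T + e)"
      by (intro almost_order_bounded_mono[OF bounded_kernel_opsD(1)[OF S] bounded_kernel_opsD(1)[OF T]] le)
    then show "mnc S \<le> mnc T + e" by (rule mnc_le_of_almost_order_bounded[OF S])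
  qed
qed (auto intro: mnc_nonneg mnc_add mnc_scale mnc_comp mnc_cong)

lemma mnc_geo_dominated:
  assumes G: "geo_dominated D P Q" and K: "D \<in> bounded_kernel_ops" "P \<in> bounded_kernel_ops" "Q \<in> bounded_kernel_ops"
  shows "mnc D \<le> sqrt (mnc P * mnc Q)"
proof -
  \<comment> \<open>\<open>mnc\<close> is an infimum that need not itself be the size of a net,
    hence the \<open>e\<close>, which a one-sided limit removes.\<close>
  have le: "mnc D \<le> sqrt ((mnc P + e) * (mnc Q + e))" if e: "0 < e" for e
  proof (rule le_sqrt_multI)
    show "0 \<le> mnc P + e" "0 \<le> mnc Q + e" using mnc_nonneg bounded_kernel_opsD(2) K e by (simp_all add: add_nonneg_nonneg)
    fix t :: real assume t: "0 < t"
    have "almost_order_bounded P (mnc P + e)" "almost_order_bounded Q (mnc Q + e)"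
      using e K by (auto intro!: mnc_almost_order_bounded bounded_kernel_opsD)
    then show "mnc D \<le> (t * (mnc P + e) + (mnc Q + e) / t) / 2"
      by (intro mnc_le_of_almost_order_bounded K(1) almost_order_bounded_mean[OF G] bounded_kernel_opsD(1)[OF K(1)] bounded_kernel_opsD(1)[OF K(2)] bounded_kernel_opsD(1)[OF K(3)] t)
  qed
  show ?thesis
  proof (rule tendsto_lowerbound)
    have "((\<lambda>e. sqrt ((mnc P + e) * (mnc Q + e))) \<longlongrightarrow> sqrt ((mnc P + 0) * (mnc Q + 0))) (at_right 0)" by (intro tendsto_intros)
    then show "((\<lambda>e. sqrt ((mnc P + e) * (mnc Q + e))) \<longlongrightarrow> sqrt (mnc P * mnc Q)) (at_right 0)" by simp
    show "\<forall>\<^sub>F e in at_right 0. mnc D \<le> sqrt ((mnc P + e) * (mnc Q + e))"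
      using eventually_at_right_less[of 0] by eventually_elim (rule le)
  qed simp
qed

text \<open>Truncation of the kernel at \<open>n w(x) v(y)\<close> splits off a compact operator.\<close>

lemma compact_plus_small:
  assumes A: "A \<in> bounded_kernel_ops" and d: "mnc A < \<delta>"
  obtains K B where "compact_op M L N K" "bounded_operator M L N B" "op_norm L N B \<le> \<delta>"
    "\<And>f. f \<in> L \<Longrightarrow> AE x in M. A f x = K f x + B f x"
proof -
  note Ak = bounded_kernel_opsD(1)[OF A] and Ab = bounded_kernel_opsD(2)[OF A]
  obtain a where a: "nonneg_kernel A a" using Ak by (auto simp: kernel_ops_def)
  obtain w where w: "w \<in> Lp" "\<And>x. 0 < w x" using obtain_weak_unit by blast
  obtain v C where v: "v \<in> borel_measurable M" "\<And>x. 0 < v x" and vint: "\<And>f. f \<in> L \<Longrightarrow> integrable M (\<lambda>x. v x * cmod (f x))"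
    and vC: "\<And>f. f \<in> L \<Longrightarrow> (\<integral>x. v x * cmod (f x) \<partial>M) \<le> C * N f" and C: "0 \<le> C"
    by (rule obtain_dual_weight) blast
  note [measurable] = v(1) nonneg_kernelD(2)[OF a] LpD(1)[OF w(1)]
  note a0 = nonneg_kernelD(3)[OF a]
  obtain \<delta>0 where d0: "mnc A < \<delta>0" "\<delta>0 < \<delta>" using dense[OF d] by blast
  \<comment> \<open>The tails contribute \<open>\<delta>0 + e\<close> and the order interval another
    \<open>e\<close>, which is \<open>\<delta>\<close> in total.\<close>
  define e where "e = (\<delta> - \<delta>0) / 2"
  have e: "0 < e" using d0 by (simp add: e_def)
  obtain k where k: "0 \<le> k" "\<And>f. f \<in> Lp \<Longrightarrow> N (cpx f) \<le> 1 \<Longrightarrow> N (A (cpx (\<lambda>x. max 0 (f x - k * w x)))) \<le> \<delta>0 + e"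
    using kernel_tail_small[OF A mnc_almost_order_bounded[OF Ab d0(1)] w e] by blast
  have kw: "(\<lambda>x. k * w x) \<in> Lp" by (intro Lp_scale w k)
  \<comment> \<open>The cut-off uses functions that are positive everywhere, so at each point
    \<open>kn n\<close> equals \<open>a\<close> for large \<open>n\<close>.\<close>
  define kn where "kn n p = min (a p) (real n * (w (fst p) * v (snd p)))" for n p
  define bn where "bn n p = a p - kn n p" for n p
  have [measurable]: "kn n \<in> borel_measurable (M \<Otimes>\<^sub>M M)" "bn n \<in> borel_measurable (M \<Otimes>\<^sub>M M)" for n
    unfolding kn_def[abs_def] bn_def[abs_def] by measurable
  have kn0: "0 \<le> kn n p" and bn0: "0 \<le> bn n p" and kna: "kn n p \<le> a p" and bna: "bn n p \<le> a p" for n p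
    using a0[of p] w(2)[of "fst p"] v(2)[of "snd p"] by (auto simp: kn_def bn_def min_def)
  have KK: "nonneg_kernel (kernel_op (kn n)) (kn n)" and BB: "nonneg_kernel (kernel_op (bn n)) (bn n)" for n
    by (rule nonneg_kernel_op[OF a]; simp add: kn0 bn0 kna bna)+
  have Kk: "kernel_op (kn n) \<in> kernel_ops" and Bk: "kernel_op (bn n) \<in> kernel_ops" for n
    using KK[of n] BB[of n] by (auto simp: kernel_ops_def)
  have leA: "AE x in M. cmod (kernel_op c f x) \<le> cmod (A (cpx (\<lambda>x. cmod (f x))) x)"
    if c: "nonneg_kernel (kernel_op c) c" "\<And>p. c p \<le> a p" and f: "f \<in> L" for c f
  proof -
    have ck: "kernel_op c \<in> kernel_ops" using c by (auto simp: kernel_ops_def)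
    show ?thesis using kernel_cmod_le[OF ck f] nonneg_kernel_real[OF c(1) cmod_mem[OF f]] nonneg_kernel_real[OF a cmod_mem[OF f]]
    proof eventually_elim
      case (elim x)
      have "(\<integral>y. c (x, y) * cmod (f y) \<partial>M) \<le> (\<integral>y. a (x, y) * cmod (f y) \<partial>M)"
        using elim by (intro integral_mono) (auto intro!: mult_right_mono c(2))
      moreover have "0 \<le> (\<integral>y. c (x, y) * cmod (f y) \<partial>M)" using nonneg_kernelD(3)[OF c(1)] by simp
      ultimately show ?case using elim by simp
    qed
  qed
  have bk: "kernel_op c \<in> bounded_kernel_ops" if c: "nonneg_kernel (kernel_op c) c" "\<And>p. c p \<le> a p" for c
  proof (rule bounded_kernel_opsI)
    show ck: "kernel_op c \<in> kernel_ops" using c by (auto simp: kernel_ops_def)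
    fix f assume f: "f \<in> L"
    have "N (kernel_op c f) \<le> N (A (cpx (\<lambda>x. cmod (f x))))"
      by (rule norm_mono[OF kernel_mem[OF Ak cmod_mem[OF f]] measurable[OF kernel_mem[OF ck f]] leA[OF c f]])
    also have "\<dots> \<le> op_norm L N A * N f" using op_norm_upper[OF Ab cmod_mem[OF f]] norm_cmod[OF f] by simp
    finally show "N (kernel_op c f) \<le> op_norm L N A * N f" .
  qed
  note Kb = bk[OF KK kna] and Bb = bk[OF BB bna]
  \<comment> \<open>On the unit ball \<open>|K f| \<le> n w \<integral> v |f| \<le> n C w\<close>:
    the image lies in an order interval without error, so \<open>mnc\<close> vanishes.\<close>
  have Kcompact: "compact_op M L N (kernel_op (kn n))" for n
  proof (rule compact_of_mnc_zero[OF bounded_kernel_opsD(2)[OF Kb]], rule mnc_le_of_almost_order_bounded[OF Kb])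
    let ?g = "\<lambda>x. real n * C * w x"
    have g: "?g \<in> Lp" using C by (intro Lp_scale w) auto
    show "almost_order_bounded (kernel_op (kn n)) 0" unfolding almost_order_bounded_def
    proof (intro bexI[OF _ g] ballI impI)
      fix f assume f: "f \<in> L" "N f \<le> 1"
      have "AE x in M. max 0 (cmod (kernel_op (kn n) f x) - ?g x) = 0"
        using kernel_cmod_le[OF Kk f(1), of n] nonneg_kernel_real[OF KK cmod_mem[OF f(1)], of n]
      proof eventually_elim
        case (elim x)
        have "(\<integral>y. kn n (x, y) * cmod (f y) \<partial>M) \<le> (\<integral>y. real n * w x * (v y * cmod (f y)) \<partial>M)"
        proof (rule integral_mono)
          fix y
          have "kn n (x, y) \<le> real n * w x * v y" by (simp add: kn_def mult.assoc)
          then have "kn n (x, y) * cmod (f y) \<le> real n * w x * v y * cmod (f y)" by (rule mult_right_mono) simp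
          then show "kn n (x, y) * cmod (f y) \<le> real n * w x * (v y * cmod (f y))" by (simp only: mult.assoc)
        qed (use elim vint[OF f(1)] in auto)
        also have "\<dots> = real n * w x * (\<integral>y. v y * cmod (f y) \<partial>M)" by simp
        also have "\<dots> \<le> real n * w x * C"
        proof (rule mult_left_mono)
          show "(\<integral>y. v y * cmod (f y) \<partial>M) \<le> C" using vC[OF f(1)] mult_left_mono[OF f(2) C] by simp
        qed (use w(2)[of x] in auto)
        finally have "(\<integral>y. kn n (x, y) * cmod (f y) \<partial>M) \<le> ?g x" by (simp add: mult_ac)
        moreover have "0 \<le> (\<integral>y. kn n (x, y) * cmod (f y) \<partial>M)" using kn0 by simp
        ultimately show ?case using elim by simp
      qed
      then have "N (cpx (\<lambda>x. max 0 (cmod (kernel_op (kn n) f x) - ?g x))) = N (\<lambda>_. 0)"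
        by (intro N_cong[OF LpD(3)[OF excess_Lp[OF kernel_mem[OF Kk f(1)] g]] zero_mem]) (auto elim!: eventually_mono)
      then show "N (cpx (\<lambda>x. max 0 (cmod (kernel_op (kn n) f x) - ?g x))) \<le> 0" by simp
    qed
  qed
  \<comment> \<open>Smallness of the remainder is shown only on the fixed function
    \<open>k w\<close>, which covers the part of the unit ball below \<open>k w\<close>. On the
    tails the bound for \<open>A\<close> itself is used.\<close>
  have "(\<lambda>n. N (kernel_op (bn n) (cpx (\<lambda>x. k * w x)))) \<longlonglongrightarrow> 0"
  proof (rule dominated_norm_convergence[OF kernel_Lp[OF Ak kw]])
    let ?u = "\<lambda>x. k * w x"
    have au: "cpx (\<lambda>x. cmod (cpx ?u x)) = cpx ?u" using k(1) w(2) by (auto simp: fun_eq_iff abs_of_nonneg less_imp_le norm_mult)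
    show "kernel_op (bn n) (cpx ?u) \<in> borel_measurable M" for n by (rule measurable[OF kernel_mem[OF Bk LpD(3)[OF kw]]])
    show "AE x in M. cmod (kernel_op (bn n) (cpx ?u) x) \<le> cmod (A (cpx ?u) x)" for n
      using leA[OF BB bna LpD(3)[OF kw], of n] unfolding au .
    have "AE x in M. \<forall>n. integrable M (\<lambda>y. bn n (x, y) * ?u y) \<and> kernel_op (bn n) (cpx ?u) x = of_real (\<integral>y. bn n (x, y) * ?u y \<partial>M)"
      unfolding AE_all_countable using nonneg_kernel_real[OF BB LpD(3)[OF kw]] by blast
    then show "AE x in M. (\<lambda>n. kernel_op (bn n) (cpx ?u) x) \<longlonglongrightarrow> 0"
      using nonneg_kernel_real[OF a LpD(3)[OF kw]] AE_space
    proof eventually_elim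
      case (elim x)
      note [measurable] = elim(3)
      have "(\<lambda>n. \<integral>y. bn n (x, y) * ?u y \<partial>M) \<longlonglongrightarrow> (\<integral>y. 0 \<partial>M)"
      proof (rule integral_dominated_convergence)
        show "integrable M (\<lambda>y. a (x, y) * ?u y)" using elim(2) by simp
        show "AE y in M. norm (bn n (x, y) * ?u y) \<le> a (x, y) * ?u y" for n
          using bn0 bna k(1) w(2) by (auto simp: abs_mult abs_of_nonneg less_imp_le intro!: mult_right_mono)
        show "AE y in M. (\<lambda>n. bn n (x, y) * ?u y) \<longlonglongrightarrow> 0"
        proof (rule AE_I2)
          fix y
          obtain n0 where n0: "a (x, y) / (w x * v y) < real n0" using reals_Archimedean2 by blast
          have wv: "0 < w x * v y" using w(2) v(2) by simp
          have "\<forall>\<^sub>F n in sequentially. bn n (x, y) * ?u y = 0"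
          proof (rule eventually_sequentiallyI[of n0])
            fix n assume "n0 \<le> n"
            then have "a (x, y) / (w x * v y) < real n" using n0 by simp
            then have "a (x, y) < real n * (w x * v y)" using wv by (simp add: field_simps)
            then show "bn n (x, y) * ?u y = 0" by (simp add: bn_def kn_def)
          qed
          then show "(\<lambda>n. bn n (x, y) * ?u y) \<longlonglongrightarrow> 0" by (rule tendsto_eventually)
        qed
        show "(\<lambda>y. bn n (x, y) * ?u y) \<in> borel_measurable M" for n by measurable
      qed measurable
      then have "(\<lambda>n. complex_of_real (\<integral>y. bn n (x, y) * ?u y \<partial>M)) \<longlonglongrightarrow> of_real 0" by (intro tendsto_of_real) simp
      moreover have "kernel_op (bn n) (cpx ?u) x = of_real (\<integral>y. bn n (x, y) * ?u y \<partial>M)" for n using elim(1) by blast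
      ultimately show ?case by (simp only: of_real_0)
    qed
  qed
  then have "\<forall>\<^sub>F n in sequentially. N (kernel_op (bn n) (cpx (\<lambda>x. k * w x))) < e" using e by (rule order_tendstoD)
  then obtain n where n: "N (kernel_op (bn n) (cpx (\<lambda>x. k * w x))) < e" using eventually_happens'[OF sequentially_bot] by blast
  have "op_norm L N (kernel_op (bn n)) \<le> \<delta>"
  proof (rule op_norm_least)
    fix f assume f: "f \<in> L" "N f \<le> 1"
    let ?B = "kernel_op (bn n)"
    have Bm: "?B q \<in> L" if "q \<in> L" for q by (rule kernel_mem[OF Bk that])
    obtain f1 f2 where s: "f1 \<in> L" "f2 \<in> L" "\<And>x. f x = f1 x + f2 x" "\<And>x. cmod (f1 x) \<le> k * w x"
      "\<And>x. cmod (f2 x) = max 0 (cmod (f x) - k * w x)" using split_at[OF f(1) kw] by metis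
    have "N (?B f1) \<le> N (?B (cpx (\<lambda>x. k * w x)))"
    proof (rule norm_mono[OF Bm[OF LpD(3)[OF kw]] measurable[OF Bm[OF s(1)]]])
      show "AE x in M. cmod (?B f1 x) \<le> cmod (?B (cpx (\<lambda>x. k * w x)) x)"
        using kernel_cmod_le[OF Bk s(1), of n] kernel_mono[OF Bk cmod_Lp[OF s(1)] kw AE_I2[OF s(4)], of n] by eventually_elim simp
    qed
    moreover have "N (?B f2) \<le> N (A (cpx (\<lambda>x. max 0 (cmod (f x) - k * w x))))"
    proof (rule norm_mono[OF kernel_mem[OF Ak LpD(3)[OF excess_Lp[OF f(1) kw]]] measurable[OF Bm[OF s(2)]]])
      show "AE x in M. cmod (?B f2 x) \<le> cmod (A (cpx (\<lambda>x. max 0 (cmod (f x) - k * w x))) x)"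
        using leA[OF BB bna s(2), of n] unfolding s(5) .
    qed
    moreover have "N (A (cpx (\<lambda>x. max 0 (cmod (f x) - k * w x)))) \<le> \<delta>0 + e" using f norm_cmod[OF f(1)] by (intro k(2) cmod_Lp) auto
    moreover have "N (?B f) \<le> N (?B f1) + N (?B f2)"
    proof -
      have "f = (\<lambda>x. f1 x + f2 x)" using s(3) by auto
      then have "AE x in M. ?B f x = ?B f1 x + ?B f2 x" using linear_add[OF kernel_linear[OF Bk] s(1,2)] by simp
      then have "N (?B f) = N (\<lambda>x. ?B f1 x + ?B f2 x)" by (rule N_cong[OF Bm[OF f(1)] add_mem[OF Bm[OF s(1)] Bm[OF s(2)]]])
      then show ?thesis using norm_triangle[OF Bm[OF s(1)] Bm[OF s(2)]] by simp
    qed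
    ultimately show "N (?B f) \<le> \<delta>" using n by (simp add: e_def field_simps)
  qed
  moreover have "AE x in M. A f x = kernel_op (kn n) f x + kernel_op (bn n) f x" if f: "f \<in> L" for f
    using nonneg_kernelD(4)[OF a f] nonneg_kernelD(4)[OF KK f, of n] nonneg_kernelD(4)[OF BB f, of n]
  proof eventually_elim
    case (elim x)
    have "(\<integral>y. of_real (a (x, y)) * f y \<partial>M) = (\<integral>y. of_real (kn n (x, y)) * f y + of_real (bn n (x, y)) * f y \<partial>M)"
      by (intro Bochner_Integration.integral_cong) (auto simp: bn_def algebra_simps)
    then show ?case using elim by simp
  qed
  ultimately show ?thesis using that[OF Kcompact bounded_kernel_opsD(2)[OF Bb]] by blast
qed

text \<open>In terms of \<open>mnc\<close> this is the ideal property of the compact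
  operators.\<close>

lemma mnc_comp_zero:
  assumes X: "bounded_operator M L N X" and Y: "bounded_operator M L N Y" and "mnc X = 0 \<or> mnc Y = 0"
  shows "mnc (X \<circ> Y) = 0"
  using mnc_comp[OF X Y] mnc_nonneg[OF bounded_comp(1)[OF X Y]] assms(3) by auto

subsection \<open>Essential spectral radius\<close>

text \<open>\<open>z^j - A^j = (z - A) P\<close> with a polynomial \<open>P\<close> in
  \<open>A\<close>, and \<open>z^j - B\<close> has a bounded inverse \<open>S\<close>. Modulo
  compact operators \<open>P \<circ> S\<close> and \<open>S \<circ> P\<close> are therefore a right
  and a left inverse of \<open>z - A\<close>.\<close>

lemma calkin_invertible_of_power:
  assumes A: "bounded_operator M L N A" and K: "compact_op M L N K" and B: "bounded_operator M L N B"
    and dec: "\<And>f. f \<in> L \<Longrightarrow> AE x in M. (A ^^ j) f x = K f x + B f x" and small: "op_norm L N B < cmod z ^ j"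
  shows "calkin_invertible M L N (\<lambda>f x. z * f x - A f x)"
proof -
  have Kb: "bounded_operator M L N K" using K by (simp add: compact_op_def)
  note K0 = mnc_compact[OF K]
  note Anb = bounded_funpow[OF A] note Al = bounded_linear'[OF A] note Anl = bounded_linear'[OF Anb]
  let ?U = "\<lambda>f x. z * f x - A f x"
  have U: "bounded_operator M L N ?U" using bounded_diff[OF bounded_scale(1)[OF bounded_id, of z] A] by simp
  have "invertible_op M L N (\<lambda>f x. z ^ j * f x - B f x)"
  proof (rule resolvent_exists[OF B])
    show "(0::real) \<le> 1" "0 \<le> op_norm L N B" "op_norm L N B < cmod (z ^ j)" using op_norm_nonneg[OF B] small by (auto simp: norm_power)
    have "op_norm L N (B ^^ n) \<le> op_norm L N B ^ n" for n
    proof (induction n)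
      case 0 show ?case by (auto intro!: op_norm_le_bound)
    next
      case (Suc n)
      have "op_norm L N (B \<circ> B ^^ n) \<le> op_norm L N B * op_norm L N (B ^^ n)" by (rule bounded_comp(2)[OF B bounded_funpow[OF B]])
      also have "\<dots> \<le> op_norm L N B * op_norm L N B ^ n" by (intro mult_left_mono Suc op_norm_nonneg B)
      finally show ?case unfolding funpow.simps(2) power_Suc .
    qed
    then show "N ((B ^^ n) f) \<le> 1 * op_norm L N B ^ n * N f" if "f \<in> L" for n f
      using op_norm_upper[OF bounded_funpow[OF B] that, of n] mult_right_mono[OF _ norm_nonneg[OF that]] by (metis mult_1 order_trans)
  qed
  then obtain S where S: "bounded_operator M L N S" "\<And>f. f \<in> L \<Longrightarrow> AE x in M. z ^ j * S f x - B (S f) x = f x"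
    "\<And>f. f \<in> L \<Longrightarrow> AE x in M. S (\<lambda>x. z ^ j * f x - B f x) x = f x" unfolding invertible_op_def by auto
  define P where "P f x = (\<Sum>i<j. z ^ (j - 1 - i) * (A ^^ i) f x)" for f x
  have P: "bounded_operator M L N P"
  proof -
    have "bounded_operator M L N (\<lambda>f x. \<Sum>i\<in>I. z ^ (j - 1 - i) * (A ^^ i) f x)" if "finite I" for I
      using that
    proof (induction I rule: finite_induct)
      case empty
      have "bounded_operator M L N (\<lambda>f x. 0)" using bounded_scale(1)[OF bounded_id, of 0] by simp
      then show ?case by simp
    next
      case (insert i I)
      have "bounded_operator M L N (\<lambda>f x. z ^ (j - 1 - i) * (A ^^ i) f x + (\<Sum>i\<in>I. z ^ (j - 1 - i) * (A ^^ i) f x))"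
        by (rule bounded_add(1)[OF bounded_scale(1)[OF Anb] insert.IH])
      then show ?case using insert.hyps by simp
    qed
    then show ?thesis unfolding P_def[abs_def] by simp
  qed
  have tele: "(\<Sum>i<m. z ^ (m - 1 - i) * (z * y i - y (Suc i))) = z ^ m * y 0 - y m" for m and y :: "nat \<Rightarrow> complex"
  proof (induction m)
    case (Suc m)
    have "(\<Sum>i<m. z ^ (Suc m - 1 - i) * (z * y i - y (Suc i))) = z * (\<Sum>i<m. z ^ (m - 1 - i) * (z * y i - y (Suc i)))"
      unfolding sum_distrib_left
    proof (rule sum.cong)
      fix i assume "i \<in> {..<m}"
      then have "Suc m - 1 - i = Suc (m - 1 - i)" by auto
      then show "z ^ (Suc m - 1 - i) * (z * y i - y (Suc i)) = z * (z ^ (m - 1 - i) * (z * y i - y (Suc i)))" by simp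
    qed simp
    then show ?case unfolding sum.lessThan_Suc Suc by (simp add: algebra_simps)
  qed simp
  have UP: "AE x in M. ?U (P f) x = z ^ j * f x - (A ^^ j) f x" if f: "f \<in> L" for f
    using linear_sum[OF Al, of "{..<j}" "\<lambda>i. (A ^^ i) f" "\<lambda>i. z ^ (j - 1 - i)"] bounded_mem[OF Anb f]
  proof -
    assume "(\<And>i. i \<in> {..<j} \<Longrightarrow> (A ^^ i) f \<in> L) \<Longrightarrow>
      AE x in M. A (\<lambda>x. \<Sum>i<j. z ^ (j - 1 - i) * (A ^^ i) f x) x = (\<Sum>i<j. z ^ (j - 1 - i) * A ((A ^^ i) f) x)"
    then have "AE x in M. A (P f) x = (\<Sum>i<j. z ^ (j - 1 - i) * A ((A ^^ i) f) x)" using bounded_mem[OF Anb f] by (simp add: P_def[abs_def])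
    then show ?thesis
    proof eventually_elim
      case (elim x)
      have "?U (P f) x = (\<Sum>i<j. z ^ (j - 1 - i) * (z * (A ^^ i) f x - (A ^^ Suc i) f x))"
        unfolding elim by (simp add: P_def sum_distrib_left sum_subtractf algebra_simps)
      then show ?case using tele[of j "\<lambda>i. (A ^^ i) f x"] by simp
    qed
  qed
  have PU: "AE x in M. P (?U f) x = z ^ j * f x - (A ^^ j) f x" if f: "f \<in> L" for f
  proof -
    have Af: "A f \<in> L" by (rule bounded_mem[OF A f])
    have "AE x in M. \<forall>i. (A ^^ i) (?U f) x = z * (A ^^ i) f x - (A ^^ Suc i) f x" unfolding AE_all_countable
    proof
      fix i
      show "AE x in M. (A ^^ i) (?U f) x = z * (A ^^ i) f x - (A ^^ Suc i) f x"
        using linear_diff[OF Anl scale_mem[OF f] Af, of i z] linear_scale[OF Anl f, of i z]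
        by eventually_elim (simp add: funpow_swap1)
    qed
    then show ?thesis
    proof eventually_elim
      case (elim x)
      then show ?case using tele[of j "\<lambda>i. (A ^^ i) f x"] by (simp add: P_def)
    qed
  qed
  note m = bounded_mem[OF S(1)] bounded_mem[OF P] bounded_mem[OF Kb] bounded_mem[OF U] bounded_mem[OF B]
  let ?R = "P \<circ> S" and ?Q = "S \<circ> P"
  have R: "bounded_operator M L N ?R" and Q: "bounded_operator M L N ?Q" by (intro bounded_comp S(1) P)+
  have UR: "AE x in M. ?U (?R f) x = f x - K (S f) x" if f: "f \<in> L" for f
    using UP[OF m(1)[OF f]] dec[OF m(1)[OF f]] S(2)[OF f] by eventually_elim (simp add: algebra_simps)
  have QU: "AE x in M. ?Q (?U f) x = f x - S (K f) x" if f: "f \<in> L" for f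
  proof -
    note Sl = bounded_linear'[OF S(1)]
    have zB: "(\<lambda>x. z ^ j * f x - B f x) \<in> L" by (rule diff_mem[OF scale_mem[OF f] m(5)[OF f]])
    have "AE x in M. P (?U f) x = (z ^ j * f x - B f x) - K f x" using PU[OF f] dec[OF f] by eventually_elim simp
    from linear_cong[OF Sl m(2)[OF m(4)[OF f]] diff_mem[OF zB m(3)[OF f]] this] linear_diff[OF Sl zB m(3)[OF f]] S(3)[OF f]
    show ?thesis by eventually_elim simp
  qed
  \<comment> \<open>\<open>calkin_invertible\<close> asks for one operator on both sides, while
    \<open>S\<close> need not commute with \<open>A\<close>. As in any algebra a right inverse
    \<open>?R\<close> and a left inverse \<open>?Q\<close> agree, because both equal
    \<open>?Q ?U ?R\<close> up to compact terms; these are written out here.\<close>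
  have RU: "AE x in M. ?R h x = ?Q h x - ?Q (K (S h)) x + S (K (?R h)) x" if h: "h \<in> L" for h
  proof -
    note Ql = bounded_linear'[OF Q] and Rh = bounded_mem[OF R h] and KS = m(3)[OF m(1)[OF h]]
    from linear_cong[OF Ql m(4)[OF Rh] diff_mem[OF h KS] UR[OF h]] linear_diff[OF Ql h KS] QU[OF Rh]
    show ?thesis by eventually_elim simp
  qed
  have 1: "compact_op M L N (\<lambda>f x. ?U (?R f) x - f x)"
  proof (rule compact_of_mnc_zero)
    have KS: "bounded_operator M L N (K \<circ> S)" by (rule bounded_comp(1)[OF Kb S(1)])
    show b: "bounded_operator M L N (\<lambda>f x. ?U (?R f) x - f x)"
      using bounded_diff[OF bounded_comp(1)[OF U R] bounded_id] by (simp add: o_def)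
    have "mnc (\<lambda>f x. ?U (?R f) x - f x) = mnc (\<lambda>f x. - 1 * (K \<circ> S) f x)"
    proof (rule mnc_cong[OF b bounded_scale(1)[OF KS]])
      fix f assume "f \<in> L"
      from UR[OF this] show "AE x in M. ?U (?R f) x - f x = - 1 * (K \<circ> S) f x" by eventually_elim simp
    qed
    also have "\<dots> \<le> cmod (- 1) * mnc (K \<circ> S)" by (rule mnc_scale[OF KS])
    also have "\<dots> = 0" using mnc_comp_zero[OF Kb S(1)] K0 by simp
    finally show "mnc (\<lambda>f x. ?U (?R f) x - f x) \<le> 0" .
  qed
  have 2: "compact_op M L N (\<lambda>f x. ?R (?U f) x - f x)"
  proof (rule compact_of_mnc_zero)
    note SK = bounded_comp(1)[OF S(1) Kb] and SU = bounded_comp(1)[OF S(1) U] and RU' = bounded_comp(1)[OF R U]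
    note KSU = bounded_comp(1)[OF Kb SU] and QK = bounded_comp(1)[OF Q bounded_comp(1)[OF Kb SU]]
      and SKR = bounded_comp(1)[OF SK RU']
    have z1: "mnc (S \<circ> K) = 0" by (rule mnc_comp_zero[OF S(1) Kb]) (simp add: K0)
    have z2: "mnc (?Q \<circ> (K \<circ> (S \<circ> ?U))) = 0" by (rule mnc_comp_zero[OF Q KSU]) (simp add: mnc_comp_zero[OF Kb SU] K0)
    have z3: "mnc ((S \<circ> K) \<circ> (?R \<circ> ?U)) = 0" by (rule mnc_comp_zero[OF SK RU']) (simp add: z1)
    show b: "bounded_operator M L N (\<lambda>f x. ?R (?U f) x - f x)"
      using bounded_diff[OF RU' bounded_id] by (simp add: o_def)
    note b1 = bounded_scale(1)[OF SK, of "- 1"] and b2 = bounded_scale(1)[OF QK, of "- 1"]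
    note b12 = bounded_add(1)[OF b1 b2]
    have "mnc (\<lambda>f x. ?R (?U f) x - f x)
       = mnc (\<lambda>f x. (- 1 * (S \<circ> K) f x + - 1 * (?Q \<circ> (K \<circ> (S \<circ> ?U))) f x) + ((S \<circ> K) \<circ> (?R \<circ> ?U)) f x)"
    proof (rule mnc_cong[OF b bounded_add(1)[OF b12 SKR]])
      fix f assume f: "f \<in> L"
      from RU[OF m(4)[OF f]] QU[OF f]
      show "AE x in M. ?R (?U f) x - f x = (- 1 * (S \<circ> K) f x + - 1 * (?Q \<circ> (K \<circ> (S \<circ> ?U))) f x) + ((S \<circ> K) \<circ> (?R \<circ> ?U)) f x"
        by eventually_elim simp
    qed
    also have "\<dots> \<le> (cmod (- 1) * mnc (S \<circ> K) + cmod (- 1) * mnc (?Q \<circ> (K \<circ> (S \<circ> ?U)))) + mnc ((S \<circ> K) \<circ> (?R \<circ> ?U))"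
      using mnc_add[OF b12 SKR] mnc_add[OF b1 b2] mnc_scale[OF SK, of "- 1"] mnc_scale[OF QK, of "- 1"] by linarith
    also have "\<dots> = 0" using z1 z2 z3 by simp
    finally show "mnc (\<lambda>f x. ?R (?U f) x - f x) \<le> 0" .
  qed
  show ?thesis unfolding calkin_invertible_def using R 1 2 by blast
qed

text \<open>If \<open>|z|\<close> exceeds the limit, some power satisfies
  \<open>mnc (A ^^ j) < |z|^j\<close> and splits into a compact and a small operator, which makes
  \<open>z - A\<close> invertible in the Calkin algebra. If the limit is positive, it lies in the
  essential spectrum by \<open>spectral_value\<close> for \<open>mnc\<close>.\<close>

lemma ess_spectral_rad_lim:
  assumes A: "A \<in> bounded_kernel_ops"
  shows "(\<lambda>n. root n (mnc (A ^^ n))) \<longlonglongrightarrow> ess_spectral_rad M L N A"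
proof -
  interpret monotone_op_seminorm M L N mnc by (rule mnc_monotone_seminorm)
  note Ab = bounded_kernel_opsD(2)[OF A]
  have Anb: "bounded_operator M L N (A ^^ n)" for n by (rule bounded_funpow[OF Ab])
  obtain s where s: "0 \<le> s" "(\<lambda>n. root n (mnc (A ^^ n))) \<longlonglongrightarrow> s" "\<And>n. n \<ge> 1 \<Longrightarrow> s ^ n \<le> mnc (A ^^ n)"
    by (rule root_tendsto_of_submultiplicative[of "\<lambda>n. mnc (A ^^ n)"])
      (auto simp: funpow_add mnc_nonneg[OF Anb] intro!: mnc_comp Anb)
  have upper: "cmod z \<le> s" if "z \<in> ess_spectrum M L N A" for z
  proof (rule ccontr)
    assume "\<not> cmod z \<le> s"
    then have "\<forall>\<^sub>F n in sequentially. root n (mnc (A ^^ n)) < cmod z \<and> n \<ge> 1"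
      using order_tendstoD(2)[OF s(2), of "cmod z"] eventually_ge_at_top[of 1] by (auto intro: eventually_conj)
    then obtain j where j: "root j (mnc (A ^^ j)) < cmod z" "j \<ge> 1" using eventually_happens'[OF sequentially_bot] by blast
    have "mnc (A ^^ j) = root j (mnc (A ^^ j)) ^ j" using j mnc_nonneg[OF Anb] by (simp add: real_root_pow_pos2)
    also have "\<dots> < cmod z ^ j" using j mnc_nonneg[OF Anb] by (intro power_strict_mono) auto
    finally obtain q where q: "mnc (A ^^ j) < q" "q < cmod z ^ j" using dense by blast
    have AjK: "A ^^ j \<in> bounded_kernel_ops" using bounded_kernel_ops_funpow[OF A, of "j - 1"] j(2) by simp
    obtain K B where "compact_op M L N K" "bounded_operator M L N B" "op_norm L N B \<le> q"
      "\<And>f. f \<in> L \<Longrightarrow> AE x in M. (A ^^ j) f x = K f x + B f x" using compact_plus_small[OF AjK q(1)] by blast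
    then have "calkin_invertible M L N (\<lambda>f x. z * f x - A f x)"
      using q(2) by (intro calkin_invertible_of_power[OF Ab, of K B j]) auto
    then show False using that by (simp add: ess_spectrum_def)
  qed
  have lower: "of_real s \<in> ess_spectrum M L N A" if "0 < s"
  proof (rule ccontr)
    assume "of_real s \<notin> ess_spectrum M L N A"
    then obtain R where R: "bounded_operator M L N R" "compact_op M L N (\<lambda>f x. R (\<lambda>x. of_real s * f x - A f x) x - f x)"
      unfolding ess_spectrum_def calkin_invertible_def by auto
    let ?K = "\<lambda>f x. R (\<lambda>x. of_real s * f x - A f x) x - f x"
    have Kb: "bounded_operator M L N ?K" using R(2) by (simp add: compact_op_def)
    \<comment> \<open>A left inverse modulo a compact operator suffices here, since
      \<open>mnc\<close> does not see compact terms.\<close>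
    have c: "mnc T \<le> mnc R * mnc (\<lambda>f x. of_real s * T f x - A (T f) x)" if T: "bounded_operator M L N T" for T
    proof -
      let ?U = "\<lambda>f x. of_real s * T f x - A (T f) x"
      have U: "bounded_operator M L N ?U"
        using bounded_diff[OF bounded_scale(1)[OF T] bounded_comp(1)[OF Ab T]] by (simp add: o_def)
      note KT = bounded_comp(1)[OF Kb T] and RU = bounded_comp(1)[OF R(1) U]
      have "mnc T = mnc (\<lambda>f x. (R \<circ> ?U) f x + - 1 * (?K \<circ> T) f x)"
        by (rule mnc_cong[OF T bounded_add(1)[OF RU bounded_scale(1)[OF KT]]]) simp
      also have "\<dots> \<le> mnc (R \<circ> ?U) + cmod (- 1) * mnc (?K \<circ> T)"
        using mnc_add[OF RU bounded_scale(1)[OF KT, of "- 1"]] mnc_scale[OF KT, of "- 1"] by linarith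
      also have "mnc (?K \<circ> T) = 0" by (rule mnc_comp_zero[OF Kb T]) (simp add: mnc_compact[OF R(2)])
      finally have "mnc T \<le> mnc (R \<circ> ?U)" by (simp only: mult_zero_right add_0_right)
      then show ?thesis using mnc_comp[OF R(1) U] by (rule order_trans)
    qed
    show False by (rule spectral_value[OF A that s(2) s(3) c])
  qed
  have "ess_spectral_rad M L N A = s" unfolding ess_spectral_rad_def by (rule Sup_norm_eq[OF s(1) upper lower])
  then show ?thesis using s(2) by simp
qed

end

context banach_function_space
begin

subsection \<open>The inequalities\<close>

text \<open>Arithmetic means pass through the triangle inequality of \<open>N\<close>; the
  optimisation over \<open>t\<close> takes place on the resulting numbers.\<close>

lemma op_norm_geo_dominated:
  assumes G: "geo_dominated D P Q" and K: "D \<in> bounded_kernel_ops" "P \<in> bounded_kernel_ops" "Q \<in> bounded_kernel_ops"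
  shows "op_norm L N D \<le> sqrt (op_norm L N P * op_norm L N Q)"
proof (rule le_sqrt_multI)
  note Kk = bounded_kernel_opsD(1)[OF K(1)] bounded_kernel_opsD(1)[OF K(2)] bounded_kernel_opsD(1)[OF K(3)]
  note Pb = bounded_kernel_opsD(2)[OF K(2)] and Qb = bounded_kernel_opsD(2)[OF K(3)]
  show nn: "0 \<le> op_norm L N P" "0 \<le> op_norm L N Q" by (rule op_norm_nonneg[OF Pb], rule op_norm_nonneg[OF Qb])
  fix t :: real assume t: "0 < t"
  show "op_norm L N D \<le> (t * op_norm L N P + op_norm L N Q / t) / 2"
  proof (rule op_norm_le_bound)
    show "0 \<le> (t * op_norm L N P + op_norm L N Q / t) / 2" using nn t by simp
    fix f assume f: "f \<in> L"
    let ?f = "cpx (\<lambda>x. cmod (f x))"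
    let ?p = "\<lambda>x. t / 2 * cmod (P ?f x)" and ?q = "\<lambda>x. 1 / (2 * t) * cmod (Q ?f x)"
    have fL: "?f \<in> L" "N ?f = N f" using cmod_mem[OF f] norm_cmod[OF f] by auto
    note Pf = kernel_mem[OF Kk(2) fL(1)] and Qf = kernel_mem[OF Kk(3) fL(1)]
    have pq: "?p \<in> Lp" "?q \<in> Lp" using t by (auto intro!: Lp_scale cmod_Lp Pf Qf simp del: times_divide_eq_left)
    have "N (D f) \<le> N (cpx (\<lambda>x. ?p x + ?q x))"
    proof (rule norm_mono[OF LpD(3)[OF Lp_add[OF pq]] measurable[OF kernel_mem[OF Kk(1) f]]])
      show "AE x in M. cmod (D f x) \<le> cmod (complex_of_real (?p x + ?q x))"
        using geo_dominated_le[OF G Kk f t]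
      proof eventually_elim
        case (elim x)
        have "(t * cmod (P ?f x) + cmod (Q ?f x) / t) / 2 = ?p x + ?q x" by (simp add: field_simps)
        then have "cmod (D f x) \<le> ?p x + ?q x" using elim by metis
        then show ?case unfolding norm_of_real by (rule order_trans[OF _ abs_ge_self])
      qed
    qed
    also have "\<dots> \<le> N (cpx ?p) + N (cpx ?q)" using norm_triangle[OF LpD(3)[OF pq(1)] LpD(3)[OF pq(2)]] by simp
    also have "\<dots> = t / 2 * N (P ?f) + 1 / (2 * t) * N (Q ?f)"
    proof -
      have "N (cpx (\<lambda>x. c * cmod (e x))) = c * N e" if "e \<in> L" "0 \<le> c" for c e
        using norm_scale[OF cmod_mem[OF that(1)], of "of_real c"] norm_cmod[OF that(1)] that(2) by simp
      from this[OF Pf, of "t / 2"] this[OF Qf, of "1 / (2 * t)"] show ?thesis using t by (simp only:) simp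
    qed
    also have "\<dots> \<le> t / 2 * (op_norm L N P * N f) + 1 / (2 * t) * (op_norm L N Q * N f)"
      using op_norm_upper[OF Pb fL(1)] op_norm_upper[OF Qb fL(1)] fL(2) t by (intro add_mono mult_left_mono) auto
    also have "\<dots> = (t * op_norm L N P + op_norm L N Q / t) / 2 * N f" by (simp add: field_simps)
    finally show "N (D f) \<le> (t * op_norm L N P + op_norm L N Q / t) / 2 * N f" .
  qed
qed

lemma radius_functional_op_norm:
  "radius_functional bounded_kernel_ops (op_norm L N) (spectral_rad M L N) geo_dominated"
proof
  show "0 \<le> op_norm L N id" using op_norm_nonneg[OF bounded_id] by (simp add: id_def)
qed (auto intro: bounded_kernel_ops_comp op_norm_nonneg bounded_comp geo_dominated_comp op_norm_geo_dominated spectral_rad_lim bounded_kernel_opsD)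

lemma bounded_kernel_ops_of_bounded_set:
  assumes "\<forall>A\<in>\<Phi>. positive_kernel_operator M L A" "bounded_op_set L N \<Phi>"
  obtains C where "\<Phi> \<subseteq> bounded_kernel_ops" "\<And>A. A \<in> \<Phi> \<Longrightarrow> op_norm L N A \<le> C"
proof -
  obtain C where C: "\<And>A f. A \<in> \<Phi> \<Longrightarrow> f \<in> L \<Longrightarrow> N (A f) \<le> C * N f" using assms(2) by (auto simp: bounded_op_set_def)
  have C': "N (A f) \<le> \<bar>C\<bar> * N f" if "A \<in> \<Phi>" "f \<in> L" for A f
    using C[OF that] mult_right_mono[OF abs_ge_self[of C] norm_nonneg[OF that(2)]] by linarith
  have "\<Phi> \<subseteq> bounded_kernel_ops" using assms(1) C' by (auto intro!: bounded_kernel_opsI positive_kernel_operatorD)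
  moreover have "op_norm L N A \<le> \<bar>C\<bar>" if "A \<in> \<Phi>" for A by (rule op_norm_le_bound) (use C'[OF that] in auto)
  ultimately show ?thesis using that by blast
qed

text \<open>The domination estimate with \<open>t = 1\<close> gives a crude norm bound, which is
  enough for membership.\<close>

lemma geo_mean_bounded_kernel_ops:
  assumes "\<Phi> \<subseteq> bounded_kernel_ops" "\<Theta> \<subseteq> bounded_kernel_ops"
  shows "geo_mean M L \<Phi> \<Theta> \<subseteq> bounded_kernel_ops"
proof
  fix D assume "D \<in> geo_mean M L \<Phi> \<Theta>"
  then obtain A B where AB: "A \<in> \<Phi>" "B \<in> \<Theta>" "is_hadamard_mean M L (1/2) A (1/2) B D" by (auto simp: hadamard_mean_def)
  then have A: "A \<in> kernel_ops" "bounded_operator M L N A" and B: "B \<in> kernel_ops" "bounded_operator M L N B"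
    using assms bounded_kernel_opsD by blast+
  have Dk: "D \<in> kernel_ops" and G: "geo_dominated D A B" using hadamard_mean_geo_dominated[OF AB(3) A(1) B(1)] by auto
  show "D \<in> bounded_kernel_ops"
  proof (rule bounded_kernel_opsI[OF Dk])
    fix f assume f: "f \<in> L"
    let ?f = "cpx (\<lambda>x. cmod (f x))"
    have fL: "?f \<in> L" "N ?f = N f" using cmod_mem[OF f] norm_cmod[OF f] by auto
    note Af = cmod_Lp[OF bounded_mem[OF A(2) fL(1)]] and Bf = cmod_Lp[OF bounded_mem[OF B(2) fL(1)]]
    have "N (D f) \<le> N (cpx (\<lambda>x. cmod (A ?f x) + cmod (B ?f x)))"
    proof (rule norm_mono[OF LpD(3)[OF Lp_add[OF Af Bf]] measurable[OF kernel_mem[OF Dk f]]])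
      show "AE x in M. cmod (D f x) \<le> cmod (complex_of_real (cmod (A ?f x) + cmod (B ?f x)))"
        using geo_dominated_le[OF G Dk A(1) B(1) f zero_less_one]
      proof eventually_elim
        case (elim x)
        then have "cmod (D f x) * 2 \<le> cmod (A ?f x) + cmod (B ?f x)" by simp
        then show ?case
          using norm_ge_zero[of "D f x"] unfolding norm_of_real by (intro order_trans[OF _ abs_ge_self]) linarith
      qed
    qed
    also have "\<dots> \<le> N (A ?f) + N (B ?f)"
      using norm_triangle[OF LpD(3)[OF Af] LpD(3)[OF Bf]] norm_cmod[OF bounded_mem[OF A(2) fL(1)]] norm_cmod[OF bounded_mem[OF B(2) fL(1)]] by simp
    also have "\<dots> \<le> (op_norm L N A + op_norm L N B) * N f"
      using op_norm_upper[OF A(2) fL(1)] op_norm_upper[OF B(2) fL(1)] fL(2) by (simp add: distrib_right)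
    finally show "N (D f) \<le> (op_norm L N A + op_norm L N B) * N f" .
  qed
qed

lemma geo_mean_geo_dominated:
  assumes "D \<in> geo_mean M L \<Phi> \<Theta>" "\<Phi> \<subseteq> bounded_kernel_ops" "\<Theta> \<subseteq> bounded_kernel_ops"
  shows "\<exists>A\<in>\<Phi>. \<exists>B\<in>\<Theta>. geo_dominated D A B"
proof -
  obtain A B where "A \<in> \<Phi>" "B \<in> \<Theta>" "is_hadamard_mean M L (1/2) A (1/2) B D" using assms(1) by (auto simp: hadamard_mean_def)
  moreover from this have "A \<in> kernel_ops" "B \<in> kernel_ops" using assms bounded_kernel_opsD by blast+
  ultimately show ?thesis using hadamard_mean_geo_dominated by blast
qed

text \<open>The mean of \<open>\<Phi>\<close> with itself also pairs distinct members, so it is in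
  general larger than \<open>\<Phi>\<close>; this inclusion gives the lower bound for its
  radius.\<close>

lemma subset_geo_mean_self: "\<Phi> \<subseteq> bounded_kernel_ops \<Longrightarrow> \<Phi> \<subseteq> geo_mean M L \<Phi> \<Phi>"
  using hadamard_mean_self bounded_kernel_opsD(1) unfolding hadamard_mean_def by blast

text \<open>Stated for abstract \<open>p\<close> and \<open>s\<close>, so that all four radii are
  instances. The bound of \<open>p\<close> by the operator norm makes norm bounded sets admissible
  for either choice of \<open>p\<close>.\<close>

lemma mean_inequalities:
  assumes rf: "radius_functional bounded_kernel_ops p s geo_dominated"
    and r: "r \<in> {radius_functional.joint_radius p, radius_functional.gen_radius s}"
    and le: "\<And>A. A \<in> bounded_kernel_ops \<Longrightarrow> p A \<le> op_norm L N A"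
    and Psi: "\<forall>A\<in>\<Psi>. positive_kernel_operator M L A" "bounded_op_set L N \<Psi>"
    and Sig: "\<forall>A\<in>\<Sigma>. positive_kernel_operator M L A" "bounded_op_set L N \<Sigma>"
    and \<alpha>: "0 \<le> \<alpha>" "\<alpha> \<le> 1"
  shows
    "r (geo_mean M L \<Psi> \<Sigma>)
       \<le> r (geo_mean M L (op_set_mult \<Psi> \<Sigma>) (op_set_mult \<Sigma> \<Psi>)) powr (1/2) \<and>
     r (geo_mean M L (op_set_mult \<Psi> \<Sigma>) (op_set_mult \<Sigma> \<Psi>)) powr (1/2)
       \<le> r (geo_mean M L (op_set_mult \<Psi> \<Sigma>) (op_set_mult \<Psi> \<Sigma>)) powr (1/4) *
         r (geo_mean M L (op_set_mult \<Sigma> \<Psi>) (op_set_mult \<Sigma> \<Psi>)) powr (1/4) \<and>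
     r (geo_mean M L (op_set_mult \<Psi> \<Sigma>) (op_set_mult \<Psi> \<Sigma>)) powr (1/4) *
         r (geo_mean M L (op_set_mult \<Sigma> \<Psi>) (op_set_mult \<Sigma> \<Psi>)) powr (1/4)
       \<le> r (op_set_mult \<Psi> \<Sigma>) powr (1/2) \<and>
     r (geo_mean M L \<Psi> \<Sigma>)
       \<le> r (op_set_mult (geo_mean M L \<Psi> \<Psi>) (geo_mean M L \<Sigma> \<Sigma>)) powr (1/2) \<and>
     r (op_set_mult (geo_mean M L \<Psi> \<Psi>) (geo_mean M L \<Sigma> \<Sigma>)) powr (1/2)
       \<le> rpow (r (geo_mean M L (op_set_mult \<Psi> \<Sigma>) (op_set_mult \<Psi> \<Sigma>))) (\<alpha>/2) *
         rpow (r (geo_mean M L (op_set_mult \<Sigma> \<Psi>) (op_set_mult \<Sigma> \<Psi>))) ((1 - \<alpha>)/2) \<and>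
     rpow (r (geo_mean M L (op_set_mult \<Psi> \<Sigma>) (op_set_mult \<Psi> \<Sigma>))) (\<alpha>/2) *
         rpow (r (geo_mean M L (op_set_mult \<Sigma> \<Psi>) (op_set_mult \<Sigma> \<Psi>))) ((1 - \<alpha>)/2)
       \<le> r (op_set_mult \<Psi> \<Sigma>) powr (1/2)"
proof -
  interpret radius_functional bounded_kernel_ops p s geo_dominated by (rule rf)
  have r': "r \<in> {joint_radius, gen_radius}" using r .
  have adm: "admissible \<Phi>" if \<Phi>: "\<forall>A\<in>\<Phi>. positive_kernel_operator M L A" "bounded_op_set L N \<Phi>" for \<Phi>
  proof -
    obtain C where C: "\<Phi> \<subseteq> bounded_kernel_ops" "\<And>A. A \<in> \<Phi> \<Longrightarrow> op_norm L N A \<le> C"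
      using bounded_kernel_ops_of_bounded_set[OF \<Phi>] by metis
    have "p A \<le> C" if "A \<in> \<Phi>" for A using le[of A] C that by force
    then show ?thesis using C(1) unfolding admissible_def by blast
  qed
  have P: "admissible \<Psi>" and S: "admissible \<Sigma>" using adm[OF Psi] adm[OF Sig] by auto
  have sub: "\<Phi> \<subseteq> bounded_kernel_ops" if "admissible \<Phi>" for \<Phi> using that by (simp add: admissible_def)
  have adm_geo: "admissible (geo_mean M L \<Phi> \<Theta>)" if ad: "admissible \<Phi>" "admissible \<Theta>" for \<Phi> \<Theta>
  proof -
    obtain K1 K2 where K: "\<forall>A\<in>\<Phi>. p A \<le> K1" "\<forall>A\<in>\<Theta>. p A \<le> K2" using ad by (auto simp: admissible_def)
    note g = geo_mean_bounded_kernel_ops[OF sub[OF ad(1)] sub[OF ad(2)]]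
    have "p D \<le> sqrt (\<bar>K1\<bar> * \<bar>K2\<bar>)" if D: "D \<in> geo_mean M L \<Phi> \<Theta>" for D
    proof -
      obtain A B where AB: "A \<in> \<Phi>" "B \<in> \<Theta>" "geo_dominated D A B"
        using geo_mean_geo_dominated[OF D sub[OF ad(1)] sub[OF ad(2)]] by blast
      have mem: "D \<in> bounded_kernel_ops" "A \<in> bounded_kernel_ops" "B \<in> bounded_kernel_ops"
        using AB D g sub[OF ad(1)] sub[OF ad(2)] by blast+
      have "p D \<le> sqrt (p A * p B)" by (rule p_mean[OF AB(3) mem])
      also have "\<dots> \<le> sqrt (\<bar>K1\<bar> * \<bar>K2\<bar>)"
        using K AB(1,2) p_nonneg[OF mem(2)] p_nonneg[OF mem(3)] by (intro real_sqrt_le_mono mult_mono) force+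
      finally show ?thesis .
    qed
    then show ?thesis using g unfolding admissible_def by blast
  qed
  have dom: "geo_dominated D D D" if "admissible \<Phi>" "D \<in> \<Phi>" for \<Phi> D
    using geo_dominated_self bounded_kernel_opsD(1) sub[OF that(1)] that(2) by blast
  \<comment> \<open>The mean bound with both dominating operators equal to \<open>E\<close> gives
    \<open>sqrt (r \<Theta> * r \<Theta>)\<close>.\<close>
  have mono: "r \<Phi> \<le> r \<Theta>" if "admissible \<Phi>" "admissible \<Theta>" "\<And>D. D \<in> \<Phi> \<Longrightarrow> \<exists>E\<in>\<Theta>. geo_dominated D E E" for \<Phi> \<Theta>
    using radius_mean[OF r' that(1,2,2)] that(3) radius_nonneg[OF that(2) r'] by fastforce
  let ?PS = "op_set_mult \<Psi> \<Sigma>" and ?SP = "op_set_mult \<Sigma> \<Psi>"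
  have PS: "admissible ?PS" and SP: "admissible ?SP" using P S admissible_mult by auto
  have geo_self: "r (geo_mean M L \<Phi> \<Phi>) = r \<Phi>" if "admissible \<Phi>" for \<Phi>
  proof (rule antisym)
    show "r (geo_mean M L \<Phi> \<Phi>) \<le> r \<Phi>"
      using radius_mean[OF r' adm_geo[OF that that] that that geo_mean_geo_dominated[OF _ sub[OF that] sub[OF that]]] radius_nonneg[OF that r'] by simp
    show "r \<Phi> \<le> r (geo_mean M L \<Phi> \<Phi>)"
      using subset_geo_mean_self[OF sub[OF that]] dom[OF that] by (intro mono that adm_geo) blast
  qed
  define x where "x = r ?PS"
  have x0: "0 \<le> x" unfolding x_def by (rule radius_nonneg[OF PS r'])
  have SPx: "r ?SP = x" unfolding x_def by (rule radius_swap[OF r' S P])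
  have gPS: "r (geo_mean M L ?PS ?PS) = x" "r (geo_mean M L ?SP ?SP) = x" using geo_self[OF PS] geo_self[OF SP] SPx by (auto simp: x_def)
  define y where "y = r (geo_mean M L \<Psi> \<Sigma>)"
  define z where "z = r (geo_mean M L ?PS ?SP)"
  note GPS = adm_geo[OF P S]
  have y0: "0 \<le> y" unfolding y_def by (rule radius_nonneg[OF GPS r'])
  have z0: "0 \<le> z" unfolding z_def by (rule radius_nonneg[OF adm_geo[OF PS SP] r'])
  have yz: "y ^ 2 \<le> z" unfolding y_def z_def radius_double[OF r' GPS, symmetric]
  proof (rule mono[OF admissible_mult[OF GPS GPS] adm_geo[OF PS SP]])
    fix D assume "D \<in> op_set_mult (geo_mean M L \<Psi> \<Sigma>) (geo_mean M L \<Psi> \<Sigma>)"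
    then obtain C1 C2 where D: "D = C1 \<circ> C2" "C1 \<in> geo_mean M L \<Psi> \<Sigma>" "C2 \<in> geo_mean M L \<Psi> \<Sigma>" by (auto simp: op_set_mult_def)
    obtain A1 B1 where 1: "A1 \<in> \<Psi>" "B1 \<in> \<Sigma>" "is_hadamard_mean M L (1/2) A1 (1/2) B1 C1" using D(2) by (auto simp: hadamard_mean_def)
    obtain A2 B2 where 2: "A2 \<in> \<Psi>" "B2 \<in> \<Sigma>" "is_hadamard_mean M L (1/2) A2 (1/2) B2 C2" using D(3) by (auto simp: hadamard_mean_def)
    have "A1 \<in> kernel_ops" "B1 \<in> kernel_ops" "A2 \<in> kernel_ops" "B2 \<in> kernel_ops"
      using 1 2 sub[OF P] sub[OF S] bounded_kernel_opsD(1) by blast+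
    from hadamard_mean_comp[OF 1(3) 2(3) this]
    obtain E where E: "is_hadamard_mean M L (1/2) (A1 \<circ> B2) (1/2) (B1 \<circ> A2) E" "geo_dominated (C1 \<circ> C2) E E" by blast
    \<comment> \<open>Crossing the pairs, \<open>A1\<close> with \<open>B2\<close> and
      \<open>B1\<close> with \<open>A2\<close>, is what makes the factors alternate, so that the two
      products lie in \<open>?PS\<close> and \<open>?SP\<close>.\<close>
    have "E \<in> geo_mean M L ?PS ?SP" unfolding hadamard_mean_def using E(1) op_set_multI[OF 1(1) 2(2)] op_set_multI[OF 1(2) 2(1)] by blast
    then show "\<exists>E\<in>geo_mean M L ?PS ?SP. geo_dominated D E E" using E(2) D(1) by blast
  qed
  have zx: "z \<le> x"
    using radius_mean[OF r' adm_geo[OF PS SP] PS SP geo_mean_geo_dominated[OF _ sub[OF PS] sub[OF SP]]] SPx x0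
    by (simp add: z_def x_def[symmetric])
  have mid: "r (op_set_mult (geo_mean M L \<Psi> \<Psi>) (geo_mean M L \<Sigma> \<Sigma>)) = x"
  proof (rule antisym)
    note G = adm_geo[OF P P] adm_geo[OF S S]
    have "r (op_set_mult (geo_mean M L \<Psi> \<Psi>) (geo_mean M L \<Sigma> \<Sigma>)) \<le> sqrt (r ?PS * r ?PS)"
    proof (rule radius_mean[OF r' admissible_mult[OF G] PS PS])
      fix D assume "D \<in> op_set_mult (geo_mean M L \<Psi> \<Psi>) (geo_mean M L \<Sigma> \<Sigma>)"
      then obtain E F where D: "D = E \<circ> F" "E \<in> geo_mean M L \<Psi> \<Psi>" "F \<in> geo_mean M L \<Sigma> \<Sigma>" by (auto simp: op_set_mult_def)
      obtain A A' where A: "A \<in> \<Psi>" "A' \<in> \<Psi>" "geo_dominated E A A'" using geo_mean_geo_dominated[OF D(2) sub[OF P] sub[OF P]] by blast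
      obtain B B' where B: "B \<in> \<Sigma>" "B' \<in> \<Sigma>" "geo_dominated F B B'" using geo_mean_geo_dominated[OF D(3) sub[OF S] sub[OF S]] by blast
      have "geo_dominated (E \<circ> F) (A \<circ> B) (A' \<circ> B')"
        using A B D sub[OF P] sub[OF S] sub[OF G(1)] sub[OF G(2)] by (intro G_comp) blast+
      then show "\<exists>P\<in>?PS. \<exists>Q\<in>?PS. geo_dominated D P Q" using D(1) op_set_multI[OF A(1) B(1)] op_set_multI[OF A(2) B(2)] by blast
    qed
    then show "r (op_set_mult (geo_mean M L \<Psi> \<Psi>) (geo_mean M L \<Sigma> \<Sigma>)) \<le> x" using x0 by (simp add: x_def[symmetric])
    have "?PS \<subseteq> op_set_mult (geo_mean M L \<Psi> \<Psi>) (geo_mean M L \<Sigma> \<Sigma>)"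
      using subset_geo_mean_self[OF sub[OF P]] subset_geo_mean_self[OF sub[OF S]] unfolding op_set_mult_def by blast
    then show "x \<le> r (op_set_mult (geo_mean M L \<Psi> \<Psi>) (geo_mean M L \<Sigma> \<Sigma>))"
      unfolding x_def using dom[OF PS] by (intro mono PS admissible_mult G) blast
  qed
  have half: "a powr (1/2) = sqrt a" if "0 \<le> a" for a using that by (rule powr_half_sqrt)
  have quarter: "x powr (1/4) * x powr (1/4) = x powr (1/2)" by (simp flip: powr_add)
  \<comment> \<open>For \<alpha> equal to 0 or 1 one factor is \<open>rpow x 0 = 1\<close> and the
    other is already \<open>x powr (1/2)\<close>; otherwise the exponents add.\<close>
  have rp: "rpow x (\<alpha>/2) * rpow x ((1 - \<alpha>)/2) = x powr (1/2)"
  proof -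
    have "x powr (\<alpha>/2) * x powr ((1 - \<alpha>)/2) = x powr (1/2)" by (simp flip: powr_add add: field_simps)
    then show ?thesis by (auto simp: rpow_def)
  qed
  have "y \<le> sqrt z" using yz y0 real_le_rsqrt by blast
  moreover have "sqrt z \<le> sqrt x" using zx by simp
  moreover from calculation have "y \<le> sqrt x" by (rule order_trans)
  ultimately show ?thesis
    unfolding gPS mid quarter rp y_def[symmetric] z_def[symmetric] x_def[symmetric] half[OF z0] half[OF x0] by auto
qed

end

theorem theorem3p5:
  fixes M :: "'a measure" and L :: "('a \<Rightarrow> complex) set" and N :: "('a \<Rightarrow> complex) \<Rightarrow> real"
    and \<Psi> \<Sigma> :: "(('a \<Rightarrow> complex) \<Rightarrow> ('a \<Rightarrow> complex)) set"
    and r :: "(('a \<Rightarrow> complex) \<Rightarrow> ('a \<Rightarrow> complex)) set \<Rightarrow> real"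
    and \<alpha> :: real
  assumes "banach_function_space M L N"
    and "\<forall>A\<in>\<Psi>. positive_kernel_operator M L A" and "bounded_op_set L N \<Psi>"
    and "\<forall>A\<in>\<Sigma>. positive_kernel_operator M L A" and "bounded_op_set L N \<Sigma>"
    and "0 \<le> \<alpha>" and "\<alpha> \<le> 1"
    and "r \<in> {gen_spectral_rad M L N, joint_spectral_rad L N} \<or>
         (order_continuous_norm L (ae_le M) N \<and>
          order_continuous_norm (dual_space L N) (dual_le M L) (dual_norm L N) \<and>
          r \<in> {gen_ess_spectral_rad M L N, joint_ess_spectral_rad L N})"
  shows
    "r (geo_mean M L \<Psi> \<Sigma>)
       \<le> r (geo_mean M L (op_set_mult \<Psi> \<Sigma>) (op_set_mult \<Sigma> \<Psi>)) powr (1/2) \<and>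
     r (geo_mean M L (op_set_mult \<Psi> \<Sigma>) (op_set_mult \<Sigma> \<Psi>)) powr (1/2)
       \<le> r (geo_mean M L (op_set_mult \<Psi> \<Sigma>) (op_set_mult \<Psi> \<Sigma>)) powr (1/4) *
         r (geo_mean M L (op_set_mult \<Sigma> \<Psi>) (op_set_mult \<Sigma> \<Psi>)) powr (1/4) \<and>
     r (geo_mean M L (op_set_mult \<Psi> \<Sigma>) (op_set_mult \<Psi> \<Sigma>)) powr (1/4) *
         r (geo_mean M L (op_set_mult \<Sigma> \<Psi>) (op_set_mult \<Sigma> \<Psi>)) powr (1/4)
       \<le> r (op_set_mult \<Psi> \<Sigma>) powr (1/2) \<and>
     r (geo_mean M L \<Psi> \<Sigma>)
       \<le> r (op_set_mult (geo_mean M L \<Psi> \<Psi>) (geo_mean M L \<Sigma> \<Sigma>)) powr (1/2) \<and>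
     r (op_set_mult (geo_mean M L \<Psi> \<Psi>) (geo_mean M L \<Sigma> \<Sigma>)) powr (1/2)
       \<le> rpow (r (geo_mean M L (op_set_mult \<Psi> \<Sigma>) (op_set_mult \<Psi> \<Sigma>))) (\<alpha>/2) *
         rpow (r (geo_mean M L (op_set_mult \<Sigma> \<Psi>) (op_set_mult \<Sigma> \<Psi>))) ((1 - \<alpha>)/2) \<and>
     rpow (r (geo_mean M L (op_set_mult \<Psi> \<Sigma>) (op_set_mult \<Psi> \<Sigma>))) (\<alpha>/2) *
         rpow (r (geo_mean M L (op_set_mult \<Sigma> \<Psi>) (op_set_mult \<Sigma> \<Psi>))) ((1 - \<alpha>)/2)
       \<le> r (op_set_mult \<Psi> \<Sigma>) powr (1/2)"
  using assms(8)
proof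
  interpret banach_function_space M L N by (rule assms(1))
  note rf = radius_functional_op_norm
  assume "r \<in> {gen_spectral_rad M L N, joint_spectral_rad L N}"
  moreover have "gen_spectral_rad M L N = radius_functional.gen_radius (spectral_rad M L N)"
    by (simp add: fun_eq_iff gen_spectral_rad_def radius_functional.gen_radius_def[OF rf])
  moreover have "joint_spectral_rad L N = radius_functional.joint_radius (op_norm L N)"
    by (simp add: fun_eq_iff joint_spectral_rad_def radius_functional.joint_radius_def[OF rf])
  ultimately show ?thesis by (intro mean_inequalities[OF rf] assms(2-7)) auto
next
  assume *: "order_continuous_norm L (ae_le M) N \<and>
          order_continuous_norm (dual_space L N) (dual_le M L) (dual_norm L N) \<and>
          r \<in> {gen_ess_spectral_rad M L N, joint_ess_spectral_rad L N}"
  interpret banach_function_space M L N by (rule assms(1))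
  interpret order_continuous_space M L N by unfold_locales (use * in auto)
  have rf: "radius_functional bounded_kernel_ops mnc (ess_spectral_rad M L N) geo_dominated"
  proof
    show "0 \<le> mnc id" using mnc_nonneg[OF bounded_id] by (simp add: id_def)
  qed (auto intro: bounded_kernel_ops_comp mnc_nonneg mnc_comp geo_dominated_comp mnc_geo_dominated ess_spectral_rad_lim bounded_kernel_opsD)
  have "gen_ess_spectral_rad M L N = radius_functional.gen_radius (ess_spectral_rad M L N)"
    by (simp add: fun_eq_iff gen_ess_spectral_rad_def radius_functional.gen_radius_def[OF rf])
  moreover have "joint_ess_spectral_rad L N = radius_functional.joint_radius mnc"
    by (simp add: fun_eq_iff joint_ess_spectral_rad_def radius_functional.joint_radius_def[OF rf])
  ultimately show ?thesis using *
    by (intro mean_inequalities[OF rf] assms(2-7)) (auto intro: mnc_le_norm bounded_kernel_opsD)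
qed

end
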